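(* For $0<\delta\le1$ let $X_\delta$ be an $(\mathcal H,\mathcal F_{\mathcal H})$-valued random variable with coalescing paths, with distribution $\mu_\delta$. Let $\mathcal D$ be a deterministic countable dense subset of $\mathbb R^2$. Suppose that all four of the following conditions hold. $(T_1)$ For every fixed $u>0$, $$t^{-3/2}\,\sup_{0<\delta\le 1}\ \sup_{x_0,t_0\in\mathbb R}\mu_\delta\bigl(A_{t,u}(x_0,t_0)\bigr)\longrightarrow0\quad\text{as }t\to0+ .$$ $(I_1)$ For each $\delta\in(0,1]$ and $y\in\mathcal D$ there exists a measurable (on the probability space of $X_\delta$) single-path-valued random variable $\theta^y_\delta$ with $\theta^y_\delta(\omega)\in X_\delta(\omega)$, such that for any deterministic $y_1,\ldots,y_m\in\mathcal D$, $(\theta^{y_1}_\delta,\ldots,\theta^{y_m}_\delta)$ converge (jointly) in distribution as $\delta\to0$ to coalescing Brownian motions (with unit diffusion constant) starting at $y_1,\ldots,y_m$. $(B_1)$ For all $-\infty<t_0<\infty$ and $0<t<\infty$, $$\limsup_{\delta\to0}\ \sup_{a\in\mathbb R}\mu_\delta\bigl(\eta(t_0,t;a,a+\epsilon)\ge2\bigr)\longrightarrow0\quad\text{as }\epsilon\to0+ .$$ $(B_2)$ For all $-\infty<t_0<\infty$ and $0<t<\infty$, $$\epsilon^{-1}\limsup_{\delta\to0}\ \sup_{a\in\mathbb R}\mu_\delta\bigl(\eta(t_0,t;a,a+\epsilon)\ge3\bigr)\longrightarrow0\quad\text{as }\epsilon\to0+ .$$ Then the distributions $\mu_\delta$ of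 $X_\delta$ converge weakly, as $\delta\to0$, to the distribution $\mu_{\bar W}$ of the standard Brownian web.
   Context: **Path space.** For $x,t\in[-\infty,\infty]$ put $\Phi(x,t)=\frac{\tanh(x)}{1+|t|}$ and $\Psi(t)=\tanh(t)$, with $\tanh(\pm\infty)=\pm1$ and $\Phi(x,\pm\infty)=0$. For $t_0\in[-\infty,\infty]$ let $C[t_0]$ be the set of functions $f:[t_0,\infty]\to[-\infty,\infty]$ such that $t\mapsto\Phi(f(t),t)$ is continuous. Let $\Pi=\bigcup_{t_0\in[-\infty,\infty]}C[t_0]\times\{t_0\}$; an element $(f,t_0)$ is a path starting at the space-time point $(f(t_0),t_0)$. For $(f,t_0)\in\Pi$ let $\hat f:[-\infty,\infty]\to[-\infty,\infty]$ be the extension of $f$ with $\hat f(t)=f(t_0)$ for $t<t_0$. Define $$d((f_1,t_1),(f_2,t_2))=\Bigl(\sup_t|\Phi(\hat f_1(t),t)-\Phi(\hat f_2(t),t)|\Bigr)\vee|\Psi(t_1)-\Psi(t_2)|,$$ where elements of $\Pi$ at $d$-distance $0$ are identified. $(\Pi,d)$ is a complete separable metric space. **The space $\mathcal H$.** $\mathcal H$ is the set of (nonempty) compact subsets of $(\Pi,d)$ with the Hausdorff metric $d_{\mathcal H}$ induced by $d$ (a complete separable metric space), and $\mathcal F_{\mathcal H}$ is its Borel $\sigma$-field. **Touching and counting variable.** A path $(f,t_* )$ touches a point $(x,s)\in\mathbb R^2$ if $s\ge t_*$ and $f(s)=x$. For $t_0\in\mathbb R$, $t>0$, $a\le b$ and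 $K\in\mathcal H$ (in particular $K=X_\delta$ or $K=\bar W$), $\eta(t_0,t;a,b)\in\{0,1,\ldots,\infty\}$ is the number of distinct points in $\mathbb R\times\{t_0+t\}$ that are touched by paths in $K$ which also touch some point of $[a,b]\times\{t_0\}$. **The event $A_{t,u}(x_0,t_0)$.** Let $R(x_0,t_0;u,t)=[x_0-u/2,x_0+u/2]\times[t_0,t_0+t]$, with right and left boundaries $\{x_0\pm u/2\}\times[t_0,t_0+t]$. For $t>0$ and $u>\sqrt t$, $A_{t,u}(x_0,t_0)\in\mathcal F_{\mathcal H}$ is the event that $K\in\mathcal H$ contains a path touching both $R(x_0,t_0;\sqrt t,t)$ and, at a later time, the left or right boundary of the bigger rectangle $R(x_0,t_0;u,2t)$. **Coalescing paths.** $X_\delta$ has coalescing paths if, almost surely, any two paths of $X_\delta$ become identical upon meeting: if $(f_1,t_1),(f_2,t_2)\in X_\delta$ and $f_1(s)=f_2(s)\in\mathbb R$ for some finite $s>\max(t_1,t_2)$, then $f_1(r)=f_2(r)$ for all finite $r\ge s$. **Coalescing Brownian motions.** Coalescing Brownian motions (unit diffusion constant) starting from $(x_1,t_1),\ldots,(x_n,t_n)\in\mathbb R^2$ are the paths $\tilde W_1,\ldots,\tilde W_n\in\Pi$ obtained as follows: let $B_1,\dots,B_n$ be independent standard Brownian motions, let $W_j$ be the path $t\mapsto x_j+B_j(t-t_j)$ started at time $t_j$, and inductively let $\tilde W_j$ follow $W_j$ until it first meets some $\tilde W_k$ with $k<j$, after which it follows $\tilde W_k$. **Standard Brownian web.**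 The standard Brownian web $\bar W$ is the $(\mathcal H,\mathcal F_{\mathcal H})$-valued random variable whose distribution $\mu_{\bar W}$ is the unique one satisfying: (i) for every finite deterministic set of points $(x_1,t_1),\ldots,(x_n,t_n)\in\mathbb R^2$, almost surely $\bar W$ contains exactly one path starting from each $(x_i,t_i)$, and these paths are jointly distributed as coalescing Brownian motions (unit diffusion constant) starting from these points; (ii) for all $t_0\in\mathbb R$, $t>0$, $-\infty<a\le b<\infty$, the expectation of $\eta(t_0,t;a,b)$ under $\mu_{\bar W}$ equals $1+\frac{b-a}{\sqrt{\pi t}}$. *)

theory Defs
  imports "HOL-Probability.Probability"
begin

definition tanh_ereal :: "ereal \<Rightarrow> real" where
  "tanh_ereal x = (if x = \<infinity> then 1 else if x = -\<infinity> then -1 else tanh (real_of_ereal x))"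

definition Phi :: "ereal \<Rightarrow> ereal \<Rightarrow> real" where
  "Phi x t = (if \<bar>t\<bar> = \<infinity> then 0 else tanh_ereal x / (1 + \<bar>real_of_ereal t\<bar>))"

definition Psi :: "ereal \<Rightarrow> real" where
  "Psi t = tanh_ereal t"

text \<open>A pair \<open>(f, t0)\<close> stands for the function \<open>f\<close> on \<open>[t0, \<infinity>]\<close>; the values of \<open>f\<close> below \<open>t0\<close>
  are junk. No definition below depends on them, since the distance only sees the extension
  \<open>path_hat\<close>, and the quotient therefore removes them.\<close>

definition prepaths :: "((ereal \<Rightarrow> ereal) \<times> ereal) set" where
  "prepaths = {(f, t0). continuous_on {t0..} (\<lambda>t. Phi (f t) t)}"

definition path_hat :: "(ereal \<Rightarrow> ereal) \<times> ereal \<Rightarrow> ereal \<Rightarrow> ereal" where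
  "path_hat = (\<lambda>(f, t0) t. if t < t0 then f t0 else f t)"

definition prepath_dist ::
  "(ereal \<Rightarrow> ereal) \<times> ereal \<Rightarrow> (ereal \<Rightarrow> ereal) \<times> ereal \<Rightarrow> real" where
  "prepath_dist p q =
     max (SUP t. \<bar>Phi (path_hat p t) t - Phi (path_hat q t) t\<bar>) \<bar>Psi (snd p) - Psi (snd q)\<bar>"

definition prepath_rel ::
  "(ereal \<Rightarrow> ereal) \<times> ereal \<Rightarrow> (ereal \<Rightarrow> ereal) \<times> ereal \<Rightarrow> bool" where
  "prepath_rel p q \<longleftrightarrow> p \<in> prepaths \<and> q \<in> prepaths \<and> prepath_dist p q = 0"

lemma abs_tanh_ereal_le_1: "\<bar>tanh_ereal x\<bar> \<le> 1"
  unfolding tanh_ereal_def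
  using tanh_real_lt_1[of "real_of_ereal x"] tanh_real_gt_neg1[of "real_of_ereal x"] by auto

lemma tanh_ereal_inject: "tanh_ereal x = tanh_ereal y \<longleftrightarrow> x = y"
proof -
  have ne: "tanh (r::real) \<noteq> 1" "tanh r \<noteq> -1" "1 \<noteq> tanh r" "-1 \<noteq> tanh r" for r
    using tanh_real_lt_1[of r] tanh_real_gt_neg1[of r] by auto
  show ?thesis
    by (cases x; cases y) (auto simp: tanh_ereal_def ne)
qed

lemma abs_Phi_le_1: "\<bar>Phi x t\<bar> \<le> 1"
  using abs_tanh_ereal_le_1[of x] by (auto simp: Phi_def abs_divide divide_le_eq)

lemma Phi_inject: "Phi x (ereal s) = Phi y (ereal s) \<longleftrightarrow> x = y"
proof -
  have "1 + \<bar>s\<bar> \<noteq> 0" by linarith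
  then show ?thesis by (simp add: Phi_def tanh_ereal_inject)
qed

lemma bdd_above_Phi_diff: "bdd_above (range (\<lambda>t. \<bar>Phi (g t) t - Phi (h t) t\<bar>))"
proof (rule bdd_aboveI2)
  fix t show "\<bar>Phi (g t) t - Phi (h t) t\<bar> \<le> 2"
    using abs_Phi_le_1[of "g t" t] abs_Phi_le_1[of "h t" t] by linarith
qed

lemma prepath_dist_ge:
  "\<bar>Phi (path_hat p t) t - Phi (path_hat q t) t\<bar> \<le> prepath_dist p q"
  "\<bar>Psi (snd p) - Psi (snd q)\<bar> \<le> prepath_dist p q"
  unfolding prepath_dist_def
  by (auto intro!: max.coboundedI1 cSUP_upper bdd_above_Phi_diff)

lemma prepath_dist_leI:
  assumes "\<And>t. \<bar>Phi (path_hat p t) t - Phi (path_hat q t) t\<bar> \<le> c"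
    and "\<bar>Psi (snd p) - Psi (snd q)\<bar> \<le> c"
  shows "prepath_dist p q \<le> c"
  unfolding prepath_dist_def using assms by (auto intro!: cSUP_least)

lemma prepath_dist_nonneg: "0 \<le> prepath_dist p q"
  using prepath_dist_ge(2)[of p q] by linarith

lemma prepath_dist_refl: "prepath_dist p p = 0"
  by (simp add: prepath_dist_def)

lemma prepath_dist_commute: "prepath_dist p q = prepath_dist q p"
  by (simp add: prepath_dist_def abs_minus_commute)

lemma prepath_dist_triangle: "prepath_dist p r \<le> prepath_dist p q + prepath_dist q r"
proof (rule prepath_dist_leI)
  fix t
  show "\<bar>Phi (path_hat p t) t - Phi (path_hat r t) t\<bar> \<le> prepath_dist p q + prepath_dist q r"
    using prepath_dist_ge(1)[of p t q] prepath_dist_ge(1)[of q t r] by linarith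
next
  show "\<bar>Psi (snd p) - Psi (snd r)\<bar> \<le> prepath_dist p q + prepath_dist q r"
    using prepath_dist_ge(2)[of p q] prepath_dist_ge(2)[of q r] by linarith
qed

lemma Phi_zero [simp]: "Phi 0 t = 0"
  by (simp add: Phi_def tanh_ereal_def zero_ereal_def)

quotient_type web_path = "(ereal \<Rightarrow> ereal) \<times> ereal" / partial: prepath_rel
proof (rule part_equivpI)
  have "(\<lambda>_. 0, 0) \<in> prepaths"
    by (simp add: prepaths_def)
  then show "\<exists>p. prepath_rel p p"
    by (auto simp: prepath_rel_def prepath_dist_refl)
  show "symp prepath_rel"
    by (auto simp: symp_def prepath_rel_def prepath_dist_commute)
  show "transp prepath_rel"
  proof (rule transpI)
    fix p q r assume "prepath_rel p q" "prepath_rel q r"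
    then show "prepath_rel p r"
      using prepath_dist_triangle[of p r q] prepath_dist_nonneg[of p r]
      by (auto simp: prepath_rel_def)
  qed
qed

lemma prepath_dist_cong:
  assumes "prepath_rel p p'" "prepath_rel q q'"
  shows "prepath_dist p q = prepath_dist p' q'"
  using assms prepath_dist_triangle[of p q p'] prepath_dist_triangle[of p' q q']
    prepath_dist_triangle[of p' q' p] prepath_dist_triangle[of p q' q]
    prepath_dist_commute[of p p'] prepath_dist_commute[of q q']
  by (auto simp: prepath_rel_def)

instantiation web_path :: metric_space
begin

lift_definition dist_web_path :: "web_path \<Rightarrow> web_path \<Rightarrow> real" is prepath_dist
  by (rule prepath_dist_cong)

definition uniformity_web_path :: "(web_path \<times> web_path) filter" where
  "uniformity_web_path = (INF e\<in>{0<..}. principal {(x, y). dist x y < e})"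

definition open_web_path :: "web_path set \<Rightarrow> bool" where
  "open_web_path U = (\<forall>x\<in>U. \<forall>\<^sub>F (x', y) in uniformity. x' = x \<longrightarrow> y \<in> U)"

instance
proof
  fix p q :: web_path
  show "dist p q = 0 \<longleftrightarrow> p = q"
  proof
    show "dist p q = 0 \<Longrightarrow> p = q"
      by transfer (simp add: prepath_rel_def)
    show "p = q \<Longrightarrow> dist p q = 0"
      by transfer (simp add: prepath_rel_def)
  qed
next
  fix p q r :: web_path
  show "dist p q \<le> dist p r + dist q r"
  proof transfer
    fix p q r :: "(ereal \<Rightarrow> ereal) \<times> ereal"
    show "prepath_dist p q \<le> prepath_dist p r + prepath_dist q r"
      using prepath_dist_triangle[of p q r] prepath_dist_commute[of q r] by simp
  qed
qed (simp_all add: uniformity_web_path_def open_web_path_def)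

end

lift_definition path_start :: "web_path \<Rightarrow> ereal" is snd
proof -
  fix p q assume "prepath_rel p q"
  then have "\<bar>Psi (snd p) - Psi (snd q)\<bar> \<le> 0"
    using prepath_dist_ge(2)[of p q] by (simp add: prepath_rel_def)
  then show "snd p = snd q"
    by (simp add: Psi_def tanh_ereal_inject)
qed

text \<open>The position at a finite time; for times before \<open>path_start\<close> it is the position of the
  extension \<open>path_hat\<close>. The values at the times \<open>\<plusminus>\<infinity>\<close> do not respect the identification.\<close>

lift_definition path_at :: "web_path \<Rightarrow> real \<Rightarrow> ereal" is "\<lambda>p s. path_hat p (ereal s)"
proof
  fix p q s assume "prepath_rel p q"
  then have "\<bar>Phi (path_hat p (ereal s)) (ereal s) - Phi (path_hat q (ereal s)) (ereal s)\<bar> \<le> 0"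
    using prepath_dist_ge(1)[of p "ereal s" q] by (simp add: prepath_rel_def)
  then show "path_hat p (ereal s) = path_hat q (ereal s)"
    by (simp add: Phi_inject)
qed

definition touches :: "web_path \<Rightarrow> real \<times> real \<Rightarrow> bool" where
  "touches p = (\<lambda>(x, s). path_start p \<le> ereal s \<and> path_at p s = ereal x)"

definition starts_at :: "web_path \<Rightarrow> real \<times> real \<Rightarrow> bool" where
  "starts_at p = (\<lambda>(x, s). path_start p = ereal s \<and> path_at p s = ereal x)"

typedef path_family = "{K :: web_path set. compact K \<and> K \<noteq> {}}"
  morphisms paths Abs_path_family
  by (rule exI[of _ "{undefined}"]) simp

setup_lifting type_definition_path_family

definition hausdorff_dist :: "'a::metric_space set \<Rightarrow> 'a set \<Rightarrow> real" where
  "hausdorff_dist K L = max (SUP x\<in>K. infdist x L) (SUP y\<in>L. infdist y K)"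

lemma bdd_above_infdist:
  assumes "compact K"
  shows "bdd_above ((\<lambda>x. infdist x L) ` K)"
proof -
  have "continuous_on K (\<lambda>x. infdist x L)"
    by (intro continuous_intros)
  then show ?thesis
    using assms by (intro bounded_imp_bdd_above compact_imp_bounded compact_continuous_image)
qed

lemma infdist_le_hausdorff_dist:
  assumes "compact K" "compact L"
  shows "x \<in> K \<Longrightarrow> infdist x L \<le> hausdorff_dist K L"
    and "y \<in> L \<Longrightarrow> infdist y K \<le> hausdorff_dist K L"
  unfolding hausdorff_dist_def
  using cSUP_upper[OF _ bdd_above_infdist[OF assms(1)], of x L]
    cSUP_upper[OF _ bdd_above_infdist[OF assms(2)], of y K] by auto

lemma hausdorff_dist_leI:
  assumes "K \<noteq> {}" "L \<noteq> {}"
    and "\<And>x. x \<in> K \<Longrightarrow> infdist x L \<le> c" "\<And>y. y \<in> L \<Longrightarrow> infdist y K \<le> c"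
  shows "hausdorff_dist K L \<le> c"
  unfolding hausdorff_dist_def using assms by (auto intro!: cSUP_least)

lemma hausdorff_dist_commute: "hausdorff_dist K L = hausdorff_dist L K"
  by (simp add: hausdorff_dist_def max.commute)

lemma infdist_triangle_hausdorff:
  assumes "compact K" "K \<noteq> {}" "compact L" "L \<noteq> {}" "compact J" "J \<noteq> {}" "x \<in> K"
  shows "infdist x L \<le> hausdorff_dist K J + hausdorff_dist J L"
proof -
  obtain y where y: "y \<in> J" "infdist x J = dist x y"
  proof -
    have "continuous_on J (dist x)" by (intro continuous_intros)
    then obtain y where "y \<in> J" "\<And>z. z \<in> J \<Longrightarrow> dist x y \<le> dist x z"
      using continuous_attains_inf[of J "dist x"] assms by blast
    then have "infdist x J = dist x y"
      using \<open>J \<noteq> {}\<close> by (intro antisym infdist_le) (auto simp: infdist_notempty intro: cINF_greatest)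
    then show thesis using \<open>y \<in> J\<close> that by blast
  qed
  have "infdist x L \<le> infdist y L + dist x y"
    by (rule infdist_triangle)
  also have "infdist y L \<le> hausdorff_dist J L"
    using infdist_le_hausdorff_dist(1) assms y by blast
  also have "dist x y \<le> hausdorff_dist K J"
    using infdist_le_hausdorff_dist(1)[of K J x] assms y by simp
  finally show ?thesis by simp
qed

instantiation path_family :: metric_space
begin

lift_definition dist_path_family :: "path_family \<Rightarrow> path_family \<Rightarrow> real" is hausdorff_dist .

definition uniformity_path_family :: "(path_family \<times> path_family) filter" where
  "uniformity_path_family = (INF e\<in>{0<..}. principal {(x, y). dist x y < e})"

definition open_path_family :: "path_family set \<Rightarrow> bool" where
  "open_path_family U = (\<forall>x\<in>U. \<forall>\<^sub>F (x', y) in uniformity. x' = x \<longrightarrow> y \<in> U)"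

instance
proof
  fix K L :: path_family
  show "dist K L = 0 \<longleftrightarrow> K = L"
  proof transfer
    fix K L :: "web_path set"
    assume K: "compact K \<and> K \<noteq> {}" and L: "compact L \<and> L \<noteq> {}"
    show "hausdorff_dist K L = 0 \<longleftrightarrow> K = L"
    proof
      assume 0: "hausdorff_dist K L = 0"
      have "x \<in> L" if "x \<in> K" for x
        using infdist_le_hausdorff_dist(1)[of K L x] that K L 0 infdist_nonneg[of x L]
          in_closed_iff_infdist_zero[of L x] compact_imp_closed by auto
      moreover have "x \<in> K" if "x \<in> L" for x
        using infdist_le_hausdorff_dist(2)[of K L x] that K L 0 infdist_nonneg[of x K]
          in_closed_iff_infdist_zero[of K x] compact_imp_closed by auto
      ultimately show "K = L" by blast
    next
      assume "K = L"
      then show "hausdorff_dist K L = 0"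
        using K by (simp add: hausdorff_dist_def)
    qed
  qed
next
  fix K L J :: path_family
  show "dist K L \<le> dist K J + dist L J"
  proof transfer
    fix K L J :: "web_path set"
    assume K: "compact K \<and> K \<noteq> {}" and L: "compact L \<and> L \<noteq> {}" and J: "compact J \<and> J \<noteq> {}"
    show "hausdorff_dist K L \<le> hausdorff_dist K J + hausdorff_dist L J"
    proof (rule hausdorff_dist_leI)
      fix x assume "x \<in> K"
      then show "infdist x L \<le> hausdorff_dist K J + hausdorff_dist L J"
        using infdist_triangle_hausdorff[of K L J x] K L J hausdorff_dist_commute[of L J] by auto
    next
      fix y assume "y \<in> L"
      then show "infdist y K \<le> hausdorff_dist K J + hausdorff_dist L J"
        using infdist_triangle_hausdorff[of L K J y] K L J hausdorff_dist_commute[of K J] by auto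
    qed (use K L in auto)
  qed
qed (simp_all add: uniformity_path_family_def open_path_family_def)

end

definition eta :: "real \<Rightarrow> real \<Rightarrow> real \<Rightarrow> real \<Rightarrow> path_family \<Rightarrow> enat" where
  "eta t0 t a b K =
     (let S = {z \<in> UNIV \<times> {t0 + t}. \<exists>p\<in>paths K. touches p z \<and> (\<exists>w\<in>{a..b} \<times> {t0}. touches p w)}
      in if finite S then enat (card S) else \<infinity>)"

definition rect :: "real \<Rightarrow> real \<Rightarrow> real \<Rightarrow> real \<Rightarrow> (real \<times> real) set" where
  "rect x0 t0 u t = {x0 - u / 2..x0 + u / 2} \<times> {t0..t0 + t}"

definition rect_sides :: "real \<Rightarrow> real \<Rightarrow> real \<Rightarrow> real \<Rightarrow> (real \<times> real) set" where
  "rect_sides x0 t0 u t = {x0 - u / 2, x0 + u / 2} \<times> {t0..t0 + t}"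

text \<open>Only meant for \<open>sqrt t < u\<close>; the smaller rectangle and the sides of the larger one are then
  disjoint.\<close>

definition crossing_event :: "real \<Rightarrow> real \<Rightarrow> real \<Rightarrow> real \<Rightarrow> path_family set" where
  "crossing_event t u x0 t0 =
     {K. \<exists>p\<in>paths K. \<exists>(x, s)\<in>rect x0 t0 (sqrt t) t. \<exists>(x', s')\<in>rect_sides x0 t0 u (2 * t).
           s < s' \<and> touches p (x, s) \<and> touches p (x', s')}"

definition coalescing :: "path_family \<Rightarrow> bool" where
  "coalescing K \<longleftrightarrow>
     (\<forall>p\<in>paths K. \<forall>q\<in>paths K. \<forall>s::real.
        max (path_start p) (path_start q) < ereal s \<and> path_at p s = path_at q s \<and>
        \<bar>path_at p s\<bar> \<noteq> \<infinity> \<longrightarrow>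
        (\<forall>r\<ge>s. path_at p r = path_at q r))"

text \<open>Processes are indexed by all reals; only the times \<open>t \<ge> 0\<close> matter.\<close>

definition standard_BM :: "'w measure \<Rightarrow> (real \<Rightarrow> 'w \<Rightarrow> real) \<Rightarrow> bool" where
  "standard_BM N B \<longleftrightarrow>
     prob_space N \<and>
     (\<forall>t\<ge>0. B t \<in> borel_measurable N) \<and>
     (\<forall>\<omega>\<in>space N. B 0 \<omega> = 0 \<and> continuous_on {0..} (\<lambda>t. B t \<omega>)) \<and>
     (\<forall>s t. 0 \<le> s \<and> s < t \<longrightarrow>
        distributed N lborel (\<lambda>\<omega>. B t \<omega> - B s \<omega>) (normal_density 0 (sqrt (t - s)))) \<and>
     (\<forall>n (\<tau>::nat \<Rightarrow> real). 0 \<le> \<tau> 0 \<and> strict_mono_on {..n} \<tau> \<longrightarrow>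
        prob_space.indep_vars N (\<lambda>_. borel) (\<lambda>i \<omega>. B (\<tau> (Suc i)) \<omega> - B (\<tau> i) \<omega>) {..<n})"

definition indep_standard_BMs :: "'w measure \<Rightarrow> nat \<Rightarrow> (nat \<Rightarrow> real \<Rightarrow> 'w \<Rightarrow> real) \<Rightarrow> bool" where
  "indep_standard_BMs N n B \<longleftrightarrow>
     prob_space N \<and>
     (\<forall>j<n. standard_BM N (B j)) \<and>
     prob_space.indep_vars N (\<lambda>_. \<Pi>\<^sub>M t\<in>{0..}. borel) (\<lambda>j \<omega>. \<lambda>t\<in>{0..}. B j t \<omega>) {..<n}"

text \<open>\<open>coalesce T w n\<close> is the family of coalesced trajectories number \<open>0, \<dots>, n - 1\<close> built from the
  trajectories \<open>w j\<close> with starting times \<open>T j\<close> (values before \<open>T j\<close> are junk). Trajectory \<open>n\<close> follows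
  \<open>w n\<close> up to its first meeting time \<open>\<tau>\<close> with one of the earlier coalesced trajectories, then that
  trajectory. For continuous trajectories the infimum is attained, and if several earlier ones
  are met at time \<open>\<tau>\<close>, they have already coalesced, so that taking the least index is immaterial.\<close>

primrec coalesce :: "(nat \<Rightarrow> real) \<Rightarrow> (nat \<Rightarrow> real \<Rightarrow> real) \<Rightarrow> nat \<Rightarrow> nat \<Rightarrow> real \<Rightarrow> real" where
  "coalesce T w 0 = (\<lambda>_ _. 0)"
| "coalesce T w (Suc n) =
     (let c = coalesce T w n;
          meets = (\<lambda>k s. k < n \<and> max (T k) (T n) \<le> s \<and> w n s = c k s);
          S = {s. \<exists>k. meets k s};
          \<tau> = Inf S;
          k = (LEAST k. meets k \<tau>)
      in c(n := (\<lambda>s. if S = {} \<or> s < \<tau> then w n s else c k s)))"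

definition real_path :: "real \<Rightarrow> (real \<Rightarrow> real) \<Rightarrow> web_path" where
  "real_path t0 c = abs_web_path (\<lambda>t. ereal (c (real_of_ereal t)), ereal t0)"

definition coalescing_paths ::
  "nat \<Rightarrow> (nat \<Rightarrow> real \<times> real) \<Rightarrow> (nat \<Rightarrow> real \<Rightarrow> real) \<Rightarrow> nat \<Rightarrow> web_path" where
  "coalescing_paths n z b =
     (\<lambda>j\<in>{..<n}. real_path (snd (z j))
        (coalesce (snd \<circ> z) (\<lambda>i s. fst (z i) + b i (s - snd (z i))) n j))"

text \<open>\<open>\<nu>\<close> is the joint law of coalescing Brownian motions from \<open>z 0, \<dots>, z (n - 1)\<close>. The law does
  not depend on the probability space carrying the Brownian motions, and the type
  \<open>nat \<Rightarrow> real \<Rightarrow> real\<close> of families of trajectories is large enough to carry them.\<close>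

definition coalescing_BM_law ::
  "nat \<Rightarrow> (nat \<Rightarrow> real \<times> real) \<Rightarrow> (nat \<Rightarrow> web_path) measure \<Rightarrow> bool" where
  "coalescing_BM_law n z \<nu> \<longleftrightarrow>
     (\<exists>(N :: (nat \<Rightarrow> real \<Rightarrow> real) measure) B. indep_standard_BMs N n B \<and>
        \<nu> = distr N (\<Pi>\<^sub>M i\<in>{..<n}. borel) (\<lambda>\<omega>. coalescing_paths n z (\<lambda>j t. B j t \<omega>)))"

definition standard_Brownian_web :: "'w measure \<Rightarrow> ('w \<Rightarrow> path_family) \<Rightarrow> bool" where
  "standard_Brownian_web N W \<longleftrightarrow>
     prob_space N \<and> W \<in> N \<rightarrow>\<^sub>M borel \<and>
     (\<forall>n (z :: nat \<Rightarrow> real \<times> real). inj_on z {..<n} \<longrightarrow>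
        (\<exists>\<xi>. (\<forall>i<n. \<xi> i \<in> N \<rightarrow>\<^sub>M borel) \<and>
             (AE \<omega> in N. \<forall>i<n. {p \<in> paths (W \<omega>). starts_at p (z i)} = {\<xi> i \<omega>}) \<and>
             coalescing_BM_law n z
               (distr N (\<Pi>\<^sub>M i\<in>{..<n}. borel) (\<lambda>\<omega>. \<lambda>i\<in>{..<n}. \<xi> i \<omega>)))) \<and>
     (\<forall>t0 t a b. 0 < t \<and> a \<le> b \<longrightarrow>
        (\<integral>\<^sup>+ K. ennreal_of_enat (eta t0 t a b K) \<partial>distr N borel W) =
          ennreal (1 + (b - a) / sqrt (pi * t)))"

text \<open>Also used for laws on \<open>\<Pi>\<^sub>M i\<in>{..<n}. borel\<close>, whose underlying space consists of the functions on
  \<open>{..<n}\<close>: the continuous functions on this \<open>n\<close>-fold product are exactly the restrictions of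
  continuous functions on the full function type.\<close>

definition weakly_converges ::
  "('i \<Rightarrow> 'a::topological_space measure) \<Rightarrow> 'a measure \<Rightarrow> 'i filter \<Rightarrow> bool" where
  "weakly_converges \<mu> \<nu> F \<longleftrightarrow>
     (\<forall>g :: 'a \<Rightarrow> real. continuous_on UNIV g \<and> bounded (range g) \<longrightarrow>
        ((\<lambda>i. \<integral>x. g x \<partial>\<mu> i) \<longlongrightarrow> (\<integral>x. g x \<partial>\<nu>)) F)"

end

theory Submission
  imports Defs
begin

text \<open>Both \<open>X\<^sub>\<delta>\<close> and \<open>W\<close> are close in the Hausdorff metric to finitely many of their paths that start
  at points of \<open>D\<close>, and for finitely many such paths convergence in distribution is (I1); this gives
  the convergence of the integrals of bounded Lipschitz functions without tightness or subsequences.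

  For \<open>X\<^sub>\<delta>\<close>, condition (T1) provides a common modulus of continuity outside an event of small
  probability. Cut a large space interval at a fixed time into pieces of length \<open>\<epsilon>\<close> bounded by paths
  from \<open>D\<close>. By (B2) the probability that some piece contains three paths that are distinct a
  little later vanishes as \<open>\<epsilon>\<close> tends to \<open>0\<close>; otherwise every path through a piece has by then merged
  with one of the two paths bounding it.

  For \<open>W\<close>, the paths from \<open>n + 1\<close> equidistant points of \<open>[a, b]\<close> at time \<open>t\<^sub>0\<close> have at time \<open>t\<^sub>0 + t\<close>
  a number of distinct positions which is at most \<open>\<eta>\<close> and whose expectation tends to
  \<open>1 + (b - a) / sqrt (\<pi> t)\<close>, the expectation of \<open>\<eta>\<close>. Hence almost surely every point counted by \<open>\<eta>\<close>
  lies on a path from a rational point, and every path of \<open>W\<close> is a limit of such paths.\<close>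

section \<open>The path space\<close>

text \<open>The order of the choices makes the skeleton of \<open>X\<close> independent of \<delta>.
  The time step \<tau> comes first: of the order of \<open>\<tau> powr (-3/2)\<close> rectangles
  cover a bounded window, which is the factor in (T1). Then comes the mesh \<open>h\<close>: each
  grid time has of the order of \<open>1 / h\<close> pieces, each bad with probability at most a
  small multiple of \<open>h\<close>, which is the factor in (B2). Only then are the points of
  \<open>D\<close> chosen. Their paths have to lie in open sets of paths, since a lower bound for
  the probability of an open set passes from the limit law to small \<delta>. Paths far out in space
  are held there by barrier paths; they are close to each other, as the metric compactifies space.

  For \<open>W\<close>, coalescence of arbitrary paths is not part of the definition; it is known
  only for countably many paths from deterministic points. An arbitrary path is therefore compared
  with these through \<open>eta\<close> at rational times, and a connectedness argument turns
  agreement with some of them at each time into agreement with a single one.\<close>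

definition pv :: "web_path \<Rightarrow> real \<Rightarrow> real" where
  "pv p t = tanh_ereal (path_at p t)"

text \<open>In these coordinates \<open>dist p q\<close> is the larger of
  \<open>\<bar>ps p - ps q\<bar>\<close> and the supremum over real \<open>t\<close> of
  \<open>\<bar>pv p t - pv q t\<bar> / (1 + \<bar>t\<bar>)\<close>. The values 1 and -1 encode
  infinite times and positions.\<close>

definition ps :: "web_path \<Rightarrow> real" where
  "ps p = Psi (path_start p)"

lemma tanh_ereal_ereal [simp]: "tanh_ereal (ereal x) = tanh x"
  by (simp add: tanh_ereal_def)

lemma abs_pv_le_1: "\<bar>pv p t\<bar> \<le> 1"
  by (simp add: pv_def abs_tanh_ereal_le_1)

lemma Phi_ereal: "Phi x (ereal t) = tanh_ereal x / (1 + \<bar>t\<bar>)"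
  by (simp add: Phi_def)

lemma tanh_ereal_less_iff: "tanh_ereal x < tanh_ereal y \<longleftrightarrow> x < y"
proof -
  have ne: "tanh (r::real) < 1" "-1 < tanh r" "\<not> 1 < tanh r" "\<not> tanh r < -1" for r
    using tanh_real_lt_1[of r] tanh_real_gt_neg1[of r] by auto
  show ?thesis
    by (cases x; cases y) (auto simp: tanh_ereal_def ne)
qed

lemma tanh_ereal_le_iff: "tanh_ereal x \<le> tanh_ereal y \<longleftrightarrow> x \<le> y"
  using tanh_ereal_less_iff[of y x] by (meson linorder_not_less)

lemma abs_tanh_ereal_less_1: "\<bar>tanh_ereal x\<bar> < 1 \<longleftrightarrow> \<bar>x\<bar> \<noteq> \<infinity>"
  using tanh_real_lt_1 tanh_real_gt_neg1
  by (cases x) (auto simp: tanh_ereal_def abs_less_iff)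

lemma abs_tanh_diff_le: "\<bar>tanh x - tanh (y::real)\<bar> \<le> \<bar>x - y\<bar>"
proof -
  have *: "tanh x - tanh y \<le> x - y" if "y < x" for x y :: real
  proof -
    have "\<exists>z. z > y \<and> z < x \<and> tanh x - tanh y = (x - y) * (1 - tanh z ^ 2)"
      by (rule MVT2[OF that]) (auto intro!: derivative_eq_intros simp: cosh_real_nonzero)
    then obtain z where z: "tanh x - tanh y = (x - y) * (1 - tanh z ^ 2)" by blast
    show ?thesis
      unfolding z using that by (simp add: mult_left_le)
  qed
  show ?thesis
    using *[of x y] *[of y x] tanh_real_less_iff[of x y] tanh_real_less_iff[of y x]
    by (cases x y rule: linorder_cases) auto
qed

lemma surj_tanh:
  assumes "\<bar>y :: real\<bar> < 1"
  obtains x :: real where "y = tanh x"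
proof -
  have "\<forall>\<^sub>F x in at_top. y < tanh (x :: real)"
    using assms by (intro order_tendstoD[OF tanh_real_at_top]) auto
  then obtain u where u: "y < tanh (u :: real)"
    using eventually_happens trivial_limit_at_top_linorder by blast
  have "\<forall>\<^sub>F x in at_bot. tanh (x :: real) < y"
    using assms by (intro order_tendstoD[OF tanh_real_at_bot]) auto
  then obtain l where l: "tanh (l :: real) < y"
    using eventually_happens trivial_limit_at_bot_linorder by blast
  have "l \<le> u"
    using l u tanh_real_le_iff[of u l] by linarith
  then have "\<exists>x. l \<le> x \<and> x \<le> u \<and> tanh x = y"
    using l u by (intro IVT') (auto intro!: continuous_intros simp: cosh_real_nonzero)
  then show ?thesis
    using that by blast
qed

lemma pv_real:
  assumes "\<bar>pv p t\<bar> < 1"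
  obtains x where "path_at p t = ereal x" "pv p t = tanh x"
  using assms unfolding pv_def abs_tanh_ereal_less_1
  by (metis tanh_ereal_ereal ereal_real)

lemma touches_iff: "touches p (x, s) \<longleftrightarrow> path_start p \<le> ereal s \<and> pv p s = tanh x"
  using tanh_ereal_inject[of "path_at p s" "ereal x"] by (simp add: touches_def pv_def)

lemma starts_at_iff: "starts_at p (x, s) \<longleftrightarrow> path_start p = ereal s \<and> pv p s = tanh x"
  using tanh_ereal_inject[of "path_at p s" "ereal x"] by (simp add: starts_at_def pv_def)

lemma ps_ereal: "path_start p = ereal s \<Longrightarrow> ps p = tanh s"
  by (simp add: ps_def Psi_def)

lemma ps_le_iff: "ps p \<le> tanh s \<longleftrightarrow> path_start p \<le> ereal s"
  using tanh_ereal_le_iff[of "path_start p" "ereal s"] by (simp add: ps_def Psi_def)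

lemma ps_ge_iff: "tanh s \<le> ps p \<longleftrightarrow> ereal s \<le> path_start p"
  using tanh_ereal_le_iff[of "ereal s" "path_start p"] by (simp add: ps_def Psi_def)

lemma ps_less_iff: "ps p < tanh s \<longleftrightarrow> path_start p < ereal s"
  using tanh_ereal_less_iff[of "path_start p" "ereal s"] by (simp add: ps_def Psi_def)

lemma ps_eq_iff: "ps p = ps q \<longleftrightarrow> path_start p = path_start q"
  by (simp add: ps_def Psi_def tanh_ereal_inject)

lemma abs_ps_le_1: "\<bar>ps p\<bar> \<le> 1"
  by (simp add: ps_def Psi_def abs_tanh_ereal_le_1)

lemma dist_web_path_ge:
  shows abs_pv_diff_le_dist: "\<bar>pv p t - pv q t\<bar> \<le> (1 + \<bar>t\<bar>) * dist p q"
    and abs_ps_diff_le_dist: "\<bar>ps p - ps q\<bar> \<le> dist p q"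
proof -
  have "\<bar>tanh_ereal (path_at p t) - tanh_ereal (path_at q t)\<bar> \<le> (1 + \<bar>t\<bar>) * dist p q"
  proof (transfer fixing: t)
    fix p q
    have "\<bar>Phi (path_hat p (ereal t)) (ereal t) - Phi (path_hat q (ereal t)) (ereal t)\<bar> \<le> prepath_dist p q"
      by (rule prepath_dist_ge)
    then show "\<bar>tanh_ereal (path_hat p (ereal t)) - tanh_ereal (path_hat q (ereal t))\<bar>
        \<le> (1 + \<bar>t\<bar>) * prepath_dist p q"
      by (simp add: Phi_ereal flip: diff_divide_distrib) (simp add: abs_divide pos_divide_le_eq mult.commute)
  qed
  then show "\<bar>pv p t - pv q t\<bar> \<le> (1 + \<bar>t\<bar>) * dist p q"
    by (simp add: pv_def)
  show "\<bar>ps p - ps q\<bar> \<le> dist p q"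
    unfolding ps_def by transfer (rule prepath_dist_ge)
qed

lemma dist_web_path_leI:
  assumes "\<And>t. \<bar>pv p t - pv q t\<bar> \<le> c * (1 + \<bar>t\<bar>)" and "\<bar>ps p - ps q\<bar> \<le> c"
  shows "dist p q \<le> c"
  using assms unfolding pv_def ps_def
proof (transfer fixing: c)
  fix p q
  assume *: "\<And>t. \<bar>tanh_ereal (path_hat p (ereal t)) - tanh_ereal (path_hat q (ereal t))\<bar> \<le> c * (1 + \<bar>t\<bar>)"
    and c: "\<bar>Psi (snd p) - Psi (snd q)\<bar> \<le> c"
  show "prepath_dist p q \<le> c"
  proof (rule prepath_dist_leI)
    fix t
    show "\<bar>Phi (path_hat p t) t - Phi (path_hat q t) t\<bar> \<le> c"
    \<comment> \<open>At the times \<plusminus>\<infinity> \<open>Phi\<close> vanishes, so only real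
      times constrain the distance.\<close>
    proof (cases t)
      case (real r)
      then show ?thesis
        using *[of r]
        by (simp add: Phi_ereal flip: diff_divide_distrib) (simp add: abs_divide pos_divide_le_eq)
    qed (use c in \<open>auto simp: Phi_def\<close>)
  qed (fact c)
qed

lemma web_path_eqI:
  assumes "path_start p = path_start q" "\<And>t. pv p t = pv q t"
  shows "p = q"
proof -
  have "dist p q \<le> 0"
    using assms by (intro dist_web_path_leI) (auto simp: ps_def)
  then show ?thesis by simp
qed

lemma pv_before_start:
  assumes "ereal t \<le> path_start p" "ereal t' \<le> path_start p"
  shows "pv p t = pv p t'"
  using assms unfolding pv_def
  by (transfer fixing: t t') (auto simp: path_hat_def split: prod.splits if_splits)

text \<open>By definition only the damped function \<open>Phi (f t) t\<close> is continuous; at real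
  times the factor \<open>1 + \<bar>t\<bar>\<close> undoes the damping. The constant extension is
  glued on at the starting time.\<close>

lemma continuous_on_pv: "continuous_on A (pv p)"
proof -
  have "continuous_on UNIV (\<lambda>t. tanh_ereal (path_at p t))"
  proof transfer
    fix p :: "(ereal \<Rightarrow> ereal) \<times> ereal"
    assume "prepath_rel p p"
    obtain f t0 where p: "p = (f, t0)" by (cases p)
    have f: "continuous_on {t0..} (\<lambda>t. Phi (f t) t)"
      using \<open>prepath_rel p p\<close> by (simp add: prepath_rel_def prepaths_def p)
    show "continuous_on UNIV (\<lambda>t. tanh_ereal (path_hat p (ereal t)))"
    proof (cases t0)
      case (real r)
      have "continuous_on {r..} (\<lambda>t. (1 + \<bar>t\<bar>) * Phi (f (ereal t)) (ereal t))"
        by (intro continuous_intros continuous_on_compose2[OF f]) (auto simp: real)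
      moreover have "(1 + \<bar>t\<bar>) * Phi (f (ereal t)) (ereal t) = tanh_ereal (path_hat p (ereal t))"
        if "t \<in> {r..}" for t
        using that by (simp add: Phi_ereal path_hat_def p real)
      ultimately have 1: "continuous_on {r..} (\<lambda>t. tanh_ereal (path_hat p (ereal t)))"
        by (metis (no_types, lifting) continuous_on_cong)
      have 2: "continuous_on {..r} (\<lambda>t. tanh_ereal (path_hat p (ereal t)))"
        by (rule continuous_on_eq[OF continuous_on_const[of _ "tanh_ereal (f t0)"]])
           (auto simp: path_hat_def p real)
      have "continuous_on ({r..} \<union> {..r}) (\<lambda>t. tanh_ereal (path_hat p (ereal t)))"
        by (rule continuous_on_closed_Un) (auto intro: 1 2)
      moreover have "{r..} \<union> {..r} = UNIV" by auto
      ultimately show ?thesis by simp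
    next
      case PInf
      show ?thesis
        by (rule continuous_on_eq[OF continuous_on_const[of _ "tanh_ereal (f t0)"]])
           (auto simp: path_hat_def p PInf)
    next
      case MInf
      have "continuous_on UNIV (\<lambda>t. (1 + \<bar>t\<bar>) * Phi (f (ereal t)) (ereal t))"
        by (intro continuous_intros continuous_on_compose2[OF f]) (auto simp: MInf)
      moreover have "(1 + \<bar>t\<bar>) * Phi (f (ereal t)) (ereal t) = tanh_ereal (path_hat p (ereal t))"
        for t by (simp add: Phi_ereal path_hat_def p MInf)
      ultimately show ?thesis by simp
    qed
  qed
  then show ?thesis
    unfolding pv_def by (rule continuous_on_subset) simp
qed

text \<open>Convergence in \<open>dist\<close> is uniform on bounded sets of times, because the
  factor \<open>1 + \<bar>T n\<bar>\<close> stays bounded. This gives joint continuity in path and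
  time.\<close>

lemma tendsto_pv:
  assumes "(P \<longlongrightarrow> p) F" "(T \<longlongrightarrow> t) F"
  shows "((\<lambda>n. pv (P n) (T n)) \<longlongrightarrow> pv p t) F"
proof -
  have "((\<lambda>n. pv p (T n)) \<longlongrightarrow> pv p t) F"
    by (rule continuous_on_tendsto_compose[OF continuous_on_pv[of UNIV p] assms(2)]) auto
  moreover have "((\<lambda>n. pv (P n) (T n) - pv p (T n)) \<longlongrightarrow> 0) F"
  proof (rule Lim_null_comparison)
    show "\<forall>\<^sub>F n in F. norm (pv (P n) (T n) - pv p (T n)) \<le> (1 + \<bar>T n\<bar>) * dist (P n) p"
      by (simp add: abs_pv_diff_le_dist)
    have "((\<lambda>n. dist (P n) p) \<longlongrightarrow> 0) F"
      using assms(1) tendsto_dist_iff by blast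
    then have "((\<lambda>n. (1 + \<bar>T n\<bar>) * dist (P n) p) \<longlongrightarrow> (1 + \<bar>t\<bar>) * 0) F"
      by (intro tendsto_intros assms)
    then show "((\<lambda>n. (1 + \<bar>T n\<bar>) * dist (P n) p) \<longlongrightarrow> 0) F" by simp
  qed
  ultimately have "((\<lambda>n. pv p (T n) + (pv (P n) (T n) - pv p (T n))) \<longlongrightarrow> pv p t + 0) F"
    by (rule tendsto_add)
  then show ?thesis by simp
qed

lemma tendsto_ps:
  assumes "(P \<longlongrightarrow> p) F"
  shows "((\<lambda>n. ps (P n)) \<longlongrightarrow> ps p) F"
proof -
  have "((\<lambda>n. ps (P n) - ps p) \<longlongrightarrow> 0) F"
    by (rule Lim_null_comparison[OF _ assms[unfolded tendsto_dist_iff[of P]]])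
       (simp add: abs_ps_diff_le_dist)
  then show ?thesis by (simp add: LIM_zero_iff)
qed

lemma continuous_on_pv_path [continuous_intros]: "continuous_on A (\<lambda>p. pv p t)"
  by (auto simp: continuous_on_def intro!: tendsto_pv tendsto_ident_at)

lemma measurable_pv [measurable]: "(\<lambda>p. pv p t) \<in> borel_measurable borel"
  by (intro borel_measurable_continuous_onI continuous_intros)

section \<open>Families of paths\<close>

lemma real_path_prepath:
  assumes c: "continuous_on {t0..} c"
  shows "(\<lambda>t. ereal (c (real_of_ereal t)), ereal t0) \<in> prepaths"
proof -
  let ?g = "\<lambda>t. Phi (ereal (c (real_of_ereal t))) t"
  have "(?g \<longlongrightarrow> ?g t) (at t within {ereal t0..})" if t: "t \<in> {ereal t0..}" for t
  proof (cases t)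
    case (real r)
    have "((\<lambda>t. tanh (c (real_of_ereal t)) / (1 + \<bar>real_of_ereal t\<bar>)) \<longlongrightarrow> ?g t) (at t within {ereal t0..})"
    proof -
      have lim: "(real_of_ereal \<longlongrightarrow> r) (at t within {ereal t0..})"
        using real by (auto intro!: tendsto_eq_intros)
      have ev: "\<forall>\<^sub>F s in at t within {ereal t0..}. real_of_ereal s \<in> {t0..}"
      proof -
        have "\<forall>\<^sub>F s in nhds t. s < \<infinity>"
          using real by (intro order_tendstoD[OF filterlim_ident]) auto
        then have "\<forall>\<^sub>F s in at t within {ereal t0..}. s < \<infinity> \<and> s \<in> {ereal t0..}"
          unfolding eventually_at_filter by (elim eventually_mono) auto
        then show ?thesis
          by (elim eventually_mono) (auto intro: real_le_ereal_iff[THEN iffD2] simp: ereal_le_real_iff)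
      qed
      have "((\<lambda>s. c (real_of_ereal s)) \<longlongrightarrow> c r) (at t within {ereal t0..})"
        by (rule continuous_on_tendsto_compose[OF c lim _ ev]) (use t real in auto)
      then show ?thesis
        using lim real
        by (auto intro!: tendsto_eq_intros simp: Phi_ereal cosh_real_nonzero add_nonneg_eq_0_iff)
    qed
    moreover have "\<forall>\<^sub>F s in at t within {ereal t0..}.
        tanh (c (real_of_ereal s)) / (1 + \<bar>real_of_ereal s\<bar>) = ?g s"
    proof -
      have "\<forall>\<^sub>F s in nhds t. s < \<infinity>"
        using real by (intro order_tendstoD[OF filterlim_ident]) auto
      then show ?thesis
        unfolding eventually_at_filter by (elim eventually_mono) (auto simp: Phi_def)
    qed
    ultimately show ?thesis
      by (rule Lim_transform_eventually)
  next
    case PInf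
    show ?thesis
    \<comment> \<open>At time \<infinity> the damping bounds \<open>Phi\<close> by
      \<open>1 / (1 + \<bar>r\<bar>)\<close>, which tends to 0 however fast \<open>c\<close>
      grows.\<close>
    proof (rule tendstoI)
      fix e :: real assume e: "0 < e"
      have "\<forall>\<^sub>F s in nhds t. ereal (1 / e) < s"
        using PInf by (intro order_tendstoD[OF filterlim_ident]) auto
      then show "\<forall>\<^sub>F s in at t within {ereal t0..}. dist (?g s) (?g t) < e"
        unfolding eventually_at_filter
      proof (elim eventually_mono, safe)
        fix s assume s: "ereal (1 / e) < s"
        have "\<bar>?g s\<bar> < e"
        proof (cases s)
          case (real r)
          then have r: "1 / e < r" using s by simp
          have "0 < r" using e r by (meson less_trans zero_less_divide_1_iff)
          have "\<bar>?g s\<bar> \<le> 1 / (1 + \<bar>r\<bar>)"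
            unfolding real Phi_ereal abs_divide
            using abs_tanh_ereal_le_1[of "ereal (c r)"] by (auto intro!: divide_mono)
          also have "\<dots> < e"
            using e r \<open>0 < r\<close> by (simp add: field_simps)
          finally show ?thesis .
        qed (use s e in \<open>auto simp: Phi_def\<close>)
        then show "dist (?g s) (?g t) < e"
          by (simp add: PInf Phi_def)
      qed
    qed
  qed (use t in auto)
  then show ?thesis
    by (simp add: prepaths_def continuous_on_def)
qed

lemma abs_web_path_cases:
  assumes "(f, t0) \<in> prepaths"
  shows path_start_abs: "path_start (abs_web_path (f, t0)) = t0"
    and path_at_abs: "path_at (abs_web_path (f, t0)) s = path_hat (f, t0) (ereal s)"
  using assms
  by (auto simp: path_start.abs_eq path_at.abs_eq prepath_rel_def prepath_dist_refl)

lemma path_start_real_path: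
  "continuous_on {t0..} c \<Longrightarrow> path_start (real_path t0 c) = ereal t0"
  unfolding real_path_def by (intro path_start_abs real_path_prepath)

lemma pv_real_path:
  "continuous_on {t0..} c \<Longrightarrow> pv (real_path t0 c) s = tanh (c (max s t0))"
  unfolding real_path_def pv_def
  by (subst path_at_abs[OF real_path_prepath]) (auto simp: path_hat_def max_def)

text \<open>A code \<open>(n, L, w)\<close> records, to precision \<open>1 / n\<close>, the starting time and the values on
  \<open>[-n, n]\<close>; two paths with the same code are close, and there are countably many codes.\<close>

definition has_code :: "nat \<times> (rat \<times> rat \<times> rat) list \<times> rat \<Rightarrow> web_path \<Rightarrow> bool" where
  "has_code = (\<lambda>(n, L, w) p. \<bar>ps p - of_rat w\<bar> < 1 / n \<and>
     {- real n..n} \<subseteq> (\<Union>(a, b, v)\<in>set L. {of_rat a<..<of_rat b}) \<and>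
     (\<forall>(a, b, v)\<in>set L. \<forall>t\<in>{of_rat a<..<of_rat b}. \<bar>pv p t - of_rat v\<bar> < 1 / n))"

lemma has_code_close:
  assumes "has_code (n, L, w) p" "has_code (n, L, w) q" "0 < n"
  shows "dist p q \<le> 2 / n"
proof (rule dist_web_path_leI)
  have two: "2 / real n = 1 / n + 1 / n" by simp
  have "\<bar>ps p - of_rat w\<bar> < 1 / n" "\<bar>ps q - of_rat w\<bar> < 1 / n"
    using assms(1,2) unfolding has_code_def prod.case by blast+
  then show "\<bar>ps p - ps q\<bar> \<le> 2 / n"
    unfolding two by linarith
  fix t
  show "\<bar>pv p t - pv q t\<bar> \<le> 2 / n * (1 + \<bar>t\<bar>)"
  proof (cases "t \<in> {- real n..n}")
    case True
    then obtain a b v where "(a, b, v) \<in> set L" "t \<in> {of_rat a<..<of_rat b}"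
      using assms(1) unfolding has_code_def prod.case by blast
    then have "\<bar>pv p t - of_rat v\<bar> < 1 / n" "\<bar>pv q t - of_rat v\<bar> < 1 / n"
      using assms(1,2) unfolding has_code_def prod.case by fast+
    then have "\<bar>pv p t - pv q t\<bar> \<le> 1 / n + 1 / n" by linarith
    also have "\<dots> = 2 / n * 1" by simp
    also have "\<dots> \<le> 2 / n * (1 + \<bar>t\<bar>)" by (intro mult_left_mono) auto
    finally show ?thesis .
  next
    \<comment> \<open>Outside the recorded window the bound exceeds 2, the largest possible
      difference of two values of \<open>pv\<close>.\<close>
    case False
    then have "\<bar>t\<bar> > n" by auto
    then have "2 / n * (1 + \<bar>t\<bar>) \<ge> 2 / n * n"
      by (intro mult_left_mono) auto
    then show ?thesis
      using abs_pv_le_1[of p t] abs_pv_le_1[of q t] \<open>0 < n\<close> by simp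
  qed
qed

text \<open>Near each time \<open>pv p\<close> varies by less than \<open>e\<close>, half of the
  precision; the other half pays for rounding the value to a rational. Compactness of the window
  leaves finitely many such intervals.\<close>

lemma ex_code:
  assumes "0 < n"
  shows "\<exists>L w. has_code (n, L, w) p"
proof -
  define e where "e = 1 / (2 * real n)"
  have e: "e > 0" using assms by (simp add: e_def)
  obtain w :: rat where w: "ps p - 1 / n < of_rat w" "of_rat w < ps p + 1 / n"
    using of_rat_dense[of "ps p - 1 / n" "ps p + 1 / n"] assms by auto
  have "\<exists>a b v :: rat. t \<in> {of_rat a<..<of_rat b} \<and>
      (\<forall>s\<in>{of_rat a<..<of_rat b}. \<bar>pv p s - of_rat v\<bar> < 1 / n)" for t :: real
  proof -
    obtain v :: rat where v: "pv p t - e < of_rat v" "of_rat v < pv p t + e"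
      using of_rat_dense[of "pv p t - e" "pv p t + e"] e by auto
    obtain d where d: "d > 0" "\<And>s. dist s t < d \<Longrightarrow> dist (pv p s) (pv p t) < e"
      using continuous_on_pv[of UNIV p] e unfolding continuous_on_iff by (meson UNIV_I)
    obtain a :: rat where a: "t - d < of_rat a" "of_rat a < t"
      using of_rat_dense[of "t - d" t] d by auto
    obtain b :: rat where b: "t < of_rat b" "of_rat b < t + d"
      using of_rat_dense[of t "t + d"] d by auto
    have "\<bar>pv p s - of_rat v\<bar> < 1 / n" if "s \<in> {of_rat a<..<of_rat b}" for s
    proof -
      have "dist s t < d" using that a b by (auto simp: dist_real_def)
      then have "\<bar>pv p s - pv p t\<bar> < e" using d by (simp add: dist_real_def)
      then show ?thesis using v by (auto simp: e_def field_simps)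
    qed
    then show ?thesis
      using a b by (intro exI[of _ a] exI[of _ b] exI[of _ v]) auto
  qed
  then obtain a b v :: "real \<Rightarrow> rat" where abv: "\<And>t. t \<in> {of_rat (a t)<..<of_rat (b t)}"
      "\<And>t s. s \<in> {of_rat (a t)<..<of_rat (b t)} \<Longrightarrow> \<bar>pv p s - of_rat (v t)\<bar> < 1 / n"
    by metis
  obtain C where C: "C \<subseteq> {- real n..n}" "finite C"
      "{- real n..n} \<subseteq> (\<Union>t\<in>C. {of_rat (a t)<..<of_rat (b t)})"
    by (rule compactE_image[of "{- real n..n}" "{- real n..n}" "\<lambda>t. {of_rat (a t)<..<of_rat (b t)}"])
       (use abv(1) in auto)
  obtain L where L: "set L = (\<lambda>t. (a t, b t, v t)) ` C"
    using finite_list[of "(\<lambda>t. (a t, b t, v t)) ` C"] C(2) by auto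
  have "has_code (n, L, w) p"
    unfolding has_code_def using w L C(3) abv(2) by (auto simp: abs_less_iff)
  then show ?thesis by blast
qed

section \<open>Separability and Borel sets of the path space\<close>

lemma web_path_separable:
  "\<exists>E :: web_path set. countable E \<and> (\<forall>p e. 0 < e \<longrightarrow> (\<exists>q\<in>E. dist p q < e))"
proof (intro exI conjI allI impI)
  \<comment> \<open>A code that no path has contributes an arbitrary path, which disturbs neither
    countability nor density.\<close>
  let ?E = "range (\<lambda>c. SOME p. has_code c p)"
  show "countable ?E" by simp
  fix p :: web_path and e :: real assume "0 < e"
  obtain n :: nat where "2 / e < n"
    using reals_Archimedean2 by blast
  moreover have "0 < 2 / e" using \<open>0 < e\<close> by simp
  ultimately have "0 < real n" by linarith
  then have n: "0 < n" "2 / n < e"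
    using \<open>0 < e\<close> \<open>2 / e < n\<close> by (auto simp: field_simps)
  obtain L w where c: "has_code (n, L, w) p"
    using ex_code[OF n(1)] by blast
  have "dist p (SOME p. has_code (n, L, w) p) \<le> 2 / n"
    using c n by (intro has_code_close) (auto intro: someI)
  then show "\<exists>q\<in>?E. dist p q < e"
    using n by (intro bexI[of _ "SOME p. has_code (n, L, w) p"]) auto
qed

lemma web_path_ball_basis:
  "\<exists>E :: web_path set. countable E \<and> topological_basis ((\<lambda>(q, r). ball q r) ` (E \<times> \<rat>))"
proof -
  obtain E :: "web_path set" where E: "countable E" "\<And>p e. 0 < e \<Longrightarrow> \<exists>q\<in>E. dist p q < e"
    using web_path_separable by blast
  have "topological_basis ((\<lambda>(q, r). ball q r) ` (E \<times> \<rat>))"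
  proof (rule topological_basisI)
    fix U :: "web_path set" and p assume "open U" "p \<in> U"
    then obtain e where e: "0 < e" "ball p e \<subseteq> U"
      by (meson open_contains_ball)
    obtain r where r: "r \<in> \<rat>" "e / 4 < r" "r < e / 2"
      using Rats_dense_in_real[of "e / 4" "e / 2"] e by auto
    obtain q where q: "q \<in> E" "dist p q < e / 4"
      using E(2)[of "e / 4"] e by auto
    have "ball q r \<subseteq> ball p e"
    proof
      fix x assume "x \<in> ball q r"
      then show "x \<in> ball p e"
        using q r e dist_triangle[of p x q] by auto
    qed
    moreover have "p \<in> ball q r"
      using q r by (simp add: dist_commute)
    moreover have "ball q r \<in> (\<lambda>(q, r). ball q r) ` (E \<times> \<rat>)"
      using q(1) r(1) by (intro image_eqI[of _ _ "(q, r)"]) auto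
    ultimately show "\<exists>B'\<in>(\<lambda>(q, r). ball q r) ` (E \<times> \<rat>). p \<in> B' \<and> B' \<subseteq> U"
      using e(2) by (intro bexI[of _ "ball q r"]) auto
  next
    fix B assume "B \<in> (\<lambda>(q :: web_path, r). ball q r) ` (E \<times> \<rat>)"
    then show "open B" by force
  qed
  then show ?thesis using E by blast
qed

text \<open>Second countability makes coordinatewise measurable maps into
  \<open>nat \<Rightarrow> web_path\<close> Borel measurable, so that continuous functions of
  finitely many random paths are random variables.\<close>

instance web_path :: second_countable_topology
proof
  obtain E :: "web_path set" where E: "countable E"
      "topological_basis ((\<lambda>(q, r). ball q r) ` (E \<times> \<rat>))"
    using web_path_ball_basis by blast
  then show "\<exists>B :: web_path set set. countable B \<and> open = generate_topology B"
    using topological_basis_imp_subbasis countable_rat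
    by (intro exI[of _ "(\<lambda>(q, r). ball q r) ` (E \<times> \<rat>)"]) auto
qed

text \<open>By continuity of \<open>pv\<close> the rational times determine the distance; its
  sublevel sets thereby become countable intersections.\<close>

lemma dist_web_path_le_iff:
  "dist p q \<le> c \<longleftrightarrow> (\<forall>t\<in>\<rat>. \<bar>pv p t - pv q t\<bar> \<le> c * (1 + \<bar>t\<bar>)) \<and> \<bar>ps p - ps q\<bar> \<le> c"
proof safe
  assume c: "dist p q \<le> c"
  show "\<bar>ps p - ps q\<bar> \<le> c"
    using abs_ps_diff_le_dist[of p q] c by linarith
  fix t :: real
  have "(1 + \<bar>t\<bar>) * dist p q \<le> (1 + \<bar>t\<bar>) * c"
    using c by (intro mult_left_mono) auto
  then show "\<bar>pv p t - pv q t\<bar> \<le> c * (1 + \<bar>t\<bar>)"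
    using abs_pv_diff_le_dist[of p t q] by (simp add: mult.commute)
next
  assume *: "\<forall>t\<in>\<rat>. \<bar>pv p t - pv q t\<bar> \<le> c * (1 + \<bar>t\<bar>)" and "\<bar>ps p - ps q\<bar> \<le> c"
  have "closed {t. \<bar>pv p t - pv q t\<bar> \<le> c * (1 + \<bar>t\<bar>)}"
    by (intro closed_Collect_le continuous_intros continuous_on_pv)
  then have "closure \<rat> \<subseteq> {t. \<bar>pv p t - pv q t\<bar> \<le> c * (1 + \<bar>t\<bar>)}"
    using * by (intro closure_minimal) auto
  then show "dist p q \<le> c"
    using \<open>\<bar>ps p - ps q\<bar> \<le> c\<close> by (intro dist_web_path_leI) (auto simp: Rats_closure_real)
qed

text \<open>Countably many balls generate the Borel sets, and \<open>dist_web_path_le_iff\<close>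
  reduces balls to evaluations at rational times.\<close>

lemma measurable_web_pathI:
  assumes [measurable]: "(\<lambda>\<omega>. ps (P \<omega>)) \<in> borel_measurable M"
    "\<And>t. (\<lambda>\<omega>. pv (P \<omega>) t) \<in> borel_measurable M"
  shows "P \<in> M \<rightarrow>\<^sub>M borel"
proof -
  obtain E :: "web_path set" where E: "countable E"
      "topological_basis ((\<lambda>(q, r). ball q r) ` (E \<times> \<rat>))"
    using web_path_ball_basis by blast
  have D [measurable]: "(\<lambda>\<omega>. dist (P \<omega>) q) \<in> borel_measurable M" for q
    unfolding borel_measurable_iff_le dist_web_path_le_iff
    by (auto intro!: sets.sets_Collect_conj sets.sets_Collect_countable_Ball simp: countable_rat)
  have "borel = sigma UNIV ((\<lambda>(q, r). ball q r) ` (E \<times> \<rat>))"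
    using E by (intro borel_eq_countable_basis) (auto simp: countable_rat)
  moreover have "P \<in> M \<rightarrow>\<^sub>M sigma UNIV ((\<lambda>(q, r). ball q r) ` (E \<times> \<rat>))"
  proof (rule measurable_measure_of)
    fix B assume "B \<in> (\<lambda>(q, r). ball q r) ` (E \<times> \<rat>)"
    then obtain q r where B: "B = ball q r" by auto
    have "P -` B \<inter> space M = {\<omega> \<in> space M. dist (P \<omega>) q < r}"
      by (auto simp: B dist_commute)
    then show "P -` B \<inter> space M \<in> sets M" by simp
  qed auto
  ultimately show ?thesis by simp
qed

section \<open>Measurable events for path families\<close>

lemma compact_paths: "compact (paths K)" and paths_nonempty: "paths K \<noteq> {}"
  using paths[of K] by auto

lemma dist_path_family: "dist K L = hausdorff_dist (paths K) (paths L)"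
  by (simp add: dist_path_family.rep_eq)

text \<open>A compact set disjoint from \<open>C\<close> has a positive distance \<open>d\<close>
  from it, and a family at Hausdorff distance less than \<open>d\<close> still misses
  \<open>C\<close>.\<close>

lemma open_avoiding:
  assumes "closed C"
  shows "open {K. paths K \<inter> C = {}}"
  unfolding open_dist
proof safe
  fix K assume K: "paths K \<inter> C = {}"
  show "\<exists>e>0. \<forall>L. dist L K < e \<longrightarrow> L \<in> {K. paths K \<inter> C = {}}"
  proof (cases "C = {}")
    case True
    then show ?thesis by (auto intro: exI[of _ 1])
  next
    case False
    have "continuous_on (paths K) (\<lambda>p. infdist p C)"
      by (intro continuous_intros)
    then obtain p where p: "p \<in> paths K" "\<And>q. q \<in> paths K \<Longrightarrow> infdist p C \<le> infdist q C"
      using continuous_attains_inf[OF compact_paths paths_nonempty] by blast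
    define d where "d = infdist p C"
    have "d > 0"
      unfolding d_def
      using p(1) K in_closed_iff_infdist_zero[OF assms False, of p] infdist_nonneg[of p C]
      by auto
    have d: "d \<le> dist p q" if "p \<in> paths K" "q \<in> C" for p q
      using p(2)[OF that(1)] infdist_le[OF that(2), of p] by (simp add: d_def)
    show ?thesis
    proof (intro exI[of _ d] conjI allI impI CollectI equals0I)
      fix L q assume L: "dist L K < d" "q \<in> paths L \<inter> C"
      have "infdist q (paths K) \<le> dist L K"
        unfolding dist_path_family
        using L(2) by (intro infdist_le_hausdorff_dist compact_paths) auto
      moreover have "d \<le> infdist q (paths K)"
        unfolding infdist_notempty[OF paths_nonempty]
        using L(2) d by (intro cINF_greatest paths_nonempty) (auto simp: dist_commute)
      ultimately show False using L(1) by simp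
    qed (fact \<open>d > 0\<close>)
  qed
qed

text \<open>Crossing events and the events of \<open>eta\<close> are assembled from conditions of
  this kind, which settles their measurability.\<close>

lemma hitting_sets:
  assumes "closed C"
  shows "{K. paths K \<inter> C \<noteq> {}} \<in> sets borel"
proof -
  have "{K. paths K \<inter> C \<noteq> {}} = - {K. paths K \<inter> C = {}}" by auto
  then show ?thesis
    using open_avoiding[OF assms] by (metis borel_closed closed_def double_complement)
qed

text \<open>Along a subsequence the touched points converge, as \<open>A\<close> and
  \<open>B\<close> are compact, and by joint continuity of \<open>pv\<close> the limit path touches
  their limits. The times are ordered by \<open>\<le>\<close> because a strict inequality would be
  lost in the limit.\<close>

lemma closed_touching_two:
  assumes "compact A" "compact B"
  shows "closed {p. \<exists>(x, s)\<in>A. \<exists>(x', s')\<in>B. s \<le> s' \<and> touches p (x, s) \<and> touches p (x', s')}"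
    (is "closed ?C")
  unfolding closed_sequential_limits
proof safe
  fix P p assume P: "\<forall>n :: nat. P n \<in> ?C" and lim: "P \<longlonglongrightarrow> p"
  have "\<exists>z. z \<in> A \<times> B \<and> snd (fst z) \<le> snd (snd z) \<and> touches (P n) (fst z) \<and> touches (P n) (snd z)" for n
    using P by fastforce
  then obtain z where z: "\<And>n. z n \<in> A \<times> B" "\<And>n. snd (fst (z n)) \<le> snd (snd (z n))"
      "\<And>n. touches (P n) (fst (z n))" "\<And>n. touches (P n) (snd (z n))"
    by metis
  have "compact (A \<times> B)" using assms by (rule compact_Times)
  then obtain l r where l: "l \<in> A \<times> B" "strict_mono r" "(z \<circ> r) \<longlonglongrightarrow> l"
    using z(1) unfolding compact_def by metis
  have zr: "(\<lambda>n. z (r n)) \<longlonglongrightarrow> l" and Pr: "(\<lambda>n. P (r n)) \<longlonglongrightarrow> p"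
    using l LIMSEQ_subseq_LIMSEQ[OF lim l(2)] by (auto simp: o_def)
  have touch: "touches p (fst w, snd w)"
    if w: "(\<lambda>n. w' (r n)) \<longlonglongrightarrow> w" "\<And>n. touches (P n) (w' n)" for w' w
  proof -
    have w1: "(\<lambda>n. fst (w' (r n))) \<longlonglongrightarrow> fst w" and w2: "(\<lambda>n. snd (w' (r n))) \<longlonglongrightarrow> snd w"
      using w(1) by (auto intro: tendsto_intros)
    have t: "ps (P n) \<le> tanh (snd (w' n))" "pv (P n) (snd (w' n)) = tanh (fst (w' n))" for n
      using w(2)[of n] touches_iff[of "P n" "fst (w' n)" "snd (w' n)"] by (auto simp: ps_le_iff)
    have "ps p \<le> tanh (snd w)"
      by (rule LIMSEQ_le[OF tendsto_ps[OF Pr] tendsto_tanh[OF w2]]) (use t in \<open>auto simp: cosh_real_nonzero\<close>)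
    moreover have "pv p (snd w) = tanh (fst w)"
      by (rule LIMSEQ_unique[OF tendsto_pv[OF Pr w2]])
         (use tendsto_tanh[OF w1] in \<open>simp add: t cosh_real_nonzero\<close>)
    ultimately show ?thesis
      using touches_iff[of p "fst w" "snd w"] by (simp add: ps_le_iff)
  qed
  have "touches p (fst l)" "touches p (snd l)"
    using touch[OF tendsto_fst[OF zr]] touch[OF tendsto_snd[OF zr]] z by auto
  moreover have "snd (fst l) \<le> snd (snd l)"
    by (rule LIMSEQ_le[OF tendsto_snd[OF tendsto_fst[OF zr]] tendsto_snd[OF tendsto_snd[OF zr]]])
       (use z(2) in auto)
  ultimately show "\<exists>(x, s)\<in>A. \<exists>(x', s')\<in>B. s \<le> s' \<and> touches p (x, s) \<and> touches p (x', s')"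
    using l(1) by (intro bexI[of _ "fst l"] bexI[of _ "snd l"]) (auto simp: split_beta)
qed

lemma crossing_event_sets:
  assumes "sqrt t < u"
  shows "crossing_event t u x0 t0 \<in> sets borel"
proof -
  let ?C = "{p. \<exists>(x, s)\<in>rect x0 t0 (sqrt t) t. \<exists>(x', s')\<in>rect_sides x0 t0 u (2 * t).
    s \<le> s' \<and> touches p (x, s) \<and> touches p (x', s')}"
  \<comment> \<open>Points of the small rectangle are within \<open>sqrt t / 2\<close> of
    \<open>x0\<close>, the sides are at distance \<open>u / 2\<close>, and a path has one position
    at a time. So the two times differ, and the strict order in the event may be replaced by the
    closed one.\<close>
  have "s \<noteq> s'" if "touches p (x, s)" "touches p (x', s')" "(x, s) \<in> rect x0 t0 (sqrt t) t"
    "(x', s') \<in> rect_sides x0 t0 u (2 * t)" for p x s x' s'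
    using that assms by (auto simp: touches_iff rect_def rect_sides_def)
  then have "crossing_event t u x0 t0 = {K. paths K \<inter> ?C \<noteq> {}}"
    unfolding crossing_event_def by (fastforce simp: order.order_iff_strict)
  moreover have "closed ?C"
    by (rule closed_touching_two) (auto simp: rect_def rect_sides_def intro!: compact_Times)
  ultimately show ?thesis
    using hitting_sets by simp
qed

definition eta_points :: "real \<Rightarrow> real \<Rightarrow> real \<Rightarrow> real \<Rightarrow> path_family \<Rightarrow> real set" where
  "eta_points t0 t a b K =
     {y. \<exists>p\<in>paths K. touches p (y, t0 + t) \<and> (\<exists>x\<in>{a..b}. touches p (x, t0))}"

lemma eta_eq:
  "eta t0 t a b K =
     (if finite (eta_points t0 t a b K) then enat (card (eta_points t0 t a b K)) else \<infinity>)"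
proof -
  let ?S = "{z \<in> UNIV \<times> {t0 + t}. \<exists>p\<in>paths K. touches p z \<and> (\<exists>w\<in>{a..b} \<times> {t0}. touches p w)}"
  have S: "?S = (\<lambda>y. (y, t0 + t)) ` eta_points t0 t a b K"
    unfolding eta_points_def by force
  have inj: "inj_on (\<lambda>y. (y, t0 + t)) A" for A
    by (auto simp: inj_on_def)
  show ?thesis
    unfolding eta_def Let_def S by (simp add: card_image[OF inj] finite_image_iff[OF inj])
qed

lemma le_eta_iff:
  "enat k \<le> eta t0 t a b K \<longleftrightarrow> (\<exists>F. finite F \<and> card F = k \<and> F \<subseteq> eta_points t0 t a b K)"
proof
  assume *: "enat k \<le> eta t0 t a b K"
  show "\<exists>F. finite F \<and> card F = k \<and> F \<subseteq> eta_points t0 t a b K"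
  proof (cases "finite (eta_points t0 t a b K)")
    case True
    then show ?thesis
      using * obtain_subset_with_card_n[of k "eta_points t0 t a b K"] by (auto simp: eta_eq)
  next
    case False
    then show ?thesis
      using infinite_arbitrarily_large by blast
  qed
next
  assume "\<exists>F. finite F \<and> card F = k \<and> F \<subseteq> eta_points t0 t a b K"
  then show "enat k \<le> eta t0 t a b K"
    by (auto simp: eta_eq intro: card_mono)
qed

lemma separated_rat_intervals:
  fixes F :: "real set"
  assumes "finite F"
  shows "\<exists>l r :: real \<Rightarrow> rat. (\<forall>x\<in>F. of_rat (l x) < x \<and> x < of_rat (r x)) \<and>
    (\<forall>x\<in>F. \<forall>y\<in>F. x < y \<longrightarrow> r x < l y)"
proof -
  \<comment> \<open>Half the smallest gap between points of \<open>F\<close>; the inserted 1 keeps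
    the minimum defined if there is no gap.\<close>
  define d where "d = Min (insert 1 {y - x |x y. x \<in> F \<and> y \<in> F \<and> x < y}) / 2"
  have fin: "finite {y - x |x y. x \<in> F \<and> y \<in> F \<and> x < y}"
    by (rule finite_subset[of _ "(\<lambda>(x, y). y - x) ` (F \<times> F)"]) (use assms in auto)
  have d: "d > 0" "\<And>x y. x \<in> F \<Longrightarrow> y \<in> F \<Longrightarrow> x < y \<Longrightarrow> 2 * d \<le> y - x"
    using fin by (auto simp: d_def intro!: Min_le)
  have "\<exists>q :: rat. x - d < of_rat q \<and> of_rat q < x" "\<exists>q :: rat. x < of_rat q \<and> of_rat q < x + d" for x
    using of_rat_dense[of "x - d" x] of_rat_dense[of x "x + d"] d(1) by auto
  then obtain l r :: "real \<Rightarrow> rat" where lr: "\<And>x. x - d < of_rat (l x) \<and> of_rat (l x) < x"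
      "\<And>x. x < of_rat (r x) \<and> of_rat (r x) < x + d"
    by metis
  have "r x < l y" if "x \<in> F" "y \<in> F" "x < y" for x y
  proof -
    have "real_of_rat (r x) < of_rat (l y)"
      using lr(2)[of x] lr(1)[of y] d(2)[OF that] by linarith
    then show ?thesis by (simp add: of_rat_less)
  qed
  then show ?thesis using lr by blast
qed

text \<open>At least \<open>k\<close> points are counted iff \<open>k\<close> disjoint closed
  intervals with rational end points are each reached by a path from \<open>[a, b]\<close>. For
  fixed intervals this is a finite intersection of hitting events, and there are countably many
  choices of intervals.\<close>

lemma eta_sets:
  assumes t: "0 \<le> t"
  shows "{K. enat k \<le> eta t0 t a b K} \<in> sets borel"
proof -
  define C where "C I = {p. \<exists>x\<in>{a..b}. \<exists>y\<in>{of_rat (fst I)..of_rat (snd I)}.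
    touches p (x, t0) \<and> touches p (y, t0 + t)}" for I :: "rat \<times> rat"
  have closed: "closed (C I)" for I
  proof -
    have "C I = {p. \<exists>(x, s)\<in>{a..b} \<times> {t0}. \<exists>(x', s')\<in>{of_rat (fst I)..of_rat (snd I)} \<times> {t0 + t}.
        s \<le> s' \<and> touches p (x, s) \<and> touches p (x', s')}"
      using t by (auto simp: C_def)
    then show ?thesis
      using closed_touching_two[of "{a..b} \<times> {t0}" "{of_rat (fst I)..of_rat (snd I)} \<times> {t0 + t}"]
      by (simp add: compact_Times)
  qed
  define FF where "FF = {F :: (rat \<times> rat) set. finite F \<and> card F = k \<and> (\<forall>I\<in>F. \<forall>J\<in>F. I \<noteq> J \<longrightarrow>
    {real_of_rat (fst I)..of_rat (snd I)} \<inter> {of_rat (fst J)..of_rat (snd J)} = {})}"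
  define G where "G F = {K. \<forall>I\<in>F. paths K \<inter> C I \<noteq> {}}" for F
  have "{K. enat k \<le> eta t0 t a b K} = (\<Union>F\<in>FF. G F)"
  proof (intro set_eqI iffI)
    fix K assume "K \<in> {K. enat k \<le> eta t0 t a b K}"
    then obtain Y where Y: "finite Y" "card Y = k" "Y \<subseteq> eta_points t0 t a b K"
      by (auto simp: le_eta_iff)
    obtain l r :: "real \<Rightarrow> rat" where lr: "\<And>x. x \<in> Y \<Longrightarrow> of_rat (l x) < x \<and> x < of_rat (r x)"
        "\<And>x y. x \<in> Y \<Longrightarrow> y \<in> Y \<Longrightarrow> x < y \<Longrightarrow> r x < l y"
      using separated_rat_intervals[OF Y(1)] by metis
    let ?I = "\<lambda>y. (l y, r y)"
    have disj: "{real_of_rat (l x)..of_rat (r x)} \<inter> {of_rat (l y)..of_rat (r y)} = {}"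
      if "x \<in> Y" "y \<in> Y" "x \<noteq> y" for x y
    proof (cases "x < y")
      case True
      then have "real_of_rat (r x) < of_rat (l y)" using lr(2) that by (simp add: of_rat_less)
      then show ?thesis by auto
    next
      case False
      then have "real_of_rat (r y) < of_rat (l x)" using lr(2) that by (simp add: of_rat_less)
      then show ?thesis by auto
    qed
    have inj: "inj_on ?I Y"
    proof (rule inj_onI)
      fix x y assume *: "x \<in> Y" "y \<in> Y" "?I x = ?I y"
      then have "x \<in> {real_of_rat (l x)..of_rat (r x)} \<inter> {of_rat (l y)..of_rat (r y)}"
        using lr(1)[of x] by auto
      then show "x = y" using disj[of x y] * by blast
    qed
    have "?I ` Y \<in> FF"
      unfolding FF_def using Y inj disj by (auto simp: card_image)
    moreover have "K \<in> G (?I ` Y)"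
      unfolding G_def
    proof (intro CollectI ballI)
      fix I assume "I \<in> ?I ` Y"
      then obtain y where y: "y \<in> Y" "I = ?I y" by blast
      then obtain p x where p: "p \<in> paths K" "touches p (y, t0 + t)" "x \<in> {a..b}" "touches p (x, t0)"
        using Y(3) unfolding eta_points_def by blast
      have "y \<in> {real_of_rat (fst I)..of_rat (snd I)}"
        using lr(1)[OF y(1)] by (simp add: y(2))
      then have "p \<in> C I"
        unfolding C_def using p by blast
      with p(1) show "paths K \<inter> C I \<noteq> {}" by blast
    qed
    ultimately show "K \<in> (\<Union>F\<in>FF. G F)"
      by (rule UN_I)
  next
    fix K assume "K \<in> (\<Union>F\<in>FF. G F)"
    then obtain F where "F \<in> FF" "K \<in> G F" by blast
    then have F: "finite F" "card F = k" "\<And>I. I \<in> F \<Longrightarrow> paths K \<inter> C I \<noteq> {}"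
      "\<And>I J. I \<in> F \<Longrightarrow> J \<in> F \<Longrightarrow> I \<noteq> J \<Longrightarrow>
        {real_of_rat (fst I)..of_rat (snd I)} \<inter> {of_rat (fst J)..of_rat (snd J)} = {}"
      by (auto simp: FF_def G_def)
    have "\<exists>y. y \<in> eta_points t0 t a b K \<and> y \<in> {real_of_rat (fst I)..of_rat (snd I)}" if "I \<in> F" for I
      using F(3)[OF that] unfolding eta_points_def C_def by blast
    then obtain y where y: "\<And>I. I \<in> F \<Longrightarrow> y I \<in> eta_points t0 t a b K"
        "\<And>I. I \<in> F \<Longrightarrow> y I \<in> {real_of_rat (fst I)..of_rat (snd I)}"
      by metis
    have "inj_on y F"
    proof (rule inj_onI)
      fix I J assume *: "I \<in> F" "J \<in> F" "y I = y J"
      then have "y I \<in> {real_of_rat (fst I)..of_rat (snd I)} \<inter> {of_rat (fst J)..of_rat (snd J)}"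
        using y(2)[of I] y(2)[of J] by simp
      then show "I = J"
        using F(4)[of I J] * by blast
    qed
    then have "finite (y ` F) \<and> card (y ` F) = k \<and> y ` F \<subseteq> eta_points t0 t a b K"
      using F(1,2) y(1) by (auto simp: card_image)
    then show "K \<in> {K. enat k \<le> eta t0 t a b K}"
      unfolding le_eta_iff by blast
  qed
  moreover have "G F \<in> sets borel" if "F \<in> FF" for F
  proof -
    have "(\<Inter>I\<in>F. {K. paths K \<inter> C I \<noteq> {}}) \<in> sets borel" if "F \<noteq> {}"
      using that \<open>F \<in> FF\<close> by (intro sets.finite_INT hitting_sets closed) (auto simp: FF_def)
    moreover have "G F = (if F = {} then UNIV else (\<Inter>I\<in>F. {K. paths K \<inter> C I \<noteq> {}}))"
      by (auto simp: G_def)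
    ultimately show ?thesis by simp
  qed
  moreover have "countable FF"
    unfolding FF_def by (rule countable_subset[OF _ countable_Collect_finite]) auto
  ultimately show ?thesis
    by (simp add: sets.countable_UN'' image_subset_iff)
qed

section \<open>Brownian motion\<close>

text \<open>Levy's maximal inequality: at the first time the partial sums exceed \<open>h\<close>, the remaining
  increment is independent of the past and nonnegative with probability at least one half.\<close>

lemma (in prob_space) levy_maximal_discrete:
  fixes X :: "nat \<Rightarrow> 'a \<Rightarrow> real"
  assumes ind: "indep_vars (\<lambda>_. borel) X {..<n}"
    and half: "\<And>j. j \<le> n \<Longrightarrow> 1 / 2 \<le> prob {\<omega> \<in> space M. 0 \<le> (\<Sum>k\<in>{j..<n}. X k \<omega>)}"
  shows "prob {\<omega> \<in> space M. \<exists>i\<le>n. h < (\<Sum>k<i. X k \<omega>)}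
    \<le> 2 * prob {\<omega> \<in> space M. h < (\<Sum>k<n. X k \<omega>)}"
proof -
  have X [measurable]: "X k \<in> borel_measurable M" if "k < n" for k
    using ind that by (auto simp: indep_vars_def)
  have S [measurable]: "(\<lambda>\<omega>. \<Sum>k<i. X k \<omega>) \<in> borel_measurable M" if "i \<le> n" for i
    using that by (intro borel_measurable_sum) auto
  have R [measurable]: "(\<lambda>\<omega>. \<Sum>k\<in>{i..<n}. X k \<omega>) \<in> borel_measurable M" for i
    by (intro borel_measurable_sum) auto
  define A where "A j = {\<omega> \<in> space M. h < (\<Sum>k<j. X k \<omega>) \<and> (\<forall>i\<in>{..<j}. (\<Sum>k<i. X k \<omega>) \<le> h)}" for j
  define E where "E j = {\<omega> \<in> space M. 0 \<le> (\<Sum>k\<in>{j..<n}. X k \<omega>)}" for j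
  have A_sets: "A j \<in> events" if "j \<le> n" for j
    unfolding A_def using that
    by (intro sets.sets_Collect_conj sets.sets_Collect_finite_All
        borel_measurable_less borel_measurable_le S) auto
  have E_sets: "E j \<in> events" for j
    unfolding E_def by measurable
  have indep: "prob (A j \<inter> E j) = prob (A j) * prob (E j)" if j: "j \<le> n" for j
  proof -
    let ?P1 = "PiM {..<j} (\<lambda>_. borel :: real measure)" and ?P2 = "PiM {j..<n} (\<lambda>_. borel :: real measure)"
    let ?X1 = "\<lambda>\<omega>. \<lambda>k\<in>{..<j}. X k \<omega>" and ?X2 = "\<lambda>\<omega>. \<lambda>k\<in>{j..<n}. X k \<omega>"
    let ?B1 = "{x \<in> space ?P1. h < (\<Sum>k<j. x k) \<and> (\<forall>i\<in>{..<j}. (\<Sum>k<i. x k) \<le> h)}"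
    let ?B2 = "{x \<in> space ?P2. 0 \<le> (\<Sum>k\<in>{j..<n}. x k)}"
    have iv: "indep_var ?P1 ?X1 ?P2 ?X2"
      by (rule indep_var_restrict[OF ind]) (use j in auto)
    have sm: "(\<lambda>x. \<Sum>k<i. x k) \<in> borel_measurable ?P1" if "i \<le> j" for i
      using that by (intro borel_measurable_sum measurable_component_singleton) auto
    have B1: "?B1 \<in> sets ?P1"
      by (intro sets.sets_Collect_conj sets.sets_Collect_finite_All
          borel_measurable_less borel_measurable_le sm) auto
    have B2: "?B2 \<in> sets ?P2"
      by measurable
    have "?X1 -` ?B1 \<inter> space M = A j"
      unfolding A_def by (auto simp: space_PiM)
    moreover have "?X2 -` ?B2 \<inter> space M = E j"
      unfolding E_def by (auto simp: space_PiM)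
    moreover have "(\<lambda>x. (?X1 x, ?X2 x)) -` (?B1 \<times> ?B2) \<inter> space M
        = (?X1 -` ?B1 \<inter> space M) \<inter> (?X2 -` ?B2 \<inter> space M)"
      by blast
    ultimately show ?thesis
      using indep_varD[OF iv B1 B2] by simp
  qed
  have disj: "disjoint_family_on A {..n}"
    unfolding disjoint_family_on_def
  proof (intro ballI impI)
    fix i j :: nat assume "i \<noteq> j"
    then show "A i \<inter> A j = {}"
      by (cases i j rule: linorder_cases) (auto simp: A_def not_le[symmetric])
  qed
  have cover: "{\<omega> \<in> space M. \<exists>i\<le>n. h < (\<Sum>k<i. X k \<omega>)} = (\<Union>j\<le>n. A j)"
  proof (intro set_eqI iffI)
    fix \<omega> assume "\<omega> \<in> {\<omega> \<in> space M. \<exists>i\<le>n. h < (\<Sum>k<i. X k \<omega>)}"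
    then obtain i where i: "\<omega> \<in> space M" "i \<le> n" "h < (\<Sum>k<i. X k \<omega>)" by blast
    define j where "j = (LEAST j. h < (\<Sum>k<j. X k \<omega>))"
    have "h < (\<Sum>k<j. X k \<omega>)" "j \<le> i"
      unfolding j_def by (rule LeastI, rule i(3), rule Least_le, rule i(3))
    moreover have "(\<Sum>k<l. X k \<omega>) \<le> h" if "l < j" for l
      using not_less_Least[OF that[unfolded j_def]] by simp
    ultimately show "\<omega> \<in> (\<Union>j\<le>n. A j)"
      using i by (auto simp: A_def)
  qed (auto simp: A_def)
  have "prob {\<omega> \<in> space M. \<exists>i\<le>n. h < (\<Sum>k<i. X k \<omega>)} = (\<Sum>j\<le>n. prob (A j))"
    unfolding cover using A_sets disj by (intro finite_measure_finite_Union) auto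
  also have "\<dots> \<le> (\<Sum>j\<le>n. 2 * prob (A j \<inter> E j))"
  proof (intro sum_mono)
    fix j assume "j \<in> {..n}"
    then have "prob (A j) * (1 / 2) \<le> prob (A j) * prob (E j)"
      using half[of j] unfolding E_def[symmetric] by (intro mult_left_mono) auto
    then show "prob (A j) \<le> 2 * prob (A j \<inter> E j)"
      using indep[of j] \<open>j \<in> {..n}\<close> by simp
  qed
  also have "\<dots> = 2 * prob (\<Union>j\<le>n. A j \<inter> E j)"
  proof -
    have "disjoint_family_on (\<lambda>j. A j \<inter> E j) {..n}"
      using disj unfolding disjoint_family_on_def by blast
    then show ?thesis
      unfolding sum_distrib_left[symmetric] using A_sets E_sets
      by (subst finite_measure_finite_Union) auto
  qed
  also have "\<dots> \<le> 2 * prob {\<omega> \<in> space M. h < (\<Sum>k<n. X k \<omega>)}"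
  proof (intro mult_left_mono finite_measure_mono)
    show "(\<Union>j\<le>n. A j \<inter> E j) \<subseteq> {\<omega> \<in> space M. h < (\<Sum>k<n. X k \<omega>)}"
    proof
      fix \<omega> assume "\<omega> \<in> (\<Union>j\<le>n. A j \<inter> E j)"
      then obtain j where j: "j \<le> n" "\<omega> \<in> A j" "\<omega> \<in> E j" by blast
      have "{..<n} = {..<j} \<union> {j..<n}" using j(1) by auto
      then have "(\<Sum>k<n. X k \<omega>) = (\<Sum>k<j. X k \<omega>) + (\<Sum>k\<in>{j..<n}. X k \<omega>)"
        by (simp add: sum.union_disjoint ivl_disj_int_one)
      then show "\<omega> \<in> {\<omega> \<in> space M. h < (\<Sum>k<n. X k \<omega>)}"
        using j by (auto simp: A_def E_def)
    qed
    show "{\<omega> \<in> space M. h < (\<Sum>k<n. X k \<omega>)} \<in> events"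
      by measurable
  qed auto
  finally show ?thesis .
qed

text \<open>Brownian motion with diffusion constant \<open>v\<close>; besides standard Brownian motions this covers the
  difference of two independent ones.\<close>

definition scaled_BM :: "'w measure \<Rightarrow> real \<Rightarrow> (real \<Rightarrow> 'w \<Rightarrow> real) \<Rightarrow> bool" where
  "scaled_BM N v B \<longleftrightarrow>
     prob_space N \<and> 0 < v \<and>
     (\<forall>t\<ge>0. B t \<in> borel_measurable N) \<and>
     (\<forall>\<omega>\<in>space N. B 0 \<omega> = 0 \<and> continuous_on {0..} (\<lambda>t. B t \<omega>)) \<and>
     (\<forall>s t. 0 \<le> s \<and> s < t \<longrightarrow>
        distributed N lborel (\<lambda>\<omega>. B t \<omega> - B s \<omega>) (normal_density 0 (sqrt (v * (t - s))))) \<and>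
     (\<forall>n (\<tau>::nat \<Rightarrow> real). 0 \<le> \<tau> 0 \<and> strict_mono_on {..n} \<tau> \<longrightarrow>
        prob_space.indep_vars N (\<lambda>_. borel) (\<lambda>i \<omega>. B (\<tau> (Suc i)) \<omega> - B (\<tau> i) \<omega>) {..<n})"

lemma standard_BM_iff: "standard_BM N B \<longleftrightarrow> scaled_BM N 1 B"
  by (simp add: standard_BM_def scaled_BM_def)

lemma (in prob_space) normal_uminus:
  assumes "distributed M lborel X (normal_density 0 \<sigma>)" "0 < \<sigma>"
  shows "distributed M lborel (\<lambda>x. - X x) (normal_density 0 \<sigma>)"
  using normal_density_affine[OF assms, of "-1" 0] by simp

lemma scaled_BM_uminus:
  assumes "scaled_BM N v B"
  shows "scaled_BM N v (\<lambda>t \<omega>. - B t \<omega>)"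
proof -
  interpret prob_space N using assms by (simp add: scaled_BM_def)
  have "distributed N lborel (\<lambda>\<omega>. - B t \<omega> - - B s \<omega>) (normal_density 0 (sqrt (v * (t - s))))"
    if "0 \<le> s" "s < t" for s t
  proof -
    have "distributed N lborel (\<lambda>\<omega>. - (B t \<omega> - B s \<omega>)) (normal_density 0 (sqrt (v * (t - s))))"
      using assms that by (intro normal_uminus) (auto simp: scaled_BM_def)
    then show ?thesis by (simp add: algebra_simps)
  qed
  moreover have "indep_vars (\<lambda>_. borel) (\<lambda>i \<omega>. - B (\<tau> (Suc i)) \<omega> - - B (\<tau> i) \<omega>) {..<n}"
    if "0 \<le> \<tau> 0" "strict_mono_on {..n} \<tau>" for n and \<tau> :: "nat \<Rightarrow> real"
  proof -
    have "indep_vars (\<lambda>_. borel) (\<lambda>i \<omega>. B (\<tau> (Suc i)) \<omega> - B (\<tau> i) \<omega>) {..<n}"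
      using assms that by (simp add: scaled_BM_def)
    then have "indep_vars (\<lambda>_. borel) (\<lambda>i \<omega>. - (B (\<tau> (Suc i)) \<omega> - B (\<tau> i) \<omega>)) {..<n}"
      by (rule indep_vars_compose2) auto
    then show ?thesis by (simp add: algebra_simps)
  qed
  ultimately show ?thesis
    using assms by (auto simp: scaled_BM_def intro: continuous_on_minus)
qed

section \<open>Maximal inequalities for Brownian motion\<close>

lemma (in prob_space) normal_half:
  assumes X: "distributed M lborel X (normal_density 0 \<sigma>)" and "0 < \<sigma>"
  shows "prob {\<omega> \<in> space M. X \<omega> < - c} = prob {\<omega> \<in> space M. c < X \<omega>}"
    and "1 / 2 \<le> prob {\<omega> \<in> space M. 0 \<le> X \<omega>}"
proof -
  have X' [measurable]: "random_variable borel X"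
    using distributed_measurable[OF X] by simp
  have eq: "distr M lborel X = distr M lborel (\<lambda>x. - X x)"
    using X normal_uminus[OF assms] by (simp add: distributed_def)
  have *: "prob {\<omega> \<in> space M. X \<omega> \<in> S} = prob {\<omega> \<in> space M. - X \<omega> \<in> S}" if "S \<in> sets borel" for S
    using that arg_cong[OF eq, of "\<lambda>\<mu>. measure \<mu> S"]
    by (simp add: measure_distr vimage_def Int_def conj_commute)
  show "prob {\<omega> \<in> space M. X \<omega> < - c} = prob {\<omega> \<in> space M. c < X \<omega>}"
    using *[of "{..< - c}"] by simp
  have "1 = prob ({\<omega> \<in> space M. 0 \<le> X \<omega>} \<union> {\<omega> \<in> space M. 0 \<le> - X \<omega>})"
    by (subst prob_space[symmetric]) (auto intro!: arg_cong[where f = prob])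
  also have "\<dots> \<le> prob {\<omega> \<in> space M. 0 \<le> X \<omega>} + prob {\<omega> \<in> space M. 0 \<le> - X \<omega>}"
    by (rule measure_Un_le) measurable
  finally show "1 / 2 \<le> prob {\<omega> \<in> space M. 0 \<le> X \<omega>}"
    using *[of "{0..}"] by simp
qed

text \<open>Exceeding \<open>h\<close> is an open condition, so a continuous path that does so at
  some time does so at a dyadic time. The dyadic events increase to the event in question, and the
  discrete inequality bounds all of them by the same right-hand side.\<close>

lemma scaled_BM_maximal:
  assumes B: "scaled_BM N v B" and T: "0 < T"
  shows "{\<omega> \<in> space N. \<exists>s\<in>{0..T}. h < B s \<omega>} \<in> sets N"
    and "measure N {\<omega> \<in> space N. \<exists>s\<in>{0..T}. h < B s \<omega>}
      \<le> 2 * measure N {\<omega> \<in> space N. h < B T \<omega>}"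
proof -
  interpret prob_space N using B by (simp add: scaled_BM_def)
  have [measurable]: "B t \<in> borel_measurable N" if "0 \<le> t" for t
    using B that by (simp add: scaled_BM_def)
  define \<tau> where "\<tau> n i = T * real i / 2 ^ n" for n i :: nat
  define A where "A n = {\<omega> \<in> space N. \<exists>i\<le>2 ^ n. h < B (\<tau> n i) \<omega>}" for n
  have \<tau>0: "0 \<le> \<tau> n i" for n i using T by (simp add: \<tau>_def)
  have \<tau>T: "\<tau> n i \<le> T" if "i \<le> 2 ^ n" for n i
    using that T by (simp add: \<tau>_def divide_le_eq mult_left_mono)
  have A_sets: "A n \<in> sets N" for n
    unfolding A_def using \<tau>0 by measurable
  have eq: "{\<omega> \<in> space N. \<exists>s\<in>{0..T}. h < B s \<omega>} = (\<Union>n. A n)"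
  proof (intro set_eqI iffI)
    fix \<omega> assume "\<omega> \<in> {\<omega> \<in> space N. \<exists>s\<in>{0..T}. h < B s \<omega>}"
    then obtain s where s: "\<omega> \<in> space N" "0 \<le> s" "s \<le> T" "h < B s \<omega>" by auto
    have "continuous_on {0..} (\<lambda>t. B t \<omega>)" using B s(1) by (simp add: scaled_BM_def)
    then obtain d where d: "d > 0" "\<And>t. 0 \<le> t \<Longrightarrow> dist t s < d \<Longrightarrow> dist (B t \<omega>) (B s \<omega>) < B s \<omega> - h"
      using s unfolding continuous_on_iff by (metis atLeast_iff diff_gt_0_iff_gt)
    obtain n :: nat where n: "T / d < 2 ^ n"
      using real_arch_pow[of 2 "T / d"] by auto
    \<comment> \<open>This gives the dyadic point just to the left of \<open>s\<close>, at distance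
      less than \<open>T / 2 ^ n < d\<close>.\<close>
    define i where "i = nat \<lfloor>s * 2 ^ n / T\<rfloor>"
    have i: "real i \<le> s * 2 ^ n / T" "s * 2 ^ n / T < real i + 1"
      using s T by (auto simp: i_def)
    have "real i \<le> 2 ^ n"
      using i(1) s T by (smt (verit) divide_right_mono mult_right_mono nonzero_mult_div_cancel_left zero_le_power)
    then have "i \<le> 2 ^ n" by (metis of_nat_le_iff of_nat_numeral of_nat_power)
    moreover have "h < B (\<tau> n i) \<omega>"
    proof -
      have "s < T * (real i + 1) / 2 ^ n" "\<tau> n i \<le> s"
        using i T by (auto simp: \<tau>_def field_simps)
      then have "\<tau> n i \<le> s" "s - \<tau> n i < T / 2 ^ n"
        by (auto simp: \<tau>_def add_divide_distrib distrib_left)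
      moreover have "T / 2 ^ n < d" using n d(1) by (simp add: field_simps)
      ultimately have "dist (\<tau> n i) s < d" by (simp add: dist_real_def)
      then show ?thesis using d(2)[OF \<tau>0] by (fastforce simp: dist_real_def)
    qed
    ultimately show "\<omega> \<in> (\<Union>n. A n)" using s(1) by (auto simp: A_def)
  next
    fix \<omega> assume "\<omega> \<in> (\<Union>n. A n)"
    then show "\<omega> \<in> {\<omega> \<in> space N. \<exists>s\<in>{0..T}. h < B s \<omega>}"
      using \<tau>0 \<tau>T unfolding A_def by fastforce
  qed
  show "{\<omega> \<in> space N. \<exists>s\<in>{0..T}. h < B s \<omega>} \<in> sets N"
    unfolding eq using A_sets by auto
  have "A n \<subseteq> A (Suc n)" for n
  proof
    fix \<omega> assume "\<omega> \<in> A n"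
    then obtain i where i: "\<omega> \<in> space N" "i \<le> 2 ^ n" "h < B (\<tau> n i) \<omega>" by (auto simp: A_def)
    have "\<tau> (Suc n) (2 * i) = \<tau> n i" by (simp add: \<tau>_def)
    then show "\<omega> \<in> A (Suc n)" using i by (auto simp: A_def intro!: exI[of _ "2 * i"])
  qed
  then have inc: "incseq A" by (rule incseq_SucI)
  have "(\<lambda>n. prob (A n)) \<longlonglongrightarrow> prob (\<Union>n. A n)"
    using A_sets inc by (intro finite_Lim_measure_incseq) auto
  moreover have "prob (A n) \<le> 2 * prob {\<omega> \<in> space N. h < B T \<omega>}" for n
  proof -
    let ?X = "\<lambda>i \<omega>. B (\<tau> n (Suc i)) \<omega> - B (\<tau> n i) \<omega>"
    have tele: "(\<Sum>k\<in>{j..<i}. ?X k \<omega>) = B (\<tau> n i) \<omega> - B (\<tau> n j) \<omega>" if "j \<le> i" for i j \<omega>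
      using that by (rule sum_Suc_diff')
    have zero: "\<omega> \<in> space N \<Longrightarrow> B (\<tau> n 0) \<omega> = 0" for \<omega>
      using B by (simp add: scaled_BM_def \<tau>_def)
    have last: "\<tau> n (2 ^ n) = T" by (simp add: \<tau>_def)
    have S: "(\<Sum>k<i. ?X k \<omega>) = B (\<tau> n i) \<omega>" if "\<omega> \<in> space N" for i \<omega>
      using tele[of 0 i \<omega>] zero[OF that] by (simp add: atLeast0LessThan)
    have "prob {\<omega> \<in> space N. \<exists>i\<le>2 ^ n. h < (\<Sum>k<i. ?X k \<omega>)}
        \<le> 2 * prob {\<omega> \<in> space N. h < (\<Sum>k<2 ^ n. ?X k \<omega>)}"
    proof (rule levy_maximal_discrete)
      show "indep_vars (\<lambda>_. borel) ?X {..<2 ^ n}"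
      proof -
        have "strict_mono_on {..2 ^ n} (\<tau> n)"
          using T by (auto simp: \<tau>_def strict_mono_on_def divide_strict_right_mono)
        then show ?thesis
          using B \<tau>0[of n 0] unfolding scaled_BM_def by blast
      qed
      fix j :: nat assume j: "j \<le> 2 ^ n"
      show "1 / 2 \<le> prob {\<omega> \<in> space N. 0 \<le> (\<Sum>k\<in>{j..<2 ^ n}. ?X k \<omega>)}"
        unfolding tele[OF j] last
      proof (cases "\<tau> n j < T")
        case True
        then show "1 / 2 \<le> prob {\<omega> \<in> space N. 0 \<le> B T \<omega> - B (\<tau> n j) \<omega>}"
          using B \<tau>0 by (intro normal_half(2)[of _ "sqrt (v * (T - \<tau> n j))"])
            (auto simp: scaled_BM_def)
      next
        case False
        then have "\<tau> n j = T" using \<tau>T[OF j] by simp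
        then show "1 / 2 \<le> prob {\<omega> \<in> space N. 0 \<le> B T \<omega> - B (\<tau> n j) \<omega>}"
          using prob_space by simp
      qed
    qed
    moreover have "{\<omega> \<in> space N. \<exists>i\<le>2 ^ n. h < (\<Sum>k<i. ?X k \<omega>)} = A n"
      unfolding A_def using S by auto
    moreover have "{\<omega> \<in> space N. h < (\<Sum>k<2 ^ n. ?X k \<omega>)} = {\<omega> \<in> space N. h < B T \<omega>}"
      using S last by auto
    ultimately show ?thesis by simp
  qed
  ultimately have "prob (\<Union>n. A n) \<le> 2 * prob {\<omega> \<in> space N. h < B T \<omega>}"
    by (intro LIMSEQ_le_const2) auto
  then show "prob {\<omega> \<in> space N. \<exists>s\<in>{0..T}. h < B s \<omega>} \<le> 2 * prob {\<omega> \<in> space N. h < B T \<omega>}"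
    unfolding eq .
qed

lemma scaled_BM_distributed:
  assumes "scaled_BM N v B" "0 < T"
  shows "distributed N lborel (B T) (normal_density 0 (sqrt (v * T)))"
proof -
  have "distributed N lborel (\<lambda>\<omega>. B T \<omega> - B 0 \<omega>) (normal_density 0 (sqrt (v * (T - 0))))"
    using assms unfolding scaled_BM_def by blast
  then show ?thesis
    using assms distr_cong[OF refl refl, of N "\<lambda>\<omega>. B T \<omega> - B 0 \<omega>" "B T" lborel]
    by (auto simp: distributed_def scaled_BM_def)
qed

text \<open>The maximal inequality for \<open>B\<close> and for \<open>-B\<close> reduces the event
  to \<open>\<bar>B T\<bar> > c\<close> at the price of a factor 2; then Chebyshev's inequality with
  variance \<open>T\<close> applies.\<close>

lemma standard_BM_sup:
  assumes B: "standard_BM N B" and T: "0 < T" and c: "0 < c"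
  shows "{\<omega> \<in> space N. \<exists>s\<in>{0..T}. c < \<bar>B s \<omega>\<bar>} \<in> sets N"
    and "measure N {\<omega> \<in> space N. \<exists>s\<in>{0..T}. c < \<bar>B s \<omega>\<bar>} \<le> 2 * T / c\<^sup>2"
proof -
  interpret prob_space N using B by (simp add: standard_BM_def)
  have [measurable]: "B t \<in> borel_measurable N" if "0 \<le> t" for t
    using B that by (simp add: standard_BM_def)
  let ?A = "\<lambda>B. {\<omega> \<in> space N. \<exists>s\<in>{0..T}. c < B s \<omega>}" and ?B' = "\<lambda>t \<omega>. - B t \<omega>"
  have s: "scaled_BM N 1 B" using B by (simp add: standard_BM_iff)
  note s' = scaled_BM_uminus[OF s]
  have eq: "{\<omega> \<in> space N. \<exists>s\<in>{0..T}. c < \<bar>B s \<omega>\<bar>} = ?A B \<union> ?A ?B'"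
  proof -
    have "c < \<bar>x\<bar> \<longleftrightarrow> c < x \<or> c < - x" for x :: real by arith
    then show ?thesis by blast
  qed
  show "{\<omega> \<in> space N. \<exists>s\<in>{0..T}. c < \<bar>B s \<omega>\<bar>} \<in> sets N"
    unfolding eq by (intro sets.Un scaled_BM_maximal(1)[OF s T] scaled_BM_maximal(1)[OF s' T])
  have X: "distributed N lborel (B T) (normal_density 0 (sqrt T))"
    using scaled_BM_distributed[OF s T] by simp
  have "prob (?A B \<union> ?A ?B') \<le> prob (?A B) + prob (?A ?B')"
    by (intro measure_Un_le scaled_BM_maximal(1)[OF s T] scaled_BM_maximal(1)[OF s' T])
  also have "\<dots> \<le> 2 * prob {\<omega> \<in> space N. c < B T \<omega>} + 2 * prob {\<omega> \<in> space N. c < - B T \<omega>}"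
    by (intro add_mono scaled_BM_maximal(2)[OF s T] scaled_BM_maximal(2)[OF s' T])
  also have "\<dots> = 2 * prob ({\<omega> \<in> space N. c < B T \<omega>} \<union> {\<omega> \<in> space N. c < - B T \<omega>})"
    using T c by (subst finite_measure_Union) (auto simp: distrib_left)
  also have "\<dots> \<le> 2 * prob {\<omega> \<in> space N. c \<le> \<bar>B T \<omega> - expectation (B T)\<bar>}"
    using T c normal_distributed_expectation[OF _ X]
    by (intro mult_left_mono finite_measure_mono) auto
  also have "\<dots> \<le> 2 * (variance (B T) / c\<^sup>2)"
  proof (intro mult_left_mono Chebyshev_inequality)
    show "integrable N (\<lambda>\<omega>. (B T \<omega>)\<^sup>2)"
      using integrable_normal_moment[of "sqrt T" 0 2] distributed_integrable[OF X, of "\<lambda>x. x\<^sup>2"] T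
      by simp
  qed (use T c in auto)
  also have "variance (B T) = T"
    using normal_distributed_variance[OF _ X] T by simp
  finally show "prob {\<omega> \<in> space N. \<exists>s\<in>{0..T}. c < \<bar>B s \<omega>\<bar>} \<le> 2 * T / c\<^sup>2"
    unfolding eq by simp
qed

section \<open>Differences of independent Brownian motions\<close>

lemma (in prob_space) indep_vars_uncurry:
  assumes Y: "indep_vars M' Y J" and J: "finite J" "J \<noteq> {}" and I: "finite I" "I \<noteq> {}"
    and f: "\<And>j i. j \<in> J \<Longrightarrow> i \<in> I \<Longrightarrow> f j i \<in> M' j \<rightarrow>\<^sub>M N"
    and inner: "\<And>j. j \<in> J \<Longrightarrow> indep_vars (\<lambda>_. N) (\<lambda>i \<omega>. f j i (Y j \<omega>)) I"
  shows "indep_vars (\<lambda>_. N) (\<lambda>(j, i) \<omega>. f j i (Y j \<omega>)) (J \<times> I)"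
proof -
  have Ym: "Y j \<in> M \<rightarrow>\<^sub>M M' j" if "j \<in> J" for j
    using Y that by (simp add: indep_vars_def)
  have "\<forall>A\<in>(\<Pi> ji\<in>J \<times> I. sets N).
      prob (\<Inter>ji\<in>J \<times> I. (\<lambda>(j, i) \<omega>. f j i (Y j \<omega>)) ji -` A ji \<inter> space M)
      = (\<Prod>ji\<in>J \<times> I. prob ((\<lambda>(j, i) \<omega>. f j i (Y j \<omega>)) ji -` A ji \<inter> space M))"
  proof
    fix A assume A: "A \<in> (\<Pi> ji\<in>J \<times> I. sets N)"
    \<comment> \<open>For fixed \<open>j\<close> the conditions on all
      \<open>f j i (Y j \<omega>)\<close> amount to a single event of \<open>Y j\<close>.
      Independence over \<open>j\<close> splits the probability into factors, and
      \<open>inner\<close> splits each factor over \<open>i\<close>.\<close>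
    define G where "G j = (\<Inter>i\<in>I. f j i -` A (j, i) \<inter> space (M' j))" for j
    have G: "G j \<in> sets (M' j)" if "j \<in> J" for j
      unfolding G_def using A f that I by (intro sets.finite_INT measurable_sets) auto
    have YG: "Y j -` G j \<inter> space M = (\<Inter>i\<in>I. (\<lambda>\<omega>. f j i (Y j \<omega>)) -` A (j, i) \<inter> space M)"
      if "j \<in> J" for j
      unfolding G_def using measurable_space[OF Ym[OF that]] I by auto
    have "(\<Inter>ji\<in>J \<times> I. (\<lambda>(j, i) \<omega>. f j i (Y j \<omega>)) ji -` A ji \<inter> space M)
        = (\<Inter>j\<in>J. (\<Inter>i\<in>I. (\<lambda>\<omega>. f j i (Y j \<omega>)) -` A (j, i) \<inter> space M))"
      using J I by auto
    also have "\<dots> = (\<Inter>j\<in>J. Y j -` G j \<inter> space M)"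
      using YG by simp
    finally have "prob (\<Inter>ji\<in>J \<times> I. (\<lambda>(j, i) \<omega>. f j i (Y j \<omega>)) ji -` A ji \<inter> space M)
        = (\<Prod>j\<in>J. prob (Y j -` G j \<inter> space M))"
      using indep_varsD_finite[OF Y J(2,1) G] by simp
    also have "\<dots> = (\<Prod>j\<in>J. \<Prod>i\<in>I. prob ((\<lambda>\<omega>. f j i (Y j \<omega>)) -` A (j, i) \<inter> space M))"
    proof (intro prod.cong refl)
      fix j assume j: "j \<in> J"
      show "prob (Y j -` G j \<inter> space M) = (\<Prod>i\<in>I. prob ((\<lambda>\<omega>. f j i (Y j \<omega>)) -` A (j, i) \<inter> space M))"
        unfolding YG[OF j] using A j by (intro indep_varsD_finite[OF inner[OF j] I(2,1)]) auto
    qed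
    also have "\<dots> = (\<Prod>ji\<in>J \<times> I. prob ((\<lambda>(j, i) \<omega>. f j i (Y j \<omega>)) ji -` A ji \<inter> space M))"
      by (simp add: prod.cartesian_product split_beta)
    finally show "prob (\<Inter>ji\<in>J \<times> I. (\<lambda>(j, i) \<omega>. f j i (Y j \<omega>)) ji -` A ji \<inter> space M)
      = (\<Prod>ji\<in>J \<times> I. prob ((\<lambda>(j, i) \<omega>. f j i (Y j \<omega>)) ji -` A ji \<inter> space M))" .
  qed
  then show ?thesis
    using J I f Ym
    by (subst indep_vars_finite[where E = "\<lambda>_. sets N"])
       (auto simp: sets.sigma_sets_eq sets.Int_stable intro: measurable_compose dest: sets.sets_into_space)
qed

text \<open>Independence of increments is first established for all pairs of a motion and a time
  interval, then regrouped by time intervals, so that the two increments over one interval form one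
  block. Their variances add, whence the 2.\<close>

lemma scaled_BM_diff:
  assumes B: "indep_standard_BMs N n B" and ij: "i < n" "j < n" "i \<noteq> j"
  shows "scaled_BM N 2 (\<lambda>t \<omega>. B i t \<omega> - B j t \<omega>)"
proof -
  interpret prob_space N using B by (simp add: indep_standard_BMs_def)
  have st: "standard_BM N (B k)" if "k \<in> {i, j}" for k
    using B ij that by (auto simp: indep_standard_BMs_def)
  have ind: "indep_vars (\<lambda>_. \<Pi>\<^sub>M t\<in>{0..}. borel) (\<lambda>k \<omega>. \<lambda>t\<in>{0..}. B k t \<omega>) {i, j}"
    using B ij unfolding indep_standard_BMs_def by (auto intro: indep_vars_subset)
  have meas [measurable]: "B k t \<in> borel_measurable N" if "k \<in> {i, j}" "0 \<le> t" for k t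
    using st[OF that(1)] that(2) by (simp add: standard_BM_def)
  have incr: "indep_vars (\<lambda>_. borel) (\<lambda>k \<omega>. (B i (\<tau> (Suc k)) \<omega> - B j (\<tau> (Suc k)) \<omega>) -
      (B i (\<tau> k) \<omega> - B j (\<tau> k) \<omega>)) {..<m}"
    if \<tau>: "0 \<le> \<tau> 0" "strict_mono_on {..m} \<tau>" for m and \<tau> :: "nat \<Rightarrow> real"
  proof (cases "m = 0")
    case False
    have \<tau>0: "0 \<le> \<tau> k" if "k \<le> m" for k
      using strict_mono_on_leD[OF \<tau>(2), of 0 k] \<tau>(1) that by auto
    define f where "f k p = p (\<tau> (Suc k)) - p (\<tau> k)" for k and p :: "real \<Rightarrow> real"
    have f: "f k \<in> (\<Pi>\<^sub>M t\<in>{0..}. borel) \<rightarrow>\<^sub>M borel" if "k < m" for k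
      unfolding f_def using \<tau>0 that
      by (intro borel_measurable_diff measurable_component_singleton) auto
    have fB: "f k (\<lambda>t\<in>{0..}. B l t \<omega>) = B l (\<tau> (Suc k)) \<omega> - B l (\<tau> k) \<omega>" if "k < m" for k l \<omega>
      unfolding f_def using \<tau>0 that by simp
    have "indep_vars (\<lambda>_. borel) (\<lambda>(l, k) \<omega>. f k (\<lambda>t\<in>{0..}. B l t \<omega>)) ({i, j} \<times> {..<m})"
    proof (rule indep_vars_uncurry[OF ind])
      fix l assume "l \<in> {i, j}"
      then have "indep_vars (\<lambda>_. borel) (\<lambda>k \<omega>. B l (\<tau> (Suc k)) \<omega> - B l (\<tau> k) \<omega>) {..<m}"
        using st \<tau> unfolding standard_BM_def by blast
      then show "indep_vars (\<lambda>_. borel) (\<lambda>k \<omega>. f k (\<lambda>t\<in>{0..}. B l t \<omega>)) {..<m}"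
        by (rule indep_vars_cong[THEN iffD1, rotated -1]) (auto simp: fB)
    qed (use False f in auto)
    then have "indep_vars (\<lambda>k. PiM {(i, k), (j, k)} (\<lambda>_. borel))
        (\<lambda>k \<omega>. \<lambda>lk\<in>{(i, k), (j, k)}. (\<lambda>(l, k) \<omega>. f k (\<lambda>t\<in>{0..}. B l t \<omega>)) lk \<omega>) {..<m}"
      by (rule indep_vars_restrict) (auto simp: disjoint_family_on_def)
    then have "indep_vars (\<lambda>_. borel)
        (\<lambda>k \<omega>. (\<lambda>x. x (i, k) - x (j, k))
          (\<lambda>lk\<in>{(i, k), (j, k)}. (\<lambda>(l, k) \<omega>. f k (\<lambda>t\<in>{0..}. B l t \<omega>)) lk \<omega>)) {..<m}"
      by (rule indep_vars_compose2) (auto intro!: borel_measurable_diff measurable_component_singleton)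
    then show ?thesis
      by (rule indep_vars_cong[THEN iffD1, rotated -1]) (auto simp: fB)
  qed (simp add: indep_vars_def indep_sets_def)
  have "distributed N lborel (\<lambda>\<omega>. (B i t \<omega> - B j t \<omega>) - (B i s \<omega> - B j s \<omega>))
      (normal_density 0 (sqrt (2 * (t - s))))" if s: "0 \<le> s" "s < t" for s t
  proof -
    let ?Y = "\<lambda>k \<omega>. B k t \<omega> - B k s \<omega>"
    have Y: "distributed N lborel (?Y k) (normal_density 0 (sqrt (t - s)))" if "k \<in> {i, j}" for k
      using st[OF that] s by (simp add: standard_BM_def)
    have "indep_vars (\<lambda>_. borel) (\<lambda>k \<omega>. (\<lambda>p. p t - p s) (\<lambda>t\<in>{0..}. B k t \<omega>)) {i, j}"
      using s by (intro indep_vars_compose2[OF ind] borel_measurable_diff measurable_component_singleton) auto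
    then have "indep_vars (\<lambda>_. borel) ?Y {i, j}"
      using s by simp
    from indep_var_restrict[OF this, of "{i}" "{j}"] ij
    have "indep_var (PiM {i} (\<lambda>_. borel)) (\<lambda>\<omega>. \<lambda>k\<in>{i}. ?Y k \<omega>)
        (PiM {j} (\<lambda>_. borel)) (\<lambda>\<omega>. \<lambda>k\<in>{j}. ?Y k \<omega>)" by simp
    from indep_var_compose[OF this, of "\<lambda>x. x i" borel "\<lambda>x. x j" borel]
    have "indep_var borel (?Y i) borel (?Y j)"
      by (simp add: o_def measurable_component_singleton)
    then have "distributed N lborel (\<lambda>\<omega>. ?Y i \<omega> - ?Y j \<omega>)
        (normal_density (0 - 0) (sqrt ((sqrt (t - s))\<^sup>2 + (sqrt (t - s))\<^sup>2)))"
      using s Y by (intro diff_indep_normal) auto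
    then show ?thesis using s by (simp add: algebra_simps)
  qed
  then show ?thesis
    unfolding scaled_BM_def using incr st[of i] st[of j] meas
    by (auto simp: standard_BM_def prob_space_axioms intro!: continuous_on_diff)
qed

text \<open>The right-hand side is the probability of \<open>[-h, h]\<close>, by symmetry, and on
  this interval of length \<open>2 * h\<close> the density is smallest at the end points.\<close>

lemma normal_density_interval:
  assumes "distributed N lborel X (normal_density 0 \<sigma>)" "0 < \<sigma>" "0 \<le> h" "prob_space N"
  shows "2 * h * normal_density 0 \<sigma> h \<le> 1 - 2 * measure N {\<omega> \<in> space N. h < X \<omega>}"
proof -
  interpret prob_space N by fact
  have X [measurable]: "random_variable borel X"
    using distributed_measurable[OF assms(1)] by simp
  have "ennreal (normal_density 0 \<sigma> h) * indicator {-h..h} x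
      \<le> ennreal (normal_density 0 \<sigma> x) * indicator {-h..h} x" for x
  proof (cases "x \<in> {-h..h}")
    case True
    then have "x\<^sup>2 \<le> h\<^sup>2" by (simp add: abs_le_iff abs_le_square_iff[symmetric])
    then have "normal_density 0 \<sigma> h \<le> normal_density 0 \<sigma> x"
      using assms(2) by (auto simp: normal_density_def intro!: mult_left_mono divide_right_mono)
    then show ?thesis by (simp add: ennreal_leI mult_right_mono)
  qed simp
  then have "(\<integral>\<^sup>+x. ennreal (normal_density 0 \<sigma> h) * indicator {-h..h} x \<partial>lborel)
      \<le> (\<integral>\<^sup>+x. ennreal (normal_density 0 \<sigma> x) * indicator {-h..h} x \<partial>lborel)"
    by (intro nn_integral_mono) auto
  also have "\<dots> = emeasure N (X -` {-h..h} \<inter> space N)"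
    by (rule distributed_emeasure[OF assms(1), symmetric]) simp
  also have "(\<integral>\<^sup>+x. ennreal (normal_density 0 \<sigma> h) * indicator {-h..h} x \<partial>lborel)
      = ennreal (normal_density 0 \<sigma> h * (2 * h))"
    using assms(3) by (subst nn_integral_cmult_indicator) (auto simp: ennreal_mult)
  finally have 1: "normal_density 0 \<sigma> h * (2 * h) \<le> prob (X -` {-h..h} \<inter> space N)"
    by (simp add: emeasure_eq_measure)
  have "X -` {-h..h} \<inter> space N = space N - ({\<omega> \<in> space N. h < X \<omega>} \<union> {\<omega> \<in> space N. X \<omega> < - h})"
    by auto
  then have "prob (X -` {-h..h} \<inter> space N)
      = 1 - prob ({\<omega> \<in> space N. h < X \<omega>} \<union> {\<omega> \<in> space N. X \<omega> < - h})"
    by (simp add: prob_compl)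
  also have "prob ({\<omega> \<in> space N. h < X \<omega>} \<union> {\<omega> \<in> space N. X \<omega> < - h})
      = prob {\<omega> \<in> space N. h < X \<omega>} + prob {\<omega> \<in> space N. X \<omega> < - h}"
    using assms(3) by (intro finite_measure_Union) auto
  also have "prob {\<omega> \<in> space N. X \<omega> < - h} = prob {\<omega> \<in> space N. h < X \<omega>}"
    using assms by (intro normal_half)
  finally show ?thesis using 1 by (simp add: algebra_simps)
qed

text \<open>By Levy's inequality the probability of staying below \<open>h\<close> is at least that of \<open>\<bar>Z\<bar> < h\<close> for a
  normal \<open>Z\<close> of variance \<open>2 t\<close>, whose density on \<open>[-h, h]\<close> is at least its value at \<open>h\<close>.\<close>

lemma scaled_BM_below:
  assumes D: "scaled_BM N 2 D" and t: "0 < t" and h: "0 < h"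
    and A: "A \<in> sets N" "\<And>\<omega>. \<omega> \<in> space N \<Longrightarrow> (\<And>s. s \<in> {0..t} \<Longrightarrow> D s \<omega> < h) \<Longrightarrow> \<omega> \<in> A"
  shows "h / sqrt (pi * t) * exp (- h\<^sup>2 / (4 * t)) \<le> measure N A"
proof (rule field_le_mult_one_interval)
  interpret prob_space N using D by (simp add: scaled_BM_def)
  \<comment> \<open>The maximal inequality controls the event that \<open>D\<close> stays at or
    below \<open>z * h\<close>, which for \<open>z < 1\<close> is strictly below \<open>h\<close>.
    For variance \<open>2 * t\<close> the number
    \<open>2 * h * normal_density 0 (sqrt (2 * t)) h\<close> is the claimed bound; the factor
    \<open>z\<close> is lost only in the limit.\<close>
  fix z :: real assume z: "0 < z" "z < 1"
  let ?\<sigma> = "sqrt (2 * t)" and ?h = "z * h"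
  have X: "distributed N lborel (D t) (normal_density 0 ?\<sigma>)"
    using scaled_BM_distributed[OF D t] .
  have "normal_density 0 ?\<sigma> ?h = 1 / (2 * sqrt (pi * t)) * exp (- ?h\<^sup>2 / (4 * t))"
    using t by (simp add: normal_density_def real_sqrt_mult power_mult_distrib)
  moreover have "exp (- h\<^sup>2 / (4 * t)) \<le> exp (- ?h\<^sup>2 / (4 * t))"
    using z h t by (simp add: divide_right_mono power_mult_distrib mult_le_cancel_right1 power_le_one)
  ultimately have "z * (h / sqrt (pi * t) * exp (- h\<^sup>2 / (4 * t))) \<le> 2 * ?h * normal_density 0 ?\<sigma> ?h"
    using z h t by (simp add: mult_left_mono divide_right_mono)
  also have "\<dots> \<le> 1 - 2 * prob {\<omega> \<in> space N. ?h < D t \<omega>}"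
    using z h t by (intro normal_density_interval[OF X]) (auto simp: prob_space_axioms)
  also have "\<dots> \<le> 1 - prob {\<omega> \<in> space N. \<exists>s\<in>{0..t}. ?h < D s \<omega>}"
    using scaled_BM_maximal(2)[OF D t, of ?h] by simp
  also have "\<dots> = prob (space N - {\<omega> \<in> space N. \<exists>s\<in>{0..t}. ?h < D s \<omega>})"
    by (rule prob_compl[symmetric]) (rule scaled_BM_maximal(1)[OF D t])
  also have "\<dots> \<le> prob A"
  proof (intro finite_measure_mono A(1) subsetI)
    fix \<omega> assume \<omega>: "\<omega> \<in> space N - {\<omega> \<in> space N. \<exists>s\<in>{0..t}. ?h < D s \<omega>}"
    have "?h < h" using z h by simp
    then show "\<omega> \<in> A" using \<omega> by (intro A(2)) force+
  qed
  finally show "z * (h / sqrt (pi * t) * exp (- h\<^sup>2 / (4 * t))) \<le> prob A" .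
qed

section \<open>Coalescing Brownian motions\<close>

text \<open>The sets \<open>meeting_times T w n k\<close> split the local set \<open>S\<close> of
  \<open>coalesce\<close> according to the earlier trajectory that is met, and
  \<open>first_meeting\<close> is its local \<open>\<tau>\<close>; the names make them available to
  lemmas.\<close>

definition meeting_times ::
  "(nat \<Rightarrow> real) \<Rightarrow> (nat \<Rightarrow> real \<Rightarrow> real) \<Rightarrow> nat \<Rightarrow> nat \<Rightarrow> real set" where
  "meeting_times T w n k = {s \<in> {max (T k) (T n)..}. w n s = coalesce T w n k s}"

definition first_meeting ::
  "(nat \<Rightarrow> real) \<Rightarrow> (nat \<Rightarrow> real \<Rightarrow> real) \<Rightarrow> nat \<Rightarrow> real" where
  "first_meeting T w n = Inf (\<Union>k<n. meeting_times T w n k)"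

section \<open>First meetings and continuity of coalesced trajectories\<close>

lemma coalesce_Suc_less: "j < n \<Longrightarrow> coalesce T w (Suc n) j = coalesce T w n j"
  by (simp add: Let_def)

lemma coalesce_Suc_same:
  "coalesce T w (Suc n) n s =
     (if (\<forall>k<n. meeting_times T w n k = {}) \<or> s < first_meeting T w n then w n s
      else coalesce T w n (LEAST k. k < n \<and> first_meeting T w n \<in> meeting_times T w n k) s)"
proof -
  have "{s. \<exists>k. k < n \<and> max (T k) (T n) \<le> s \<and> w n s = coalesce T w n k s}
      = (\<Union>k<n. meeting_times T w n k)"
    by (auto simp: meeting_times_def)
  then show ?thesis
    by (simp add: Let_def first_meeting_def meeting_times_def) blast
qed

lemma first_meeting_le: "k < n \<Longrightarrow> s \<in> meeting_times T w n k \<Longrightarrow> first_meeting T w n \<le> s"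
  unfolding first_meeting_def
  by (intro cInf_lower bdd_belowI[of _ "T n"]) (auto simp: meeting_times_def)

text \<open>By continuity the meeting times with one earlier trajectory form a closed set. The union
  over the finitely many earlier trajectories is closed as well and contains its infimum.\<close>

lemma first_meeting_attained:
  assumes w: "continuous_on {T n..} (w n)"
    and c: "\<And>k. k < n \<Longrightarrow> continuous_on {T k..} (coalesce T w n k)"
    and ne: "k0 < n" "meeting_times T w n k0 \<noteq> {}"
  shows "\<exists>k<n. first_meeting T w n \<in> meeting_times T w n k"
proof -
  have "closed (meeting_times T w n k)" if "k < n" for k
  proof -
    have "continuous_on {max (T k) (T n)..} (\<lambda>s. w n s - coalesce T w n k s)"
      by (intro continuous_on_diff continuous_on_subset[OF w] continuous_on_subset[OF c[OF that]]) auto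
    from continuous_closed_preimage_constant[OF this closed_atLeast, of 0]
    show ?thesis by (simp add: meeting_times_def)
  qed
  then have "closed (\<Union>k<n. meeting_times T w n k)" by auto
  moreover have "(\<Union>k<n. meeting_times T w n k) \<noteq> {}" using ne by auto
  moreover have "bdd_below (\<Union>k<n. meeting_times T w n k)"
    by (rule bdd_belowI[of _ "T n"]) (auto simp: meeting_times_def)
  ultimately have "first_meeting T w n \<in> (\<Union>k<n. meeting_times T w n k)"
    unfolding first_meeting_def by (intro closed_contains_Inf)
  then show ?thesis by auto
qed

lemma continuous_on_coalesce:
  assumes "\<And>i. i < n \<Longrightarrow> continuous_on {T i..} (w i)" "j < n"
  shows "continuous_on {T j..} (coalesce T w n j)"
  using assms
proof (induction n arbitrary: j)
  case (Suc n)
  have c: "continuous_on {T k..} (coalesce T w n k)" if "k < n" for k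
    using Suc.IH[of k] Suc.prems(1) that by simp
  show ?case
  proof (cases "j = n")
    case j: True
    let ?\<tau> = "first_meeting T w n"
    let ?k = "LEAST k. k < n \<and> ?\<tau> \<in> meeting_times T w n k"
    show ?thesis
    proof (cases "\<forall>k<n. meeting_times T w n k = {}")
      case True
      then have "coalesce T w (Suc n) n = w n"
        by (auto simp: coalesce_Suc_same simp del: coalesce.simps)
      then show ?thesis using Suc.prems(1)[of n] j by simp
    next
      case False
      then have ex: "\<exists>k. k < n \<and> ?\<tau> \<in> meeting_times T w n k"
        using first_meeting_attained[of T n w] Suc.prems(1) c by blast
      have k: "?k < n" "?\<tau> \<in> meeting_times T w n ?k"
        using LeastI_ex[OF ex] by auto
      \<comment> \<open>The branch is decided by \<open>\<le>\<close> rather than \<open><\<close>: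
        the pieces agree at \<open>?\<tau>\<close> and can be glued along closed sets.\<close>
      have "continuous_on ({T n..?\<tau>} \<union> {?\<tau>..})
          (\<lambda>s. if s \<le> ?\<tau> then w n s else coalesce T w n ?k s)"
        using k(2)
        by (intro continuous_on_If continuous_on_subset[OF Suc.prems(1)[of n]]
            continuous_on_subset[OF c[OF k(1)]])
           (auto simp: meeting_times_def)
      then have "continuous_on {T n..} (\<lambda>s. if s \<le> ?\<tau> then w n s else coalesce T w n ?k s)"
        by (rule continuous_on_subset) auto
      then show ?thesis
        unfolding j
        by (rule continuous_on_eq) (use False k(2) in \<open>auto simp: coalesce_Suc_same meeting_times_def simp del: coalesce.simps\<close>)
    qed
  next
    case False
    then show ?thesis using Suc.prems(2) c by (simp add: coalesce_Suc_less del: coalesce.simps)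
  qed
qed simp

lemma coalesce_Suc_cases:
  assumes "\<And>i. i < Suc n \<Longrightarrow> continuous_on {T i..} (w i)"
  obtains "\<And>k. k < n \<Longrightarrow> meeting_times T w n k = {}" "coalesce T w (Suc n) n = w n"
  | k where "k < n" "first_meeting T w n \<in> meeting_times T w n k"
    "k = (LEAST k. k < n \<and> first_meeting T w n \<in> meeting_times T w n k)"
    "\<And>s. coalesce T w (Suc n) n s = (if s < first_meeting T w n then w n s else coalesce T w n k s)"
proof (cases "\<forall>k<n. meeting_times T w n k = {}")
  case True
  then have "coalesce T w (Suc n) n = w n"
    by (auto simp: coalesce_Suc_same simp del: coalesce.simps)
  then show ?thesis using True that(1) by blast
next
  case False
  let ?k = "LEAST k. k < n \<and> first_meeting T w n \<in> meeting_times T w n k"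
  have ex: "\<exists>k. k < n \<and> first_meeting T w n \<in> meeting_times T w n k"
    using False first_meeting_attained[of T n w] assms continuous_on_coalesce[of n T w] by (metis less_SucI lessI)
  have "?k < n" "first_meeting T w n \<in> meeting_times T w n ?k"
    using LeastI_ex[OF ex] by auto
  then show ?thesis
    by (rule that(2)) (use False in \<open>auto simp: coalesce_Suc_same simp del: coalesce.simps\<close>)
qed

text \<open>Values before the starting times are junk. They influence neither the meeting times,
  which come after both starts, nor the index followed; hence a process may be restricted to
  \<open>[0, \<infinity>)\<close> without changing its coalesced paths.\<close>

lemma coalesce_cong:
  assumes "\<And>i s. i < n \<Longrightarrow> T i \<le> s \<Longrightarrow> w i s = w' i s"
    and "\<And>i. i < n \<Longrightarrow> continuous_on {T i..} (w i)" "j < n" "T j \<le> s"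
  shows "coalesce T w n j s = coalesce T w' n j s"
  using assms
proof (induction n arbitrary: j s)
  case (Suc n)
  have eq: "coalesce T w n k s = coalesce T w' n k s" if "k < n" "T k \<le> s" for k s
    using Suc.IH[of k s] Suc.prems(1,2) that by simp
  have mt: "meeting_times T w n k = meeting_times T w' n k" if "k < n" for k
    using eq[OF that] Suc.prems(1)[of n] by (auto simp: meeting_times_def)
  then have fm: "first_meeting T w n = first_meeting T w' n"
    by (simp add: first_meeting_def)
  show ?case
  proof (cases "j = n")
    case j: True
    have w: "w n s = w' n s" using Suc.prems(1)[of n s] Suc.prems(4) j by simp
    from Suc.prems(2) show ?thesis
    proof (rule coalesce_Suc_cases)
      assume "\<And>k. k < n \<Longrightarrow> meeting_times T w n k = {}" "coalesce T w (Suc n) n = w n"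
      then show ?thesis
        using w mt by (simp add: j coalesce_Suc_same del: coalesce.simps)
    next
      fix k assume k: "k < n" "first_meeting T w n \<in> meeting_times T w n k"
        "k = (LEAST k. k < n \<and> first_meeting T w n \<in> meeting_times T w n k)"
        "\<And>s. coalesce T w (Suc n) n s = (if s < first_meeting T w n then w n s else coalesce T w n k s)"
      have "(\<lambda>k. k < n \<and> first_meeting T w n \<in> meeting_times T w n k)
          = (\<lambda>k. k < n \<and> first_meeting T w' n \<in> meeting_times T w' n k)"
        using mt fm by auto
      then have "(LEAST k. k < n \<and> first_meeting T w' n \<in> meeting_times T w' n k) = k"
        using k(3) by simp
      moreover have "\<not> (\<forall>k<n. meeting_times T w' n k = {})"
        using k(1,2) mt by blast
      ultimately have "coalesce T w' (Suc n) n s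
          = (if s < first_meeting T w n then w' n s else coalesce T w' n k s)"
        unfolding fm coalesce_Suc_same[of T w' n s] by (simp only: simp_thms)
      moreover have "coalesce T w n k s = coalesce T w' n k s" if "first_meeting T w n \<le> s"
        using k(1,2) that by (intro eq) (auto simp: meeting_times_def)
      ultimately show ?thesis
        using w by (simp add: j k(4) del: coalesce.simps)
    qed
  next
    case False
    then show ?thesis using Suc.prems(3,4) eq by (simp add: coalesce_Suc_less del: coalesce.simps)
  qed
qed simp

section \<open>Measurability of coalesced trajectories\<close>

lemma closure_rat_Int_open:
  assumes "open (S :: real set)"
  shows "S \<subseteq> closure (S \<inter> \<rat>)"
  using open_Int_closure_subset[OF assms, of \<rat>] by (simp add: Rats_closure_real)

text \<open>On a compact interval a continuous function has a zero as soon as its absolute value has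
  infimum 0, and the infimum may be taken over a countable dense set.\<close>

lemma measurable_zero_hit:
  fixes g :: "real \<Rightarrow> 'w \<Rightarrow> real"
  assumes meas: "\<And>r. a \<le> r \<Longrightarrow> r \<le> b \<Longrightarrow> g r \<in> borel_measurable N"
    and cont: "\<And>\<omega>. \<omega> \<in> space N \<Longrightarrow> continuous_on {a..b} (\<lambda>r. g r \<omega>)"
  shows "{\<omega> \<in> space N. \<exists>r\<in>{a..b}. g r \<omega> = 0} \<in> sets N"
proof (cases "a \<le> b")
  case True
  \<comment> \<open>The end points are included so that \<open>Q\<close> is dense in
    \<open>[a, b]\<close> even if \<open>a = b\<close>.\<close>
  define Q where "Q = insert a (insert b ({a<..<b} \<inter> \<rat>))"
  have Q: "countable Q" "Q \<subseteq> {a..b}"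
    using True by (auto simp: Q_def countable_rat)
  have "{a..b} \<subseteq> closure Q"
  proof
    fix x assume x: "x \<in> {a..b}"
    show "x \<in> closure Q"
    proof (cases "x \<in> {a<..<b}")
      case True
      then have "x \<in> closure ({a<..<b} \<inter> \<rat>)"
        using closure_rat_Int_open[of "{a<..<b}"] by auto
      then show ?thesis
        using closure_mono[of "{a<..<b} \<inter> \<rat>" Q] by (auto simp: Q_def)
    next
      case False
      then have "x \<in> Q" using x by (auto simp: Q_def)
      then show ?thesis using closure_subset by blast
    qed
  qed
  have eq: "{\<omega> \<in> space N. \<exists>r\<in>{a..b}. g r \<omega> = 0}
      = {\<omega> \<in> space N. \<forall>n :: nat. \<exists>r\<in>Q. \<bar>g r \<omega>\<bar> < 1 / Suc n}"
  proof (intro set_eqI iffI)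
    fix \<omega> assume "\<omega> \<in> {\<omega> \<in> space N. \<exists>r\<in>{a..b}. g r \<omega> = 0}"
    then obtain r where r: "\<omega> \<in> space N" "r \<in> {a..b}" "g r \<omega> = 0" by blast
    have "\<exists>s\<in>Q. \<bar>g s \<omega>\<bar> < 1 / Suc n" for n :: nat
    proof -
      obtain d where d: "d > 0" "\<And>s. s \<in> {a..b} \<Longrightarrow> dist s r < d \<Longrightarrow> dist (g s \<omega>) (g r \<omega>) < 1 / Suc n"
        using cont[OF r(1)] r(2) unfolding continuous_on_iff
        by (metis of_nat_0_less_iff zero_less_Suc zero_less_divide_1_iff)
      obtain s where "s \<in> Q" "dist s r < d"
        using \<open>{a..b} \<subseteq> closure Q\<close> r(2) d(1) closure_approachable[of r Q] by blast
      then show ?thesis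
        using d(2)[of s] Q(2) r(3) by (auto simp: dist_real_def intro!: bexI[of _ s])
    qed
    then show "\<omega> \<in> {\<omega> \<in> space N. \<forall>n :: nat. \<exists>r\<in>Q. \<bar>g r \<omega>\<bar> < 1 / Suc n}" using r by blast
  next
    fix \<omega> assume *: "\<omega> \<in> {\<omega> \<in> space N. \<forall>n :: nat. \<exists>r\<in>Q. \<bar>g r \<omega>\<bar> < 1 / Suc n}"
    have "continuous_on {a..b} (\<lambda>r. \<bar>g r \<omega>\<bar>)"
      using cont * by (intro continuous_on_rabs) auto
    then obtain r where r: "r \<in> {a..b}" "\<And>s. s \<in> {a..b} \<Longrightarrow> \<bar>g r \<omega>\<bar> \<le> \<bar>g s \<omega>\<bar>"
      using continuous_attains_inf[of "{a..b}" "\<lambda>r. \<bar>g r \<omega>\<bar>"] True by auto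
    have "g r \<omega> = 0"
    proof (rule ccontr)
      assume "g r \<omega> \<noteq> 0"
      then obtain n :: nat where n: "1 / Suc n < \<bar>g r \<omega>\<bar>"
        using nat_approx_posE[of "\<bar>g r \<omega>\<bar>"] by auto
      obtain s where "s \<in> Q" "\<bar>g s \<omega>\<bar> < 1 / Suc n" using * by blast
      then show False using r(2)[of s] Q(2) n by fastforce
    qed
    then show "\<omega> \<in> {\<omega> \<in> space N. \<exists>r\<in>{a..b}. g r \<omega> = 0}" using r(1) * by blast
  qed
  have "{\<omega> \<in> space N. \<exists>r\<in>Q. \<bar>g r \<omega>\<bar> < 1 / Suc n} \<in> sets N" for n :: nat
  proof (rule sets.sets_Collect_countable_Ex'[OF _ Q(1)])
    fix r assume "r \<in> Q"
    then have [measurable]: "g r \<in> borel_measurable N" using Q(2) meas by auto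
    show "{\<omega> \<in> space N. \<bar>g r \<omega>\<bar> < 1 / Suc n} \<in> sets N" by measurable
  qed
  then show ?thesis
    unfolding eq by (intro sets.sets_Collect_countable_All)
qed simp

text \<open>The value at \<open>s\<close> depends on whether a meeting has occurred by time
  \<open>s\<close>, and on the trajectory followed from then on. The obstacle is the second point:
  that the random time \<open>?\<tau>\<close> is a meeting with number \<open>k\<close> has to be
  expressed by countably many events.\<close>

lemma measurable_coalesce:
  fixes w :: "nat \<Rightarrow> real \<Rightarrow> 'w \<Rightarrow> real"
  assumes "\<And>i s. i < n \<Longrightarrow> T i \<le> s \<Longrightarrow> w i s \<in> borel_measurable N"
    and "\<And>i \<omega>. i < n \<Longrightarrow> \<omega> \<in> space N \<Longrightarrow> continuous_on {T i..} (\<lambda>s. w i s \<omega>)"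
    and "j < n" "T j \<le> s"
  shows "(\<lambda>\<omega>. coalesce T (\<lambda>i s. w i s \<omega>) n j s) \<in> borel_measurable N"
  using assms
proof (induction n arbitrary: j s)
  case (Suc n)
  let ?w = "\<lambda>\<omega> i s. w i s \<omega>"
  let ?c = "\<lambda>k s \<omega>. coalesce T (?w \<omega>) n k s"
  let ?mt = "\<lambda>\<omega>. meeting_times T (?w \<omega>) n" and ?\<tau> = "\<lambda>\<omega>. first_meeting T (?w \<omega>) n"
  have c [measurable]: "?c k s \<in> borel_measurable N" if "k < n" "T k \<le> s" for k s
    using Suc.IH[of k s] Suc.prems(1,2) that by simp
  have cc: "continuous_on {T k..} (\<lambda>s. ?c k s \<omega>)" if "k < n" "\<omega> \<in> space N" for k \<omega>
    using continuous_on_coalesce[of n T "?w \<omega>" k] Suc.prems(2)[OF _ that(2)] that(1) by auto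
  show ?case
  proof (cases "j = n")
    case j: True
    then have s: "T n \<le> s" using Suc.prems(4) by simp
    have wn [measurable]: "w n r \<in> borel_measurable N" if "T n \<le> r" for r
      using Suc.prems(1)[of n r] that by simp
    define H where "H k q = {\<omega> \<in> space N. \<exists>r\<in>{max (T k) (T n)..q}. w n r \<omega> - ?c k r \<omega> = 0}" for k q
    have H [measurable]: "H k q \<in> sets N" if "k < n" for k q
      unfolding H_def
    proof (rule measurable_zero_hit)
      fix \<omega> assume "\<omega> \<in> space N"
      then show "continuous_on {max (T k) (T n)..q} (\<lambda>r. w n r \<omega> - ?c k r \<omega>)"
        by (intro continuous_on_diff continuous_on_subset[OF cc[OF that]]
            continuous_on_subset[OF Suc.prems(2)[of n]]) auto
    qed (use that in measurable)
    have H_iff: "\<omega> \<in> H k q \<longleftrightarrow> \<omega> \<in> space N \<and> (\<exists>r\<in>?mt \<omega> k. r \<le> q)" for \<omega> k q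
      by (auto simp: H_def meeting_times_def)
    define E where "E q = (\<Union>k<n. H k q)" for q
    have E [measurable]: "E q \<in> sets N" for q
      unfolding E_def by auto
    define Q where "Q = insert s (\<rat> \<inter> {..<s})"
    have Q: "countable Q" by (auto simp: Q_def countable_rat)
    \<comment> \<open>Whenever some meeting has occurred by \<open>q\<close>, number
      \<open>k\<close> has been met by \<open>q\<close>. Letting \<open>q\<close> decrease to
      \<open>?\<tau>\<close>, closedness of the meeting times shows that \<open>k\<close> is met at
      \<open>?\<tau>\<close> itself. The set \<open>Q\<close> contains \<open>s\<close> for the case
      \<open>?\<tau> \<omega> = s\<close>.\<close>
    define P where "P k = {\<omega> \<in> space N. k < n \<and> \<omega> \<in> E s \<and> (\<forall>q\<in>Q. \<omega> \<in> E q \<longrightarrow> \<omega> \<in> H k q)}" for k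
    have P [measurable]: "P k \<in> sets N" for k
    proof (cases "k < n")
      case True
      then show ?thesis
        unfolding P_def using Q H[OF True]
        by (intro sets.sets_Collect_conj sets.sets_Collect_countable_Ball sets.sets_Collect_imp
            sets.sets_Collect_const) auto
    qed (simp add: P_def)
    have attained: "\<exists>k<n. ?\<tau> \<omega> \<in> ?mt \<omega> k" if "\<omega> \<in> space N" "k < n" "?mt \<omega> k \<noteq> {}" for \<omega> k
      using that first_meeting_attained[of T n "?w \<omega>"] Suc.prems(2)[of n \<omega>] cc by auto
    have E_iff: "\<omega> \<in> E q \<longleftrightarrow> (\<exists>k<n. ?mt \<omega> k \<noteq> {}) \<and> ?\<tau> \<omega> \<le> q" if \<omega>: "\<omega> \<in> space N" for \<omega> q
    proof
      assume "\<omega> \<in> E q"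
      then obtain k r where "k < n" "r \<in> ?mt \<omega> k" "r \<le> q" by (auto simp: E_def H_iff)
      then show "(\<exists>k<n. ?mt \<omega> k \<noteq> {}) \<and> ?\<tau> \<omega> \<le> q"
        using first_meeting_le[of k n r] by fastforce
    next
      assume "(\<exists>k<n. ?mt \<omega> k \<noteq> {}) \<and> ?\<tau> \<omega> \<le> q"
      then show "\<omega> \<in> E q" using attained \<omega> by (auto simp: E_def H_iff)
    qed
    have P_iff: "\<omega> \<in> P k \<longleftrightarrow> k < n \<and> ?\<tau> \<omega> \<in> ?mt \<omega> k" if \<omega>: "\<omega> \<in> E s" for \<omega> k
    proof
      have sp: "\<omega> \<in> space N" using \<omega> sets.sets_into_space[OF E] by blast
      assume k: "\<omega> \<in> P k"
      then have "k < n" by (simp add: P_def)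
      have \<tau>s: "?\<tau> \<omega> \<le> s" using E_iff[OF sp] \<omega> by blast
      have hit: "\<exists>r\<in>?mt \<omega> k. ?\<tau> \<omega> \<le> r \<and> r \<le> q" if "q \<in> Q" "?\<tau> \<omega> \<le> q" for q
      proof -
        have "\<omega> \<in> E q" using E_iff[OF sp] \<omega> that(2) by blast
        then have "\<omega> \<in> H k q" using k that(1) by (auto simp: P_def)
        then show ?thesis using first_meeting_le[OF \<open>k < n\<close>] by (auto simp: H_iff)
      qed
      have "closed (?mt \<omega> k)"
      proof -
        have "continuous_on {max (T k) (T n)..} (\<lambda>r. w n r \<omega> - ?c k r \<omega>)"
          using sp \<open>k < n\<close> by (intro continuous_on_diff continuous_on_subset[OF cc[of k]]
            continuous_on_subset[OF Suc.prems(2)[of n]]) auto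
        from continuous_closed_preimage_constant[OF this closed_atLeast, of 0]
        show ?thesis by (simp add: meeting_times_def)
      qed
      moreover have "?\<tau> \<omega> \<in> closure (?mt \<omega> k)"
        unfolding closure_approachable
      proof (intro allI impI)
        fix e :: real assume "0 < e"
        show "\<exists>y\<in>?mt \<omega> k. dist y (?\<tau> \<omega>) < e"
        proof -
          have "\<exists>q\<in>Q. ?\<tau> \<omega> \<le> q \<and> q < ?\<tau> \<omega> + e"
          proof (cases "?\<tau> \<omega> = s")
            case True
            then show ?thesis using \<open>0 < e\<close> by (auto simp: Q_def)
          next
            case False
            then obtain q where "q \<in> \<rat>" "?\<tau> \<omega> < q" "q < min s (?\<tau> \<omega> + e)"
              using Rats_dense_in_real[of "?\<tau> \<omega>" "min s (?\<tau> \<omega> + e)"] \<tau>s \<open>0 < e\<close> by auto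
            then show ?thesis by (intro bexI[of _ q]) (auto simp: Q_def)
          qed
          then obtain q where q: "q \<in> Q" "?\<tau> \<omega> \<le> q" "q < ?\<tau> \<omega> + e" by blast
          obtain r where "r \<in> ?mt \<omega> k" "?\<tau> \<omega> \<le> r" "r \<le> q"
            using hit[OF q(1,2)] by blast
          then show ?thesis using q(3) by (intro bexI[of _ r]) (auto simp: dist_real_def)
        qed
      qed
      ultimately show "k < n \<and> ?\<tau> \<omega> \<in> ?mt \<omega> k"
        using \<open>k < n\<close> by (simp add: closure_closed)
    next
      have sp: "\<omega> \<in> space N" using \<omega> sets.sets_into_space[OF E] by blast
      assume "k < n \<and> ?\<tau> \<omega> \<in> ?mt \<omega> k"
      then show "\<omega> \<in> P k"
        using \<omega> sp E_iff[OF sp] by (auto simp: P_def H_iff)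
    qed
    \<comment> \<open>The function is total in \<open>k\<close>, with 0 in place of junk, so that
      inserting a measurable random index keeps it measurable.\<close>
    define f where "f k \<omega> = (if k < n \<and> T k \<le> s then ?c k s \<omega> else 0)" for k \<omega>
    have f [measurable]: "f k \<in> borel_measurable N" for k
      by (cases "k < n \<and> T k \<le> s") (auto simp: f_def[abs_def])
    have L [measurable]: "(\<lambda>\<omega>. LEAST k. \<omega> \<in> P k) \<in> N \<rightarrow>\<^sub>M count_space UNIV"
      by measurable
    have "(\<lambda>\<omega>. if \<omega> \<in> E s then f (LEAST k. \<omega> \<in> P k) \<omega> else w n s \<omega>) \<in> borel_measurable N"
      using s measurable_compose_countable[OF f L] by measurable
    moreover have "coalesce T (?w \<omega>) (Suc n) n s
        = (if \<omega> \<in> E s then f (LEAST k. \<omega> \<in> P k) \<omega> else w n s \<omega>)" if \<omega>: "\<omega> \<in> space N" for \<omega>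
    proof -
      from Suc.prems(2)[OF _ \<omega>] show ?thesis
      proof (rule coalesce_Suc_cases)
        assume *: "\<And>k. k < n \<Longrightarrow> ?mt \<omega> k = {}" "coalesce T (?w \<omega>) (Suc n) n = ?w \<omega> n"
        then have "\<omega> \<notin> E s" by (auto simp: E_iff[OF \<omega>])
        then show ?thesis using * by (simp del: coalesce.simps)
      next
        fix k assume k: "k < n" "?\<tau> \<omega> \<in> ?mt \<omega> k"
          "k = (LEAST k. k < n \<and> ?\<tau> \<omega> \<in> ?mt \<omega> k)"
          "\<And>s. coalesce T (?w \<omega>) (Suc n) n s = (if s < ?\<tau> \<omega> then w n s \<omega> else ?c k s \<omega>)"
        have E: "\<omega> \<in> E s \<longleftrightarrow> ?\<tau> \<omega> \<le> s" using k(1,2) by (auto simp: E_iff[OF \<omega>])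
        moreover have "(LEAST k. \<omega> \<in> P k) = k" if "?\<tau> \<omega> \<le> s"
          using k(3) that E by (simp add: P_iff)
        moreover have "T k \<le> s" if "?\<tau> \<omega> \<le> s"
          using k(2) that by (auto simp: meeting_times_def)
        ultimately show ?thesis using k(1,4) by (auto simp: f_def simp del: coalesce.simps)
      qed
    qed
    ultimately show ?thesis
      unfolding j by (subst measurable_cong) auto
  next
    case False
    then show ?thesis using Suc.prems(3,4) by (simp add: coalesce_Suc_less del: coalesce.simps)
  qed
qed simp

abbreviation bm_paths :: "(nat \<Rightarrow> real \<times> real) \<Rightarrow> (nat \<Rightarrow> real \<Rightarrow> real) \<Rightarrow> nat \<Rightarrow> real \<Rightarrow> real" where
  "bm_paths z b \<equiv> \<lambda>i s. fst (z i) + b i (s - snd (z i))"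

lemma continuous_on_bm_paths:
  assumes "continuous_on {0..} (b i)"
  shows "continuous_on {(snd \<circ> z) i..} (bm_paths z b i)"
  by (intro continuous_intros continuous_on_compose2[OF assms]) auto

lemma coalescing_paths_apply:
  "j < n \<Longrightarrow> coalescing_paths n z b j = real_path (snd (z j)) (coalesce (snd \<circ> z) (bm_paths z b) n j)"
  by (simp add: coalescing_paths_def)

lemma
  assumes b: "\<And>i. i < n \<Longrightarrow> continuous_on {0..} (b i)" and j: "j < n"
  shows path_start_coalescing_paths: "path_start (coalescing_paths n z b j) = ereal (snd (z j))"
    and pv_coalescing_paths: "pv (coalescing_paths n z b j) s
      = tanh (coalesce (snd \<circ> z) (bm_paths z b) n j (max s (snd (z j))))"
proof -
  have "continuous_on {(snd \<circ> z) j..} (coalesce (snd \<circ> z) (bm_paths z b) n j)"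
    by (intro continuous_on_coalesce continuous_on_bm_paths b j)
  then have "continuous_on {snd (z j)..} (coalesce (snd \<circ> z) (bm_paths z b) n j)"
    by simp
  then show "path_start (coalescing_paths n z b j) = ereal (snd (z j))"
    "pv (coalescing_paths n z b j) s = tanh (coalesce (snd \<circ> z) (bm_paths z b) n j (max s (snd (z j))))"
    by (simp_all add: coalescing_paths_apply[OF j] path_start_real_path pv_real_path)
qed

lemma coalescing_paths_cong:
  assumes b: "\<And>i. i < n \<Longrightarrow> continuous_on {0..} (b i)"
    and eq: "\<And>i s. i < n \<Longrightarrow> 0 \<le> s \<Longrightarrow> b i s = b' i s"
  shows "coalescing_paths n z b = coalescing_paths n z b'"
proof
  fix j
  show "coalescing_paths n z b j = coalescing_paths n z b' j"
  proof (cases "j < n")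
    case True
    have b': "continuous_on {0..} (b' i)" if "i < n" for i
      using b[OF that] by (rule continuous_on_eq) (simp add: eq that)
    have "coalesce (snd \<circ> z) (bm_paths z b) n j s = coalesce (snd \<circ> z) (bm_paths z b') n j s"
      if "(snd \<circ> z) j \<le> s" for s
      using that True eq
      by (intro coalesce_cong continuous_on_bm_paths b) auto
    then show ?thesis
      using True b b'
      by (intro web_path_eqI) (simp_all add: path_start_coalescing_paths pv_coalescing_paths)
  qed (simp add: coalescing_paths_def)
qed

lemma measurable_coalescing_paths:
  fixes B :: "nat \<Rightarrow> real \<Rightarrow> 'w \<Rightarrow> real"
  assumes "\<And>i s. i < n \<Longrightarrow> 0 \<le> s \<Longrightarrow> B i s \<in> borel_measurable N"
    and cont: "\<And>i \<omega>. i < n \<Longrightarrow> \<omega> \<in> space N \<Longrightarrow> continuous_on {0..} (\<lambda>s. B i s \<omega>)"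
  shows "(\<lambda>\<omega>. coalescing_paths n z (\<lambda>j t. B j t \<omega>)) \<in> N \<rightarrow>\<^sub>M (\<Pi>\<^sub>M i\<in>{..<n}. borel)"
proof -
  have "(\<lambda>\<omega>. coalescing_paths n z (\<lambda>j t. B j t \<omega>) j) \<in> N \<rightarrow>\<^sub>M borel" if j: "j < n" for j
  proof (rule measurable_web_pathI)
    have "(\<lambda>\<omega>. ps (coalescing_paths n z (\<lambda>j t. B j t \<omega>) j)) \<in> borel_measurable N
        \<longleftrightarrow> (\<lambda>\<omega>. tanh (snd (z j))) \<in> borel_measurable N"
      using j cont by (intro measurable_cong ps_ereal path_start_coalescing_paths) auto
    then show "(\<lambda>\<omega>. ps (coalescing_paths n z (\<lambda>j t. B j t \<omega>) j)) \<in> borel_measurable N"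
      by simp
    fix t
    have "(\<lambda>\<omega>. coalesce (snd \<circ> z) (\<lambda>i s. bm_paths z (\<lambda>j t. B j t \<omega>) i s) n j (max t (snd (z j))))
        \<in> borel_measurable N"
      by (rule measurable_coalesce[where w = "\<lambda>i s \<omega>. bm_paths z (\<lambda>j t. B j t \<omega>) i s"])
         (use j assms in \<open>auto intro!: continuous_on_bm_paths[where z = z, unfolded comp_def] borel_measurable_add\<close>)
    then have "(\<lambda>\<omega>. tanh (coalesce (snd \<circ> z) (bm_paths z (\<lambda>j t. B j t \<omega>)) n j (max t (snd (z j)))))
        \<in> borel_measurable N"
      by (rule borel_measurable_continuous_on[rotated]) (auto intro!: continuous_intros simp: cosh_real_nonzero)
    moreover have "(\<lambda>\<omega>. pv (coalescing_paths n z (\<lambda>j t. B j t \<omega>) j) t) \<in> borel_measurable N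
        \<longleftrightarrow> (\<lambda>\<omega>. tanh (coalesce (snd \<circ> z) (bm_paths z (\<lambda>j t. B j t \<omega>)) n j (max t (snd (z j)))))
        \<in> borel_measurable N"
      using j cont by (intro measurable_cong pv_coalescing_paths) auto
    ultimately show "(\<lambda>\<omega>. pv (coalescing_paths n z (\<lambda>j t. B j t \<omega>) j) t) \<in> borel_measurable N"
      by blast
  qed
  then have "(\<lambda>\<omega>. \<lambda>j\<in>{..<n}. coalescing_paths n z (\<lambda>j t. B j t \<omega>) j) \<in> N \<rightarrow>\<^sub>M (\<Pi>\<^sub>M i\<in>{..<n}. borel)"
    by (intro measurable_restrict) auto
  moreover have "(\<lambda>j\<in>{..<n}. coalescing_paths n z b j) = coalescing_paths n z b" for b
    by (auto simp: coalescing_paths_def)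
  ultimately show ?thesis by simp
qed

section \<open>Uniqueness of the laws\<close>

lemma indep_BMs_regular:
  assumes "indep_standard_BMs N n B"
  shows "\<And>i s. i < n \<Longrightarrow> 0 \<le> s \<Longrightarrow> B i s \<in> borel_measurable N"
    and "\<And>i \<omega>. i < n \<Longrightarrow> \<omega> \<in> space N \<Longrightarrow> continuous_on {0..} (\<lambda>s. B i s \<omega>)"
    and "\<And>i. i < n \<Longrightarrow> standard_BM N (B i)" and "prob_space N"
  using assms by (auto simp: indep_standard_BMs_def standard_BM_def)

lemma measurable_coalescing_BMs:
  "indep_standard_BMs N n B \<Longrightarrow>
    (\<lambda>\<omega>. coalescing_paths n z (\<lambda>j t. B j t \<omega>)) \<in> N \<rightarrow>\<^sub>M (\<Pi>\<^sub>M i\<in>{..<n}. borel)"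
  by (intro measurable_coalescing_paths indep_BMs_regular)

text \<open>Finite-dimensional events determine the law. Positions at finitely many times are sums
  of independent normal increments, and their joint law \<open>PiM {..<m} I\<close> makes no
  reference to the process.\<close>

lemma standard_BM_law_unique:
  fixes B :: "real \<Rightarrow> 'w \<Rightarrow> real" and B' :: "real \<Rightarrow> 'v \<Rightarrow> real"
  assumes B: "standard_BM N B" and B': "standard_BM N' B'"
  shows "distr N (\<Pi>\<^sub>M t\<in>{0..}. borel) (\<lambda>\<omega>. \<lambda>t\<in>{0..}. B t \<omega>)
    = distr N' (\<Pi>\<^sub>M t\<in>{0..}. borel) (\<lambda>\<omega>. \<lambda>t\<in>{0..}. B' t \<omega>)"
proof (rule measure_eqI_PiM_infinite)
  have path: "(\<lambda>\<omega>. \<lambda>t\<in>{0..}. C t \<omega>) \<in> M \<rightarrow>\<^sub>M (\<Pi>\<^sub>M t\<in>{0..}. borel)" if "standard_BM M C"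
    for M :: "'x measure" and C
    using that by (intro measurable_restrict) (auto simp: standard_BM_def)
  interpret prob_space N using B by (simp add: standard_BM_def)
  interpret D: prob_space "distr N (\<Pi>\<^sub>M t\<in>{0..}. borel) (\<lambda>\<omega>. \<lambda>t\<in>{0..}. B t \<omega>)"
    by (rule prob_space_distr[OF path[OF B]])
  show "finite_measure (distr N (\<Pi>\<^sub>M t\<in>{0..}. borel) (\<lambda>\<omega>. \<lambda>t\<in>{0..}. B t \<omega>))"
    by unfold_locales
  fix A :: "real \<Rightarrow> real set" and J :: "real set"
  assume J: "finite J" "J \<subseteq> {0..}" and A: "\<And>t. t \<in> J \<Longrightarrow> A t \<in> sets borel"
  \<comment> \<open>Time 0 is added to \<open>J\<close> so that every position is a sum of
    increments starting from \<open>B 0 = 0\<close>.\<close>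
  define xs where "xs = sorted_list_of_set (insert 0 J)"
  define m where "m = length xs - 1"
  define \<tau> where "\<tau> i = xs ! i" for i
  have set: "set xs = insert 0 J"
    using set_sorted_list_of_set[of "insert 0 J"] J(1) by (simp only: xs_def finite_insert)
  have len: "length xs = Suc m" unfolding m_def using set by (cases xs) auto
  have mono: "strict_mono_on {..m} \<tau>"
    unfolding strict_mono_on_def \<tau>_def
    using strict_sorted_list_of_set[of "insert 0 J"] len
    by (auto simp: xs_def intro: sorted_wrt_nth_less)
  have \<tau>0: "\<tau> 0 = 0"
  proof -
    obtain i where i: "i < Suc m" "\<tau> i = 0"
      using set len unfolding \<tau>_def by (metis in_set_conv_nth insertI1)
    have "\<tau> 0 \<in> set xs" using len by (simp add: \<tau>_def)
    then have "0 \<le> \<tau> 0" using set J by auto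
    then show ?thesis
      using i strict_mono_onD[OF mono, of 0 i] by (cases "i = 0") auto
  qed
  define idx where "idx t = (SOME i. i \<le> m \<and> \<tau> i = t)" for t
  have idx: "idx t \<le> m \<and> \<tau> (idx t) = t" if "t \<in> J" for t
  proof -
    have "\<exists>i. i \<le> m \<and> \<tau> i = t"
      using set len that unfolding \<tau>_def by (metis in_set_conv_nth insertI2 less_Suc_eq_le)
    then show ?thesis unfolding idx_def by (rule someI_ex)
  qed
  define I where "I i = density lborel (normal_density 0 (sqrt (\<tau> (Suc i) - \<tau> i)))" for i
  define E where "E = {x \<in> space (PiM {..<m} (\<lambda>_. borel :: real measure)). \<forall>t\<in>J. (\<Sum>i<idx t. x i) \<in> A t}"
  have E: "E \<in> sets (PiM {..<m} (\<lambda>_. borel))"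
    unfolding E_def
  proof (rule sets.sets_Collect_finite_All[OF _ J(1)])
    fix t assume t: "t \<in> J"
    have "(\<lambda>x. \<Sum>i<idx t. x i) \<in> borel_measurable (PiM {..<m} (\<lambda>_. borel :: real measure))"
      using idx[OF t] by (intro borel_measurable_sum measurable_component_singleton) auto
    from measurable_sets_Collect[OF this, of "\<lambda>y. y \<in> A t"] A[OF t]
    show "{x \<in> space (PiM {..<m} (\<lambda>_. borel)). (\<Sum>i<idx t. x i) \<in> A t} \<in> sets (PiM {..<m} (\<lambda>_. borel))"
      by simp
  qed
  have fdd: "emeasure (distr M (\<Pi>\<^sub>M t\<in>{0..}. borel) (\<lambda>\<omega>. \<lambda>t\<in>{0..}. C t \<omega>))
      (prod_emb {0..} (\<lambda>_. borel) J (Pi\<^sub>E J A))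
      = (if m = 0 then indicator {True} (\<forall>t\<in>J. 0 \<in> A t) else emeasure (PiM {..<m} I) E)"
    if C: "standard_BM M C" for M :: "'x measure" and C
  proof -
    interpret M: prob_space M using C by (simp add: standard_BM_def)
    have C0: "C 0 \<omega> = 0" if "\<omega> \<in> space M" for \<omega> using C that by (simp add: standard_BM_def)
    let ?X = "\<lambda>i \<omega>. C (\<tau> (Suc i)) \<omega> - C (\<tau> i) \<omega>"
    let ?S = "{\<omega> \<in> space M. \<forall>t\<in>J. C t \<omega> \<in> A t}"
    have "emeasure (distr M (\<Pi>\<^sub>M t\<in>{0..}. borel) (\<lambda>\<omega>. \<lambda>t\<in>{0..}. C t \<omega>))
        (prod_emb {0..} (\<lambda>_. borel) J (Pi\<^sub>E J A))
        = emeasure M ((\<lambda>\<omega>. \<lambda>t\<in>{0..}. C t \<omega>) -` prod_emb {0..} (\<lambda>_. borel) J (Pi\<^sub>E J A) \<inter> space M)"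
      using J A by (intro emeasure_distr path[OF C] sets_PiM_I) auto
    also have "(\<lambda>\<omega>. \<lambda>t\<in>{0..}. C t \<omega>) -` prod_emb {0..} (\<lambda>_. borel) J (Pi\<^sub>E J A) \<inter> space M = ?S"
      using J by (auto simp: prod_emb_def PiE_iff subset_eq)
    also have "emeasure M ?S
        = (if m = 0 then indicator {True} (\<forall>t\<in>J. 0 \<in> A t) else emeasure (PiM {..<m} I) E)"
    proof (cases "m = 0")
      \<comment> \<open>There are no increments if 0 is the only time; the event is then certain or
        empty.\<close>
      case True
      then have "t = 0" if "t \<in> J" for t using idx[OF that] \<tau>0 by auto
      then have "C t \<omega> = 0" if "t \<in> J" "\<omega> \<in> space M" for t \<omega> using C0 that by metis
      then have "?S = (if \<forall>t\<in>J. 0 \<in> A t then space M else {})"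
        by auto
      then show ?thesis using True M.emeasure_space_1 by (auto simp: indicator_def)
    next
      case False
      have ind: "M.indep_vars (\<lambda>_. borel) ?X {..<m}"
        using C mono \<tau>0 unfolding standard_BM_def by auto
      have X: "?X i \<in> borel_measurable M" if "i < m" for i
        using ind that by (auto simp: M.indep_vars_def)
      have \<tau>nn: "0 \<le> \<tau> i" if "i \<le> m" for i
        using strict_mono_on_leD[OF mono, of 0 i] that \<tau>0 by auto
      have "distr M borel (?X i) = I i" if "i < m" for i
      proof -
        have "0 \<le> \<tau> i \<and> \<tau> i < \<tau> (Suc i)"
          using strict_mono_onD[OF mono, of i "Suc i"] \<tau>nn[of i] that by simp
        then have "distributed M lborel (?X i) (normal_density 0 (sqrt (\<tau> (Suc i) - \<tau> i)))"
          using C unfolding standard_BM_def by blast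
        then have "distr M lborel (?X i) = I i"
          by (simp add: distributed_def I_def)
        then show ?thesis
          by (simp cong: distr_cong)
      qed
      then have I: "PiM {..<m} (\<lambda>i. distr M borel (?X i)) = PiM {..<m} I"
        by (intro PiM_cong) auto
      have XI: "distr M (PiM {..<m} (\<lambda>_. borel)) (\<lambda>\<omega>. \<lambda>i\<in>{..<m}. ?X i \<omega>)
          = PiM {..<m} (\<lambda>i. distr M borel (?X i))"
        using ind False X by (subst M.indep_vars_iff_distr_eq_PiM'[symmetric]) auto
      have Xm: "(\<lambda>\<omega>. \<lambda>i\<in>{..<m}. ?X i \<omega>) \<in> M \<rightarrow>\<^sub>M PiM {..<m} (\<lambda>_. borel)"
        using X by (intro measurable_restrict) auto
      have "emeasure (PiM {..<m} I) E
          = emeasure M ((\<lambda>\<omega>. \<lambda>i\<in>{..<m}. ?X i \<omega>) -` E \<inter> space M)"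
        unfolding I[symmetric] XI[symmetric] by (rule emeasure_distr[OF Xm E])
      also have "(\<lambda>\<omega>. \<lambda>i\<in>{..<m}. ?X i \<omega>) -` E \<inter> space M = ?S"
      proof -
        have "(\<Sum>i<idx t. (\<lambda>i\<in>{..<m}. ?X i \<omega>) i) = C t \<omega>" if "t \<in> J" "\<omega> \<in> space M" for t \<omega>
        proof -
          have "(\<Sum>i<idx t. (\<lambda>i\<in>{..<m}. ?X i \<omega>) i) = (\<Sum>i<idx t. ?X i \<omega>)"
            using idx[OF that(1)] by (intro sum.cong) auto
          also have "\<dots> = C (\<tau> (idx t)) \<omega> - C (\<tau> 0) \<omega>"
            by (rule sum_lessThan_telescope)
          finally show ?thesis using idx[OF that(1)] \<tau>0 C0 that by simp
        qed
        then show ?thesis by (auto simp: E_def space_PiM)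
      qed
      finally show ?thesis using False by simp
    qed
    finally show ?thesis .
  qed
  show "emeasure (distr N (\<Pi>\<^sub>M t\<in>{0..}. borel) (\<lambda>\<omega>. \<lambda>t\<in>{0..}. B t \<omega>)) (prod_emb {0..} (\<lambda>_. borel) J (Pi\<^sub>E J A))
    = emeasure (distr N' (\<Pi>\<^sub>M t\<in>{0..}. borel) (\<lambda>\<omega>. \<lambda>t\<in>{0..}. B' t \<omega>)) (prod_emb {0..} (\<lambda>_. borel) J (Pi\<^sub>E J A))"
    by (simp add: fdd[OF B] fdd[OF B'])
qed simp_all

text \<open>The space of families of continuous trajectories carries the law of the Brownian motions, and
  the coalesced paths are a measurable function on it.\<close>

lemma coalescing_BM_law_unique:
  assumes "coalescing_BM_law n z \<nu>" "coalescing_BM_law n z \<nu>'" "0 < n"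
  shows "\<nu> = \<nu>'"
proof -
  let ?P = "\<Pi>\<^sub>M j\<in>{..<n}. \<Pi>\<^sub>M t\<in>{0 :: real..}. (borel :: real measure)"
  let ?W = "\<Pi>\<^sub>M i\<in>{..<n}. (borel :: web_path measure)"
  define C where "C = {b :: nat \<Rightarrow> real \<Rightarrow> real. \<forall>j<n. continuous_on {0..} (b j)}"
  \<comment> \<open>The set \<open>C\<close> of continuous trajectories need not be measurable in
    the product. Hence the sigma-field is traced on it, and an event is represented by a measurable
    \<open>A\<close> that agrees with it on \<open>C\<close> only.\<close>
  define K where "K = restrict_space ?P C"
  have K_space: "space K = space ?P \<inter> C"
    by (simp add: K_def space_restrict_space Int_commute)
  have \<Gamma>: "(\<lambda>b. coalescing_paths n z (\<lambda>j t. b j t)) \<in> K \<rightarrow>\<^sub>M ?W"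
  proof (rule measurable_coalescing_paths)
    fix i s assume "i < n" "0 \<le> (s :: real)"
    then have "(\<lambda>b. b i s) \<in> borel_measurable ?P"
      by (intro measurable_compose[OF measurable_component_singleton[of i] measurable_component_singleton]) auto
    then show "(\<lambda>b. b i s) \<in> borel_measurable K"
      unfolding K_def by (rule measurable_restrict_space1)
  next
    fix i b assume "i < n" "b \<in> space K"
    then show "continuous_on {0..} (\<lambda>s. b i s)" by (simp add: K_space C_def)
  qed
  define path where "path B \<omega> = (\<lambda>j\<in>{..<n}. \<lambda>t\<in>{0..}. B j t \<omega>)"
    for B :: "nat \<Rightarrow> real \<Rightarrow> (nat \<Rightarrow> real \<Rightarrow> real) \<Rightarrow> real" and \<omega>
  have path: "path B \<in> N \<rightarrow>\<^sub>M ?P" if "indep_standard_BMs N n B" for N B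
    unfolding path_def[abs_def] using indep_BMs_regular(1)[OF that]
    by (intro measurable_restrict) auto
  have path_C: "path B \<omega> \<in> C" if B: "indep_standard_BMs N n B" and \<omega>: "\<omega> \<in> space N" for N B \<omega>
  proof -
    have "continuous_on {0..} (path B \<omega> j)" if "j < n" for j
      by (rule continuous_on_eq[OF indep_BMs_regular(2)[OF B that \<omega>]]) (simp add: path_def that)
    then show ?thesis by (simp add: C_def)
  qed
  have law: "emeasure \<nu> E = emeasure (\<Pi>\<^sub>M j\<in>{..<n}. distr N (\<Pi>\<^sub>M t\<in>{0..}. borel) (\<lambda>\<omega>. \<lambda>t\<in>{0..}. B j t \<omega>)) A"
    if B: "indep_standard_BMs N n B"
      and \<nu>: "\<nu> = distr N ?W (\<lambda>\<omega>. coalescing_paths n z (\<lambda>j t. B j t \<omega>))"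
      and A: "A \<in> sets ?P" "(\<lambda>b. coalescing_paths n z (\<lambda>j t. b j t)) -` E \<inter> space K = C \<inter> A"
      and E: "E \<in> sets ?W"
    for \<nu> E A B and N :: "(nat \<Rightarrow> real \<Rightarrow> real) measure"
  proof -
    have eq: "coalescing_paths n z (\<lambda>j t. B j t \<omega>) = coalescing_paths n z (path B \<omega>)" if "\<omega> \<in> space N" for \<omega>
      by (rule coalescing_paths_cong) (use indep_BMs_regular(2)[OF B] that in \<open>auto simp: path_def\<close>)
    have sp: "path B \<omega> \<in> space K" if "\<omega> \<in> space N" for \<omega>
      using path_C[OF B that] measurable_space[OF path[OF B] that] by (simp add: K_space)
    have "emeasure \<nu> E = emeasure N ((\<lambda>\<omega>. coalescing_paths n z (\<lambda>j t. B j t \<omega>)) -` E \<inter> space N)"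
      unfolding \<nu> by (rule emeasure_distr[OF measurable_coalescing_BMs[OF B] E])
    also have "(\<lambda>\<omega>. coalescing_paths n z (\<lambda>j t. B j t \<omega>)) -` E \<inter> space N = path B -` A \<inter> space N"
    proof (intro set_eqI)
      fix \<omega>
      have "path B \<omega> \<in> A \<longleftrightarrow> coalescing_paths n z (path B \<omega>) \<in> E" if "\<omega> \<in> space N"
        using A(2) sp[OF that] path_C[OF B that] by blast
      then show "\<omega> \<in> (\<lambda>\<omega>. coalescing_paths n z (\<lambda>j t. B j t \<omega>)) -` E \<inter> space N
          \<longleftrightarrow> \<omega> \<in> path B -` A \<inter> space N"
        using eq by auto
    qed
    also have "emeasure N (path B -` A \<inter> space N) = emeasure (distr N ?P (path B)) A"
      by (rule emeasure_distr[OF path[OF B] A(1), symmetric])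
    also have "distr N ?P (path B)
        = (\<Pi>\<^sub>M j\<in>{..<n}. distr N (\<Pi>\<^sub>M t\<in>{0..}. borel) (\<lambda>\<omega>. \<lambda>t\<in>{0..}. B j t \<omega>))"
    proof -
      interpret prob_space N using B by (simp add: indep_standard_BMs_def)
      have "(\<lambda>\<omega>. \<lambda>t\<in>{0..}. B j t \<omega>) \<in> N \<rightarrow>\<^sub>M (\<Pi>\<^sub>M t\<in>{0..}. borel)" if "j < n" for j
        using indep_BMs_regular(1)[OF B that] by (intro measurable_restrict) auto
      then show ?thesis
        using B \<open>0 < n\<close> unfolding path_def[abs_def] indep_standard_BMs_def
        by (subst indep_vars_iff_distr_eq_PiM'[symmetric]) auto
    qed
    finally show ?thesis .
  qed
  obtain N :: "(nat \<Rightarrow> real \<Rightarrow> real) measure" and B where B: "indep_standard_BMs N n B"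
      "\<nu> = distr N ?W (\<lambda>\<omega>. coalescing_paths n z (\<lambda>j t. B j t \<omega>))"
    using assms(1) unfolding coalescing_BM_law_def by blast
  obtain N' :: "(nat \<Rightarrow> real \<Rightarrow> real) measure" and B' where B': "indep_standard_BMs N' n B'"
      "\<nu>' = distr N' ?W (\<lambda>\<omega>. coalescing_paths n z (\<lambda>j t. B' j t \<omega>))"
    using assms(2) unfolding coalescing_BM_law_def by blast
  show ?thesis
  proof (rule measure_eqI)
    show "sets \<nu> = sets \<nu>'" by (simp add: B(2) B'(2))
    fix E assume "E \<in> sets \<nu>"
    then have E: "E \<in> sets ?W" by (simp add: B(2))
    obtain A where A: "A \<in> sets ?P"
        "(\<lambda>b. coalescing_paths n z (\<lambda>j t. b j t)) -` E \<inter> space K = C \<inter> A"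
      using measurable_sets[OF \<Gamma> E] unfolding K_def sets_restrict_space by auto
    have "(\<Pi>\<^sub>M j\<in>{..<n}. distr N (\<Pi>\<^sub>M t\<in>{0..}. borel) (\<lambda>\<omega>. \<lambda>t\<in>{0..}. B j t \<omega>))
        = (\<Pi>\<^sub>M j\<in>{..<n}. distr N' (\<Pi>\<^sub>M t\<in>{0..}. borel) (\<lambda>\<omega>. \<lambda>t\<in>{0..}. B' j t \<omega>))"
      using indep_BMs_regular(3)[OF B(1)] indep_BMs_regular(3)[OF B'(1)]
      by (intro PiM_cong standard_BM_law_unique) auto
    then show "emeasure \<nu> E = emeasure \<nu>' E"
      using law[OF B A E] law[OF B' A E] by simp
  qed
qed

section \<open>Estimates for one and two coalescing Brownian motions\<close>

lemma prob_space_coalescing_BM_law: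
  assumes "coalescing_BM_law n z \<nu>"
  shows "prob_space \<nu>" and "sets \<nu> = sets (\<Pi>\<^sub>M i\<in>{..<n}. borel)"
proof -
  obtain N :: "(nat \<Rightarrow> real \<Rightarrow> real) measure" and B where B: "indep_standard_BMs N n B"
      "\<nu> = distr N (\<Pi>\<^sub>M i\<in>{..<n}. borel) (\<lambda>\<omega>. coalescing_paths n z (\<lambda>j t. B j t \<omega>))"
    using assms unfolding coalescing_BM_law_def by blast
  show "prob_space \<nu>"
    unfolding B(2) by (rule prob_space.prob_space_distr[OF indep_BMs_regular(4)[OF B(1)]
        measurable_coalescing_BMs[OF B(1)]])
  show "sets \<nu> = sets (\<Pi>\<^sub>M i\<in>{..<n}. borel)" by (simp add: B(2))
qed

text \<open>Paths started between the times \<open>l\<close> and \<open>r\<close> with compactified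
  positions between \<open>a\<close> and \<open>b\<close> during \<open>[R1, R2]\<close>. Strict
  inequalities over a compact time interval make this set open, which is what weak convergence can
  use.\<close>

definition tube :: "real \<Rightarrow> real \<Rightarrow> real \<Rightarrow> real \<Rightarrow> real \<Rightarrow> real \<Rightarrow> web_path set" where
  "tube l r R1 R2 a b = {p. tanh l < ps p \<and> ps p < tanh r \<and> (\<forall>t\<in>{R1..R2}. a < pv p t \<and> pv p t < b)}"

lemma open_tube: "open (tube l r R1 R2 a b)"
  unfolding open_dist
proof
  fix p assume p: "p \<in> tube l r R1 R2 a b"
  obtain m where m: "m > 0" "\<And>t. t \<in> {R1..R2} \<Longrightarrow> a + m \<le> pv p t \<and> pv p t \<le> b - m"
  proof (cases "R1 \<le> R2")
    case True
    have "continuous_on {R1..R2} (\<lambda>t. min (pv p t - a) (b - pv p t))"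
      by (intro continuous_intros continuous_on_pv)
    then obtain t0 where t0: "t0 \<in> {R1..R2}"
        "\<And>t. t \<in> {R1..R2} \<Longrightarrow> min (pv p t0 - a) (b - pv p t0) \<le> min (pv p t - a) (b - pv p t)"
      using continuous_attains_inf[of "{R1..R2}" "\<lambda>t. min (pv p t - a) (b - pv p t)"] True
      by fastforce
    show ?thesis
    proof (rule that[of "min (pv p t0 - a) (b - pv p t0)"])
      show "0 < min (pv p t0 - a) (b - pv p t0)" using p t0(1) by (auto simp: tube_def)
    qed (use t0(2) in fastforce)
  qed (auto intro: that[of 1])
  define m' where "m' = min (ps p - tanh l) (tanh r - ps p)"
  define C where "C = 1 + \<bar>R1\<bar> + \<bar>R2\<bar>"
  have C: "C > 0" and m': "m' > 0" using p by (auto simp: C_def m'_def tube_def)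
  show "\<exists>e>0. \<forall>q. dist q p < e \<longrightarrow> q \<in> tube l r R1 R2 a b"
  proof (intro exI[of _ "min (m / C) m'"] conjI allI impI)
    fix q assume q: "dist q p < min (m / C) m'"
    have "a < pv q t \<and> pv q t < b" if "t \<in> {R1..R2}" for t
    proof -
      have "\<bar>pv q t - pv p t\<bar> \<le> (1 + \<bar>t\<bar>) * dist q p" by (rule abs_pv_diff_le_dist)
      also have "\<dots> \<le> C * dist q p"
        using that by (intro mult_right_mono) (auto simp: C_def)
      also have "\<dots> < m" using q C by (simp add: field_simps)
      finally show ?thesis using m(2)[OF that] by linarith
    qed
    moreover have "tanh l < ps q \<and> ps q < tanh r"
      using abs_ps_diff_le_dist[of q p] q unfolding m'_def by linarith
    ultimately show "q \<in> tube l r R1 R2 a b" by (simp add: tube_def)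
  qed (use m C m' in auto)
qed

lemma sets_tube [measurable]: "tube l r R1 R2 a b \<in> sets borel"
  by (simp add: open_tube)

text \<open>A single coalescing path is Brownian motion, extended by a constant before
  \<open>t0\<close>. It leaves the tube only if the Brownian motion moves by more than
  \<open>c\<close> within time \<open>H\<close>.\<close>

lemma coalescing_BM_law_tube:
  assumes \<nu>: "coalescing_BM_law 1 z \<nu>" and z: "z 0 = (x, t0)"
    and "l < t0" "t0 < r" and c: "0 < c" "a < tanh (x - c)" "tanh (x + c) < b"
    and H: "R2 \<le> t0 + H" "0 < H"
  shows "measure \<nu> {f \<in> space \<nu>. f 0 \<notin> tube l r R1 R2 a b} \<le> 2 * H / c\<^sup>2"
proof -
  obtain N :: "(nat \<Rightarrow> real \<Rightarrow> real) measure" and B where B: "indep_standard_BMs N 1 B"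
      "\<nu> = distr N (\<Pi>\<^sub>M i\<in>{..<1}. borel) (\<lambda>\<omega>. coalescing_paths 1 z (\<lambda>j t. B j t \<omega>))"
    using \<nu> unfolding coalescing_BM_law_def by blast
  interpret prob_space N by (rule indep_BMs_regular(4)[OF B(1)])
  note X = measurable_coalescing_BMs[OF B(1), of z]
  have "(\<lambda>f. f 0) \<in> (\<Pi>\<^sub>M i\<in>{..<1 :: nat}. borel) \<rightarrow>\<^sub>M (borel :: web_path measure)"
    by (rule measurable_component_singleton) simp
  then have "{f \<in> space (\<Pi>\<^sub>M i\<in>{..<1 :: nat}. borel). f 0 \<notin> tube l r R1 R2 a b} \<in> sets (\<Pi>\<^sub>M i\<in>{..<1}. borel)"
    using measurable_sets_Collect[of "\<lambda>f. f 0" _ borel "\<lambda>p. p \<notin> tube l r R1 R2 a b"] by auto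
  then have "measure \<nu> {f \<in> space \<nu>. f 0 \<notin> tube l r R1 R2 a b}
      = prob ((\<lambda>\<omega>. coalescing_paths 1 z (\<lambda>j t. B j t \<omega>)) -` {f \<in> space (\<Pi>\<^sub>M i\<in>{..<1}. borel).
          f 0 \<notin> tube l r R1 R2 a b} \<inter> space N)"
    unfolding B(2) by (subst measure_distr[OF X]) auto
  also have "\<dots> \<le> prob {\<omega> \<in> space N. \<exists>s\<in>{0..H}. c < \<bar>B 0 s \<omega>\<bar>}"
  proof (rule finite_measure_mono)
    have BM: "standard_BM N (B 0)" by (rule indep_BMs_regular(3)[OF B(1)]) simp
    then show "{\<omega> \<in> space N. \<exists>s\<in>{0..H}. c < \<bar>B 0 s \<omega>\<bar>} \<in> events"
      using c H by (intro standard_BM_sup) auto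
    show "(\<lambda>\<omega>. coalescing_paths 1 z (\<lambda>j t. B j t \<omega>)) -` {f \<in> space (\<Pi>\<^sub>M i\<in>{..<1}. borel).
          f 0 \<notin> tube l r R1 R2 a b} \<inter> space N \<subseteq> {\<omega> \<in> space N. \<exists>s\<in>{0..H}. c < \<bar>B 0 s \<omega>\<bar>}"
    proof (safe, rule ccontr)
      fix \<omega> assume \<omega>: "\<omega> \<in> space N"
        and out: "coalescing_paths 1 z (\<lambda>j t. B j t \<omega>) 0 \<notin> tube l r R1 R2 a b"
        and "\<not> (\<exists>s\<in>{0..H}. c < \<bar>B 0 s \<omega>\<bar>)"
      then have small: "\<bar>B 0 s \<omega>\<bar> \<le> c" if "0 \<le> s" "s \<le> H" for s
        using that by force
      have cont: "continuous_on {0..} (\<lambda>s. B i s \<omega>)" if "i < 1" for i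
        using indep_BMs_regular(2)[OF B(1) that \<omega>] .
      have "coalesce (snd \<circ> z) (bm_paths z (\<lambda>j t. B j t \<omega>)) 1 0 s = x + B 0 (s - t0) \<omega>" for s
        using coalesce_Suc_same[of "snd \<circ> z" _ 0] by (simp add: z)
      then have pv: "pv (coalescing_paths 1 z (\<lambda>j t. B j t \<omega>) 0) s = tanh (x + B 0 (max s t0 - t0) \<omega>)" for s
        using pv_coalescing_paths[of 1 "\<lambda>j t. B j t \<omega>" 0 z s] cont by (simp add: z)
      have "ps (coalescing_paths 1 z (\<lambda>j t. B j t \<omega>) 0) = tanh t0"
        using path_start_coalescing_paths[of 1 "\<lambda>j t. B j t \<omega>" 0 z] cont by (simp add: z ps_ereal)
      moreover have "a < tanh (x + B 0 (max s t0 - t0) \<omega>) \<and> tanh (x + B 0 (max s t0 - t0) \<omega>) < b"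
        if "s \<in> {R1..R2}" for s
      proof -
        have "\<bar>B 0 (max s t0 - t0) \<omega>\<bar> \<le> c"
          using that H by (intro small) auto
        then have "tanh (x - c) \<le> tanh (x + B 0 (max s t0 - t0) \<omega>)"
            "tanh (x + B 0 (max s t0 - t0) \<omega>) \<le> tanh (x + c)"
          by (simp_all add: tanh_real_le_iff)
        then show ?thesis using c by linarith
      qed
      ultimately show False
        using out \<open>l < t0\<close> \<open>t0 < r\<close> by (simp add: tube_def pv del: One_nat_def)
    qed
  qed
  also have "\<dots> \<le> 2 * H / c\<^sup>2"
    using c H by (intro standard_BM_sup indep_BMs_regular(3)[OF B(1)]) auto
  finally show ?thesis .
qed

text \<open>In contrast to \<open>coalescing\<close>, a meeting at the time \<open>m\<close> itself
  or at an infinite position counts as well.\<close>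

definition coalesce_from :: "real \<Rightarrow> web_path \<Rightarrow> web_path \<Rightarrow> bool" where
  "coalesce_from m p q \<longleftrightarrow> (\<forall>s t. m \<le> s \<longrightarrow> s \<le> t \<longrightarrow> pv p s = pv q s \<longrightarrow> pv p t = pv q t)"

text \<open>By continuity it is enough that the paths agree at every rational time beyond a meeting,
  and a meeting within \<open>[m, r]\<close> is an event by
  \<open>measurable_zero_hit\<close>.\<close>

lemma sets_coalesce_from:
  assumes [measurable]: "P \<in> N \<rightarrow>\<^sub>M borel" "Q \<in> N \<rightarrow>\<^sub>M borel"
  shows "{\<omega> \<in> space N. coalesce_from m (P \<omega>) (Q \<omega>)} \<in> sets N"
proof -
  have "coalesce_from m p q \<longleftrightarrow>
      (\<forall>r\<in>{r \<in> \<rat>. m < r}. pv p r = pv q r \<or> \<not> (\<exists>s\<in>{m..r}. pv p s - pv q s = 0))" for p q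
  proof
    assume "coalesce_from m p q"
    then show "\<forall>r\<in>{r \<in> \<rat>. m < r}. pv p r = pv q r \<or> \<not> (\<exists>s\<in>{m..r}. pv p s - pv q s = 0)"
      unfolding coalesce_from_def by fastforce
  next
    assume *: "\<forall>r\<in>{r \<in> \<rat>. m < r}. pv p r = pv q r \<or> \<not> (\<exists>s\<in>{m..r}. pv p s - pv q s = 0)"
    show "coalesce_from m p q"
      unfolding coalesce_from_def
    proof (intro allI impI)
      fix s t assume st: "m \<le> s" "s \<le> t" "pv p s = pv q s"
      show "pv p t = pv q t"
      proof (cases "s = t")
        case False
        have "closed {t. pv p t = pv q t}"
          by (intro closed_Collect_eq continuous_on_pv)
        moreover have "{s<..} \<inter> \<rat> \<subseteq> {t. pv p t = pv q t}"
          using * st by fastforce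
        ultimately have "closure ({s<..} \<inter> \<rat>) \<subseteq> {t. pv p t = pv q t}"
          by (intro closure_minimal)
        moreover have "t \<in> {s<..}" using False st(2) by simp
        ultimately show ?thesis
          using closure_rat_Int_open[OF open_greaterThan, of s] by blast
      qed (use st in simp)
    qed
  qed
  then have "{\<omega> \<in> space N. coalesce_from m (P \<omega>) (Q \<omega>)}
      = {\<omega> \<in> space N. \<forall>r\<in>{r \<in> \<rat>. m < r}. pv (P \<omega>) r = pv (Q \<omega>) r \<or>
          \<not> (\<exists>s\<in>{m..r}. pv (P \<omega>) s - pv (Q \<omega>) s = 0)}"
    by simp
  also have "\<dots> \<in> sets N"
  proof (rule sets.sets_Collect_countable_All')
    fix r
    have [measurable]: "{\<omega> \<in> space N. \<exists>s\<in>{m..r}. pv (P \<omega>) s - pv (Q \<omega>) s = 0} \<in> sets N"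
      by (rule measurable_zero_hit) (measurable, intro continuous_on_diff continuous_on_pv)
    show "{\<omega> \<in> space N. pv (P \<omega>) r = pv (Q \<omega>) r \<or>
        \<not> (\<exists>s\<in>{m..r}. pv (P \<omega>) s - pv (Q \<omega>) s = 0)} \<in> sets N"
      by measurable
  qed (auto intro: countable_subset[OF _ countable_rat])
  finally show ?thesis .
qed

text \<open>With two trajectories the second one follows its own Brownian motion up to the first
  meeting and the first trajectory afterwards. Both conclusions are read off from this description,
  the second with \<open>scaled_BM_below\<close> for the difference of the motions.\<close>

lemma coalescing_BM_law_pair:
  assumes \<nu>: "coalescing_BM_law 2 z \<nu>"
  shows coalescing_BM_law_coalesce_from:
      "AE f in \<nu>. coalesce_from (max (snd (z 0)) (snd (z 1))) (f 0) (f 1)"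
    and coalescing_BM_law_distinct:
      "\<lbrakk>z 0 = (x, t0); z 1 = (x + h, t0); 0 < h; 0 < t\<rbrakk> \<Longrightarrow>
        h / sqrt (pi * t) * exp (- h\<^sup>2 / (4 * t))
          \<le> measure \<nu> {f \<in> space \<nu>. pv (f 0) (t0 + t) \<noteq> pv (f 1) (t0 + t)}"
proof -
  obtain N :: "(nat \<Rightarrow> real \<Rightarrow> real) measure" and B where B: "indep_standard_BMs N 2 B"
      "\<nu> = distr N (\<Pi>\<^sub>M i\<in>{..<2}. borel) (\<lambda>\<omega>. coalescing_paths 2 z (\<lambda>j t. B j t \<omega>))"
    using \<nu> unfolding coalescing_BM_law_def by blast
  note X = measurable_coalescing_BMs[OF B(1), of z]
  have comp [measurable]: "(\<lambda>f. f i) \<in> (\<Pi>\<^sub>M i\<in>{..<2}. borel) \<rightarrow>\<^sub>M (borel :: web_path measure)"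
    if "i < 2" for i :: nat
    using that by (intro measurable_component_singleton) simp
  let ?T = "snd \<circ> z" and ?m = "max (snd (z 0)) (snd (z 1))"
  let ?w = "\<lambda>\<omega>. bm_paths z (\<lambda>j t. B j t \<omega>)"
  let ?mt = "\<lambda>\<omega>. meeting_times ?T (?w \<omega>) 1 0" and ?\<tau> = "\<lambda>\<omega>. first_meeting ?T (?w \<omega>) 1"
  have cont: "continuous_on {0..} (\<lambda>s. B i s \<omega>)" if "i < 2" "\<omega> \<in> space N" for i \<omega>
    using indep_BMs_regular(2)[OF B(1) that] .
  have c0: "coalesce ?T (?w \<omega>) 1 0 = ?w \<omega> 0" "coalesce ?T (?w \<omega>) 2 0 = ?w \<omega> 0" for \<omega>
    using coalesce_Suc_same[of ?T "?w \<omega>" 0] coalesce_Suc_less[of 0 1 ?T "?w \<omega>"]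
    by (auto simp: numeral_2_eq_2 simp del: coalesce.simps)
  have mt: "?mt \<omega> = {s \<in> {?m..}. ?w \<omega> 1 s = ?w \<omega> 0 s}" for \<omega>
    unfolding meeting_times_def c0(1) by auto
  have c1: "?mt \<omega> = {} \<and> coalesce ?T (?w \<omega>) 2 1 = ?w \<omega> 1 \<or>
      ?\<tau> \<omega> \<in> ?mt \<omega> \<and> (\<forall>s. coalesce ?T (?w \<omega>) 2 1 s = (if s < ?\<tau> \<omega> then ?w \<omega> 1 s else ?w \<omega> 0 s))"
    if \<omega>: "\<omega> \<in> space N" for \<omega>
  proof -
    have "continuous_on {?T i..} (?w \<omega> i)" if "i < Suc 1" for i
      using that by (intro continuous_on_bm_paths cont \<omega>) simp
    then show ?thesis
    proof (rule coalesce_Suc_cases)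
      assume "\<And>k. k < 1 \<Longrightarrow> meeting_times ?T (?w \<omega>) 1 k = {}" "coalesce ?T (?w \<omega>) (Suc 1) 1 = ?w \<omega> 1"
      then show ?thesis unfolding Suc_1 by auto
    next
      fix k assume "k < 1" "?\<tau> \<omega> \<in> meeting_times ?T (?w \<omega>) 1 k"
        "\<And>s. coalesce ?T (?w \<omega>) (Suc 1) 1 s =
          (if s < ?\<tau> \<omega> then ?w \<omega> 1 s else coalesce ?T (?w \<omega>) 1 k s)"
      then show ?thesis unfolding Suc_1 less_one using c0(1)[of \<omega>] by simp
    qed
  qed
  have pv0: "pv (coalescing_paths 2 z (\<lambda>j t. B j t \<omega>) 0) s = tanh (?w \<omega> 0 s)"
    if "\<omega> \<in> space N" "?m \<le> s" for \<omega> s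
    using pv_coalescing_paths[of 2 "\<lambda>j t. B j t \<omega>" 0 z s] cont that by (simp add: c0 max_absorb1)
  have pv1: "pv (coalescing_paths 2 z (\<lambda>j t. B j t \<omega>) 1) s = tanh (coalesce ?T (?w \<omega>) 2 1 s)"
    if "\<omega> \<in> space N" "?m \<le> s" for \<omega> s
    using pv_coalescing_paths[of 2 "\<lambda>j t. B j t \<omega>" 1 z s] cont that
    by (simp add: max_absorb1 del: coalesce.simps)
  have "coalesce_from ?m (coalescing_paths 2 z (\<lambda>j t. B j t \<omega>) 0) (coalescing_paths 2 z (\<lambda>j t. B j t \<omega>) 1)"
    if \<omega>: "\<omega> \<in> space N" for \<omega>
    unfolding coalesce_from_def
  proof (intro allI impI)
    fix s t assume st: "?m \<le> s" "s \<le> t"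
      and "pv (coalescing_paths 2 z (\<lambda>j t. B j t \<omega>) 0) s = pv (coalescing_paths 2 z (\<lambda>j t. B j t \<omega>) 1) s"
    then have eq: "?w \<omega> 0 s = coalesce ?T (?w \<omega>) 2 1 s"
      using pv0[OF \<omega> st(1)] pv1[OF \<omega> st(1)] by simp
    from c1[OF \<omega>] have "?w \<omega> 0 t = coalesce ?T (?w \<omega>) 2 1 t"
    proof
      assume "?mt \<omega> = {} \<and> coalesce ?T (?w \<omega>) 2 1 = ?w \<omega> 1"
      then show ?thesis using mt[of \<omega>] st(1) eq by auto
    next
      assume *: "?\<tau> \<omega> \<in> ?mt \<omega> \<and> (\<forall>s. coalesce ?T (?w \<omega>) 2 1 s = (if s < ?\<tau> \<omega> then ?w \<omega> 1 s else ?w \<omega> 0 s))"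
      have "?\<tau> \<omega> \<le> s"
      proof (rule ccontr)
        assume "\<not> ?\<tau> \<omega> \<le> s"
        then have "s \<in> ?mt \<omega>" using * eq st(1) mt[of \<omega>] by simp
        from first_meeting_le[OF _ this] \<open>\<not> ?\<tau> \<omega> \<le> s\<close> show False by simp
      qed
      then show ?thesis using * st(2) by simp
    qed
    then show "pv (coalescing_paths 2 z (\<lambda>j t. B j t \<omega>) 0) t = pv (coalescing_paths 2 z (\<lambda>j t. B j t \<omega>) 1) t"
      using pv0[OF \<omega>, of t] pv1[OF \<omega>, of t] st by simp
  qed
  then show "AE f in \<nu>. coalesce_from ?m (f 0) (f 1)"
    unfolding B(2)
    by (subst AE_distr_iff[OF X]) (auto intro!: sets_coalesce_from comp)
  assume z: "z 0 = (x, t0)" "z 1 = (x + h, t0)" and ht: "0 < h" "0 < t"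
  let ?A = "{f \<in> space (\<Pi>\<^sub>M i\<in>{..<2}. borel). pv (f 0) (t0 + t) \<noteq> pv (f (1 :: nat)) (t0 + t)}"
  have A: "?A \<in> sets (\<Pi>\<^sub>M i\<in>{..<2}. borel)"
    by (intro borel_measurable_neq measurable_compose[OF comp measurable_pv]) auto
  have D: "scaled_BM N 2 (\<lambda>t \<omega>. B 0 t \<omega> - B 1 t \<omega>)"
    by (rule scaled_BM_diff[OF B(1)]) auto
  have "h / sqrt (pi * t) * exp (- h\<^sup>2 / (4 * t))
      \<le> measure N ((\<lambda>\<omega>. coalescing_paths 2 z (\<lambda>j t. B j t \<omega>)) -` ?A \<inter> space N)"
  proof (rule scaled_BM_below[OF D ht(2,1) measurable_sets[OF X A]])
    fix \<omega> assume \<omega>: "\<omega> \<in> space N" and below: "\<And>s. s \<in> {0..t} \<Longrightarrow> B 0 s \<omega> - B 1 s \<omega> < h"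
    \<comment> \<open>The trajectories start at distance \<open>h\<close>, so a meeting requires
      \<open>B 0 - B 1\<close> to equal \<open>h\<close>.\<close>
    have no: "s \<notin> ?mt \<omega>" if "s \<le> t0 + t" for s
      using below[of "s - t0"] that unfolding mt by (auto simp: z simp del: One_nat_def)
    have "coalesce ?T (?w \<omega>) 2 1 (t0 + t) = ?w \<omega> 1 (t0 + t)"
      using c1[OF \<omega>] no[of "?\<tau> \<omega>"] by (auto simp del: coalesce.simps)
    then have "?w \<omega> 0 (t0 + t) \<noteq> coalesce ?T (?w \<omega>) 2 1 (t0 + t)"
      using below[of t] ht by (simp add: z del: One_nat_def)
    then have "pv (coalescing_paths 2 z (\<lambda>j t. B j t \<omega>) 0) (t0 + t)
        \<noteq> pv (coalescing_paths 2 z (\<lambda>j t. B j t \<omega>) 1) (t0 + t)"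
      using pv0[OF \<omega>, of "t0 + t"] pv1[OF \<omega>, of "t0 + t"] ht by (simp add: z del: coalesce.simps One_nat_def)
    then show "\<omega> \<in> (\<lambda>\<omega>. coalescing_paths 2 z (\<lambda>j t. B j t \<omega>)) -` ?A \<inter> space N"
      using \<omega> measurable_space[OF X \<omega>] by simp
  qed
  also have "\<dots> = measure \<nu> {f \<in> space \<nu>. pv (f 0) (t0 + t) \<noteq> pv (f 1) (t0 + t)}"
    unfolding B(2) using A by (subst measure_distr[OF X]) auto
  finally show "h / sqrt (pi * t) * exp (- h\<^sup>2 / (4 * t))
      \<le> measure \<nu> {f \<in> space \<nu>. pv (f 0) (t0 + t) \<noteq> pv (f 1) (t0 + t)}" .
qed

section \<open>Families of coalescing paths\<close>

lemma coalescingD: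
  assumes "coalescing K" "p \<in> paths K" "q \<in> paths K" "path_start p < ereal s" "path_start q < ereal s"
    and "pv p s = pv q s" "\<bar>pv p s\<bar> < 1" "s \<le> r"
  shows "pv p r = pv q r"
proof -
  have "max (path_start p) (path_start q) < ereal s \<and> path_at p s = path_at q s \<and>
      \<bar>path_at p s\<bar> \<noteq> \<infinity> \<longrightarrow> (\<forall>r\<ge>s. path_at p r = path_at q r)"
    by (rule spec[OF bspec[OF bspec[OF assms(1)[unfolded coalescing_def] assms(2)] assms(3)]])
  moreover have "path_at p s = path_at q s" "\<bar>path_at p s\<bar> \<noteq> \<infinity>"
    using assms(6,7) by (simp_all add: pv_def tanh_ereal_inject abs_tanh_ereal_less_1)
  ultimately show ?thesis
    using assms(4,5,8) by (simp add: pv_def)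
qed

text \<open>A change of order forces a meeting in between. It lies strictly after a time at which
  the paths differ, hence strictly after both starts as \<open>coalescing\<close> requires, and at a
  finite position by \<open>fin\<close>. From then on the paths agree, which contradicts the later
  strict order.\<close>

lemma noncrossing:
  assumes K: "coalescing K" and pq: "p \<in> paths K" "q \<in> paths K"
    and start: "path_start p \<le> ereal s" "path_start q \<le> ereal s"
    and fin: "\<And>v. v \<in> {s..R} \<Longrightarrow> \<bar>pv q v\<bar> < 1"
  shows "(\<forall>v\<in>{s..R}. pv q v \<le> pv p v) \<or> (\<forall>v\<in>{s..R}. pv p v \<le> pv q v)"
proof (rule ccontr)
  assume "\<not> ?thesis"
  then obtain v w where vw: "v \<in> {s..R}" "pv p v < pv q v" "w \<in> {s..R}" "pv q w < pv p w"
    by (auto simp: not_le)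
  define f where "f t = pv p t - pv q t" for t
  have cont: "continuous_on A f" for A
    unfolding f_def by (intro continuous_intros continuous_on_pv)
  have contra: False if ab: "a < b" "s \<le> a" "b \<le> R" and z: "\<exists>z. a \<le> z \<and> z \<le> b \<and> f z = 0"
    and ne: "f a \<noteq> 0" "f b \<noteq> 0" for a b
  proof -
    obtain z where z: "a \<le> z" "z \<le> b" "f z = 0" using z by blast
    then have "a < z" using ne by (metis order_le_less)
    then have "s < z" using ab by simp
    then have "path_start p < ereal z" "path_start q < ereal z"
      using start by (meson ereal_less_eq(3) leD le_less_trans less_ereal.simps(1))+
    then have "pv p b = pv q b"
      using coalescingD[OF K pq] z ab fin[of z] \<open>s < z\<close> by (simp add: f_def)
    then show False using ne by (simp add: f_def)
  qed
  have vw0: "\<exists>z. v \<le> z \<and> z \<le> w \<and> f z = 0" if "v < w"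
    using vw that by (intro IVT' cont) (auto simp: f_def)
  have wv0: "\<exists>z. w \<le> z \<and> z \<le> v \<and> f z = 0" if "w < v"
    using vw that by (intro IVT2' cont) (auto simp: f_def)
  have "f v \<noteq> 0" "f w \<noteq> 0" "v \<noteq> w" using vw by (auto simp: f_def)
  then show False
    using contra[of v w] contra[of w v] vw0 wv0 vw(1,3)
    by (cases v w rule: linorder_cases) (simp_all del: One_nat_def)
qed

section \<open>A deterministic criterion for a dense skeleton\<close>

lemma dist_le_window:
  assumes "0 < T" "2 / (1 + T) \<le> e" "\<And>t. t \<in> {-T..T} \<Longrightarrow> \<bar>pv p t - pv q t\<bar> \<le> e" "\<bar>ps p - ps q\<bar> \<le> e"
  shows "dist p q \<le> e"
proof (rule dist_web_path_leI)
  have e: "0 \<le> e" using assms(4) by linarith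
  fix t
  show "\<bar>pv p t - pv q t\<bar> \<le> e * (1 + \<bar>t\<bar>)"
  proof (cases "t \<in> {-T..T}")
    case True
    have "e * 1 \<le> e * (1 + \<bar>t\<bar>)" using e by (intro mult_left_mono) auto
    then show ?thesis using assms(3)[OF True] by simp
  next
    case False
    then have "T \<le> \<bar>t\<bar>" by auto
    have "2 \<le> e * (1 + T)" using assms(1,2) by (simp add: pos_divide_le_eq)
    also have "\<dots> \<le> e * (1 + \<bar>t\<bar>)" using e \<open>T \<le> \<bar>t\<bar>\<close> by (intro mult_left_mono) auto
    finally show ?thesis using abs_pv_le_1[of p t] abs_pv_le_1[of q t] by linarith
  qed
qed (fact assms(4))

text \<open>A path starting in the time window either stays beyond one of the barrier paths, and is then
  close to it, or is confined to a compact region; there it has a small modulus of continuity and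
  coalesces quickly with a nearby path of \<open>Q\<close>.\<close>

lemma skeleton_dense:
  assumes K: "coalescing K" and Q: "Q \<subseteq> paths K"
    and e: "0 < e" "e < 1" and T: "0 < T" "2 / (1 + T) \<le> e" "1 - tanh T \<le> e / 2"
    and \<tau>: "0 < \<tau>" "\<tau> \<le> e / 2" and u: "4 * u \<le> e" and m: "m < 1" "m \<le> m'"
    and net: "\<And>x. x \<in> {-1..1} \<Longrightarrow> \<exists>q\<in>Q. tanh T \<le> ps q \<and> (\<forall>t\<in>{-T..T}. \<bar>pv q t - x\<bar> \<le> e)"
    and upper: "\<And>s. s \<in> {-T..T} \<Longrightarrow> \<exists>q\<in>Q. tanh (s - e / 2) \<le> ps q \<and> ps q \<le> tanh s \<and>
      (\<forall>t\<in>{-T..T + 1}. 1 - e \<le> pv q t \<and> pv q t \<le> m)"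
    and lower: "\<And>s. s \<in> {-T..T} \<Longrightarrow> \<exists>q\<in>Q. tanh (s - e / 2) \<le> ps q \<and> ps q \<le> tanh s \<and>
      (\<forall>t\<in>{-T..T + 1}. - m \<le> pv q t \<and> pv q t \<le> - (1 - e))"
    and modulus: "\<And>p v v'. \<lbrakk>p \<in> paths K; v \<in> {-T..T + 1}; v' \<in> {v..v + \<tau>}; path_start p \<le> ereal v;
      \<bar>pv p v\<bar> \<le> m'\<rbrakk> \<Longrightarrow> \<bar>pv p v' - pv p v\<bar> \<le> u"
    and grid: "\<And>s. s \<in> {-T..T} \<Longrightarrow> \<exists>r\<in>{s..s + \<tau>}. \<forall>p\<in>paths K.
      path_start p \<le> ereal r \<and> \<bar>pv p r\<bar> \<le> m \<and> \<bar>pv p (r + \<tau>)\<bar> \<le> m \<longrightarrow>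
      (\<exists>q\<in>Q. tanh (r - \<tau>) \<le> ps q \<and> ps q \<le> tanh r \<and> (\<forall>t\<in>{r - \<tau>..r}. \<bar>pv q t - pv p r\<bar> \<le> u) \<and>
        \<bar>pv q r\<bar> \<le> m' \<and> pv q (r + \<tau>) = pv p (r + \<tau>))"
    and p: "p \<in> paths K"
  shows "\<exists>q\<in>Q. dist p q \<le> e"
proof (cases "path_start p \<le> ereal T")
  case False
  \<comment> \<open>A path that starts after the window is constant on it, so the net provides a
    path with nearly the same value throughout.\<close>
  then have late: "ereal T \<le> path_start p" by simp
  have "pv p T \<in> {-1..1}" using abs_pv_le_1[of p T] by auto
  then obtain q where q: "q \<in> Q" "tanh T \<le> ps q" "\<And>t. t \<in> {-T..T} \<Longrightarrow> \<bar>pv q t - pv p T\<bar> \<le> e"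
    using net by blast
  have "\<bar>pv p t - pv q t\<bar> \<le> e" if "t \<in> {-T..T}" for t
  proof -
    have "pv p t = pv p T"
      using that late by (intro pv_before_start) (auto intro: order_trans[of _ "ereal T"])
    then show ?thesis using q(3)[OF that] by (simp add: abs_minus_commute)
  qed
  moreover have "\<bar>ps p - ps q\<bar> \<le> e"
  proof -
    have "tanh T \<le> ps p" using late by (simp add: ps_ge_iff)
    then show ?thesis using q(2) T(3) e(1) abs_ps_le_1[of p] abs_ps_le_1[of q] by linarith
  qed
  ultimately have "dist p q \<le> e"
    by (intro dist_le_window[OF T(1,2)]) auto
  then show ?thesis using q(1) by blast
next
  case True
  \<comment> \<open>Here \<open>s\<close> is the starting time, moved up to \<open>-T\<close> if it
    precedes the window. By the choice of \<open>T\<close> such a move changes \<open>ps\<close> by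
    at most \<open>e / 2\<close>.\<close>
  obtain s where s: "s \<in> {-T..T}" "path_start p \<le> ereal s"
    and before: "\<And>t. t \<in> {-T..s} \<Longrightarrow> pv p t = pv p s" and ps: "\<bar>ps p - tanh s\<bar> \<le> e / 2"
  proof (cases "path_start p \<le> ereal (- T)")
    case early: True
    show ?thesis
    proof (rule that[of "- T"])
      have "ps p \<le> tanh (- T)" using early by (simp add: ps_le_iff del: tanh_minus)
      then show "\<bar>ps p - tanh (- T)\<bar> \<le> e / 2"
        using T(3) abs_ps_le_1[of p] by (simp add: abs_le_iff)
    qed (use early T in auto)
  next
    case False
    then obtain s where s: "path_start p = ereal s"
      using True by (cases "path_start p") auto
    show ?thesis
    proof (rule that[of s])
      fix t assume "t \<in> {-T..s}"
      then show "pv p t = pv p s" using s by (intro pv_before_start) auto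
    qed (use s True False e in \<open>auto simp: ps_ereal\<close>)
  qed
  have p_eq: "pv p t = pv p (max t s)" if "t \<in> {-T..T}" for t
    using before[of t] that by (auto simp: max_def)
  have barrier: "(\<forall>v\<in>{s..T + 1}. pv q v \<le> pv p v) \<or> (\<forall>v\<in>{s..T + 1}. pv p v \<le> pv q v)"
    if "q \<in> Q" "ps q \<le> tanh s" "\<And>t. t \<in> {-T..T + 1} \<Longrightarrow> \<bar>pv q t\<bar> < 1" for q
    using that s by (intro noncrossing[OF K p]) (use Q in \<open>auto simp: ps_le_iff\<close>)
  have ps_close: "\<bar>ps p - ps q\<bar> \<le> e" if "tanh (s - e / 2) \<le> ps q" "ps q \<le> tanh s" for q
    using ps that abs_tanh_diff_le[of s "s - e / 2"] e by linarith
  obtain b where b: "b \<in> Q" "tanh (s - e / 2) \<le> ps b" "ps b \<le> tanh s"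
      "\<And>t. t \<in> {-T..T + 1} \<Longrightarrow> 1 - e \<le> pv b t \<and> pv b t \<le> m"
    using upper[OF s(1)] by blast
  obtain c where c: "c \<in> Q" "tanh (s - e / 2) \<le> ps c" "ps c \<le> tanh s"
      "\<And>t. t \<in> {-T..T + 1} \<Longrightarrow> - m \<le> pv c t \<and> pv c t \<le> - (1 - e)"
    using lower[OF s(1)] by blast
  have b1: "\<bar>pv b t\<bar> < 1" if "t \<in> {-T..T + 1}" for t using b(4)[OF that] e m(1) by auto
  have c1: "\<bar>pv c t\<bar> < 1" if "t \<in> {-T..T + 1}" for t using c(4)[OF that] e m(1) by auto
  consider (above) "\<forall>v\<in>{s..T + 1}. pv b v \<le> pv p v" | (below) "\<forall>v\<in>{s..T + 1}. pv p v \<le> pv c v"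
    | (between) "\<forall>v\<in>{s..T + 1}. pv p v \<le> pv b v" "\<forall>v\<in>{s..T + 1}. pv c v \<le> pv p v"
    using barrier[OF b(1,3) b1] barrier[OF c(1,3) c1] by blast
  then show ?thesis
  proof cases
    case above
    have "\<bar>pv p t - pv b t\<bar> \<le> e" if t: "t \<in> {-T..T}" for t
    proof -
      have "1 - e \<le> pv p t"
        unfolding p_eq[OF t] using above b(4)[of "max t s"] t s(1)
        by (auto intro: order_trans[of _ "pv b (max t s)"])
      then show ?thesis using b(4)[of t] t abs_pv_le_1[of p t] abs_pv_le_1[of b t] by auto
    qed
    then have "dist p b \<le> e" using ps_close[OF b(2,3)] by (intro dist_le_window[OF T(1,2)]) auto
    then show ?thesis using b(1) by blast
  next
    case below
    have "\<bar>pv p t - pv c t\<bar> \<le> e" if t: "t \<in> {-T..T}" for t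
    proof -
      have "pv p t \<le> - (1 - e)"
        unfolding p_eq[OF t] using below c(4)[of "max t s"] t s(1)
        by (auto intro: order_trans[of _ "pv c (max t s)"])
      then show ?thesis using c(4)[of t] t abs_pv_le_1[of p t] abs_pv_le_1[of c t] by auto
    qed
    then have "dist p c \<le> e" using ps_close[OF c(2,3)] by (intro dist_le_window[OF T(1,2)]) auto
    then show ?thesis using c(1) by blast
  next
    case between
    have pm: "\<bar>pv p v\<bar> \<le> m" if "v \<in> {s..T + 1}" for v
    proof -
      have "v \<in> {-T..T + 1}" using that s(1) by auto
      then show ?thesis
        using bspec[OF between(1) that] bspec[OF between(2) that] b(4)[of v] c(4)[of v] by auto
    qed
    \<comment> \<open>The start of \<open>p\<close> is arbitrary, so the comparison path is taken at
      the grid time \<open>r\<close>, at most \<tau> later; from \<open>s\<close> to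
      \<open>r\<close> the modulus controls \<open>p\<close>.\<close>
    obtain r where r: "r \<in> {s..s + \<tau>}" "\<And>p. \<lbrakk>p \<in> paths K; path_start p \<le> ereal r; \<bar>pv p r\<bar> \<le> m;
        \<bar>pv p (r + \<tau>)\<bar> \<le> m\<rbrakk> \<Longrightarrow> \<exists>q\<in>Q. tanh (r - \<tau>) \<le> ps q \<and> ps q \<le> tanh r \<and>
        (\<forall>t\<in>{r - \<tau>..r}. \<bar>pv q t - pv p r\<bar> \<le> u) \<and> \<bar>pv q r\<bar> \<le> m' \<and> pv q (r + \<tau>) = pv p (r + \<tau>)"
      using grid[OF s(1)] by blast
    have rT: "r \<in> {s..T + 1}" "r + \<tau> \<in> {s..T + 1}" using r(1) s(1) \<tau> e by auto
    have start_r: "path_start p \<le> ereal r"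
      using s(2) r(1) by (auto intro: order_trans[of _ "ereal s"])
    obtain q where q: "q \<in> Q" "tanh (r - \<tau>) \<le> ps q" "ps q \<le> tanh r"
        "\<And>t. t \<in> {r - \<tau>..r} \<Longrightarrow> \<bar>pv q t - pv p r\<bar> \<le> u" "\<bar>pv q r\<bar> \<le> m'" "pv q (r + \<tau>) = pv p (r + \<tau>)"
      using r(2)[OF p start_r pm[OF rT(1)] pm[OF rT(2)]] by blast
    have start_q: "path_start q \<le> ereal r" using q(3) by (simp add: ps_le_iff)
    have ms: "\<bar>pv p v - pv p s\<bar> \<le> u" if "v \<in> {s..r}" for v
      using that r(1) s pm[of s] m(2) T(1) by (intro modulus[OF p]) auto
    have mr: "\<bar>pv p v - pv p r\<bar> \<le> u" if "v \<in> {r..r + \<tau>}" for v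
      using that rT(1) s(1) pm[of r] m(2) start_r by (intro modulus[OF p]) auto
    have mq: "\<bar>pv q v - pv q r\<bar> \<le> u" if "v \<in> {r..r + \<tau>}" for v
      using that rT(1) s(1) q(1,5) Q start_q by (intro modulus) auto
    have "\<bar>pv p t - pv q t\<bar> \<le> e" if t: "t \<in> {-T..T}" for t
    proof -
      \<comment> \<open>From \<open>r + \<tau>\<close> on the two paths have coalesced. Before that
        the difference is a chain of three terms of size at most \<open>u\<close>, while
        \<open>4 * u \<le> e\<close>.\<close>
      consider "r + \<tau> \<le> t" | "r \<le> t" "t \<le> r + \<tau>" | "t \<le> r" by linarith
      then show ?thesis
      proof cases
        case 1
        have "ereal r < ereal (r + \<tau>)" using \<tau>(1) by simp
        then have "path_start p < ereal (r + \<tau>)" "path_start q < ereal (r + \<tau>)"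
          by (rule le_less_trans[OF start_r], rule le_less_trans[OF start_q])
        moreover have "\<bar>pv p (r + \<tau>)\<bar> < 1" using pm[OF rT(2)] m(1) by linarith
        ultimately have "pv p t = pv q t"
          using q(1,6) Q 1 by (metis coalescingD[OF K p] subsetD)
        then show ?thesis using e by simp
      next
        case 2
        then show ?thesis using mr[of t] mq[of t] q(4)[of r] \<tau>(1) u by auto
      next
        case 3
        have "\<bar>pv p t - pv p s\<bar> \<le> u" "\<bar>pv p r - pv p s\<bar> \<le> u"
          using p_eq[OF t] ms[of "max t s"] ms[of r] 3 r(1) by auto
        moreover have "\<bar>pv q t - pv p r\<bar> \<le> u"
        proof (cases "r - \<tau> \<le> t")
          case True
          then show ?thesis using q(4)[of t] 3 by auto
        next
          case False
          have "ereal (r - \<tau>) \<le> path_start q" using q(2) by (simp add: ps_ge_iff)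
          then have "pv q t = pv q (r - \<tau>)"
            using False by (intro pv_before_start) (auto intro: order_trans[of _ "ereal (r - \<tau>)"])
          then show ?thesis using q(4)[of "r - \<tau>"] \<tau>(1) by auto
        qed
        ultimately show ?thesis using u by linarith
      qed
    qed
    moreover have "\<bar>ps p - ps q\<bar> \<le> e"
    proof -
      have "tanh (r - \<tau>) \<ge> tanh (s - e / 2)" "tanh r \<le> tanh (s + e / 2)"
        using r(1) \<tau>(2) by (simp_all add: tanh_real_le_iff)
      then show ?thesis
        using ps q(2,3) abs_tanh_diff_le[of s "s - e / 2"] abs_tanh_diff_le[of "s + e / 2" s] e by linarith
    qed
    ultimately have "dist p q \<le> e" by (intro dist_le_window[OF T(1,2)]) auto
    then show ?thesis using q(1) by blast
  qed
qed

text \<open>Rectangles of width \<open>sqrt \<tau>\<close> and height \<tau> on a lattice cover the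
  region, and \<open>(x, v)\<close> lies in one of them. As \<open>v\<close> is less than \<tau>
  above its bottom, \<open>v + \<tau>\<close> is still within the height \<open>2 * \<tau>\<close>
  of the bigger rectangle. A path that avoids the sides of the latter stays between them, and they
  are \<open>u\<close> apart.\<close>

lemma modulus_of_no_crossing:
  assumes \<tau>: "0 < \<tau>" "sqrt \<tau> < u"
    and no: "\<And>i j :: int. \<bar>of_int i\<bar> \<le> B / sqrt \<tau> + 1 \<Longrightarrow> \<bar>of_int j\<bar> \<le> V / \<tau> + 1 \<Longrightarrow>
      K \<notin> crossing_event \<tau> u (of_int i * sqrt \<tau>) (of_int j * \<tau>)"
    and p: "p \<in> paths K" "path_start p \<le> ereal v" "\<bar>v\<bar> \<le> V" "\<bar>pv p v\<bar> \<le> tanh B" "v' \<in> {v..v + \<tau>}"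
  shows "\<bar>pv p v' - pv p v\<bar> \<le> u" and "\<bar>pv p v'\<bar> < 1"
proof -
  obtain x where x: "pv p v = tanh x"
    using pv_real[of p v] p(4) tanh_real_lt_1[of B] by auto
  have "\<bar>x\<bar> \<le> B"
    using p(4) by (auto simp: x abs_le_iff tanh_real_le_iff simp flip: tanh_minus)
  define i where "i = round (x / sqrt \<tau>)"
  define j where "j = \<lfloor>v / \<tau>\<rfloor>"
  let ?x0 = "of_int i * sqrt \<tau>" and ?t0 = "of_int j * \<tau>"
  have "\<bar>of_int i - x / sqrt \<tau>\<bar> \<le> 1 / 2"
    unfolding i_def by (rule of_int_round_abs_le)
  then have ix: "\<bar>?x0 - x\<bar> \<le> sqrt \<tau> / 2"
  proof -
    have "\<bar>?x0 - x\<bar> = \<bar>of_int i - x / sqrt \<tau>\<bar> * sqrt \<tau>"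
    proof -
      have "(of_int i - x / sqrt \<tau>) * sqrt \<tau> = ?x0 - x"
        using \<tau>(1) by (simp add: left_diff_distrib)
      then show ?thesis using \<tau>(1) by (metis abs_mult abs_of_pos real_sqrt_gt_zero)
    qed
    also have "\<dots> \<le> 1 / 2 * sqrt \<tau>"
      using \<open>\<bar>of_int i - x / sqrt \<tau>\<bar> \<le> 1 / 2\<close> \<tau>(1) by (intro mult_right_mono) auto
    finally show ?thesis by simp
  qed
  have "\<bar>x / sqrt \<tau>\<bar> \<le> B / sqrt \<tau>"
    using \<open>\<bar>x\<bar> \<le> B\<close> \<tau>(1) by (simp add: divide_right_mono)
  then have i: "\<bar>of_int i\<bar> \<le> B / sqrt \<tau> + 1"
    using \<open>\<bar>of_int i - x / sqrt \<tau>\<bar> \<le> 1 / 2\<close> by linarith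
  have jv: "of_int j \<le> v / \<tau>" "v / \<tau> < of_int j + 1"
    unfolding j_def by linarith+
  then have tv: "?t0 \<le> v" "v < ?t0 + \<tau>"
    using \<tau>(1) by (simp_all add: field_simps)
  have "\<bar>v / \<tau>\<bar> \<le> V / \<tau>"
    using p(3) \<tau>(1) by (simp add: divide_right_mono)
  then have j: "\<bar>of_int j\<bar> \<le> V / \<tau> + 1"
    using jv by linarith
  have K: "K \<notin> crossing_event \<tau> u ?x0 ?t0" by (rule no[OF i j])
  have inside: "(x, v) \<in> rect ?x0 ?t0 (sqrt \<tau>) \<tau>"
  proof -
    have "?x0 - sqrt \<tau> / 2 \<le> x" "x \<le> ?x0 + sqrt \<tau> / 2" using ix by linarith+
    then show ?thesis using tv by (simp add: rect_def)
  qed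
  have touch: "touches p (x, v)" using p(2) x by (simp add: touches_iff)
  have no_hit: "pv p s \<noteq> tanh y" if y: "y \<in> {?x0 - u / 2, ?x0 + u / 2}" and s: "v \<le> s" "s \<le> v'" for s y
  proof
    assume hit: "pv p s = tanh y"
    have "y \<noteq> x" using y ix \<tau>(2) by auto
    then have "s \<noteq> v" using hit x by auto
    moreover have "(y, s) \<in> rect_sides ?x0 ?t0 u (2 * \<tau>)"
      using y s p(5) tv by (auto simp: rect_sides_def)
    moreover have "touches p (y, s)"
      using hit p(2) s(1) by (auto simp: touches_iff intro: order_trans[of _ "ereal v"])
    ultimately have "K \<in> crossing_event \<tau> u ?x0 ?t0"
      unfolding crossing_event_def using p(1) inside touch s(1)
      by (intro CollectI bexI[of _ p] bexI[of _ "(x, v)"]) (auto intro!: bexI[of _ "(y, s)"])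
    then show False using K by blast
  qed
  have vv': "v \<le> v'" using p(5) by simp
  have x0: "tanh (?x0 - u / 2) \<le> tanh x" "tanh x \<le> tanh (?x0 + u / 2)"
  proof -
    have "?x0 - u / 2 \<le> x" "x \<le> ?x0 + u / 2" using ix \<tau>(2) by linarith+
    then show "tanh (?x0 - u / 2) \<le> tanh x" "tanh x \<le> tanh (?x0 + u / 2)" by simp_all
  qed
  have "pv p v' < tanh (?x0 + u / 2)"
  proof (rule ccontr)
    assume "\<not> ?thesis"
    then have "\<exists>s. v \<le> s \<and> s \<le> v' \<and> pv p s = tanh (?x0 + u / 2)"
      using x0 x vv' by (intro IVT' continuous_on_pv) auto
    then show False using no_hit by blast
  qed
  moreover have "tanh (?x0 - u / 2) < pv p v'"
  proof (rule ccontr)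
    assume "\<not> ?thesis"
    then have "\<exists>s. v \<le> s \<and> s \<le> v' \<and> pv p s = tanh (?x0 - u / 2)"
      using x0 x vv' by (intro IVT2' continuous_on_pv) auto
    then show False using no_hit by blast
  qed
  moreover have "tanh (?x0 + u / 2) - tanh (?x0 - u / 2) \<le> u"
    using abs_tanh_diff_le[of "?x0 + u / 2" "?x0 - u / 2"] \<tau> real_sqrt_gt_zero[OF \<tau>(1)] by auto
  ultimately show "\<bar>pv p v' - pv p v\<bar> \<le> u" "\<bar>pv p v'\<bar> < 1"
    using x0 x tanh_real_lt_1[of "?x0 + u / 2"] tanh_real_gt_neg1[of "?x0 - u / 2"] by linarith+
qed

lemma three_le_eta:
  assumes "p1 \<in> paths K" "p2 \<in> paths K" "p3 \<in> paths K"
    and "\<And>p. p \<in> {p1, p2, p3} \<Longrightarrow> path_start p \<le> ereal r"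
    and "\<And>p. p \<in> {p1, p2, p3} \<Longrightarrow> tanh a \<le> pv p r \<and> pv p r \<le> tanh b"
    and "\<And>p. p \<in> {p1, p2, p3} \<Longrightarrow> \<bar>pv p (r + \<tau>)\<bar> < 1"
    and "pv p1 (r + \<tau>) \<noteq> pv p2 (r + \<tau>)" "pv p1 (r + \<tau>) \<noteq> pv p3 (r + \<tau>)" "pv p2 (r + \<tau>) \<noteq> pv p3 (r + \<tau>)"
    and "0 \<le> \<tau>"
  shows "3 \<le> eta r \<tau> a b K"
proof -
  have "\<exists>y. y \<in> eta_points r \<tau> a b K \<and> pv p (r + \<tau>) = tanh y" if p: "p \<in> {p1, p2, p3}" for p
  proof -
    obtain y where y: "pv p (r + \<tau>) = tanh y" using assms(6)[OF p] pv_real by blast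
    have "\<bar>pv p r\<bar> < 1"
      using assms(5)[OF p] tanh_real_lt_1[of b] tanh_real_gt_neg1[of a] by auto
    then obtain x where x: "pv p r = tanh x" using pv_real by blast
    have "x \<in> {a..b}" using assms(5)[OF p] by (simp add: x)
    moreover have "path_start p \<le> ereal (r + \<tau>)"
      using assms(4)[OF p] assms(10) by (auto intro: order_trans[of _ "ereal r"])
    moreover have "p \<in> paths K" using p assms(1-3) by blast
    ultimately show ?thesis
      using y x assms(4)[OF p] unfolding eta_points_def by (auto simp: touches_iff)
  qed
  then obtain y where y: "\<And>p. p \<in> {p1, p2, p3} \<Longrightarrow> y p \<in> eta_points r \<tau> a b K"
      "\<And>p. p \<in> {p1, p2, p3} \<Longrightarrow> pv p (r + \<tau>) = tanh (y p)" by metis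
  have "card {y p1, y p2, y p3} = 3"
    using assms(7-9) y(2)[of p1] y(2)[of p2] y(2)[of p3] by auto
  then have "enat 3 \<le> eta r \<tau> a b K"
    unfolding le_eta_iff using y(1) by (intro exI[of _ "{y p1, y p2, y p3}"]) auto
  then show ?thesis by (simp add: numeral_eq_enat)
qed

text \<open>At time \<open>r\<close> the paths \<open>q j\<close> are spaced by \<open>h\<close> up
  to errors \<open>h / 4\<close>, and \<open>p\<close> lies strictly between some \<open>q j\<close>
  and \<open>q (j + 2)\<close>. All three are in an interval of length \<open>5 / 2 * h\<close>. If
  they are distinct at \<open>r + \<tau>\<close>, \<open>eta\<close> is at least 3; if the outer two
  have merged, \<open>p\<close> is squeezed between them. So \<open>p\<close> agrees with one of
  them.\<close>

lemma grid_of_eta: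
  assumes K: "coalescing K" and \<tau>: "0 < \<tau>" and h: "0 < h" "3 * h \<le> u" "3 * h \<le> 1"
    and q: "\<And>j. j \<le> J \<Longrightarrow> q j \<in> paths K" "\<And>j. j \<le> J \<Longrightarrow> ps (q j) \<le> tanh r"
    and near: "\<And>j t. j \<le> J \<Longrightarrow> t \<in> {r - \<tau>..r} \<Longrightarrow>
      tanh (a + real j * h - h / 4) < pv (q j) t \<and> pv (q j) t < tanh (a + real j * h + h / 4)"
    and fin: "\<And>j v. j \<le> J \<Longrightarrow> v \<in> {r..r + \<tau>} \<Longrightarrow> \<bar>pv (q j) v\<bar> < 1"
    and eta: "\<And>j. j + 2 \<le> J \<Longrightarrow> \<not> 3 \<le> eta r \<tau> (a + real j * h - h / 4) (a + real j * h + 9 / 4 * h) K"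
    and cover: "a + h / 4 \<le> - B" "B \<le> a + real J * h - h - h / 4"
    and p: "p \<in> paths K" "path_start p \<le> ereal r" "\<bar>pv p r\<bar> \<le> tanh B" "\<bar>pv p (r + \<tau>)\<bar> < 1"
  shows "\<exists>j\<le>J. (\<forall>t\<in>{r - \<tau>..r}. \<bar>pv (q j) t - pv p r\<bar> \<le> u) \<and> \<bar>pv (q j) r\<bar> \<le> tanh (B + 1) \<and>
    pv (q j) (r + \<tau>) = pv p (r + \<tau>)"
proof -
  obtain x where x: "pv p r = tanh x"
    using pv_real[of p r] p(3) tanh_real_lt_1[of B] by auto
  have xB: "\<bar>x\<bar> \<le> B"
    using p(3) by (auto simp: x abs_le_iff tanh_real_le_iff simp flip: tanh_minus)
  have rr: "r \<in> {r - \<tau>..r}" "r \<in> {r..r + \<tau>}" "r + \<tau> \<in> {r..r + \<tau>}" using \<tau> by auto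
  define P where "P j \<longleftrightarrow> j \<le> J \<and> pv (q j) r < pv p r" for j
  have "pv (q 0) r < tanh (a + h / 4)" using near[of 0 r] rr by simp
  also have "\<dots> \<le> tanh x" using cover(1) xB by (simp add: abs_le_iff)
  finally have "P 0" by (simp add: P_def x)
  define j where "j = (GREATEST j. P j)"
  have j: "P j" "\<And>k. P k \<Longrightarrow> k \<le> j"
    unfolding j_def using GreatestI_nat[of P 0 J] Greatest_le_nat[of P _ J] \<open>P 0\<close> by (auto simp: P_def)
  \<comment> \<open>The slack in \<open>cover\<close> keeps the last two paths of the grid above
    \<open>p\<close>.\<close>
  have J2: "j + 2 \<le> J"
  proof (rule ccontr)
    assume "\<not> j + 2 \<le> J"
    then have "real J \<le> real j + 1" by linarith
    then have "real J * h \<le> (real j + 1) * h" using h(1) by (intro mult_right_mono) auto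
    then have "B \<le> a + real j * h - h / 4"
      using cover(2) by (simp add: algebra_simps)
    then have "tanh x \<le> tanh (a + real j * h - h / 4)" using xB by (simp add: abs_le_iff)
    also have "\<dots> < pv (q j) r" using near[of j r] j(1) rr by (simp add: P_def)
    finally show False using j(1) by (simp add: P_def x)
  qed
  \<comment> \<open>Maximality of \<open>j\<close> gives only a weak inequality, possibly an
    equality; the strict upper neighbour is therefore \<open>q (j + 2)\<close>.\<close>
  have "pv p r \<le> pv (q (j + 1)) r"
    using j(2)[of "j + 1"] J2 by (force simp: P_def)
  also have "\<dots> < tanh (a + real (j + 1) * h + h / 4)"
    using near[of "j + 1" r] J2 rr by simp
  also have "\<dots> \<le> tanh (a + real (j + 2) * h - h / 4)"
    using h(1) by (simp add: algebra_simps)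
  also have "\<dots> < pv (q (j + 2)) r"
    using near[of "j + 2" r] J2 rr by simp
  finally have up: "pv p r < pv (q (j + 2)) r" .
  have lo: "pv (q j) r < pv p r" using j(1) by (simp add: P_def)
  let ?a = "a + real j * h - h / 4" and ?b = "a + real j * h + 9 / 4 * h"
  have ab: "tanh ?a < pv (q k) t \<and> pv (q k) t < tanh ?b" if "k = j \<or> k = j + 2" "t \<in> {r - \<tau>..r}" for k t
  proof -
    have "tanh ?a \<le> tanh (a + real k * h - h / 4)" "tanh (a + real k * h + h / 4) \<le> tanh ?b"
      using that(1) h(1) by (auto simp: algebra_simps)
    moreover have "k \<le> J" using that(1) J2 by auto
    ultimately show ?thesis using near[OF _ that(2), of k] by linarith
  qed
  have pab: "tanh ?a \<le> pv p r" "pv p r \<le> tanh ?b"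
    using ab[of j r] ab[of "j + 2" r] lo up rr by auto
  have NC: "(\<forall>v\<in>{r..r + \<tau>}. pv (q k) v \<le> pv p v) \<or> (\<forall>v\<in>{r..r + \<tau>}. pv p v \<le> pv (q k) v)"
    if "k \<le> J" for k
    using q[OF that] fin[OF that] p by (intro noncrossing[OF K]) (auto simp: ps_le_iff)
  have "\<exists>k\<in>{j, j + 2}. pv (q k) (r + \<tau>) = pv p (r + \<tau>)"
  proof (rule ccontr)
    assume *: "\<not> ?thesis"
    show False
    proof (cases "pv (q j) (r + \<tau>) = pv (q (j + 2)) (r + \<tau>)")
      case True
      have "pv (q j) (r + \<tau>) \<le> pv p (r + \<tau>)"
        using NC[of j] lo J2 rr by (metis leD le_add1 order_trans)
      moreover have "pv p (r + \<tau>) \<le> pv (q (j + 2)) (r + \<tau>)"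
        using NC[of "j + 2"] up J2 rr by (metis leD)
      ultimately show False using True * by auto
    next
      case False
      have "3 \<le> eta r \<tau> ?a ?b K"
      proof (rule three_le_eta[of p K "q j" "q (j + 2)"])
        fix k assume k: "k \<in> {p, q j, q (j + 2)}"
        show "path_start k \<le> ereal r"
          using k p(2) q(2)[of j] q(2)[of "j + 2"] J2 by (auto simp: ps_le_iff)
        show "tanh ?a \<le> pv k r \<and> pv k r \<le> tanh ?b"
          using k pab ab[of j r] ab[of "j + 2" r] rr by auto
        show "\<bar>pv k (r + \<tau>)\<bar> < 1"
          using k p(4) fin[of j "r + \<tau>"] fin[of "j + 2" "r + \<tau>"] J2 rr by auto
      qed (use p(1) q(1) J2 False * \<tau> in auto)
      then show False using eta[OF J2] by blast
    qed
  qed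
  then obtain k where k: "k = j \<or> k = j + 2" "pv (q k) (r + \<tau>) = pv p (r + \<tau>)" by blast
  have "k \<le> J" using k(1) J2 by auto
  moreover have "\<bar>pv (q k) t - pv p r\<bar> \<le> u" if "t \<in> {r - \<tau>..r}" for t
    using ab[OF k(1) that] pab abs_tanh_diff_le[of ?b ?a] h(1,2) by (auto simp: abs_le_iff)
  moreover have "\<bar>pv (q k) r\<bar> \<le> tanh (B + 1)"
  proof -
    have "\<bar>pv (q k) r\<bar> < 1" using fin[OF \<open>k \<le> J\<close> rr(2)] .
    then obtain y where y: "pv (q k) r = tanh y" using pv_real by blast
    have "?a < y" "y < ?b" "?a \<le> x" "x \<le> ?b"
      using ab[OF k(1) rr(1)] pab by (simp_all add: y x)
    then have "\<bar>y\<bar> \<le> B + 1" using xB h(3) by (auto simp: abs_le_iff)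
    then show ?thesis
      unfolding y abs_le_iff tanh_minus[symmetric] tanh_real_le_iff by simp
  qed
  ultimately show ?thesis using k(2) by blast
qed

section \<open>Skeletons of the approximating families\<close>

text \<open>The exceptional set is measurable while \<open>P\<close> is arbitrary. Statements about
  all paths of a random family can thus be handled without showing that they are events.\<close>

definition whp :: "'w measure \<Rightarrow> real \<Rightarrow> ('w \<Rightarrow> bool) \<Rightarrow> bool" where
  "whp M \<gamma> P \<longleftrightarrow> (\<exists>A\<in>sets M. measure M A \<le> \<gamma> \<and> (\<forall>\<omega>\<in>space M - A. P \<omega>))"

lemma whpI:
  assumes "{\<omega> \<in> space M. \<not> P \<omega>} \<in> sets M" "measure M {\<omega> \<in> space M. \<not> P \<omega>} \<le> \<gamma>"
  shows "whp M \<gamma> P"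
  unfolding whp_def using assms by (intro bexI[of _ "{\<omega> \<in> space M. \<not> P \<omega>}"]) auto

lemma whp_mono:
  assumes "whp M \<gamma> P" "\<gamma> \<le> \<gamma>'" "\<And>\<omega>. \<omega> \<in> space M \<Longrightarrow> P \<omega> \<Longrightarrow> Q \<omega>"
  shows "whp M \<gamma>' Q"
  using assms unfolding whp_def by (meson DiffD1 order_trans)

lemma whp_conj:
  assumes "whp M \<gamma> P" "whp M \<gamma>' Q"
  shows "whp M (\<gamma> + \<gamma>') (\<lambda>\<omega>. P \<omega> \<and> Q \<omega>)"
proof -
  obtain A B where A: "A \<in> sets M" "measure M A \<le> \<gamma>" "\<forall>\<omega>\<in>space M - A. P \<omega>"
    and B: "B \<in> sets M" "measure M B \<le> \<gamma>'" "\<forall>\<omega>\<in>space M - B. Q \<omega>"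
    using assms unfolding whp_def by blast
  have "measure M (A \<union> B) \<le> \<gamma> + \<gamma>'"
    using measure_Un_le[OF A(1) B(1)] A(2) B(2) by linarith
  then show ?thesis
    unfolding whp_def using A(1,3) B(1,3) by (intro bexI[of _ "A \<union> B"]) auto
qed

lemma whp_ball:
  assumes "finite I" "\<And>i. i \<in> I \<Longrightarrow> whp M (\<gamma> i) (P i)" "(\<Sum>i\<in>I. \<gamma> i) \<le> g"
  shows "whp M g (\<lambda>\<omega>. \<forall>i\<in>I. P i \<omega>)"
proof -
  obtain A where A: "\<And>i. i \<in> I \<Longrightarrow> A i \<in> sets M" "\<And>i. i \<in> I \<Longrightarrow> measure M (A i) \<le> \<gamma> i"
      "\<And>i. i \<in> I \<Longrightarrow> \<forall>\<omega>\<in>space M - A i. P i \<omega>"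
    using assms(2) unfolding whp_def by metis
  have "measure M (\<Union>i\<in>I. A i) \<le> (\<Sum>i\<in>I. measure M (A i))"
    using assms(1) A(1) by (rule measure_UNION_le)
  also have "\<dots> \<le> (\<Sum>i\<in>I. \<gamma> i)"
    using A(2) by (rule sum_mono)
  finally have "measure M (\<Union>i\<in>I. A i) \<le> g" using assms(3) by simp
  then show ?thesis
    unfolding whp_def using A(1,3) assms(1) by (intro bexI[of _ "\<Union>i\<in>I. A i"]) auto
qed

lemma whp_AE:
  assumes "AE \<omega> in M. P \<omega>"
  shows "whp M 0 P"
proof -
  obtain A where "{\<omega> \<in> space M. \<not> P \<omega>} \<subseteq> A" "A \<in> sets M" "emeasure M A = 0"
    using assms by (rule AE_E)
  then show ?thesis
    unfolding whp_def by (intro bexI[of _ A]) (auto simp: measure_def)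
qed

lemma continuous_on_coordinate: "continuous_on A (\<lambda>f. f i)"
  by (rule continuous_on_product_then_coordinatewise[OF continuous_on_id])

text \<open>The portmanteau bound for open sets: the continuous functions \<open>g k\<close>
  increase to the indicator of \<open>U\<close>, one of them already has integral above
  \<open>1 - \<gamma>\<close>, and weak convergence carries this over to the approximating
  laws.\<close>

lemma eventually_whp_open:
  fixes Y :: "'i \<Rightarrow> 'w \<Rightarrow> nat \<Rightarrow> web_path"
  assumes conv: "weakly_converges (\<lambda>\<delta>. distr (M \<delta>) (\<Pi>\<^sub>M i\<in>{..<m}. borel) (Y \<delta>)) \<nu> F"
    and M: "\<forall>\<^sub>F \<delta> in F. prob_space (M \<delta>) \<and> Y \<delta> \<in> M \<delta> \<rightarrow>\<^sub>M (\<Pi>\<^sub>M i\<in>{..<m}. borel)"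
    and \<nu>: "prob_space \<nu>" "sets \<nu> = sets (\<Pi>\<^sub>M i\<in>{..<m}. borel)"
    and i: "i < m" and U: "open U" and small: "measure \<nu> {f \<in> space \<nu>. f i \<notin> U} < \<gamma>"
  shows "\<forall>\<^sub>F \<delta> in F. whp (M \<delta>) \<gamma> (\<lambda>\<omega>. Y \<delta> \<omega> i \<in> U)"
proof (cases "U = UNIV")
  \<comment> \<open>The distance to the empty complement is 0 by convention, so the functions
    \<open>g k\<close> below would vanish.\<close>
  case True
  have "0 \<le> \<gamma>"
    using small measure_nonneg[of \<nu> "{f \<in> space \<nu>. f i \<notin> U}"] by linarith
  then have "whp N \<gamma> (\<lambda>\<omega>. True)" for N :: "'w measure"
    by (intro whpI) auto
  then show ?thesis using True by simp
next
  case False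
  then have neU: "- U \<noteq> {}" by auto
  define g where "g k f = min 1 (real k * infdist (f i) (- U))" for k and f :: "nat \<Rightarrow> web_path"
  have g_cont: "continuous_on UNIV (g k)" for k
    unfolding g_def by (intro continuous_intros continuous_on_coordinate)
  have g01: "0 \<le> g k f" "g k f \<le> 1" for k f
    by (auto simp: g_def infdist_nonneg)
  have comp: "(\<lambda>f. f i) \<in> (\<Pi>\<^sub>M i\<in>{..<m}. borel) \<rightarrow>\<^sub>M (borel :: web_path measure)"
    using i by (intro measurable_component_singleton) auto
  have g_meas: "g k \<in> borel_measurable (\<Pi>\<^sub>M i\<in>{..<m}. borel)" for k
  proof -
    have "(\<lambda>p. min 1 (real k * infdist p (- U))) \<in> borel_measurable borel"
      by (intro borel_measurable_continuous_onI continuous_intros)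
    from measurable_compose[OF comp this] show ?thesis by (simp add: g_def[abs_def])
  qed
  interpret \<nu>: prob_space \<nu> by fact
  have g_meas\<nu>: "g k \<in> borel_measurable \<nu>" for k
    using g_meas measurable_cong_sets[OF \<nu>(2) refl] by blast
  let ?A = "{f \<in> space \<nu>. f i \<in> U}"
  have A: "?A \<in> sets \<nu>"
    using measurable_sets[OF comp, of U] U \<nu>(2) sets_eq_imp_space_eq[OF \<nu>(2)]
    by (simp add: vimage_def Int_def conj_commute)
  have lim: "(\<lambda>k. g k f) \<longlonglongrightarrow> indicator ?A f" if "f \<in> space \<nu>" for f
  proof (cases "f i \<in> U")
    case True
    then have pos: "0 < infdist (f i) (- U)"
      using in_closed_iff_infdist_zero[of "- U" "f i"] U neU infdist_nonneg[of "f i" "- U"]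
      by (auto simp: closed_def)
    have "\<forall>\<^sub>F k in sequentially. g k f = 1"
    proof -
      obtain K :: nat where "1 / infdist (f i) (- U) < K"
        using reals_Archimedean2 by blast
      then have K: "1 < real K * infdist (f i) (- U)" using pos by (simp add: field_simps)
      show ?thesis
        unfolding eventually_sequentially
      proof (intro exI[of _ K] allI impI)
        fix k assume "K \<le> k"
        then have "real K * infdist (f i) (- U) \<le> real k * infdist (f i) (- U)"
          using pos by (intro mult_right_mono) auto
        then show "g k f = 1" using K by (simp add: g_def)
      qed
    qed
    then show ?thesis using True that by (simp add: tendsto_eventually)
  next
    case False
    then have "g k f = 0" for k by (simp add: g_def)
    then show ?thesis using False by simp
  qed
  have "(\<lambda>k. \<integral>f. g k f \<partial>\<nu>) \<longlonglongrightarrow> (\<integral>f. indicator ?A f \<partial>\<nu>)"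
    by (rule integral_dominated_convergence[where w = "\<lambda>_. 1"])
       (use g_meas\<nu> A lim g01 in auto)
  moreover have "(\<integral>f. indicator ?A f \<partial>\<nu>) = 1 - measure \<nu> {f \<in> space \<nu>. f i \<notin> U}"
  proof -
    have "{f \<in> space \<nu>. f i \<notin> U} = space \<nu> - ?A" by auto
    then show ?thesis using A by (simp add: \<nu>.prob_compl)
  qed
  ultimately have "\<forall>\<^sub>F k in sequentially. 1 - \<gamma> < (\<integral>f. g k f \<partial>\<nu>)"
    using small by (intro order_tendstoD) auto
  then obtain k where k: "1 - \<gamma> < (\<integral>f. g k f \<partial>\<nu>)"
    using eventually_happens by fastforce
  have "bounded (range (g k))"
    unfolding bounded_iff using g01 by (intro exI[of _ 1]) auto
  then have "((\<lambda>\<delta>. \<integral>f. g k f \<partial>distr (M \<delta>) (\<Pi>\<^sub>M i\<in>{..<m}. borel) (Y \<delta>)) \<longlongrightarrow> (\<integral>f. g k f \<partial>\<nu>)) F"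
    using conv g_cont unfolding weakly_converges_def by blast
  from order_tendstoD(1)[OF this k] M show ?thesis
  proof eventually_elim
    case (elim \<delta>)
    then interpret prob_space "M \<delta>" by simp
    have Y: "Y \<delta> \<in> M \<delta> \<rightarrow>\<^sub>M (\<Pi>\<^sub>M i\<in>{..<m}. borel)" using elim by simp
    have Yi: "(\<lambda>\<omega>. Y \<delta> \<omega> i) \<in> M \<delta> \<rightarrow>\<^sub>M borel" by (rule measurable_compose[OF Y comp])
    have G: "{\<omega> \<in> space (M \<delta>). Y \<delta> \<omega> i \<in> U} \<in> sets (M \<delta>)"
      using measurable_sets[OF Yi, of U] U by (simp add: vimage_def Int_def conj_commute)
    have "1 - \<gamma> < (\<integral>f. g k f \<partial>distr (M \<delta>) (\<Pi>\<^sub>M i\<in>{..<m}. borel) (Y \<delta>))" using elim by simp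
    also have "\<dots> = (\<integral>\<omega>. g k (Y \<delta> \<omega>) \<partial>M \<delta>)"
      by (rule integral_distr[OF Y g_meas])
    also have "\<dots> \<le> (\<integral>\<omega>. indicator {\<omega> \<in> space (M \<delta>). Y \<delta> \<omega> i \<in> U} \<omega> \<partial>M \<delta>)"
    proof (rule integral_mono)
      show "integrable (M \<delta>) (\<lambda>\<omega>. g k (Y \<delta> \<omega>))"
        using g01 measurable_compose[OF Y g_meas]
        by (intro integrable_const_bound[of _ 1]) auto
      show "integrable (M \<delta>) (indicat_real {\<omega> \<in> space (M \<delta>). Y \<delta> \<omega> i \<in> U})"
        using G by (intro integrable_real_indicator) (simp_all add: less_top[symmetric])
      fix \<omega> assume "\<omega> \<in> space (M \<delta>)"
      then show "g k (Y \<delta> \<omega>) \<le> indicator {\<omega> \<in> space (M \<delta>). Y \<delta> \<omega> i \<in> U} \<omega>"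
        using g01(2)[of k "Y \<delta> \<omega>"] by (auto simp: indicator_def g_def)
    qed
    also have "\<dots> = prob {\<omega> \<in> space (M \<delta>). Y \<delta> \<omega> i \<in> U}"
      using G by simp
    finally have "prob (space (M \<delta>) - {\<omega> \<in> space (M \<delta>). Y \<delta> \<omega> i \<in> U}) \<le> \<gamma>"
      using G by (simp add: prob_compl)
    moreover have "space (M \<delta>) - {\<omega> \<in> space (M \<delta>). Y \<delta> \<omega> i \<in> U} = {\<omega> \<in> space (M \<delta>). Y \<delta> \<omega> i \<notin> U}"
      by auto
    ultimately show ?case
      using G sets.compl_sets[OF G] by (intro whpI) auto
  qed
qed

lemma card_int_bounded:
  assumes "0 \<le> c"
  shows "finite {i :: int. \<bar>real_of_int i\<bar> \<le> c}" "real (card {i :: int. \<bar>real_of_int i\<bar> \<le> c}) \<le> 2 * c + 1"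
proof -
  have eq: "{i :: int. \<bar>real_of_int i\<bar> \<le> c} = {-\<lfloor>c\<rfloor>..\<lfloor>c\<rfloor>}"
  proof (intro set_eqI)
    fix i :: int
    have "- \<lfloor>c\<rfloor> \<le> i \<longleftrightarrow> - i \<le> \<lfloor>c\<rfloor>" by linarith
    also have "\<dots> \<longleftrightarrow> - real_of_int i \<le> c" by (simp add: le_floor_iff)
    finally show "i \<in> {i. \<bar>real_of_int i\<bar> \<le> c} \<longleftrightarrow> i \<in> {-\<lfloor>c\<rfloor>..\<lfloor>c\<rfloor>}"
      by (auto simp: le_floor_iff abs_le_iff)
  qed
  show "finite {i :: int. \<bar>real_of_int i\<bar> \<le> c}" by (simp add: eq)
  have "0 \<le> \<lfloor>c\<rfloor>" using assms by simp
  then show "real (card {i :: int. \<bar>real_of_int i\<bar> \<le> c}) \<le> 2 * c + 1"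
    unfolding eq by (simp add: of_nat_nat)
qed

lemma dense_pick:
  assumes "closure D = (UNIV :: (real \<times> real) set)" "a < b" "c < d"
  obtains x t where "(x, t) \<in> D" "a < x" "x < b" "c < t" "t < d"
proof -
  have "open ({a<..<b} \<times> {c<..<d})" by (intro open_Times) auto
  moreover have "((a + b) / 2, (c + d) / 2) \<in> {a<..<b} \<times> {c<..<d}" using assms by auto
  ultimately obtain y where "y \<in> D" "y \<in> {a<..<b} \<times> {c<..<d}"
    using assms(1) open_Int_closure_eq_empty[of "{a<..<b} \<times> {c<..<d}" D] by blast
  then show ?thesis by (cases y) (auto intro: that)
qed

lemma eventually_unit: "\<forall>\<^sub>F \<delta> in at_right 0. \<delta> \<in> {0<..1::real}"
  unfolding eventually_at_right_field by (intro exI[of _ 1]) auto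

section \<open>Consequences of the hypotheses for small \<delta>\<close>

context
  fixes M :: "real \<Rightarrow> 'w measure"
    and X :: "real \<Rightarrow> 'w \<Rightarrow> path_family"
    and \<mu> :: "real \<Rightarrow> path_family measure"
    and D :: "(real \<times> real) set"
    and \<theta> :: "real \<Rightarrow> real \<times> real \<Rightarrow> 'w \<Rightarrow> web_path"
  assumes prob: "\<And>\<delta>. \<delta> \<in> {0<..1} \<Longrightarrow> prob_space (M \<delta>)"
    and X: "\<And>\<delta>. \<delta> \<in> {0<..1} \<Longrightarrow> X \<delta> \<in> M \<delta> \<rightarrow>\<^sub>M borel"
    and \<mu>: "\<And>\<delta>. \<delta> \<in> {0<..1} \<Longrightarrow> \<mu> \<delta> = distr (M \<delta>) borel (X \<delta>)"
    and coal: "\<And>\<delta>. \<delta> \<in> {0<..1} \<Longrightarrow> AE \<omega> in M \<delta>. coalescing (X \<delta> \<omega>)"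
    and D: "closure D = UNIV"
    and T1: "\<And>u. 0 < u \<Longrightarrow>
      ((\<lambda>t. ennreal (t powr (-3/2)) *
            (SUP \<delta>\<in>{0<..1}. SUP x0. SUP t0. emeasure (\<mu> \<delta>) (crossing_event t u x0 t0)))
        \<longlongrightarrow> 0) (at_right 0)"
    and B2: "\<And>t0 t. 0 < t \<Longrightarrow>
      ((\<lambda>\<epsilon>. ennreal (1 / \<epsilon>) *
            Limsup (at_right 0) (\<lambda>\<delta>. SUP a. emeasure (\<mu> \<delta>) {K. 3 \<le> eta t0 t a (a + \<epsilon>) K}))
        \<longlongrightarrow> 0) (at_right 0)"
    and \<theta>: "\<And>\<delta> y. \<delta> \<in> {0<..1} \<Longrightarrow> y \<in> D \<Longrightarrow> \<theta> \<delta> y \<in> M \<delta> \<rightarrow>\<^sub>M borel"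
    and \<theta>_paths: "\<And>\<delta> y \<omega>. \<delta> \<in> {0<..1} \<Longrightarrow> y \<in> D \<Longrightarrow> \<omega> \<in> space (M \<delta>) \<Longrightarrow>
      \<theta> \<delta> y \<omega> \<in> paths (X \<delta> \<omega>)"
    and I1: "\<And>m (y :: nat \<Rightarrow> real \<times> real). (\<And>i. i < m \<Longrightarrow> y i \<in> D) \<Longrightarrow>
      \<exists>\<nu>. coalescing_BM_law m y \<nu> \<and>
        weakly_converges
          (\<lambda>\<delta>. distr (M \<delta>) (\<Pi>\<^sub>M i\<in>{..<m}. borel) (\<lambda>\<omega>. \<lambda>i\<in>{..<m}. \<theta> \<delta> (y i) \<omega>))
          \<nu> (at_right 0)"
begin

lemma measure_X_le:
  assumes "\<delta> \<in> {0<..1}" "S \<in> sets borel" "emeasure (\<mu> \<delta>) S \<le> ennreal c" "0 \<le> c"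
  shows "whp (M \<delta>) c (\<lambda>\<omega>. X \<delta> \<omega> \<notin> S)"
proof (rule whpI)
  interpret prob_space "M \<delta>" by (rule prob[OF assms(1)])
  have eq: "{\<omega> \<in> space (M \<delta>). \<not> X \<delta> \<omega> \<notin> S} = X \<delta> -` S \<inter> space (M \<delta>)" by auto
  show "{\<omega> \<in> space (M \<delta>). \<not> X \<delta> \<omega> \<notin> S} \<in> sets (M \<delta>)"
    unfolding eq by (rule measurable_sets[OF X[OF assms(1)] assms(2)])
  have "emeasure (\<mu> \<delta>) S = ennreal (prob (X \<delta> -` S \<inter> space (M \<delta>)))"
    unfolding \<mu>[OF assms(1)] emeasure_distr[OF X[OF assms(1)] assms(2)] by (rule emeasure_eq_measure)
  then show "prob {\<omega> \<in> space (M \<delta>). \<not> X \<delta> \<omega> \<notin> S} \<le> c"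
    unfolding eq using assms(3,4) by simp
qed

text \<open>A union bound over the lattice rectangles that meet a bounded window: there are at most
  \<open>C * \<tau> powr (-3/2)\<close> of them, and (T1) makes each crossing probability small
  compared with \<open>\<tau> powr (3/2)\<close>, uniformly in \<delta>.\<close>

lemma no_crossing_whp:
  assumes u: "0 < u" and \<gamma>: "0 < \<gamma>" and BV: "0 \<le> B" "0 \<le> V"
  shows "\<forall>\<^sub>F \<tau> in at_right 0. sqrt \<tau> < u \<and> (\<forall>\<delta>\<in>{0<..1}. whp (M \<delta>) \<gamma> (\<lambda>\<omega>. \<forall>i j :: int.
    \<bar>of_int i\<bar> \<le> B / sqrt \<tau> + 1 \<longrightarrow> \<bar>of_int j\<bar> \<le> V / \<tau> + 1 \<longrightarrow>
    X \<delta> \<omega> \<notin> crossing_event \<tau> u (of_int i * sqrt \<tau>) (of_int j * \<tau>)))"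
proof -
  \<comment> \<open>For \<open>\<tau> < 1\<close> the range of \<open>i\<close> has at most \<open>2
    * (B / sqrt \<tau> + 1) + 1 \<le> (2 * B + 3) / sqrt \<tau>\<close> elements; likewise for
    \<open>j\<close> with \<open>V\<close> and \<tau>.\<close>
  define C where "C = (2 * B + 3) * (2 * V + 3)"
  have C: "0 < C" using BV by (simp add: C_def)
  let ?S = "\<lambda>\<tau>. SUP \<delta>\<in>{0<..1}. SUP x0. SUP t0. emeasure (\<mu> \<delta>) (crossing_event \<tau> u x0 t0)"
  have "\<forall>\<^sub>F \<tau> in at_right 0. ennreal (\<tau> powr (-3/2)) * ?S \<tau> < ennreal (\<gamma> / C)"
    using \<gamma> C by (intro order_tendstoD(2)[OF T1[OF u]]) auto
  moreover have "\<forall>\<^sub>F \<tau> in at_right 0. 0 < \<tau> \<and> \<tau> < min 1 (u\<^sup>2)"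
    unfolding eventually_at_right_field using u by (intro exI[of _ "min 1 (u\<^sup>2)"]) auto
  ultimately show ?thesis
  proof eventually_elim
    case (elim \<tau>)
    have \<tau>: "0 < \<tau>" "\<tau> < 1" "sqrt \<tau> < u"
      using elim u by (auto intro: real_less_lsqrt)
    define c where "c = \<tau> powr (-3/2)"
    have c: "c = 1 / (sqrt \<tau> * \<tau>)"
    proof -
      have "\<tau> powr (1/2) * \<tau> powr 1 = \<tau> powr (3/2)" unfolding powr_add[symmetric] by simp
      then show ?thesis
        using \<tau>(1) by (simp add: c_def powr_minus_divide powr_half_sqrt minus_divide_left[symmetric])
    qed
    have c0: "0 < c" using \<tau> by (simp add: c)
    define I where "I = {i :: int. \<bar>real_of_int i\<bar> \<le> B / sqrt \<tau> + 1}"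
    define J where "J = {j :: int. \<bar>real_of_int j\<bar> \<le> V / \<tau> + 1}"
    have s1: "1 \<le> 1 / sqrt \<tau>" "1 \<le> 1 / \<tau>" using \<tau> by (simp_all add: less_imp_le)
    have "real (card I) \<le> 2 * (B / sqrt \<tau> + 1) + 1"
      unfolding I_def using BV \<tau> by (intro card_int_bounded) simp
    also have "\<dots> = 2 * (B / sqrt \<tau>) + 3 * 1" by simp
    also have "\<dots> \<le> 2 * (B / sqrt \<tau>) + 3 * (1 / sqrt \<tau>)"
      using s1 by (intro add_left_mono mult_left_mono) auto
    also have "\<dots> = (2 * B + 3) * (1 / sqrt \<tau>)" by (simp add: add_divide_distrib)
    finally have cI: "real (card I) \<le> (2 * B + 3) * (1 / sqrt \<tau>)" .
    have "real (card J) \<le> 2 * (V / \<tau> + 1) + 1"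
      unfolding J_def using BV \<tau> by (intro card_int_bounded) simp
    also have "\<dots> = 2 * (V / \<tau>) + 3 * 1" by simp
    also have "\<dots> \<le> 2 * (V / \<tau>) + 3 * (1 / \<tau>)"
      using s1 by (intro add_left_mono mult_left_mono) auto
    also have "\<dots> = (2 * V + 3) * (1 / \<tau>)" by (simp add: add_divide_distrib)
    finally have cJ: "real (card J) \<le> (2 * V + 3) * (1 / \<tau>)" .
    have "real (card (I \<times> J)) \<le> ((2 * B + 3) * (1 / sqrt \<tau>)) * ((2 * V + 3) * (1 / \<tau>))"
      unfolding card_cartesian_product of_nat_mult using cI cJ BV \<tau> by (intro mult_mono) auto
    also have "\<dots> = C * c" by (simp add: C_def c)
    finally have card: "real (card (I \<times> J)) \<le> C * c" .
    have fin: "finite (I \<times> J)"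
      unfolding I_def J_def using BV \<tau> by (intro finite_cartesian_product card_int_bounded) auto
    have "whp (M \<delta>) \<gamma> (\<lambda>\<omega>. \<forall>ij\<in>I \<times> J. X \<delta> \<omega> \<notin>
        crossing_event \<tau> u (of_int (fst ij) * sqrt \<tau>) (of_int (snd ij) * \<tau>))" if \<delta>: "\<delta> \<in> {0<..1}" for \<delta>
    proof (rule whp_ball[OF fin, where \<gamma> = "\<lambda>_. \<gamma> / C / c"])
      fix ij
      let ?E = "crossing_event \<tau> u (of_int (fst ij) * sqrt \<tau>) (of_int (snd ij) * \<tau>)"
      have "emeasure (\<mu> \<delta>) ?E
          \<le> (SUP t0. emeasure (\<mu> \<delta>) (crossing_event \<tau> u (of_int (fst ij) * sqrt \<tau>) t0))"
        by (rule SUP_upper) simp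
      also have "\<dots> \<le> (SUP x0. SUP t0. emeasure (\<mu> \<delta>) (crossing_event \<tau> u x0 t0))"
        by (rule SUP_upper) simp
      also have "\<dots> \<le> ?S \<tau>"
        by (rule SUP_upper[OF \<delta>])
      finally have "emeasure (\<mu> \<delta>) ?E \<le> ?S \<tau>" .
      then have "ennreal c * emeasure (\<mu> \<delta>) ?E < ennreal (\<gamma> / C)"
        using elim(1) unfolding c_def by (meson le_less_trans mult_left_mono zero_le)
      moreover have "emeasure (\<mu> \<delta>) ?E = ennreal (measure (\<mu> \<delta>) ?E)"
        unfolding \<mu>[OF \<delta>] using prob_space.prob_space_distr[OF prob[OF \<delta>] X[OF \<delta>]]
        by (metis finite_measure.emeasure_eq_measure prob_space.finite_measure)
      ultimately have "c * measure (\<mu> \<delta>) ?E < \<gamma> / C"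
        using c0 \<gamma> C by (simp add: ennreal_less_iff flip: ennreal_mult)
      then have "measure (\<mu> \<delta>) ?E \<le> \<gamma> / C / c"
        unfolding pos_le_divide_eq[OF c0] by (subst mult.commute) (rule less_imp_le)
      then have "emeasure (\<mu> \<delta>) ?E \<le> ennreal (\<gamma> / C / c)"
        using \<open>emeasure (\<mu> \<delta>) ?E = ennreal (measure (\<mu> \<delta>) ?E)\<close> by (simp add: ennreal_leI)
      then show "whp (M \<delta>) (\<gamma> / C / c) (\<lambda>\<omega>. X \<delta> \<omega> \<notin> ?E)"
        using \<gamma> C c0 by (intro measure_X_le[OF \<delta>] crossing_event_sets \<tau>) auto
    next
      have "real (card (I \<times> J)) * (\<gamma> / C / c) \<le> C * c * (\<gamma> / C / c)"
        using card \<gamma> C c0 by (intro mult_right_mono) auto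
      then show "(\<Sum>ij\<in>I \<times> J. \<gamma> / C / c) \<le> \<gamma>"
        using C c0 by simp
    qed
    then have "whp (M \<delta>) \<gamma> (\<lambda>\<omega>. \<forall>i j :: int.
        \<bar>of_int i\<bar> \<le> B / sqrt \<tau> + 1 \<longrightarrow> \<bar>of_int j\<bar> \<le> V / \<tau> + 1 \<longrightarrow>
        X \<delta> \<omega> \<notin> crossing_event \<tau> u (of_int i * sqrt \<tau>) (of_int j * \<tau>))" if "\<delta> \<in> {0<..1}" for \<delta>
      by (rule whp_mono[OF _ order_refl]) (use that in \<open>auto simp: I_def J_def\<close>)
    then show ?case using \<tau> by blast
  qed
qed

text \<open>The limit superior in (B2) fixes the order: first \<open>h\<close> is small, then
  \<delta> is small depending on \<open>h\<close>. Owing to the supremum the threshold for \<delta>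
  is the same for all \<open>a\<close>.\<close>

lemma eta_whp:
  assumes \<tau>: "0 < \<tau>" and \<kappa>: "0 < \<kappa>"
  shows "\<forall>\<^sub>F h in at_right 0. \<forall>\<^sub>F \<delta> in at_right 0. \<forall>a.
    whp (M \<delta>) (\<kappa> * h) (\<lambda>\<omega>. \<not> 3 \<le> eta r \<tau> a (a + h) (X \<delta> \<omega>))"
proof -
  let ?S = "\<lambda>h \<delta>. SUP a. emeasure (\<mu> \<delta>) {K. 3 \<le> eta r \<tau> a (a + h) K}"
  have "\<forall>\<^sub>F h in at_right 0. ennreal (1 / h) * Limsup (at_right 0) (?S h) < ennreal \<kappa>"
    using \<kappa> by (intro order_tendstoD(2)[OF B2[OF \<tau>]]) auto
  moreover have "\<forall>\<^sub>F h in at_right 0. 0 < (h :: real)"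
    by (rule eventually_at_right_less)
  ultimately show ?thesis
  proof eventually_elim
    case (elim h)
    have "Limsup (at_right 0) (?S h) = ennreal h * (ennreal (1 / h) * Limsup (at_right 0) (?S h))"
      using elim(2) by (simp add: mult.assoc[symmetric] ennreal_mult[symmetric])
    also have "\<dots> < ennreal h * ennreal \<kappa>"
      using elim by (intro ennreal_mult_strict_left_mono) auto
    also have "\<dots> = ennreal (\<kappa> * h)"
      using elim \<kappa> by (simp add: ennreal_mult mult.commute)
    finally have "\<forall>\<^sub>F \<delta> in at_right 0. ?S h \<delta> < ennreal (\<kappa> * h)"
      by (rule Limsup_lessD)
    then show ?case
      using eventually_unit
    proof eventually_elim
      case \<delta>: (elim \<delta>)
      show ?case
      proof
        fix a
        have "emeasure (\<mu> \<delta>) {K. 3 \<le> eta r \<tau> a (a + h) K} \<le> ennreal (\<kappa> * h)"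
          using \<delta>(1) by (intro order_trans[OF SUP_upper[of a UNIV] less_imp_le]) auto
        moreover have "{K. 3 \<le> eta r \<tau> a (a + h) K} \<in> sets borel"
          using eta_sets[of \<tau> 3 r a "a + h"] \<tau> by (simp add: numeral_eq_enat)
        ultimately show "whp (M \<delta>) (\<kappa> * h) (\<lambda>\<omega>. \<not> 3 \<le> eta r \<tau> a (a + h) (X \<delta> \<omega>))"
          using measure_X_le[OF \<delta>(2), of "{K. 3 \<le> eta r \<tau> a (a + h) K}"] \<kappa> elim(2) by simp
      qed
    qed
  qed
qed

lemma tube_whp:
  assumes y: "(x, t0) \<in> D" and "l < t0" "t0 < r" and c: "0 < c" "a < tanh (x - c)" "tanh (x + c) < b"
    and H: "R2 \<le> t0 + H" "0 < H" and \<gamma>: "2 * H / c\<^sup>2 < \<gamma>"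
  shows "\<forall>\<^sub>F \<delta> in at_right 0. whp (M \<delta>) \<gamma> (\<lambda>\<omega>. \<theta> \<delta> (x, t0) \<omega> \<in> tube l r R1 R2 a b)"
proof -
  obtain \<nu> where \<nu>: "coalescing_BM_law 1 (\<lambda>_. (x, t0)) \<nu>"
      "weakly_converges (\<lambda>\<delta>. distr (M \<delta>) (\<Pi>\<^sub>M i\<in>{..<1}. borel) (\<lambda>\<omega>. \<lambda>i\<in>{..<1}. \<theta> \<delta> (x, t0) \<omega>))
        \<nu> (at_right 0)"
    using I1[of 1 "\<lambda>_. (x, t0)"] y by auto
  have "measure \<nu> {f \<in> space \<nu>. f 0 \<notin> tube l r R1 R2 a b} < \<gamma>"
    using coalescing_BM_law_tube[OF \<nu>(1) refl assms(2,3) c H, of R1] \<gamma> by linarith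
  have "\<forall>\<^sub>F \<delta> in at_right 0. prob_space (M \<delta>) \<and>
      (\<lambda>\<omega>. \<lambda>i\<in>{..<1 :: nat}. \<theta> \<delta> (x, t0) \<omega>) \<in> M \<delta> \<rightarrow>\<^sub>M (\<Pi>\<^sub>M i\<in>{..<1}. borel)"
    using eventually_unit
    by (rule eventually_mono) (intro conjI prob measurable_restrict \<theta> y)
  from eventually_whp_open[OF \<nu>(2) this prob_space_coalescing_BM_law[OF \<nu>(1)] zero_less_one open_tube
      \<open>measure \<nu> _ < \<gamma>\<close>]
  show ?thesis by simp
qed

text \<open>The time window ends at or before \<open>r\<close>, and the start may be taken as close
  to \<open>r\<close> as desired. So the path has no time to leave even a narrow tube.\<close>

lemma ex_tube_small:
  assumes "l < r" "R2 \<le> r" "a < tanh \<xi>" "tanh \<xi> < b" "0 < \<gamma>"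
  shows "\<exists>y\<in>D. \<forall>\<^sub>F \<delta> in at_right 0. whp (M \<delta>) \<gamma> (\<lambda>\<omega>. \<theta> \<delta> y \<omega> \<in> tube l r R1 R2 a b)"
proof -
  define c where "c = min (tanh \<xi> - a) (b - tanh \<xi>) / 4"
  have c: "0 < c" "a < tanh \<xi> - 2 * c" "tanh \<xi> + 2 * c < b"
    using assms by (auto simp: c_def min_def field_simps)
  \<comment> \<open>The resulting error \<open>2 * H / c\<^sup>2\<close> is
    \<open>\<gamma> / 2\<close>.\<close>
  define H where "H = \<gamma> * c\<^sup>2 / 4"
  have H: "0 < H" "2 * H / c\<^sup>2 < \<gamma>" using assms(5) c(1) by (auto simp: H_def)
  obtain x t0 where y: "(x, t0) \<in> D" "\<xi> - c < x" "x < \<xi> + c" "max l (r - H) < t0" "t0 < r"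
    by (rule dense_pick[OF D, of "\<xi> - c" "\<xi> + c" "max l (r - H)" r]) (use c(1) assms(1) H(1) in auto)
  have "tanh \<xi> - 2 * c \<le> tanh (\<xi> - 2 * c)" "tanh (\<xi> + 2 * c) \<le> tanh \<xi> + 2 * c"
    using abs_tanh_diff_le[of \<xi> "\<xi> - 2 * c"] abs_tanh_diff_le[of "\<xi> + 2 * c" \<xi>] c(1) by auto
  moreover have "tanh (\<xi> - 2 * c) < tanh (x - c)" "tanh (x + c) < tanh (\<xi> + 2 * c)"
    unfolding tanh_real_less_iff using y(2,3) by linarith+
  ultimately have "a < tanh (x - c)" "tanh (x + c) < b" using c by linarith+
  moreover have "l < t0" "R2 \<le> t0 + H" using y assms(2) by auto
  ultimately have "\<forall>\<^sub>F \<delta> in at_right 0. whp (M \<delta>) \<gamma> (\<lambda>\<omega>. \<theta> \<delta> (x, t0) \<omega> \<in> tube l r R1 R2 a b)"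
    using y(5) c(1) H by (intro tube_whp[OF y(1)])
  then show ?thesis using y(1) by blast
qed

text \<open>The opposite regime to \<open>ex_tube_small\<close>: the path runs for the long time
  \<open>H\<close>, and a tube of large width \<open>c\<close> makes leaving it unlikely. Half of
  \<open>c\<close> absorbs the choice of a point of \<open>D\<close> near \<xi>, which turns 2 into
  8.\<close>

lemma ex_tube_big:
  assumes "l < r" "R2 \<le> l + H" "0 < H" "0 < c" "a \<le> tanh (\<xi> - c)" "tanh (\<xi> + c) \<le> b" "8 * H / c\<^sup>2 < \<gamma>"
  shows "\<exists>y\<in>D. \<forall>\<^sub>F \<delta> in at_right 0. whp (M \<delta>) \<gamma> (\<lambda>\<omega>. \<theta> \<delta> y \<omega> \<in> tube l r R1 R2 a b)"
proof -
  obtain x t0 where y: "(x, t0) \<in> D" "\<xi> - c / 2 < x" "x < \<xi> + c / 2" "l < t0" "t0 < r"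
    by (rule dense_pick[OF D, of "\<xi> - c / 2" "\<xi> + c / 2" l r]) (use assms(1,4) in auto)
  have t1: "tanh (\<xi> - c) < tanh (x - c / 2)" and t2: "tanh (x + c / 2) < tanh (\<xi> + c)"
    unfolding tanh_real_less_iff using y(2,3) by linarith+
  have "\<forall>\<^sub>F \<delta> in at_right 0. whp (M \<delta>) \<gamma> (\<lambda>\<omega>. \<theta> \<delta> (x, t0) \<omega> \<in> tube l r R1 R2 a b)"
  proof (rule tube_whp[OF y(1,4,5), where c = "c / 2" and H = H])
    show "2 * H / (c / 2)\<^sup>2 < \<gamma>"
      using assms(7) by (simp add: power_divide)
    show "a < tanh (x - c / 2)" "tanh (x + c / 2) < b"
      using t1 t2 assms(5,6) by linarith+
  qed (use assms y in auto)
  then show ?thesis using y(1) by blast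
qed

section \<open>Nets, barriers and grids of paths from \<open>D\<close>\<close>

lemma ex_tubes:
  assumes I: "finite I" and \<gamma>: "0 < \<gamma>"
    and tube: "\<And>i. i \<in> I \<Longrightarrow> \<exists>y\<in>D. \<forall>\<^sub>F \<delta> in at_right 0.
      whp (M \<delta>) (\<gamma> / (real (card I) + 1)) (\<lambda>\<omega>. \<theta> \<delta> y \<omega> \<in> U i)"
  shows "\<exists>y. y ` I \<subseteq> D \<and> (\<forall>\<^sub>F \<delta> in at_right 0. whp (M \<delta>) \<gamma> (\<lambda>\<omega>. \<forall>i\<in>I. \<theta> \<delta> (y i) \<omega> \<in> U i))"
proof -
  let ?P = "\<lambda>i y. \<forall>\<^sub>F \<delta> in at_right 0. whp (M \<delta>) (\<gamma> / (real (card I) + 1)) (\<lambda>\<omega>. \<theta> \<delta> y \<omega> \<in> U i)"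
  have "\<forall>i\<in>I. \<exists>y. y \<in> D \<and> ?P i y"
    using tube by blast
  from bchoice[OF this] obtain y where y: "\<And>i. i \<in> I \<Longrightarrow> y i \<in> D" "\<And>i. i \<in> I \<Longrightarrow> ?P i (y i)"
    by blast
  have "\<forall>\<^sub>F \<delta> in at_right 0. \<forall>i\<in>I. whp (M \<delta>) (\<gamma> / (real (card I) + 1)) (\<lambda>\<omega>. \<theta> \<delta> (y i) \<omega> \<in> U i)"
    using I y(2) by (intro eventually_ball_finite) auto
  then have "\<forall>\<^sub>F \<delta> in at_right 0. whp (M \<delta>) \<gamma> (\<lambda>\<omega>. \<forall>i\<in>I. \<theta> \<delta> (y i) \<omega> \<in> U i)"
  proof (rule eventually_mono)
    fix \<delta> assume "\<forall>i\<in>I. whp (M \<delta>) (\<gamma> / (real (card I) + 1)) (\<lambda>\<omega>. \<theta> \<delta> (y i) \<omega> \<in> U i)"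
    \<comment> \<open>The \<open>+ 1\<close> in the denominator of each share covers an empty
      \<open>I\<close>.\<close>
    moreover have "(\<Sum>i\<in>I. \<gamma> / (real (card I) + 1)) \<le> \<gamma>"
      using \<gamma> by (simp add: field_simps)
    ultimately show "whp (M \<delta>) \<gamma> (\<lambda>\<omega>. \<forall>i\<in>I. \<theta> \<delta> (y i) \<omega> \<in> U i)"
      using I by (intro whp_ball[where \<gamma> = "\<lambda>_. \<gamma> / (real (card I) + 1)"]) auto
  qed
  then show ?thesis using y(1) by blast
qed

text \<open>Paths started just after \<open>T\<close> are constant on the window. Finitely many of
  them, with nearly every possible value, approximate the paths that start too late to
  matter.\<close>

lemma ex_net:
  assumes e: "0 < e" and \<gamma>: "0 < \<gamma>"
  shows "\<exists>F. finite F \<and> F \<subseteq> D \<and> (\<forall>\<^sub>F \<delta> in at_right 0. whp (M \<delta>) \<gamma> (\<lambda>\<omega>. \<forall>x\<in>{-1..1}. \<exists>y\<in>F.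
    tanh T \<le> ps (\<theta> \<delta> y \<omega>) \<and> (\<forall>t\<in>{-T..T}. \<bar>pv (\<theta> \<delta> y \<omega>) t - x\<bar> \<le> e)))"
proof -
  have cov: "\<exists>\<xi> :: real. x \<in> ball (tanh \<xi>) (e / 2)" if "x \<in> {-1..1}" for x :: real
  proof -
    \<comment> \<open>Shrinking towards 0 avoids the values 1 and -1, which \<open>tanh\<close> does
      not take.\<close>
    define z where "z = x * (1 - min 1 (e / 4))"
    have "x - z = x * min 1 (e / 4)" by (simp add: z_def algebra_simps)
    then have "\<bar>x - z\<bar> \<le> 1 * min 1 (e / 4)"
      using that e by (simp only: abs_mult) (intro mult_mono, auto)
    then have "\<bar>x - z\<bar> \<le> e / 4" by simp
    have "\<bar>z\<bar> \<le> 1 * (1 - min 1 (e / 4))"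
      unfolding z_def abs_mult using that e by (intro mult_mono) auto
    then have "\<bar>z\<bar> < 1" using e by (auto simp: min_def split: if_splits)
    then obtain \<xi> where "z = tanh \<xi>" by (rule surj_tanh)
    then show ?thesis
      using \<open>\<bar>x - z\<bar> \<le> e / 4\<close> e by (intro exI[of _ \<xi>]) (auto simp: dist_real_def abs_minus_commute)
  qed
  have cover: "{-1..1 :: real} \<subseteq> (\<Union>\<xi>\<in>(UNIV :: real set). ball (tanh \<xi>) (e / 2))"
  proof
    fix x :: real assume "x \<in> {-1..1}"
    from cov[OF this] show "x \<in> (\<Union>\<xi>\<in>UNIV. ball (tanh \<xi>) (e / 2))" by blast
  qed
  obtain I :: "real set" where I: "finite I" "{-1..1 :: real} \<subseteq> (\<Union>\<xi>\<in>I. ball (tanh \<xi>) (e / 2))"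
    by (rule compactE_image[OF compact_Icc _ cover]) auto
  have "\<exists>y. y ` I \<subseteq> D \<and> (\<forall>\<^sub>F \<delta> in at_right 0. whp (M \<delta>) \<gamma> (\<lambda>\<omega>. \<forall>\<xi>\<in>I. \<theta> \<delta> (y \<xi>) \<omega> \<in>
      tube T (T + 1) (- T) T (tanh \<xi> - e / 2) (tanh \<xi> + e / 2)))"
  proof (rule ex_tubes[OF I(1) \<gamma>])
    fix \<xi> :: real
    show "\<exists>y\<in>D. \<forall>\<^sub>F \<delta> in at_right 0. whp (M \<delta>) (\<gamma> / (real (card I) + 1)) (\<lambda>\<omega>. \<theta> \<delta> y \<omega> \<in>
        tube T (T + 1) (- T) T (tanh \<xi> - e / 2) (tanh \<xi> + e / 2))"
      using e \<gamma> by (intro ex_tube_small[where \<xi> = \<xi>]) (auto intro!: divide_pos_pos)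
  qed
  then obtain y where y: "y ` I \<subseteq> D" "\<forall>\<^sub>F \<delta> in at_right 0. whp (M \<delta>) \<gamma> (\<lambda>\<omega>. \<forall>\<xi>\<in>I. \<theta> \<delta> (y \<xi>) \<omega> \<in>
      tube T (T + 1) (- T) T (tanh \<xi> - e / 2) (tanh \<xi> + e / 2))" by blast
  show ?thesis
  proof (intro exI[of _ "y ` I"] conjI eventually_mono[OF y(2)])
    fix \<delta> assume wh: "whp (M \<delta>) \<gamma> (\<lambda>\<omega>. \<forall>\<xi>\<in>I. \<theta> \<delta> (y \<xi>) \<omega> \<in>
      tube T (T + 1) (- T) T (tanh \<xi> - e / 2) (tanh \<xi> + e / 2))"
    show "whp (M \<delta>) \<gamma> (\<lambda>\<omega>. \<forall>x\<in>{-1..1}. \<exists>y\<in>y ` I.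
        tanh T \<le> ps (\<theta> \<delta> y \<omega>) \<and> (\<forall>t\<in>{-T..T}. \<bar>pv (\<theta> \<delta> y \<omega>) t - x\<bar> \<le> e))"
    proof (rule whp_mono[OF wh order_refl], intro ballI)
      fix \<omega> and x :: real
      assume *: "\<forall>\<xi>\<in>I. \<theta> \<delta> (y \<xi>) \<omega> \<in> tube T (T + 1) (- T) T (tanh \<xi> - e / 2) (tanh \<xi> + e / 2)"
        and "x \<in> {-1..1}"
      then obtain \<xi> where \<xi>: "\<xi> \<in> I" "\<bar>tanh \<xi> - x\<bar> < e / 2"
        using I(2) by (force simp: dist_real_def)
      then have t: "\<theta> \<delta> (y \<xi>) \<omega> \<in> tube T (T + 1) (- T) T (tanh \<xi> - e / 2) (tanh \<xi> + e / 2)"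
        using * by blast
      have "\<bar>pv (\<theta> \<delta> (y \<xi>) \<omega>) t - x\<bar> \<le> e" if "t \<in> {-T..T}" for t
      proof -
        have "tanh \<xi> - e / 2 < pv (\<theta> \<delta> (y \<xi>) \<omega>) t \<and> pv (\<theta> \<delta> (y \<xi>) \<omega>) t < tanh \<xi> + e / 2"
          using t that unfolding tube_def by blast
        then show ?thesis using \<xi>(2) by linarith
      qed
      moreover have "tanh T \<le> ps (\<theta> \<delta> (y \<xi>) \<omega>)" using t by (simp add: tube_def)
      ultimately show "\<exists>y\<in>y ` I. tanh T \<le> ps (\<theta> \<delta> y \<omega>) \<and> (\<forall>t\<in>{-T..T}. \<bar>pv (\<theta> \<delta> y \<omega>) t - x\<bar> \<le> e)"
        using \<xi>(1) by blast
    qed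
  qed (use I y in auto)
qed

text \<open>Barriers are started on a time grid of spacing \<open>e / 4\<close>, so that one starts
  shortly before any \<open>s\<close>. The admissible range depends on \<open>c\<close>, because
  \<open>c\<close> has to be chosen in terms of the number of barriers: more barriers need a wider
  tube each.\<close>

lemma ex_barrier:
  assumes e: "0 < e" "e < 1" and \<gamma>: "0 < \<gamma>" and T: "0 < T"
    and ab: "\<And>c. 0 < c \<Longrightarrow> \<exists>\<xi>. a c \<le> tanh (\<xi> - c) \<and> tanh (\<xi> + c) \<le> b c"
  shows "\<exists>c>0. \<exists>F. finite F \<and> F \<subseteq> D \<and> (\<forall>\<^sub>F \<delta> in at_right 0. whp (M \<delta>) \<gamma> (\<lambda>\<omega>. \<forall>s\<in>{-T..T}. \<exists>y\<in>F.
    tanh (s - e / 2) \<le> ps (\<theta> \<delta> y \<omega>) \<and> ps (\<theta> \<delta> y \<omega>) \<le> tanh s \<and>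
    (\<forall>t\<in>{-T..T + 1}. a c \<le> pv (\<theta> \<delta> y \<omega>) t \<and> pv (\<theta> \<delta> y \<omega>) t \<le> b c)))"
proof -
  define \<sigma> where "\<sigma> = e / 4"
  have \<sigma>: "0 < \<sigma>" "\<sigma> < 1" using e by (auto simp: \<sigma>_def)
  define n where "n = nat \<lceil>2 * T / \<sigma>\<rceil>"
  define H where "H = 2 * T + 3"
  define g where "g = \<gamma> / (real (card {..n}) + 1)"
  have g: "0 < g" using \<gamma> by (simp add: g_def)
  \<comment> \<open>With this value \<open>8 * H / c\<^sup>2\<close> is \<open>g / 2\<close>, below
    the share \<open>g\<close> of one barrier.\<close>
  define c where "c = sqrt (16 * H / g)"
  have H: "0 < H" using T by (simp add: H_def)
  have "c\<^sup>2 = 16 * H / g" using g H by (simp add: c_def)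
  then have c: "0 < c" "8 * H / c\<^sup>2 < g" using g H by (simp_all add: c_def)
  obtain \<xi> where \<xi>: "a c \<le> tanh (\<xi> - c)" "tanh (\<xi> + c) \<le> b c" using ab[OF c(1)] by blast
  define s where "s k = - T + real k * \<sigma>" for k :: nat
  let ?U = "\<lambda>k. tube (s k - \<sigma>) (s k) (- T) (T + 1) (a c) (b c)"
  have "\<exists>y. y ` {..n} \<subseteq> D \<and> (\<forall>\<^sub>F \<delta> in at_right 0. whp (M \<delta>) \<gamma> (\<lambda>\<omega>. \<forall>k\<in>{..n}. \<theta> \<delta> (y k) \<omega> \<in> ?U k))"
  proof (rule ex_tubes[OF _ \<gamma>])
    fix k
    have "- T \<le> s k" using \<sigma> by (simp add: s_def)
    then show "\<exists>y\<in>D. \<forall>\<^sub>F \<delta> in at_right 0. whp (M \<delta>) (\<gamma> / (real (card {..n}) + 1)) (\<lambda>\<omega>. \<theta> \<delta> y \<omega> \<in> ?U k)"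
      using \<sigma> \<xi> c T unfolding g_def[symmetric]
      by (intro ex_tube_big[of _ _ _ H c _ \<xi>]) (auto simp: H_def)
  qed simp
  then obtain y where y: "y ` {..n} \<subseteq> D"
      "\<forall>\<^sub>F \<delta> in at_right 0. whp (M \<delta>) \<gamma> (\<lambda>\<omega>. \<forall>k\<in>{..n}. \<theta> \<delta> (y k) \<omega> \<in> ?U k)" by blast
  have ev: "\<forall>\<^sub>F \<delta> in at_right 0. whp (M \<delta>) \<gamma> (\<lambda>\<omega>. \<forall>s\<in>{-T..T}. \<exists>y\<in>y ` {..n}.
    tanh (s - e / 2) \<le> ps (\<theta> \<delta> y \<omega>) \<and> ps (\<theta> \<delta> y \<omega>) \<le> tanh s \<and>
    (\<forall>t\<in>{-T..T + 1}. a c \<le> pv (\<theta> \<delta> y \<omega>) t \<and> pv (\<theta> \<delta> y \<omega>) t \<le> b c))"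
  proof (rule eventually_mono[OF y(2)], rule whp_mono[OF _ order_refl], assumption, intro ballI)
    fix \<delta> \<omega> v assume U: "\<forall>k\<in>{..n}. \<theta> \<delta> (y k) \<omega> \<in> ?U k" and v: "v \<in> {-T..T}"
    define k where "k = nat \<lfloor>(v + T) / \<sigma>\<rfloor>"
    have fl: "real k \<le> (v + T) / \<sigma>" "(v + T) / \<sigma> < real k + 1"
      using v \<sigma> by (auto simp: k_def)
    have "(v + T) / \<sigma> \<le> 2 * T / \<sigma>" using v \<sigma> by (intro divide_right_mono) auto
    then have "real k \<le> real n" using fl(1) unfolding n_def by linarith
    then have k: "k \<in> {..n}" by simp
    have "s k \<le> v" "v < s k + \<sigma>" using fl \<sigma> by (auto simp: s_def field_simps)
    then have mono: "tanh (v - e / 2) \<le> tanh (s k - \<sigma>)" "tanh (s k) \<le> tanh v" by (auto simp: \<sigma>_def)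
    have t: "\<theta> \<delta> (y k) \<omega> \<in> ?U k" using U k by blast
    then have "tanh (s k - \<sigma>) < ps (\<theta> \<delta> (y k) \<omega>)" "ps (\<theta> \<delta> (y k) \<omega>) < tanh (s k)"
      by (simp_all add: tube_def)
    then have "tanh (v - e / 2) \<le> ps (\<theta> \<delta> (y k) \<omega>)" "ps (\<theta> \<delta> (y k) \<omega>) \<le> tanh v"
      using mono by linarith+
    then show "\<exists>y\<in>y ` {..n}. tanh (v - e / 2) \<le> ps (\<theta> \<delta> y \<omega>) \<and> ps (\<theta> \<delta> y \<omega>) \<le> tanh v \<and>
      (\<forall>t\<in>{-T..T + 1}. a c \<le> pv (\<theta> \<delta> y \<omega>) t \<and> pv (\<theta> \<delta> y \<omega>) t \<le> b c)"
      using k t unfolding tube_def by (intro bexI[of _ "y k"]) (auto intro: less_imp_le)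
  qed
  show ?thesis
    by (intro exI[of _ c] exI[of _ "y ` {..n}"] conjI) (fact c(1), simp, fact y(1), fact ev)
qed

text \<open>This provides the assumption \<open>grid\<close> of \<open>skeleton_dense\<close>: half
  of \<gamma> is spent on placing the grid paths, half on the events of \<open>eta\<close>.
  Coalescence and the finiteness that follows from the modulus are kept as premises, so that their
  probability is charged only once.\<close>

lemma ex_grid:
  assumes \<gamma>: "0 < \<gamma>" and \<tau>: "0 < \<tau>" "\<tau> < 1" and u: "0 < u" and B: "0 < B" and T: "0 < T"
  shows "\<exists>F. finite F \<and> F \<subseteq> D \<and> (\<forall>\<^sub>F \<delta> in at_right 0. whp (M \<delta>) \<gamma> (\<lambda>\<omega>.
    coalescing (X \<delta> \<omega>) \<longrightarrow>
    (\<forall>p\<in>paths (X \<delta> \<omega>). \<forall>v\<in>{-T..T + 1}. \<forall>v'\<in>{v..v + \<tau>}. path_start p \<le> ereal v \<longrightarrow>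
      \<bar>pv p v\<bar> \<le> tanh (B + 2) \<longrightarrow> \<bar>pv p v'\<bar> < 1) \<longrightarrow>
    (\<forall>s\<in>{-T..T}. \<exists>r\<in>{s..s + \<tau>}. \<forall>p\<in>paths (X \<delta> \<omega>).
      path_start p \<le> ereal r \<and> \<bar>pv p r\<bar> \<le> tanh B \<and> \<bar>pv p (r + \<tau>)\<bar> \<le> tanh B \<longrightarrow>
      (\<exists>y\<in>F. tanh (r - \<tau>) \<le> ps (\<theta> \<delta> y \<omega>) \<and> ps (\<theta> \<delta> y \<omega>) \<le> tanh r \<and>
        (\<forall>t\<in>{r - \<tau>..r}. \<bar>pv (\<theta> \<delta> y \<omega>) t - pv p r\<bar> \<le> u) \<and>
        \<bar>pv (\<theta> \<delta> y \<omega>) r\<bar> \<le> tanh (B + 2) \<and> pv (\<theta> \<delta> y \<omega>) (r + \<tau>) = pv p (r + \<tau>)))))"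
proof -
  define n where "n = nat \<lceil>2 * T / \<tau>\<rceil>"
  define r where "r k = - T + real k * \<tau>" for k :: nat
  \<comment> \<open>There are \<open>(n + 1) * (J + 1)\<close> events of probability at most
    \<open>\<kappa> * h'\<close>, where \<open>h' = 5 / 2 * h\<close> and
    \<open>(J + 1) * h \<le> 2 * B + 6\<close>. Their sum is at most \<open>\<gamma> / 2\<close>,
    independently of \<open>h\<close>.\<close>
  define \<kappa> where "\<kappa> = \<gamma> / 2 / ((real n + 1) * (2 * B + 6) * (5 / 2))"
  have \<kappa>: "0 < \<kappa>" using \<gamma> B by (simp add: \<kappa>_def add_pos_pos)
  have "\<forall>\<^sub>F h in at_right 0. \<forall>k\<in>{..n}. \<forall>\<^sub>F \<delta> in at_right 0. \<forall>a.
      whp (M \<delta>) (\<kappa> * h) (\<lambda>\<omega>. \<not> 3 \<le> eta (r k) \<tau> a (a + h) (X \<delta> \<omega>))"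
    by (intro eventually_ball_finite ballI eta_whp \<tau>(1) \<kappa>) simp
  moreover have "\<forall>\<^sub>F h in at_right 0. 0 < h \<and> h < min (5 / 8) (5 / 6 * u)"
    unfolding eventually_at_right_field using u by (intro exI[of _ "min (5 / 8) (5 / 6 * u)"]) auto
  ultimately have "\<forall>\<^sub>F h in at_right 0. (\<forall>k\<in>{..n}. \<forall>\<^sub>F \<delta> in at_right 0. \<forall>a.
      whp (M \<delta>) (\<kappa> * h) (\<lambda>\<omega>. \<not> 3 \<le> eta (r k) \<tau> a (a + h) (X \<delta> \<omega>))) \<and>
      0 < h \<and> h < min (5 / 8) (5 / 6 * u)"
    by (rule eventually_conj)
  from eventually_happens'[OF trivial_limit_at_right_real this] obtain h'
    where raw: "(\<forall>k\<in>{..n}. \<forall>\<^sub>F \<delta> in at_right 0. \<forall>a.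
      whp (M \<delta>) (\<kappa> * h') (\<lambda>\<omega>. \<not> 3 \<le> eta (r k) \<tau> a (a + h') (X \<delta> \<omega>))) \<and>
      0 < h' \<and> h' < min (5 / 8) (5 / 6 * u)" by blast
  note eta_h' = raw[THEN conjunct1]
  have h': "0 < h'" "h' < 5 / 8" "h' < 5 / 6 * u" using raw[THEN conjunct2] by simp_all
  \<comment> \<open>The interval to which \<open>grid_of_eta\<close> applies \<open>eta\<close> has
    length \<open>5 / 2 * h = h'\<close>.\<close>
  define h where "h = 2 / 5 * h'"
  have h: "0 < h" "h < 1 / 4" "3 * h \<le> u" "3 * h \<le> 1" using h' by (auto simp: h_def)
  \<comment> \<open>The grid extends a little beyond \<open>[-B, B]\<close> on both sides, which
    gives \<open>cover\<close> in \<open>grid_of_eta\<close>.\<close>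
  define a where "a = - B - h"
  define J where "J = nat \<lceil>2 * B / h\<rceil> + 4"
  have J1: "2 * B / h + 4 \<le> real J" "real J \<le> 2 * B / h + 5"
  proof -
    have "real (nat \<lceil>2 * B / h\<rceil>) = of_int \<lceil>2 * B / h\<rceil>"
      using B h(1) by (simp add: less_imp_le)
    then show "2 * B / h + 4 \<le> real J" "real J \<le> 2 * B / h + 5"
      using le_of_int_ceiling[of "2 * B / h"] of_int_ceiling_le_add_one[of "2 * B / h"]
      unfolding J_def of_nat_add of_nat_numeral by linarith+
  qed
  have Jh: "2 * B + 4 * h \<le> real J * h" "real J * h \<le> 2 * B + 5 * h"
    using J1 h(1) by (simp_all add: field_simps)
  let ?a = "\<lambda>j. a + real j * h"
  let ?I = "{..n} \<times> {..J}"
  let ?U = "\<lambda>(k, j). tube (r k - \<tau>) (r k) (r k - \<tau>) (r k) (tanh (?a j - h / 4)) (tanh (?a j + h / 4))"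
  have "\<exists>y. y ` ?I \<subseteq> D \<and> (\<forall>\<^sub>F \<delta> in at_right 0. whp (M \<delta>) (\<gamma> / 2) (\<lambda>\<omega>. \<forall>i\<in>?I. \<theta> \<delta> (y i) \<omega> \<in> ?U i))"
  proof (rule ex_tubes)
    fix i assume "i \<in> ?I"
    define g where "g = \<gamma> / 2 / (real (card ?I) + 1)"
    have "0 < g"
      unfolding g_def using \<gamma>
      by (intro divide_pos_pos add_nonneg_pos of_nat_0_le_iff zero_less_one) auto
    then show "\<exists>y\<in>D. \<forall>\<^sub>F \<delta> in at_right 0. whp (M \<delta>) (\<gamma> / 2 / (real (card ?I) + 1)) (\<lambda>\<omega>. \<theta> \<delta> y \<omega> \<in> ?U i)"
      unfolding split_beta g_def[symmetric] using \<tau> h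
      by (intro ex_tube_small[where \<xi> = "?a (snd i)"]) auto
  qed (use \<gamma> in auto)
  then obtain y where y: "y ` ?I \<subseteq> D"
      "\<forall>\<^sub>F \<delta> in at_right 0. whp (M \<delta>) (\<gamma> / 2) (\<lambda>\<omega>. \<forall>i\<in>?I. \<theta> \<delta> (y i) \<omega> \<in> ?U i)" by blast
  have eta: "\<forall>\<^sub>F \<delta> in at_right 0. whp (M \<delta>) (\<gamma> / 2) (\<lambda>\<omega>. \<forall>i\<in>?I.
      \<not> 3 \<le> eta (r (fst i)) \<tau> (?a (snd i) - h / 4) (?a (snd i) - h / 4 + h') (X \<delta> \<omega>))"
  proof -
    have "\<forall>\<^sub>F \<delta> in at_right 0. \<forall>k\<in>{..n}. \<forall>a.
        whp (M \<delta>) (\<kappa> * h') (\<lambda>\<omega>. \<not> 3 \<le> eta (r k) \<tau> a (a + h') (X \<delta> \<omega>))"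
      using eta_h' by (intro eventually_ball_finite) simp_all
    then show ?thesis
    proof (rule eventually_mono, intro whp_ball[where \<gamma> = "\<lambda>_. \<kappa> * h'"])
      have "real (J + 1) * h \<le> 2 * B + 6"
        using Jh(2) h(2) by (simp add: distrib_right)
      then have "(real n + 1) * (5 / 2 * \<kappa>) * (real (J + 1) * h) \<le> (real n + 1) * (5 / 2 * \<kappa>) * (2 * B + 6)"
        using \<kappa> by (intro mult_left_mono) auto
      also have "\<dots> = \<kappa> * ((real n + 1) * (2 * B + 6) * (5 / 2))" by simp
      also have "\<dots> = \<gamma> / 2"
      proof -
        have "0 < (real n + 1) * (2 * B + 6) * (5 / 2)"
          using B by (intro mult_pos_pos add_nonneg_pos) auto
        then show ?thesis unfolding \<kappa>_def by (intro nonzero_eq_divide_eq[THEN iffD1]) auto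
      qed
      finally show "(\<Sum>i\<in>?I. \<kappa> * h') \<le> \<gamma> / 2"
        by (simp add: h_def card_cartesian_product algebra_simps)
    qed auto
  qed
  have "\<forall>\<^sub>F \<delta> in at_right 0. whp (M \<delta>) \<gamma> (\<lambda>\<omega>. (\<forall>i\<in>?I. \<theta> \<delta> (y i) \<omega> \<in> ?U i) \<and> (\<forall>i\<in>?I.
      \<not> 3 \<le> eta (r (fst i)) \<tau> (?a (snd i) - h / 4) (?a (snd i) - h / 4 + h') (X \<delta> \<omega>)))"
    using y(2) eta by eventually_elim (drule (1) whp_conj, simp)
  then have ev: "\<forall>\<^sub>F \<delta> in at_right 0. \<delta> \<in> {0<..1} \<and> whp (M \<delta>) \<gamma> (\<lambda>\<omega>. (\<forall>i\<in>?I. \<theta> \<delta> (y i) \<omega> \<in> ?U i) \<and> (\<forall>i\<in>?I.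
      \<not> 3 \<le> eta (r (fst i)) \<tau> (?a (snd i) - h / 4) (?a (snd i) - h / 4 + h') (X \<delta> \<omega>)))"
    using eventually_unit by eventually_elim simp
  show ?thesis
  proof (intro exI[of _ "y ` ?I"] conjI, goal_cases)
    case 3
    show ?case
    proof (rule eventually_mono[OF ev], elim conjE, rule whp_mono[OF _ order_refl], assumption, intro impI ballI)
      fix \<delta> \<omega> s
      assume \<delta>: "\<delta> \<in> {0<..1}" and \<omega>: "\<omega> \<in> space (M \<delta>)"
        and *: "(\<forall>i\<in>?I. \<theta> \<delta> (y i) \<omega> \<in> ?U i) \<and> (\<forall>i\<in>?I.
          \<not> 3 \<le> eta (r (fst i)) \<tau> (?a (snd i) - h / 4) (?a (snd i) - h / 4 + h') (X \<delta> \<omega>))"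
        and K: "coalescing (X \<delta> \<omega>)"
        and mod: "\<forall>p\<in>paths (X \<delta> \<omega>). \<forall>v\<in>{-T..T + 1}. \<forall>v'\<in>{v..v + \<tau>}. path_start p \<le> ereal v \<longrightarrow>
          \<bar>pv p v\<bar> \<le> tanh (B + 2) \<longrightarrow> \<bar>pv p v'\<bar> < 1"
        and s: "s \<in> {-T..T}"
      \<comment> \<open>The ceiling gives the first grid time at or after \<open>s\<close>: the path
        need not exist earlier.\<close>
      define k where "k = nat \<lceil>(s + T) / \<tau>\<rceil>"
      have cl: "(s + T) / \<tau> \<le> real k" "real k < (s + T) / \<tau> + 1"
      proof -
        have "0 \<le> (s + T) / \<tau>" using s \<tau> by simp
        then have "real k = of_int \<lceil>(s + T) / \<tau>\<rceil>" by (simp add: k_def)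
        then show "(s + T) / \<tau> \<le> real k" "real k < (s + T) / \<tau> + 1"
          by linarith+
      qed
      have "(s + T) / \<tau> \<le> 2 * T / \<tau>" using s \<tau> by (intro divide_right_mono) auto
      then have k: "k \<le> n" unfolding k_def n_def by (intro nat_mono ceiling_mono)
      have rs: "s \<le> r k" "r k \<le> s + \<tau>" using cl \<tau> by (auto simp: r_def field_simps)
      have rT: "r k \<in> {-T..T + 1}" using rs s \<tau> by auto
      define q where "q j = \<theta> \<delta> (y (k, j)) \<omega>" for j
      have q: "q j \<in> paths (X \<delta> \<omega>)" "q j \<in> ?U (k, j)" if "j \<le> J" for j
        using * that k \<theta>_paths[OF \<delta> _ \<omega>, of "y (k, j)"] y(1) by (auto simp: q_def)
      have ps_q: "tanh (r k - \<tau>) \<le> ps (q j)" "ps (q j) \<le> tanh (r k)" if "j \<le> J" for j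
        using q(2)[OF that] by (auto simp: tube_def intro: less_imp_le)
      have near: "tanh (?a j - h / 4) < pv (q j) t \<and> pv (q j) t < tanh (?a j + h / 4)"
        if "j \<le> J" "t \<in> {r k - \<tau>..r k}" for j t
        using q(2)[OF that(1)] that(2) unfolding tube_def by blast
      have fin: "\<bar>pv (q j) v\<bar> < 1" if j: "j \<le> J" and v: "v \<in> {r k..r k + \<tau>}" for j v
      proof -
        have "real j * h \<le> real J * h" using j h(1) by (intro mult_right_mono) auto
        then have "?a j + h / 4 \<le> B + 2" "- (B + 2) \<le> ?a j - h / 4"
          using Jh(2) h(1,2) B mult_nonneg_nonneg[of "real j" h] unfolding a_def by linarith+
        then have "tanh (?a j + h / 4) \<le> tanh (B + 2)" "- tanh (B + 2) \<le> tanh (?a j - h / 4)"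
          by (simp_all add: tanh_minus[symmetric])
        moreover have "r k \<in> {r k - \<tau>..r k}" using \<tau>(1) by simp
        ultimately have "\<bar>pv (q j) (r k)\<bar> \<le> tanh (B + 2)"
          using near[OF j, of "r k"] by linarith
        moreover have "path_start (q j) \<le> ereal (r k)" using ps_q(2)[OF j] by (simp add: ps_le_iff)
        ultimately show ?thesis using mod q(1)[OF j] rT v by blast
      qed
      show "\<exists>r\<in>{s..s + \<tau>}. \<forall>p\<in>paths (X \<delta> \<omega>).
          path_start p \<le> ereal r \<and> \<bar>pv p r\<bar> \<le> tanh B \<and> \<bar>pv p (r + \<tau>)\<bar> \<le> tanh B \<longrightarrow>
          (\<exists>y\<in>y ` ?I. tanh (r - \<tau>) \<le> ps (\<theta> \<delta> y \<omega>) \<and> ps (\<theta> \<delta> y \<omega>) \<le> tanh r \<and>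
            (\<forall>t\<in>{r - \<tau>..r}. \<bar>pv (\<theta> \<delta> y \<omega>) t - pv p r\<bar> \<le> u) \<and>
            \<bar>pv (\<theta> \<delta> y \<omega>) r\<bar> \<le> tanh (B + 2) \<and> pv (\<theta> \<delta> y \<omega>) (r + \<tau>) = pv p (r + \<tau>))"
      proof (rule bexI[of _ "r k"], intro ballI impI)
        fix p assume p: "p \<in> paths (X \<delta> \<omega>)"
          and pr: "path_start p \<le> ereal (r k) \<and> \<bar>pv p (r k)\<bar> \<le> tanh B \<and> \<bar>pv p (r k + \<tau>)\<bar> \<le> tanh B"
        have "\<exists>j\<le>J. (\<forall>t\<in>{r k - \<tau>..r k}. \<bar>pv (q j) t - pv p (r k)\<bar> \<le> u) \<and>
            \<bar>pv (q j) (r k)\<bar> \<le> tanh (B + 1) \<and> pv (q j) (r k + \<tau>) = pv p (r k + \<tau>)"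
        proof (rule grid_of_eta[OF K \<tau>(1) h(1,3,4), where q = q and a = a])
          fix j assume "j + 2 \<le> J"
          then have kj: "(k, j) \<in> ?I" using k by auto
          have eq: "?a j - h / 4 + h' = ?a j + 9 / 4 * h" by (simp add: h_def)
          show "\<not> 3 \<le> eta (r k) \<tau> (?a j - h / 4) (?a j + 9 / 4 * h) (X \<delta> \<omega>)"
            using bspec[OF conjunct2[OF *] kj] unfolding fst_conv snd_conv eq .
        next
          show "a + h / 4 \<le> - B" "B \<le> a + real J * h - h - h / 4"
            using h(1) Jh(1) by (auto simp: a_def)
          show "\<bar>pv p (r k + \<tau>)\<bar> < 1" using pr tanh_real_lt_1[of B] by linarith
        qed (use q(1) ps_q near fin p pr in auto)
        then obtain j where j: "j \<le> J" "\<forall>t\<in>{r k - \<tau>..r k}. \<bar>pv (q j) t - pv p (r k)\<bar> \<le> u"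
            "\<bar>pv (q j) (r k)\<bar> \<le> tanh (B + 1)" "pv (q j) (r k + \<tau>) = pv p (r k + \<tau>)" by blast
        have "tanh (B + 1) \<le> tanh (B + 2)" by simp
        then have "\<bar>pv (q j) (r k)\<bar> \<le> tanh (B + 2)" using j(3) by linarith
        then show "\<exists>y\<in>y ` ?I. tanh (r k - \<tau>) \<le> ps (\<theta> \<delta> y \<omega>) \<and> ps (\<theta> \<delta> y \<omega>) \<le> tanh (r k) \<and>
            (\<forall>t\<in>{r k - \<tau>..r k}. \<bar>pv (\<theta> \<delta> y \<omega>) t - pv p (r k)\<bar> \<le> u) \<and>
            \<bar>pv (\<theta> \<delta> y \<omega>) (r k)\<bar> \<le> tanh (B + 2) \<and> pv (\<theta> \<delta> y \<omega>) (r k + \<tau>) = pv p (r k + \<tau>)"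
          using j k ps_q[OF j(1)] unfolding q_def by (intro bexI[of _ "y (k, j)"]) auto
      qed (use rs in auto)
    qed
  qed (use y(1) in auto)
qed

text \<open>Net, upper barriers, lower barriers, grid and absence of crossings fail with probability
  at most \<open>e / 5\<close> each. The barriers come before \<tau>, since they determine how far
  out in space a modulus of continuity is required, and \<tau> comes before the grid.\<close>

lemma X_skeleton:
  assumes e: "0 < e" "e < 1"
  shows "\<exists>F. finite F \<and> F \<subseteq> D \<and> (\<forall>\<^sub>F \<delta> in at_right 0.
    whp (M \<delta>) e (\<lambda>\<omega>. \<forall>p\<in>paths (X \<delta> \<omega>). \<exists>y\<in>F. dist p (\<theta> \<delta> y \<omega>) \<le> e))"
proof -
  have "\<forall>\<^sub>F T in at_top. 1 - e / 2 < tanh (T :: real)"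
    using e by (intro order_tendstoD[OF tanh_real_at_top]) auto
  moreover have "\<forall>\<^sub>F T in at_top. 2 / e \<le> (T :: real)"
    by (rule eventually_ge_at_top)
  ultimately have "\<forall>\<^sub>F T in at_top. 1 - e / 2 < tanh (T :: real) \<and> 2 / e \<le> T"
    by (rule eventually_conj)
  from eventually_happens'[OF trivial_limit_at_top_linorder this]
  obtain T :: real where T': "1 - e / 2 < tanh T" "2 / e \<le> T" by blast
  have "0 < 2 / e" using e by simp
  then have T0: "0 < T" using T'(2) by linarith
  have "2 \<le> T * e" using T'(2) e(1) by (simp add: pos_divide_le_eq)
  also have "\<dots> \<le> e * (1 + T)" using e(1) by (simp add: algebra_simps)
  finally have T: "0 < T" "2 / (1 + T) \<le> e" "1 - tanh T \<le> e / 2"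
    using T' T0 by (simp_all add: pos_divide_le_eq)
  obtain L :: real where L: "0 < L" "1 - e \<le> tanh L" using T e by (intro that[of T]) auto
  have g: "0 < e / 5" using e by simp
  obtain F1 where F1: "finite F1" "F1 \<subseteq> D"
    "\<forall>\<^sub>F \<delta> in at_right 0. whp (M \<delta>) (e / 5) (\<lambda>\<omega>. \<forall>x\<in>{-1..1}. \<exists>y\<in>F1.
      tanh T \<le> ps (\<theta> \<delta> y \<omega>) \<and> (\<forall>t\<in>{-T..T}. \<bar>pv (\<theta> \<delta> y \<omega>) t - x\<bar> \<le> e))"
    using ex_net[OF e(1) g] by blast
  have "\<exists>\<xi>. 1 - e \<le> tanh (\<xi> - c) \<and> tanh (\<xi> + c) \<le> tanh (L + 2 * c)" for c
    using L by (intro exI[of _ "L + c"]) auto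
  from ex_barrier[OF e g T(1), of "\<lambda>_. 1 - e" "\<lambda>c. tanh (L + 2 * c)", OF this]
  obtain c2 F2 where F2: "0 < c2" "finite F2" "F2 \<subseteq> D"
    "\<forall>\<^sub>F \<delta> in at_right 0. whp (M \<delta>) (e / 5) (\<lambda>\<omega>. \<forall>s\<in>{-T..T}. \<exists>y\<in>F2.
      tanh (s - e / 2) \<le> ps (\<theta> \<delta> y \<omega>) \<and> ps (\<theta> \<delta> y \<omega>) \<le> tanh s \<and>
      (\<forall>t\<in>{-T..T + 1}. 1 - e \<le> pv (\<theta> \<delta> y \<omega>) t \<and> pv (\<theta> \<delta> y \<omega>) t \<le> tanh (L + 2 * c2)))"
    by blast
  have "\<exists>\<xi>. - tanh (L + 2 * c) \<le> tanh (\<xi> - c) \<and> tanh (\<xi> + c) \<le> - (1 - e)" for c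
  proof (intro exI[of _ "- (L + c)"] conjI)
    have "tanh (- (L + c) - c) = - tanh (L + 2 * c)" "tanh (- (L + c) + c) = - tanh L"
      unfolding tanh_minus[symmetric] by (rule arg_cong[where f = tanh], simp)+
    then show "- tanh (L + 2 * c) \<le> tanh (- (L + c) - c)" "tanh (- (L + c) + c) \<le> - (1 - e)"
      using L(2) by linarith+
  qed
  from ex_barrier[OF e g T(1), of "\<lambda>c. - tanh (L + 2 * c)" "\<lambda>_. - (1 - e)", OF this]
  obtain c3 F3 where F3: "0 < c3" "finite F3" "F3 \<subseteq> D"
    "\<forall>\<^sub>F \<delta> in at_right 0. whp (M \<delta>) (e / 5) (\<lambda>\<omega>. \<forall>s\<in>{-T..T}. \<exists>y\<in>F3.
      tanh (s - e / 2) \<le> ps (\<theta> \<delta> y \<omega>) \<and> ps (\<theta> \<delta> y \<omega>) \<le> tanh s \<and>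
      (\<forall>t\<in>{-T..T + 1}. - tanh (L + 2 * c3) \<le> pv (\<theta> \<delta> y \<omega>) t \<and> pv (\<theta> \<delta> y \<omega>) t \<le> - (1 - e)))"
    by blast
  \<comment> \<open>Paths between the barriers have positions in \<open>[-B, B]\<close>. The modulus
    is taken on the larger range \<open>B + 2\<close>, which also contains the grid paths.\<close>
  define B where "B = L + 2 * max c2 c3"
  have B: "0 < B" using L F2(1) by (simp add: B_def)
  have BB: "tanh (L + 2 * c2) \<le> tanh B" "- tanh B \<le> - tanh (L + 2 * c3)" by (simp_all add: B_def)
  define u where "u = e / 4"
  have u: "0 < u" "4 * u \<le> e" using e by (simp_all add: u_def)
  have B2T: "0 \<le> B + 2" "0 \<le> T + 1" using B T by simp_all
  have "\<forall>\<^sub>F \<tau> in at_right 0. 0 < \<tau> \<and> \<tau> < e / 2"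
    unfolding eventually_at_right_field using e by (intro exI[of _ "e / 2"]) auto
  from eventually_happens'[OF trivial_limit_at_right_real eventually_conj[OF this no_crossing_whp[OF u(1) g B2T]]]
  obtain \<tau> where \<tau>: "0 < \<tau>" "\<tau> < e / 2" "sqrt \<tau> < u"
    and cross: "\<And>\<delta>. \<delta> \<in> {0<..1} \<Longrightarrow> whp (M \<delta>) (e / 5) (\<lambda>\<omega>. \<forall>i j :: int.
      \<bar>of_int i\<bar> \<le> (B + 2) / sqrt \<tau> + 1 \<longrightarrow> \<bar>of_int j\<bar> \<le> (T + 1) / \<tau> + 1 \<longrightarrow>
      X \<delta> \<omega> \<notin> crossing_event \<tau> u (of_int i * sqrt \<tau>) (of_int j * \<tau>))"
    by blast
  have \<tau>1: "\<tau> < 1" using \<tau> e by simp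
  let ?cross = "\<lambda>\<delta> \<omega>. \<forall>i j :: int.
      \<bar>of_int i\<bar> \<le> (B + 2) / sqrt \<tau> + 1 \<longrightarrow> \<bar>of_int j\<bar> \<le> (T + 1) / \<tau> + 1 \<longrightarrow>
      X \<delta> \<omega> \<notin> crossing_event \<tau> u (of_int i * sqrt \<tau>) (of_int j * \<tau>)"
  let ?G = "\<lambda>F \<delta> \<omega>. \<forall>s\<in>{-T..T}. \<exists>r\<in>{s..s + \<tau>}. \<forall>p\<in>paths (X \<delta> \<omega>).
      path_start p \<le> ereal r \<and> \<bar>pv p r\<bar> \<le> tanh B \<and> \<bar>pv p (r + \<tau>)\<bar> \<le> tanh B \<longrightarrow>
      (\<exists>y\<in>F. tanh (r - \<tau>) \<le> ps (\<theta> \<delta> y \<omega>) \<and> ps (\<theta> \<delta> y \<omega>) \<le> tanh r \<and>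
        (\<forall>t\<in>{r - \<tau>..r}. \<bar>pv (\<theta> \<delta> y \<omega>) t - pv p r\<bar> \<le> u) \<and>
        \<bar>pv (\<theta> \<delta> y \<omega>) r\<bar> \<le> tanh (B + 2) \<and> pv (\<theta> \<delta> y \<omega>) (r + \<tau>) = pv p (r + \<tau>))"
  let ?mod = "\<lambda>\<delta> \<omega>. \<forall>p\<in>paths (X \<delta> \<omega>). \<forall>v\<in>{-T..T + 1}. \<forall>v'\<in>{v..v + \<tau>}. path_start p \<le> ereal v \<longrightarrow>
      \<bar>pv p v\<bar> \<le> tanh (B + 2) \<longrightarrow> \<bar>pv p v'\<bar> < 1"
  obtain F4 where F4: "finite F4" "F4 \<subseteq> D"
    "\<forall>\<^sub>F \<delta> in at_right 0. whp (M \<delta>) (e / 5) (\<lambda>\<omega>. coalescing (X \<delta> \<omega>) \<longrightarrow> ?mod \<delta> \<omega> \<longrightarrow> ?G F4 \<delta> \<omega>)"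
    using ex_grid[OF g \<tau>(1) \<tau>1 u(1) B T(1)] by blast
  define F where "F = F1 \<union> F2 \<union> F3 \<union> F4"
  have FD: "F \<subseteq> D" using F1 F2 F3 F4 by (simp add: F_def)
  have "\<forall>\<^sub>F \<delta> in at_right 0. whp (M \<delta>) e (\<lambda>\<omega>. \<forall>p\<in>paths (X \<delta> \<omega>). \<exists>y\<in>F. dist p (\<theta> \<delta> y \<omega>) \<le> e)"
    using F1(3) F2(4) F3(4) F4(3) eventually_unit
  proof eventually_elim
    case (elim \<delta>)
    note wh = whp_conj[OF elim(1) whp_conj[OF elim(2) whp_conj[OF elim(3) whp_conj[OF elim(4)
        whp_conj[OF cross[OF elim(5)] whp_AE[OF coal[OF elim(5)]]]]]]]
    show ?case
    proof (rule whp_mono[OF wh], goal_cases)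
      case (2 \<omega>)
      note all = 2(2)
      have net: "\<forall>x\<in>{-1..1}. \<exists>y\<in>F1. tanh T \<le> ps (\<theta> \<delta> y \<omega>) \<and> (\<forall>t\<in>{-T..T}. \<bar>pv (\<theta> \<delta> y \<omega>) t - x\<bar> \<le> e)"
        and up: "\<forall>s\<in>{-T..T}. \<exists>y\<in>F2. tanh (s - e / 2) \<le> ps (\<theta> \<delta> y \<omega>) \<and> ps (\<theta> \<delta> y \<omega>) \<le> tanh s \<and>
          (\<forall>t\<in>{-T..T + 1}. 1 - e \<le> pv (\<theta> \<delta> y \<omega>) t \<and> pv (\<theta> \<delta> y \<omega>) t \<le> tanh (L + 2 * c2))"
        and low: "\<forall>s\<in>{-T..T}. \<exists>y\<in>F3. tanh (s - e / 2) \<le> ps (\<theta> \<delta> y \<omega>) \<and> ps (\<theta> \<delta> y \<omega>) \<le> tanh s \<and>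
          (\<forall>t\<in>{-T..T + 1}. - tanh (L + 2 * c3) \<le> pv (\<theta> \<delta> y \<omega>) t \<and> pv (\<theta> \<delta> y \<omega>) t \<le> - (1 - e))"
        and G: "coalescing (X \<delta> \<omega>) \<longrightarrow> ?mod \<delta> \<omega> \<longrightarrow> ?G F4 \<delta> \<omega>"
        and no: "?cross \<delta> \<omega>" and K: "coalescing (X \<delta> \<omega>)"
        by (rule all[THEN conjunct1], rule all[THEN conjunct2, THEN conjunct1],
          rule all[THEN conjunct2, THEN conjunct2, THEN conjunct1],
          rule all[THEN conjunct2, THEN conjunct2, THEN conjunct2, THEN conjunct1],
          rule all[THEN conjunct2, THEN conjunct2, THEN conjunct2, THEN conjunct2, THEN conjunct1],
          rule all[THEN conjunct2, THEN conjunct2, THEN conjunct2, THEN conjunct2, THEN conjunct2])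
      have modulus: "\<bar>pv p v' - pv p v\<bar> \<le> u \<and> \<bar>pv p v'\<bar> < 1"
        if "p \<in> paths (X \<delta> \<omega>)" "v \<in> {-T..T + 1}" "v' \<in> {v..v + \<tau>}" "path_start p \<le> ereal v"
          "\<bar>pv p v\<bar> \<le> tanh (B + 2)" for p v v'
        using no that T(1)
        by (intro conjI modulus_of_no_crossing[OF \<tau>(1,3), where B = "B + 2" and V = "T + 1" and p = p and v = v])
          (auto simp: abs_le_iff)
      have G': "?G F4 \<delta> \<omega>" using G K modulus by blast
      show ?case
      proof
        fix p assume p: "p \<in> paths (X \<delta> \<omega>)"
        have "\<exists>q\<in>(\<lambda>y. \<theta> \<delta> y \<omega>) ` F. dist p q \<le> e"
        proof (rule skeleton_dense[OF K _ e T \<tau>(1) less_imp_le[OF \<tau>(2)] u(2), where m = "tanh B" and m' = "tanh (B + 2)"])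
          show "(\<lambda>y. \<theta> \<delta> y \<omega>) ` F \<subseteq> paths (X \<delta> \<omega>)"
            using FD \<theta>_paths[OF elim(5) _ 2(1)] by blast
          show "tanh B < 1" by (rule tanh_real_lt_1)
          show "tanh B \<le> tanh (B + 2)" by simp
          show "\<exists>q\<in>(\<lambda>y. \<theta> \<delta> y \<omega>) ` F. tanh T \<le> ps q \<and> (\<forall>t\<in>{-T..T}. \<bar>pv q t - x\<bar> \<le> e)"
            if "x \<in> {-1..1}" for x
            using bspec[OF net that] unfolding F_def by blast
          show "\<exists>q\<in>(\<lambda>y. \<theta> \<delta> y \<omega>) ` F. tanh (s - e / 2) \<le> ps q \<and> ps q \<le> tanh s \<and>
              (\<forall>t\<in>{-T..T + 1}. 1 - e \<le> pv q t \<and> pv q t \<le> tanh B)" if s: "s \<in> {-T..T}" for s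
          proof -
            obtain y where y: "y \<in> F2" "tanh (s - e / 2) \<le> ps (\<theta> \<delta> y \<omega>)" "ps (\<theta> \<delta> y \<omega>) \<le> tanh s"
              "\<And>t. t \<in> {-T..T + 1} \<Longrightarrow> 1 - e \<le> pv (\<theta> \<delta> y \<omega>) t \<and> pv (\<theta> \<delta> y \<omega>) t \<le> tanh (L + 2 * c2)"
              using bspec[OF up s] by blast
            have "1 - e \<le> pv (\<theta> \<delta> y \<omega>) t \<and> pv (\<theta> \<delta> y \<omega>) t \<le> tanh B" if "t \<in> {-T..T + 1}" for t
              using y(4)[OF that] BB(1) by linarith
            then show ?thesis using y(1-3) unfolding F_def by blast
          qed
          show "\<exists>q\<in>(\<lambda>y. \<theta> \<delta> y \<omega>) ` F. tanh (s - e / 2) \<le> ps q \<and> ps q \<le> tanh s \<and>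
              (\<forall>t\<in>{-T..T + 1}. - tanh B \<le> pv q t \<and> pv q t \<le> - (1 - e))" if s: "s \<in> {-T..T}" for s
          proof -
            obtain y where y: "y \<in> F3" "tanh (s - e / 2) \<le> ps (\<theta> \<delta> y \<omega>)" "ps (\<theta> \<delta> y \<omega>) \<le> tanh s"
              "\<And>t. t \<in> {-T..T + 1} \<Longrightarrow> - tanh (L + 2 * c3) \<le> pv (\<theta> \<delta> y \<omega>) t \<and> pv (\<theta> \<delta> y \<omega>) t \<le> - (1 - e)"
              using bspec[OF low s] by blast
            have "- tanh B \<le> pv (\<theta> \<delta> y \<omega>) t \<and> pv (\<theta> \<delta> y \<omega>) t \<le> - (1 - e)" if "t \<in> {-T..T + 1}" for t
              using y(4)[OF that] BB(2) by linarith
            then show ?thesis using y(1-3) unfolding F_def by blast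
          qed
          show "\<bar>pv p v' - pv p v\<bar> \<le> u"
            if "p \<in> paths (X \<delta> \<omega>)" "v \<in> {-T..T + 1}" "v' \<in> {v..v + \<tau>}" "path_start p \<le> ereal v"
              "\<bar>pv p v\<bar> \<le> tanh (B + 2)" for p v v'
            using modulus[OF that] by blast
          show "\<exists>r\<in>{s..s + \<tau>}. \<forall>p\<in>paths (X \<delta> \<omega>).
              path_start p \<le> ereal r \<and> \<bar>pv p r\<bar> \<le> tanh B \<and> \<bar>pv p (r + \<tau>)\<bar> \<le> tanh B \<longrightarrow>
              (\<exists>q\<in>(\<lambda>y. \<theta> \<delta> y \<omega>) ` F. tanh (r - \<tau>) \<le> ps q \<and> ps q \<le> tanh r \<and>
                (\<forall>t\<in>{r - \<tau>..r}. \<bar>pv q t - pv p r\<bar> \<le> u) \<and>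
                \<bar>pv q r\<bar> \<le> tanh (B + 2) \<and> pv q (r + \<tau>) = pv p (r + \<tau>))" if s: "s \<in> {-T..T}" for s
          proof -
            have "\<exists>r\<in>{s..s + \<tau>}. \<forall>p\<in>paths (X \<delta> \<omega>).
              path_start p \<le> ereal r \<and> \<bar>pv p r\<bar> \<le> tanh B \<and> \<bar>pv p (r + \<tau>)\<bar> \<le> tanh B \<longrightarrow>
              (\<exists>y\<in>F4. tanh (r - \<tau>) \<le> ps (\<theta> \<delta> y \<omega>) \<and> ps (\<theta> \<delta> y \<omega>) \<le> tanh r \<and>
                (\<forall>t\<in>{r - \<tau>..r}. \<bar>pv (\<theta> \<delta> y \<omega>) t - pv p r\<bar> \<le> u) \<and>
                \<bar>pv (\<theta> \<delta> y \<omega>) r\<bar> \<le> tanh (B + 2) \<and> pv (\<theta> \<delta> y \<omega>) (r + \<tau>) = pv p (r + \<tau>))"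
              by (rule bspec[OF G' s])
            moreover have "F4 \<subseteq> F" by (auto simp: F_def)
            ultimately show ?thesis by (meson imageI subsetD)
          qed
          show "p \<in> paths (X \<delta> \<omega>)" by (fact p)
        qed
        then show "\<exists>y\<in>F. dist p (\<theta> \<delta> y \<omega>) \<le> e" by blast
      qed
    qed simp
  qed
  then show ?thesis using FD F1(1) F2(2) F3(2) F4(1) by (intro exI[of _ F]) (simp add: F_def)
qed

end

section \<open>Skeletons of the Brownian web\<close>

lemma web_path_eq_after:
  assumes ps: "ps p = ps q" and pv: "\<And>t. ps p < tanh t \<Longrightarrow> pv p t = pv q t" and "ps p < 1"
  shows "p = q"
proof (rule web_path_eqI)
  show start: "path_start p = path_start q" using ps by (simp add: ps_eq_iff)
  fix t
  have closed: "closed {t. pv p t = pv q t}" by (intro closed_Collect_eq continuous_on_pv)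
  show "pv p t = pv q t"
  proof (cases "ps p < tanh t")
    case False
    then have t: "ereal t \<le> path_start p" by (simp add: ps_ge_iff not_less)
    have "path_start p \<noteq> \<infinity>" using \<open>ps p < 1\<close> by (auto simp: ps_def Psi_def tanh_ereal_def)
    with t obtain s where s: "path_start p = ereal s" by (cases "path_start p") auto
    have "{s<..} \<subseteq> {t. pv p t = pv q t}" using pv s by (auto simp: ps_ereal)
    then have "closure {s<..} \<subseteq> {t. pv p t = pv q t}" using closed by (rule closure_minimal)
    then have "pv p s = pv q s" by auto
    moreover have "pv p t = pv p s" "pv q t = pv q s"
      using t s start by (auto intro: pv_before_start)
    ultimately show ?thesis by simp
  qed (rule pv)
qed

text \<open>Compactness of the family supplies a convergent subsequence, so only its limit has to be
  identified; a uniform estimate for the distance to \<open>p\<close> is avoided.\<close>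

lemma limit_in_closure:
  fixes P :: "nat \<Rightarrow> web_path"
  assumes K: "\<And>n. P n \<in> paths K" and S: "\<And>n. P n \<in> S"
    and lim: "\<And>q r. q \<in> paths K \<Longrightarrow> strict_mono r \<Longrightarrow> (\<lambda>n. P (r n)) \<longlonglongrightarrow> q \<Longrightarrow> q = p"
  shows "p \<in> closure S"
proof -
  obtain q r where q: "q \<in> paths K" "strict_mono r" "(P \<circ> r) \<longlonglongrightarrow> q"
    using compact_paths[of K, unfolded compact_def, rule_format, of P] K by blast
  then have "(\<lambda>n. P (r n)) \<longlonglongrightarrow> q" by (simp add: o_def)
  with lim q have "q = p" by blast
  then show ?thesis
    using \<open>(\<lambda>n. P (r n)) \<longlonglongrightarrow> q\<close> S
    unfolding closure_sequential by (intro exI[of _ "\<lambda>n. P (r n)"]) simp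
qed

text \<open>Paths that swap their order meet by the intermediate value theorem and agree afterwards.
  The sign \<sigma> treats upper and lower bounds at once.\<close>

lemma coalesce_from_order:
  assumes "coalesce_from m p q" "m \<le> v" "v \<le> t" "\<sigma> * pv q v \<le> \<sigma> * pv p v" "\<sigma> \<in> {1, -1}"
  shows "\<sigma> * pv q t \<le> \<sigma> * pv p t"
proof (rule ccontr)
  assume neg: "\<not> ?thesis"
  have "\<exists>z. v \<le> z \<and> z \<le> t \<and> \<sigma> * pv p z - \<sigma> * pv q z = 0"
    using assms neg by (intro IVT2' continuous_intros continuous_on_pv) auto
  then obtain z where "v \<le> z" "z \<le> t" "pv p z = pv q z" using assms(5) by auto
  then have "pv p t = pv q t" using assms unfolding coalesce_from_def by (meson order_trans)
  then show False using neg by simp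
qed

section \<open>One realisation of the web\<close>

context
  fixes K :: path_family and \<xi> :: "real \<times> real \<Rightarrow> web_path"
  assumes unique: "\<And>x r. x \<in> \<rat> \<Longrightarrow> r \<in> \<rat> \<Longrightarrow> {p \<in> paths K. starts_at p (x, r)} = {\<xi> (x, r)}"
    and finite_vals: "\<And>x r t. x \<in> \<rat> \<Longrightarrow> r \<in> \<rat> \<Longrightarrow> \<bar>pv (\<xi> (x, r)) t\<bar> < 1"
    and coal: "\<And>x r x' r'. \<lbrakk>x \<in> \<rat>; r \<in> \<rat>; x' \<in> \<rat>; r' \<in> \<rat>\<rbrakk> \<Longrightarrow>
      coalesce_from (max r r') (\<xi> (x, r)) (\<xi> (x', r'))"
    and eta: "\<And>r \<tau> j :: real. \<lbrakk>r \<in> \<rat>; \<tau> \<in> \<rat>; 0 < \<tau>; j \<in> \<nat>; 0 < j\<rbrakk> \<Longrightarrow> finite (eta_points r \<tau> (-j) j K) \<and>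
      (\<forall>y\<in>eta_points r \<tau> (-j) j K. \<exists>x\<in>\<rat> \<inter> {-j..j}. pv (\<xi> (x, r)) (r + \<tau>) = tanh y)"
    and barrier: "\<And>\<sigma> n :: real. \<lbrakk>\<sigma> \<in> {1, -1}; n \<in> \<nat>; 0 < n\<rbrakk> \<Longrightarrow>
      \<exists>x\<in>\<rat>. \<forall>t\<in>{-n..n}. tanh n \<le> \<sigma> * pv (\<xi> (x, - n)) t"
begin

lemma \<xi>_paths:
  assumes "x \<in> \<rat>" "r \<in> \<rat>"
  shows "\<xi> (x, r) \<in> paths K" "ps (\<xi> (x, r)) = tanh r" "pv (\<xi> (x, r)) r = tanh x" "path_start (\<xi> (x, r)) = ereal r"
proof -
  have "\<xi> (x, r) \<in> {p \<in> paths K. starts_at p (x, r)}" using unique[OF assms] by simp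
  then show "\<xi> (x, r) \<in> paths K" "ps (\<xi> (x, r)) = tanh r" "pv (\<xi> (x, r)) r = tanh x"
    "path_start (\<xi> (x, r)) = ereal r" by (auto simp: starts_at_iff ps_ereal)
qed

text \<open>At each rational time after \<open>r\<close>, \<open>eta\<close> gives a skeleton path
  from time \<open>r\<close> at the position of \<open>p\<close>, possibly a different one for each
  time. At a time \<open>r0\<close> shortly after \<open>r\<close> only finitely many positions are
  left, so by coalescence finitely many skeleton paths suffice for all later times. Switching
  between them is excluded by connectedness.\<close>

lemma follows_skeleton:
  assumes p: "p \<in> paths K" and r: "r \<in> \<rat>" "path_start p \<le> ereal r" "\<bar>pv p r\<bar> < 1" and \<tau>: "0 < \<tau>"
  shows "\<exists>x\<in>\<rat>. \<forall>t\<ge>r + \<tau>. pv p t = pv (\<xi> (x, r)) t"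
proof -
  obtain d where d: "0 < d" "\<And>t. dist t r < d \<Longrightarrow> dist (pv p t) (pv p r) < 1 - \<bar>pv p r\<bar>"
    using continuous_on_pv[of UNIV p] r(3) unfolding continuous_on_iff
    by (metis UNIV_I diff_gt_0_iff_gt)
  obtain \<tau>0 where \<tau>0: "\<tau>0 \<in> \<rat>" "0 < \<tau>0" "\<tau>0 < min d \<tau>"
    using Rats_dense_in_real[of 0 "min d \<tau>"] d(1) \<tau> by auto
  define r0 where "r0 = r + \<tau>0"
  have r0: "r0 \<in> \<rat>" "r < r0" "r0 < r + \<tau>" using \<tau>0 r(1) by (auto simp: r0_def)
  have fin0: "\<bar>pv p r0\<bar> < 1"
    using d(2)[of r0] \<tau>0 by (auto simp: r0_def dist_real_def)
  obtain x0 where x0: "pv p r = tanh x0" using r(3) pv_real by blast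
  obtain j0 :: nat where j0: "\<bar>x0\<bar> < j0" using reals_Archimedean2 by blast
  define j where "j = real j0"
  have j: "j \<in> \<nat>" "0 < j" "x0 \<in> {-j..j}" using j0 by (auto simp: j_def)
  have touch_r: "touches p (x0, r)" using r(2) x0 by (simp add: touches_iff)
  have point: "y \<in> eta_points r t (-j) j K" if "pv p (r + t) = tanh y" "0 \<le> t" for y t
    unfolding eta_points_def using p touch_r j(3) that r(2)
    by (auto simp: touches_iff intro!: bexI[of _ p] intro: order_trans[of _ "ereal r"])
  define Y where "Y = eta_points r \<tau>0 (-j) j K"
  have Y: "finite Y" "\<forall>y\<in>Y. \<exists>x. x \<in> \<rat> \<inter> {-j..j} \<and> pv (\<xi> (x, r)) r0 = tanh y"
    unfolding Y_def r0_def using eta[OF r(1) \<tau>0(1,2) j(1,2)] by blast+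
  obtain f where f: "\<And>y. y \<in> Y \<Longrightarrow> f y \<in> \<rat> \<inter> {-j..j} \<and> pv (\<xi> (f y, r)) r0 = tanh y"
    using bchoice[OF Y(2)] by blast
  define F where "F = f ` Y"
  have F: "finite F" "F \<subseteq> \<rat>" using Y f by (auto simp: F_def)
  have coalF: "pv (\<xi> (x, r)) t' = pv (\<xi> (x', r)) t'"
    if "x \<in> \<rat>" "x' \<in> \<rat>" "pv (\<xi> (x, r)) t = pv (\<xi> (x', r)) t" "r \<le> t" "t \<le> t'" for x x' t t'
    using coal[OF that(1) r(1) that(2) r(1)] that(3-5) unfolding coalesce_from_def by auto
  define C where "C x = {t. pv p t = pv (\<xi> (x, r)) t}" for x
  have C: "closed (C x)" for x unfolding C_def by (intro closed_Collect_eq continuous_on_pv)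
  define I where "I = {t. \<bar>pv p t\<bar> = 1}"
  have I: "closed I" unfolding I_def by (intro closed_Collect_eq continuous_intros continuous_on_pv)
  \<comment> \<open>The skeleton path through \<open>p\<close> at time \<open>s\<close> has already
    merged at time \<open>r0\<close> with one of the finitely many paths indexed by
    \<open>F\<close>.\<close>
  have rat: "s \<in> (\<Union>x\<in>F. C x) \<union> I" if s: "s \<in> \<rat>" "r0 \<le> s" for s
  proof (cases "\<bar>pv p s\<bar> = 1")
    case False
    then have "\<bar>pv p s\<bar> < 1" using abs_pv_le_1[of p s] by linarith
    then obtain y where y: "pv p s = tanh y" using pv_real by blast
    have "s - r \<in> \<rat>" "0 < s - r" using s r0 r(1) by auto
    then obtain x where x: "x \<in> \<rat>" "x \<in> {-j..j}" "pv (\<xi> (x, r)) s = tanh y"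
      using eta[OF r(1) _ _ j(1,2), of "s - r"] point[of "s - r" y] y by auto
    obtain y' where y': "pv (\<xi> (x, r)) r0 = tanh y'"
      using finite_vals[OF x(1) r(1)] pv_real by blast
    have "y' \<in> Y"
      unfolding Y_def eta_points_def using \<xi>_paths[OF x(1) r(1)] x(2) y' r0(2)
      by (auto simp: touches_iff r0_def intro!: bexI[of _ "\<xi> (x, r)"] bexI[of _ x])
    then have "pv (\<xi> (x, r)) s = pv (\<xi> (f y', r)) s"
      using f[of y'] y' x(1) r0(2) s(2) by (intro coalF[of x "f y'" r0 s]) auto
    then show ?thesis using y x(3) \<open>y' \<in> Y\<close> by (auto simp: C_def F_def)
  qed (simp add: I_def)
  have cover: "s \<in> (\<Union>x\<in>F. C x) \<union> I" if s: "r0 \<le> s" for s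
  proof (cases "s = r0")
    case False
    have "closed ((\<Union>x\<in>F. C x) \<union> I)" using F C I by (intro closed_Un closed_UN) auto
    moreover have "{r0<..} \<inter> \<rat> \<subseteq> (\<Union>x\<in>F. C x) \<union> I"
    proof
      fix s assume "s \<in> {r0<..} \<inter> \<rat>"
      then have "s \<in> \<rat>" "r0 \<le> s" by auto
      then show "s \<in> (\<Union>x\<in>F. C x) \<union> I" by (rule rat)
    qed
    ultimately have "closure ({r0<..} \<inter> \<rat>) \<subseteq> (\<Union>x\<in>F. C x) \<union> I" by (intro closure_minimal)
    moreover have "s \<in> {r0<..}" using s False by simp
    ultimately show ?thesis using closure_rat_Int_open[OF open_greaterThan, of r0] by blast
  qed (use rat r0 in auto)
  obtain y0 where y0: "pv p r0 = tanh y0" using fin0 pv_real by blast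
  have "y0 \<in> Y" unfolding Y_def using point[of \<tau>0 y0] y0 \<tau>0(2) by (simp add: r0_def)
  define x where "x = f y0"
  have x: "x \<in> F" "x \<in> \<rat>" "r0 \<in> C x" using f[OF \<open>y0 \<in> Y\<close>] \<open>y0 \<in> Y\<close> y0 by (auto simp: x_def F_def C_def)
  have "pv p s = pv (\<xi> (x, r)) s" if s: "r0 \<le> s" for s
  proof -
    \<comment> \<open>The interval \<open>[r0, s]\<close> is covered by two closed sets: times at
      which \<open>p\<close> is on a path that has joined the path from \<open>x\<close> by time
      \<open>s\<close>, and times at which it is on another path or at infinity. A common time would
      make two of these paths coalesce, so the sets are disjoint; the first contains
      \<open>r0\<close>, hence also \<open>s\<close>.\<close>
    define A where "A = (\<Union>x'\<in>{x' \<in> F. pv (\<xi> (x', r)) s = pv (\<xi> (x, r)) s}. C x')"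
    define B where "B = (\<Union>x'\<in>{x' \<in> F. pv (\<xi> (x', r)) s \<noteq> pv (\<xi> (x, r)) s}. C x') \<union> I"
    have "closed A" "closed B"
      unfolding A_def B_def using F C I by (intro closed_Un closed_UN; auto)+
    moreover have "{r0..s} \<subseteq> A \<union> B" using cover unfolding A_def B_def by fastforce
    moreover have "A \<inter> B \<inter> {r0..s} = {}"
    proof (rule ccontr)
      assume "A \<inter> B \<inter> {r0..s} \<noteq> {}"
      then obtain t where tA: "t \<in> A" and tB: "t \<in> B" and tI: "t \<in> {r0..s}" by blast
      from tA obtain x1 where "x1 \<in> F" "pv (\<xi> (x1, r)) s = pv (\<xi> (x, r)) s" "pv p t = pv (\<xi> (x1, r)) t"
        unfolding A_def C_def by blast
      note t = tI this tB
      have "t \<notin> I" using finite_vals[of x1 r t] t(2,4) F(2) r(1) by (auto simp: I_def)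
      then obtain x2 where x2: "x2 \<in> F" "pv (\<xi> (x2, r)) s \<noteq> pv (\<xi> (x, r)) s" "pv p t = pv (\<xi> (x2, r)) t"
        using t(5) by (auto simp: B_def C_def)
      have "pv (\<xi> (x1, r)) s = pv (\<xi> (x2, r)) s"
        using t x2 F(2) r0(2) by (intro coalF[of x1 x2 t s]) auto
      then show False using t(3) x2(2) by simp
    qed
    moreover have "A \<inter> {r0..s} \<noteq> {}" using x s unfolding A_def by (auto simp: C_def)
    ultimately have "B \<inter> {r0..s} = {}"
      using connected_Icc[of r0 s] unfolding connected_closed by blast
    moreover have "s \<in> {r0..s}" using s by simp
    ultimately have "s \<in> A" using \<open>{r0..s} \<subseteq> A \<union> B\<close> by blast
    then show ?thesis by (auto simp: A_def C_def)
  qed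
  then show ?thesis using x(2) r0(3) by (intro bexI[of _ x]) auto
qed

text \<open>Stated for \<open>ps\<close> rather than for the starting time, so that a start at
  -\<infinity> is included. The margin \<open>1 / Suc k\<close> is the delay after which a skeleton
  path follows \<open>p\<close>.\<close>

lemma eventually_after_start:
  assumes "ps p < tanh t" "\<And>k :: nat. ps p < tanh (s k)" "(\<lambda>k. tanh (s k)) \<longlonglongrightarrow> ps p"
  shows "\<forall>\<^sub>F k in sequentially. s k + 1 / Suc k < t"
proof -
  obtain z where z: "max (-1) (ps p) < z" "z < tanh t"
    using dense[of "max (-1) (ps p)" "tanh t"] assms(1) tanh_real_gt_neg1[of t] by auto
  then have "\<bar>z\<bar> < 1" using tanh_real_lt_1[of t] by auto
  then obtain t' where t': "z = tanh t'" by (rule surj_tanh)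
  have "t' < t" using z(2) t' by simp
  have "\<forall>\<^sub>F k in sequentially. tanh (s k) < z"
    using order_tendstoD(2)[OF assms(3)] z(1) by auto
  moreover have "\<forall>\<^sub>F k in sequentially. 1 / real (Suc k) < t - t'"
    using \<open>t' < t\<close> by (intro order_tendstoD(2)[OF LIMSEQ_Suc[OF lim_1_over_n]]) auto
  ultimately show ?thesis
    by eventually_elim (auto simp: t')
qed

lemma ex_rat_times:
  assumes "\<And>\<eta>. 0 < \<eta> \<Longrightarrow> \<exists>r\<in>\<rat>. ps p < tanh r \<and> tanh r < ps p + \<eta> \<and> Q r"
  shows "\<exists>s :: nat \<Rightarrow> real. (\<forall>k. s k \<in> \<rat> \<and> ps p < tanh (s k) \<and> Q (s k)) \<and> (\<lambda>k. tanh (s k)) \<longlonglongrightarrow> ps p"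
proof -
  have "\<forall>k :: nat. \<exists>r. r \<in> \<rat> \<and> ps p < tanh r \<and> tanh r < ps p + 1 / Suc k \<and> Q r"
    using assms[of "1 / Suc k" for k :: nat] by auto
  from choice[OF this] obtain s :: "nat \<Rightarrow> real" where
    s: "\<And>k. s k \<in> \<rat> \<and> ps p < tanh (s k) \<and> tanh (s k) < ps p + 1 / Suc k \<and> Q (s k)"
    by blast
  have le: "ps p \<le> tanh (s k)" "tanh (s k) \<le> ps p + 1 / Suc k" for k
    using s[of k] by auto
  have "(\<lambda>k. ps p + 1 / real (Suc k)) \<longlonglongrightarrow> ps p + 0"
    by (intro tendsto_intros LIMSEQ_Suc[OF lim_1_over_n])
  then have lim: "(\<lambda>k. ps p + 1 / real (Suc k)) \<longlonglongrightarrow> ps p" by simp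
  have "(\<lambda>k. tanh (s k)) \<longlonglongrightarrow> ps p"
    by (rule real_tendsto_sandwich[OF always_eventually always_eventually tendsto_const lim])
      (rule allI, rule le)+
  then show ?thesis using s by blast
qed

text \<open>From rational times \<open>s k\<close> decreasing towards the start, \<open>p\<close>
  follows a skeleton path after a delay of \<open>1 / Suc k\<close>. A limit of these paths has the
  start of \<open>p\<close> and agrees with \<open>p\<close> at every later time.\<close>

lemma dense_if_finite_near_start:
  assumes p: "p \<in> paths K" "ps p < 1"
    and near: "\<And>\<eta>. 0 < \<eta> \<Longrightarrow> \<exists>r\<in>\<rat>. ps p < tanh r \<and> tanh r < ps p + \<eta> \<and> \<bar>pv p r\<bar> < 1"
  shows "p \<in> closure (\<xi> ` (\<rat> \<times> \<rat>))"
proof -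
  obtain s where s: "\<And>k. s k \<in> \<rat>" "\<And>k. ps p < tanh (s k)" "\<And>k. \<bar>pv p (s k)\<bar> < 1"
    "(\<lambda>k :: nat. tanh (s k)) \<longlonglongrightarrow> ps p"
    using ex_rat_times[OF near] by blast
  have "\<exists>x\<in>\<rat>. \<forall>t\<ge>s k + 1 / Suc k. pv p t = pv (\<xi> (x, s k)) t" for k
    using s(2)[of k] by (intro follows_skeleton p s) (auto simp: ps_less_iff intro: less_imp_le)
  then obtain x where x: "\<And>k. x k \<in> \<rat>" "\<And>k t. s k + 1 / Suc k \<le> t \<Longrightarrow> pv p t = pv (\<xi> (x k, s k)) t"
    by metis
  show ?thesis
  proof (rule limit_in_closure[where P = "\<lambda>k. \<xi> (x k, s k)" and K = K])
    fix q r assume q: "strict_mono (r :: nat \<Rightarrow> nat)" "(\<lambda>n. \<xi> (x (r n), s (r n))) \<longlonglongrightarrow> q"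
    have "(\<lambda>n. tanh (s (r n))) \<longlonglongrightarrow> ps q"
      using tendsto_ps[OF q(2)] \<xi>_paths(2)[OF x(1) s(1)] by simp
    moreover have "(\<lambda>n. tanh (s (r n))) \<longlonglongrightarrow> ps p"
      using LIMSEQ_subseq_LIMSEQ[OF s(4) q(1)] by (simp add: o_def)
    ultimately have ps: "ps q = ps p" by (rule LIMSEQ_unique)
    have "pv q t = pv p t" if t: "ps q < tanh t" for t
    proof -
      have "\<forall>\<^sub>F k in sequentially. s k + 1 / Suc k < t"
        using t s(2,4) ps by (intro eventually_after_start[of p]) auto
      from eventually_subseq[OF q(1) this]
      have "\<forall>\<^sub>F n in sequentially. pv (\<xi> (x (r n), s (r n))) t = pv p t"
        by (rule eventually_mono) (intro x(2)[symmetric] less_imp_le)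
      then have "(\<lambda>n. pv (\<xi> (x (r n), s (r n))) t) \<longlonglongrightarrow> pv p t"
        by (rule tendsto_eventually)
      moreover have "(\<lambda>n. pv (\<xi> (x (r n), s (r n))) t) \<longlonglongrightarrow> pv q t"
        by (rule tendsto_pv[OF q(2) tendsto_const])
      ultimately show ?thesis using LIMSEQ_unique by blast
    qed
    then show "q = p" using ps p(2) by (intro web_path_eq_after) auto
  qed (use \<xi>_paths x s in auto)
qed

text \<open>Suppose that the path comes back from infinity. Just after the last time
  \<open>ts\<close> at infinity it is finite but beyond a barrier path chosen to lie farther out
  than its position at \<open>t1\<close>. From a rational time on it follows a skeleton path, which
  cannot cross the barrier, so it is beyond the barrier at \<open>t1\<close> too.\<close>

lemma infinite_forever:
  assumes p: "p \<in> paths K" and \<sigma>: "\<sigma> \<in> {1, -1}" and start: "ps p < tanh c" "pv p c = \<sigma>" "c \<le> t1"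
  shows "pv p t1 = \<sigma>"
proof (rule ccontr)
  assume ne: "pv p t1 \<noteq> \<sigma>"
  define A where "A = {t \<in> {c..t1}. pv p t = \<sigma>}"
  have "closed A" unfolding A_def
    using continuous_closed_preimage_constant[OF continuous_on_pv closed_atLeastAtMost] by blast
  moreover have "A \<noteq> {}" "bdd_above A" using start by (auto simp: A_def intro!: bdd_aboveI[of _ t1])
  ultimately have "Sup A \<in> A" by (intro closed_contains_Sup)
  define ts where "ts = Sup A"
  have ts: "c \<le> ts" "ts < t1" "pv p ts = \<sigma>"
    using \<open>Sup A \<in> A\<close> ne by (auto simp: ts_def A_def order_less_le)
  have after: "pv p t \<noteq> \<sigma>" if "ts < t" "t \<le> t1" for t
  proof
    assume "pv p t = \<sigma>"
    then have "t \<le> ts" unfolding ts_def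
      using that ts(1) \<open>bdd_above A\<close> by (intro cSup_upper) (auto simp: A_def)
    then show False using that by simp
  qed
  have "\<sigma> * pv p t1 < 1" using ne \<sigma> abs_pv_le_1[of p t1] by auto
  then have "\<forall>\<^sub>F n in at_top. \<sigma> * pv p t1 < tanh n"
    by (rule order_tendstoD(1)[OF tanh_real_at_top])
  then obtain n0 where n0: "\<And>n. n0 \<le> n \<Longrightarrow> \<sigma> * pv p t1 < tanh n"
    by (auto simp: eventually_at_top_linorder)
  obtain m :: nat where m: "max n0 (max \<bar>ts\<bar> \<bar>t1\<bar>) < m" using reals_Archimedean2 by blast
  define n where "n = real m"
  have n: "n \<in> \<nat>" "0 < n" "\<sigma> * pv p t1 < tanh n" "- n < ts" "t1 < n"
  proof -
    have "n0 < n" "\<bar>ts\<bar> < n" "\<bar>t1\<bar> < n" using m by (simp_all add: n_def)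
    then show "0 < n" "\<sigma> * pv p t1 < tanh n" "- n < ts" "t1 < n"
      using n0[of n] by linarith+
  qed (simp add: n_def)
  obtain x where x: "x \<in> \<rat>" "\<And>t. t \<in> {-n..n} \<Longrightarrow> tanh n \<le> \<sigma> * pv (\<xi> (x, - n)) t"
    using barrier[OF \<sigma> n(1,2)] by blast
  have nQ: "- n \<in> \<rat>" by (simp add: n_def)
  let ?\<beta> = "\<xi> (x, - n)"
  have "\<sigma> * pv ?\<beta> ts < \<sigma> * pv p ts"
    using finite_vals[OF x(1) nQ, of ts] ts(3) \<sigma> by auto
  then have pos: "0 < \<sigma> * pv p ts - \<sigma> * pv ?\<beta> ts" by simp
  have "continuous_on UNIV (\<lambda>t. \<sigma> * pv p t - \<sigma> * pv ?\<beta> t)"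
    by (intro continuous_intros continuous_on_pv)
  from this[unfolded continuous_on_iff, rule_format, OF UNIV_I pos]
  obtain d where d: "0 < d" "\<And>t. dist t ts < d \<Longrightarrow>
      dist (\<sigma> * pv p t - \<sigma> * pv ?\<beta> t) (\<sigma> * pv p ts - \<sigma> * pv ?\<beta> ts) < \<sigma> * pv p ts - \<sigma> * pv ?\<beta> ts"
    by blast
  have above: "\<sigma> * pv ?\<beta> t < \<sigma> * pv p t" if "dist t ts < d" for t
    using d(2)[OF that] by (simp add: dist_real_def abs_less_iff)
  define v where "v = min t1 (ts + d / 2)"
  have v: "ts < v" "v \<le> t1" "v < ts + d" using ts d(1) by (auto simp: v_def)
  \<comment> \<open>Finiteness at \<open>r\<close> allows \<open>follows_skeleton\<close> to be
    applied from there on; by time \<open>v\<close>, still beyond the barrier, the skeleton path has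
    taken over.\<close>
  obtain r where r: "r \<in> \<rat>" "ts < r" "r < v" using Rats_dense_in_real[OF v(1)] by blast
  have fin: "\<bar>pv p r\<bar> < 1"
  proof -
    have "tanh n \<le> \<sigma> * pv ?\<beta> r" using r v n by (intro x(2)) auto
    moreover have "0 < tanh n" using n(2) by simp
    moreover have "\<sigma> * pv ?\<beta> r < \<sigma> * pv p r" using r v by (intro above) (simp add: dist_real_def)
    ultimately have "0 < \<sigma> * pv p r" by linarith
    then show ?thesis using after[of r] r v abs_pv_le_1[of p r] \<sigma> by auto
  qed
  have "path_start p \<le> ereal c" using start(1) by (simp add: ps_less_iff)
  then have "path_start p \<le> ereal r" using ts r by (auto intro: order_trans[of _ "ereal c"])
  from follows_skeleton[OF p r(1) this fin, of "v - r"] r(3)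
  obtain x' where x': "x' \<in> \<rat>" "\<And>t. v \<le> t \<Longrightarrow> pv p t = pv (\<xi> (x', r)) t" by auto
  have "\<sigma> * pv ?\<beta> t1 \<le> \<sigma> * pv (\<xi> (x', r)) t1"
  proof (rule coalesce_from_order[OF coal[OF x'(1) r(1) x(1) nQ] _ v(2) _ \<sigma>])
    show "max r (- n) \<le> v" using r v n by auto
    show "\<sigma> * pv ?\<beta> v \<le> \<sigma> * pv (\<xi> (x', r)) v"
      using above[of v] v x'(2)[of v] by (auto simp: dist_real_def)
  qed
  moreover have "tanh n \<le> \<sigma> * pv ?\<beta> t1" using n ts by (intro x(2)) auto
  ultimately show False using n(3) x'(2)[OF v(2)] by simp
qed

text \<open>A barrier starts at time \<open>-n\<close>, far from the start of \<open>p\<close>.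
  Instead a skeleton path is started near the start of \<open>p\<close> and beyond the barrier; by
  coalescence it stays beyond. With barriers moving to infinity these paths approximate
  \<open>p\<close>.\<close>

lemma dense_if_infinite:
  assumes p: "p \<in> paths K" "ps p < 1" and \<sigma>: "\<sigma> \<in> {1, -1}"
    and inf: "\<And>t. ps p < tanh t \<Longrightarrow> pv p t = \<sigma>"
  shows "p \<in> closure (\<xi> ` (\<rat> \<times> \<rat>))"
proof -
  have "\<exists>r\<in>\<rat>. ps p < tanh r \<and> tanh r < ps p + \<eta> \<and> True" if "0 < \<eta>" for \<eta>
  proof -
    have lt: "ps p < min 1 (ps p + \<eta>)" using p(2) that by simp
    obtain z1 where z1: "ps p < z1" "z1 < min 1 (ps p + \<eta>)" using dense[OF lt] by blast
    obtain z2 where z2: "z1 < z2" "z2 < min 1 (ps p + \<eta>)" using dense[OF z1(2)] by blast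
    have "\<bar>z1\<bar> < 1" "\<bar>z2\<bar> < 1" using z1 z2 abs_ps_le_1[of p] by auto
    then obtain a b where ab: "z1 = tanh a" "z2 = tanh b" by (meson surj_tanh)
    then have "a < b" using z2(1) by simp
    then obtain r where "r \<in> \<rat>" "a < r" "r < b" using Rats_dense_in_real by blast
    moreover have "tanh a < tanh r" "tanh r < tanh b" using \<open>a < r\<close> \<open>r < b\<close> by simp_all
    moreover have "ps p < tanh a" "tanh b < ps p + \<eta>" using z1 z2 ab by simp_all
    ultimately show ?thesis using less_trans by blast
  qed
  then obtain s where s: "\<And>k. s k \<in> \<rat>" "\<And>k. ps p < tanh (s k)" "(\<lambda>k :: nat. tanh (s k)) \<longlonglongrightarrow> ps p"
    using ex_rat_times[of p "\<lambda>_. True"] by blast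
  have "\<exists>x\<in>\<rat>. \<forall>t\<in>{s k..real k}. tanh (real k) \<le> \<sigma> * pv (\<xi> (x, s k)) t" for k
  proof -
    obtain m :: nat where m: "max (real k) \<bar>s k\<bar> < m" using reals_Archimedean2 by blast
    define n where "n = real m"
    have n: "n \<in> \<nat>" "0 < n" "real k < n" "\<bar>s k\<bar> < n" "- n \<in> \<rat>" using m by (auto simp: n_def)
    obtain x where x: "x \<in> \<rat>" "\<And>t. t \<in> {-n..n} \<Longrightarrow> tanh n \<le> \<sigma> * pv (\<xi> (x, - n)) t"
      using barrier[OF \<sigma> n(1,2)] by blast
    have "\<bar>\<sigma> * pv (\<xi> (x, - n)) (s k)\<bar> < 1"
      using finite_vals[OF x(1) n(5), of "s k"] \<sigma> by auto
    then obtain y where y: "\<sigma> * pv (\<xi> (x, - n)) (s k) = tanh y" by (rule surj_tanh)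
    \<comment> \<open>A rational position beyond that of the barrier at time
      \<open>s k\<close>.\<close>
    obtain z where z: "z \<in> \<rat>" "y < z" using Rats_dense_in_real[of y "y + 1"] by auto
    have \<sigma>z: "\<sigma> * z \<in> \<rat>" using \<sigma> z(1) by auto
    have "tanh n \<le> \<sigma> * pv (\<xi> (\<sigma> * z, s k)) t" if t: "t \<in> {s k..real k}" for t
    proof -
      have "tanh n \<le> \<sigma> * pv (\<xi> (x, - n)) t" using t n by (intro x(2)) auto
      also have "\<dots> \<le> \<sigma> * pv (\<xi> (\<sigma> * z, s k)) t"
      proof (rule coalesce_from_order[OF coal[OF \<sigma>z s(1) x(1) n(5)] _ _ _ \<sigma>])
        show "max (s k) (- n) \<le> s k" "s k \<le> t" using n t by auto
        show "\<sigma> * pv (\<xi> (x, - n)) (s k) \<le> \<sigma> * pv (\<xi> (\<sigma> * z, s k)) (s k)"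
          using \<xi>_paths(3)[OF \<sigma>z s(1)] y z(2) \<sigma> by auto
      qed
      finally show ?thesis .
    qed
    moreover have "tanh (real k) \<le> tanh n" using n(3) by simp
    ultimately show ?thesis using \<sigma>z by (meson order_trans)
  qed
  then obtain x where x: "\<And>k. x k \<in> \<rat>" "\<And>k t. t \<in> {s k..real k} \<Longrightarrow> tanh (real k) \<le> \<sigma> * pv (\<xi> (x k, s k)) t"
    by metis
  show ?thesis
  proof (rule limit_in_closure[where P = "\<lambda>k. \<xi> (x k, s k)" and K = K])
    fix q r assume q: "strict_mono (r :: nat \<Rightarrow> nat)" "(\<lambda>n. \<xi> (x (r n), s (r n))) \<longlonglongrightarrow> q"
    have "(\<lambda>n. tanh (s (r n))) \<longlonglongrightarrow> ps q"
      using tendsto_ps[OF q(2)] \<xi>_paths(2)[OF x(1) s(1)] by simp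
    moreover have "(\<lambda>n. tanh (s (r n))) \<longlonglongrightarrow> ps p"
      using LIMSEQ_subseq_LIMSEQ[OF s(3) q(1)] by (simp add: o_def)
    ultimately have ps: "ps q = ps p" by (rule LIMSEQ_unique)
    have "pv q t = pv p t" if t: "ps q < tanh t" for t
    proof -
      have "\<forall>\<^sub>F k in sequentially. s k + 1 / Suc k < t"
        using t s(2,3) ps by (intro eventually_after_start[of p]) auto
      moreover have "\<forall>\<^sub>F k in sequentially. t \<le> real k"
        using filterlim_real_sequentially by (simp add: filterlim_at_top)
      ultimately have "\<forall>\<^sub>F k in sequentially. tanh (real k) \<le> \<sigma> * pv (\<xi> (x k, s k)) t"
      proof eventually_elim
        case (elim k)
        have "0 < 1 / real (Suc k)" by simp
        then have "s k \<le> t" using elim(1) by linarith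
        then show ?case using elim(2) by (intro x(2)) simp
      qed
      then have "\<forall>\<^sub>F n in sequentially. tanh (real (r n)) \<le> \<sigma> * pv (\<xi> (x (r n), s (r n))) t"
        by (rule eventually_subseq[OF q(1)])
      moreover have "(\<lambda>n. tanh (real (r n))) \<longlonglongrightarrow> 1"
        using filterlim_compose[OF filterlim_compose[OF tanh_real_at_top filterlim_real_sequentially]
            filterlim_subseq[OF q(1)]] .
      moreover have "(\<lambda>n. \<sigma> * pv (\<xi> (x (r n), s (r n))) t) \<longlonglongrightarrow> \<sigma> * pv q t"
        by (intro tendsto_intros tendsto_pv[OF q(2) tendsto_const])
      ultimately have "1 \<le> \<sigma> * pv q t"
        using tendsto_le[OF sequentially_bot] by blast
      then have "pv q t = \<sigma>" using \<sigma> abs_pv_le_1[of q t] by auto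
      then show ?thesis using inf t ps by simp
    qed
    then show "q = p" using ps p(2) by (intro web_path_eq_after) auto
  qed (use \<xi>_paths x s in auto)
qed

text \<open>At all real times the path is constant. It is approximated by skeleton paths from time
  \<open>k\<close>, whose extensions are constant before \<open>k\<close>, with starting values
  tending to the constant.\<close>

lemma dense_if_start_infinite:
  assumes p: "ps p = 1"
  shows "p \<in> closure (\<xi> ` (\<rat> \<times> \<rat>))"
proof -
  have start: "path_start p = \<infinity>"
    using p tanh_real_lt_1 by (cases "path_start p") (auto simp: ps_def Psi_def tanh_ereal_def less_le)
  have const: "pv p t = pv p 0" for t using start by (intro pv_before_start) auto
  have "\<exists>x\<in>\<rat>. \<bar>tanh x - pv p 0\<bar> \<le> 1 / Suc k" for k :: nat
  proof -
    \<comment> \<open>The constant may be 1 or -1, so it is first moved into the range of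
      \<open>tanh\<close>.\<close>
    define z where "z = pv p 0 * (1 - 1 / (2 * Suc k))"
    have "pv p 0 - z = pv p 0 * (1 / (2 * Suc k))" by (simp add: z_def algebra_simps)
    then have "\<bar>pv p 0 - z\<bar> \<le> 1 * (1 / (2 * Suc k))"
      using abs_pv_le_1[of p 0] by (simp only: abs_mult) (intro mult_mono, auto)
    have "\<bar>z\<bar> \<le> 1 * (1 - 1 / (2 * Suc k))"
      unfolding z_def abs_mult using abs_pv_le_1[of p 0] by (intro mult_mono) auto
    also have "\<dots> < 1" by simp
    finally obtain y where y: "z = tanh y" by (rule surj_tanh)
    obtain x where x: "x \<in> \<rat>" "y < x" "x < y + 1 / (2 * Suc k)"
      using Rats_dense_in_real[of y "y + 1 / (2 * Suc k)"] by auto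
    have 1: "\<bar>tanh x - z\<bar> \<le> 1 / (2 * Suc k)"
      using abs_tanh_diff_le[of x y] x y by auto
    have "\<bar>tanh x - pv p 0\<bar> \<le> \<bar>tanh x - z\<bar> + \<bar>pv p 0 - z\<bar>" by linarith
    also note add_mono[OF 1 \<open>\<bar>pv p 0 - z\<bar> \<le> 1 * (1 / (2 * Suc k))\<close>]
    also have "1 / (2 * Suc k) + 1 * (1 / (2 * Suc k)) = 1 / real (Suc k)" by (simp add: field_simps)
    finally have "\<bar>tanh x - pv p 0\<bar> \<le> 1 / Suc k" .
    then show ?thesis using x(1) by blast
  qed
  then obtain x where x: "\<And>k. x k \<in> \<rat>" "\<And>k :: nat. \<bar>tanh (x k) - pv p 0\<bar> \<le> 1 / Suc k" by metis
  have lim_x: "(\<lambda>k. tanh (x k)) \<longlonglongrightarrow> pv p 0"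
  proof -
    have "(\<lambda>k. tanh (x k) - pv p 0) \<longlonglongrightarrow> 0"
      by (rule Lim_null_comparison[OF _ LIMSEQ_Suc[OF lim_1_over_n]]) (use x(2) in auto)
    then show ?thesis by (simp add: LIM_zero_iff)
  qed
  have kQ: "real k \<in> \<rat>" for k by simp
  show ?thesis
  proof (rule limit_in_closure[where P = "\<lambda>k. \<xi> (x k, real k)" and K = K])
    fix q r assume q: "strict_mono (r :: nat \<Rightarrow> nat)" "(\<lambda>n. \<xi> (x (r n), real (r n))) \<longlonglongrightarrow> q"
    have "(\<lambda>n. tanh (real (r n))) \<longlonglongrightarrow> 1"
      using filterlim_compose[OF filterlim_compose[OF tanh_real_at_top filterlim_real_sequentially]
          filterlim_subseq[OF q(1)]] .
    moreover have "(\<lambda>n. tanh (real (r n))) \<longlonglongrightarrow> ps q"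
      using tendsto_ps[OF q(2)] \<xi>_paths(2)[OF x(1) kQ] by simp
    ultimately have ps: "ps q = ps p" using LIMSEQ_unique p by metis
    have "pv q t = pv p t" for t
    proof -
      have "\<forall>\<^sub>F k in sequentially. t \<le> real k"
        using filterlim_real_sequentially by (simp add: filterlim_at_top)
      then have "\<forall>\<^sub>F k in sequentially. tanh (x k) = pv (\<xi> (x k, real k)) t"
      proof eventually_elim
        case (elim k)
        have "pv (\<xi> (x k, real k)) t = pv (\<xi> (x k, real k)) (real k)"
          using elim \<xi>_paths(4)[OF x(1) kQ] by (intro pv_before_start) auto
        then show ?case using \<xi>_paths(3)[OF x(1) kQ] by simp
      qed
      from eventually_subseq[OF q(1) this]
      have "(\<lambda>n. pv (\<xi> (x (r n), real (r n))) t) \<longlonglongrightarrow> pv p 0"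
        using LIMSEQ_subseq_LIMSEQ[OF lim_x q(1)] by (simp add: o_def Lim_transform_eventually)
      moreover have "(\<lambda>n. pv (\<xi> (x (r n), real (r n))) t) \<longlonglongrightarrow> pv q t"
        by (rule tendsto_pv[OF q(2) tendsto_const])
      ultimately have "pv p 0 = pv q t" by (rule LIMSEQ_unique)
      then show ?thesis using const[of t] by simp
    qed
    then show "q = p" using ps by (intro web_path_eqI) (auto simp: ps_eq_iff)
  qed (use \<xi>_paths x in auto)
qed

text \<open>Either there are rational times arbitrarily close to the start with finite positions, or
  the path is infinite on a whole interval after the start. In the second case
  \<open>infinite_forever\<close> fixes one sign for all times after the start.\<close>

lemma skeleton_dense_web:
  assumes p: "p \<in> paths K"
  shows "p \<in> closure (\<xi> ` (\<rat> \<times> \<rat>))"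
proof (cases "ps p < 1")
  case False
  then have "ps p = 1" using abs_ps_le_1[of p] by simp
  then show ?thesis by (rule dense_if_start_infinite)
next
  case lt: True
  show ?thesis
  proof (cases "\<forall>\<eta>>0. \<exists>r\<in>\<rat>. ps p < tanh r \<and> tanh r < ps p + \<eta> \<and> \<bar>pv p r\<bar> < 1")
    case True
    then show ?thesis by (intro dense_if_finite_near_start p lt) auto
  next
    case False
    then obtain \<eta> where \<eta>: "0 < \<eta>"
      and inf: "\<And>r. r \<in> \<rat> \<Longrightarrow> ps p < tanh r \<Longrightarrow> tanh r < ps p + \<eta> \<Longrightarrow> \<not> \<bar>pv p r\<bar> < 1" by blast
    define U where "U = {t. ps p < tanh t \<and> tanh t < ps p + \<eta>}"
    have U_open: "open U"
      unfolding U_def by (intro open_Collect_conj open_Collect_less continuous_intros) (auto simp: cosh_real_nonzero)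
    have "U \<inter> \<rat> \<subseteq> {t. \<bar>pv p t\<bar> = 1}"
    proof
      fix r assume "r \<in> U \<inter> \<rat>"
      then have "\<not> \<bar>pv p r\<bar> < 1" by (intro inf) (auto simp: U_def)
      then show "r \<in> {t. \<bar>pv p t\<bar> = 1}" using abs_pv_le_1[of p r] by simp
    qed
    moreover have "closed {t. \<bar>pv p t\<bar> = 1}"
      by (intro closed_Collect_eq continuous_intros continuous_on_pv)
    ultimately have "closure (U \<inter> \<rat>) \<subseteq> {t. \<bar>pv p t\<bar> = 1}" by (rule closure_minimal)
    then have U1: "\<bar>pv p t\<bar> = 1" if "t \<in> U" for t
      using closure_rat_Int_open[OF U_open] that by blast
    have "ps p < min 1 (ps p + \<eta>)" using lt \<eta> by simp
    from dense[OF this] obtain z where z: "ps p < z" "z < min 1 (ps p + \<eta>)" by blast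
    then have "\<bar>z\<bar> < 1" using abs_ps_le_1[of p] by auto
    then obtain c where c: "z = tanh c" by (rule surj_tanh)
    have cU: "c \<in> U" using z c by (simp add: U_def)
    define \<sigma> where "\<sigma> = pv p c"
    have \<sigma>: "\<sigma> \<in> {1, -1}" using U1[OF cU] by (auto simp: \<sigma>_def)
    have "pv p t = \<sigma>" if t: "ps p < tanh t" for t
    proof (cases "c \<le> t")
      case True
      show ?thesis by (rule infinite_forever[OF p \<sigma> _ _ True]) (use z c in \<open>simp_all add: \<sigma>_def\<close>)
    next
      case False
      then have "tanh t < tanh c" by simp
      moreover have "tanh c < ps p + \<eta>" using z c by simp
      ultimately have "t \<in> U" using t unfolding U_def by (intro CollectI conjI) (simp, rule less_trans)
      then have "pv p t \<in> {1, -1}" using U1[of t] by (simp add: abs_if split: if_splits)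
      from infinite_forever[OF p this t refl, of c] have "pv p c = pv p t" using False by simp
      then show ?thesis by (simp add: \<sigma>_def)
    qed
    then show ?thesis by (rule dense_if_infinite[OF p lt \<sigma>])
  qed
qed

text \<open>Paths from points of \<open>D\<close> tending to a rational point have, by compactness,
  limits in the family that start at this point. There is only one such path, so the rational
  skeleton lies in the closure of the one over \<open>D\<close>.\<close>

lemma skeleton_dense_web':
  assumes D: "closure D = UNIV" and uniqueD: "\<And>y. y \<in> D \<Longrightarrow> {p \<in> paths K. starts_at p y} = {\<xi> y}"
    and p: "p \<in> paths K"
  shows "p \<in> closure (\<xi> ` D)"
proof -
  have "\<xi> (x, r) \<in> closure (\<xi> ` D)" if xr: "x \<in> \<rat>" "r \<in> \<rat>" for x r
  proof -
    have "(x, r) \<in> closure D" using D by simp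
    then obtain y where y: "\<And>n. y n \<in> D" "y \<longlonglongrightarrow> (x, r)" by (auto simp: closure_sequential)
    have y_paths: "\<xi> (y n) \<in> paths K" "ps (\<xi> (y n)) = tanh (snd (y n))"
        "pv (\<xi> (y n)) (snd (y n)) = tanh (fst (y n))" for n
    proof -
      have "\<xi> (y n) \<in> {p \<in> paths K. starts_at p (y n)}" using uniqueD[OF y(1), of n] by blast
      then have "\<xi> (y n) \<in> paths K" "starts_at (\<xi> (y n)) (fst (y n), snd (y n))"
        by simp_all
      then show "\<xi> (y n) \<in> paths K" "ps (\<xi> (y n)) = tanh (snd (y n))"
        "pv (\<xi> (y n)) (snd (y n)) = tanh (fst (y n))" unfolding starts_at_iff by (simp_all add: ps_ereal)
    qed
    show ?thesis
    proof (rule limit_in_closure[where P = "\<lambda>n. \<xi> (y n)" and K = K])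
      fix q s assume q: "q \<in> paths K" "strict_mono (s :: nat \<Rightarrow> nat)" "(\<lambda>n. \<xi> (y (s n))) \<longlonglongrightarrow> q"
      have ys: "(\<lambda>n. y (s n)) \<longlonglongrightarrow> (x, r)"
        using LIMSEQ_subseq_LIMSEQ[OF y(2) q(2)] by (simp add: o_def)
      have fs: "(\<lambda>n. fst (y (s n))) \<longlonglongrightarrow> x" "(\<lambda>n. snd (y (s n))) \<longlonglongrightarrow> r"
        using tendsto_fst[OF ys] tendsto_snd[OF ys] by simp_all
      have "(\<lambda>n. tanh (snd (y (s n)))) \<longlonglongrightarrow> tanh r" "(\<lambda>n. tanh (fst (y (s n)))) \<longlonglongrightarrow> tanh x"
        using fs by (auto intro!: tendsto_intros simp: cosh_real_nonzero)
      then have "ps q = tanh r" "pv q r = tanh x"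
        using tendsto_ps[OF q(3)] tendsto_pv[OF q(3) fs(2)] LIMSEQ_unique by (auto simp: y_paths)
      then have "starts_at q (x, r)"
        by (simp add: starts_at_iff ps_ereal[symmetric]) (metis ps_ge_iff ps_le_iff antisym order_refl)
      then show "q = \<xi> (x, r)" using unique[OF xr] q(1) by blast
    qed (use y y_paths in auto)
  qed
  then have "\<xi> ` (\<rat> \<times> \<rat>) \<subseteq> closure (\<xi> ` D)" by auto
  then have "closure (\<xi> ` (\<rat> \<times> \<rat>)) \<subseteq> closure (\<xi> ` D)" by (rule closure_minimal) simp
  then show ?thesis using skeleton_dense_web[OF p] by blast
qed

end

section \<open>Almost sure properties of the web\<close>

lemma (in finite_measure) AE_if_whp:
  assumes "\<And>\<gamma>. 0 < \<gamma> \<Longrightarrow> whp M \<gamma> P"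
  shows "AE \<omega> in M. P \<omega>"
proof -
  have "\<exists>A\<in>sets M. measure M A \<le> 1 / Suc k \<and> (\<forall>\<omega>\<in>space M - A. P \<omega>)" for k :: nat
    using assms[of "1 / Suc k"] by (simp add: whp_def)
  then obtain A where A: "\<And>k. A k \<in> sets M" "\<And>k :: nat. measure M (A k) \<le> 1 / Suc k"
    and P: "\<And>k. \<forall>\<omega>\<in>space M - A k. P \<omega>" by metis
  have "(\<Inter>k. A k) \<in> sets M" using A by (intro sets.countable_INT) auto
  have "measure M (\<Inter>k. A k) \<le> 1 / Suc k" for k :: nat
    by (rule order_trans[OF finite_measure_mono A(2)]) (use A in auto)
  then have "measure M (\<Inter>k. A k) \<le> 0"
    by (intro LIMSEQ_le_const[OF LIMSEQ_Suc[OF lim_1_over_n]]) auto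
  then have "(\<Inter>k. A k) \<in> null_sets M"
    using \<open>(\<Inter>k. A k) \<in> sets M\<close> by (simp add: emeasure_eq_measure null_sets_def measure_le_0_iff)
  then show ?thesis by (rule AE_I') (use P in blast)
qed

lemma measurable_eta:
  assumes "0 \<le> t"
  shows "(\<lambda>K. ennreal_of_enat (eta t0 t a b K)) \<in> borel_measurable borel"
proof -
  have "{K. eta t0 t a b K = n} \<in> sets borel" for n
  proof (cases n)
    case (enat k)
    have "{K. eta t0 t a b K = enat k} =
        {K. enat k \<le> eta t0 t a b K} - {K. enat (Suc k) \<le> eta t0 t a b K}"
      using Suc_ile_eq by (auto simp: not_le)
    then show ?thesis using enat eta_sets[OF assms] by (auto intro: sets.Diff)
  next
    case infinity
    have "{K. eta t0 t a b K = \<infinity>} = (\<Inter>k. {K. enat k \<le> eta t0 t a b K})"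
      by (auto dest: enat_ile) (metis Suc_n_not_le_n enat.exhaust enat_ord_simps(1))
    then show ?thesis using infinity eta_sets[OF assms] by (simp add: sets.countable_INT)
  qed
  then have "eta t0 t a b \<in> borel \<rightarrow>\<^sub>M count_space UNIV"
    unfolding measurable_count_space_eq2_countable by (simp add: vimage_def)
  then show ?thesis by (rule measurable_compose) simp
qed

text \<open>This turns the number of distinct positions into a sum over neighbours, so that its
  expectation involves only the laws of pairs of paths.\<close>

lemma card_monotone_values:
  fixes V :: "nat \<Rightarrow> real"
  assumes "\<And>i. i < n \<Longrightarrow> V i \<le> V (Suc i)"
  shows "card (V ` {..n}) = 1 + card {i \<in> {..<n}. V i \<noteq> V (Suc i)}"
  using assms
proof (induction n)
  case (Suc n)
  have le: "V i \<le> V n" if "i \<le> n" for i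
    using that
  proof (induction i rule: inc_induct)
    case (step i)
    then show ?case using Suc.prems[of i] by simp
  qed simp
  have IH: "card (V ` {..n}) = 1 + card {i \<in> {..<n}. V i \<noteq> V (Suc i)}"
    using Suc.prems by (intro Suc.IH) simp
  show ?case
  proof (cases "V n = V (Suc n)")
    case True
    then have "V ` {..Suc n} = V ` {..n}" by (auto simp: atMost_Suc intro: image_eqI[of _ _ n])
    moreover have "{i \<in> {..<Suc n}. V i \<noteq> V (Suc i)} = {i \<in> {..<n}. V i \<noteq> V (Suc i)}"
      using True by (auto simp: less_Suc_eq)
    ultimately show ?thesis using IH by simp
  next
    case False
    then have "V (Suc n) \<notin> V ` {..n}" using le Suc.prems[of n] by force
    then have "card (V ` {..Suc n}) = Suc (card (V ` {..n}))" by (simp add: atMost_Suc)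
    moreover have "{i \<in> {..<Suc n}. V i \<noteq> V (Suc i)} = insert n {i \<in> {..<n}. V i \<noteq> V (Suc i)}"
      using False by (auto simp: less_Suc_eq)
    ultimately show ?thesis using IH by simp
  qed
qed simp

context
  fixes N :: "'v measure" and W :: "'v \<Rightarrow> path_family" and \<Xi> :: "real \<times> real \<Rightarrow> 'v \<Rightarrow> web_path"
  assumes web: "standard_Brownian_web N W"
    and \<Xi> [measurable]: "\<And>z. \<Xi> z \<in> N \<rightarrow>\<^sub>M borel"
    and \<Xi>_unique: "\<And>z. AE \<omega> in N. {p \<in> paths (W \<omega>). starts_at p z} = {\<Xi> z \<omega>}"
begin

interpretation N: prob_space N using web by (simp add: standard_Brownian_web_def)

lemma W_measurable [measurable]: "W \<in> N \<rightarrow>\<^sub>M borel"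
  using web by (simp add: standard_Brownian_web_def)

text \<open>The definition of the web provides random paths for each finite set of points
  separately. As the path from a point is almost surely unique, they agree almost surely with the
  single choice \<Xi>.\<close>

lemma web_skeleton_law:
  assumes "inj_on z {..<n}"
  shows "coalescing_BM_law n z (distr N (\<Pi>\<^sub>M i\<in>{..<n}. borel) (\<lambda>\<omega>. \<lambda>i\<in>{..<n}. \<Xi> (z i) \<omega>))"
proof -
  obtain \<xi> where \<xi> [measurable]: "\<And>i. i < n \<Longrightarrow> \<xi> i \<in> N \<rightarrow>\<^sub>M borel"
    and AE: "AE \<omega> in N. \<forall>i<n. {p \<in> paths (W \<omega>). starts_at p (z i)} = {\<xi> i \<omega>}"
    and law: "coalescing_BM_law n z (distr N (\<Pi>\<^sub>M i\<in>{..<n}. borel) (\<lambda>\<omega>. \<lambda>i\<in>{..<n}. \<xi> i \<omega>))"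
    using web assms unfolding standard_Brownian_web_def by blast
  have "AE \<omega> in N. \<forall>i<n. {p \<in> paths (W \<omega>). starts_at p (z i)} = {\<Xi> (z i) \<omega>}"
    using \<Xi>_unique by (simp add: AE_all_countable)
  with AE have "AE \<omega> in N. (\<lambda>i\<in>{..<n}. \<xi> i \<omega>) = (\<lambda>i\<in>{..<n}. \<Xi> (z i) \<omega>)"
    by eventually_elim (auto intro!: restrict_ext)
  then have "distr N (\<Pi>\<^sub>M i\<in>{..<n}. borel) (\<lambda>\<omega>. \<lambda>i\<in>{..<n}. \<xi> i \<omega>) =
      distr N (\<Pi>\<^sub>M i\<in>{..<n}. borel) (\<lambda>\<omega>. \<lambda>i\<in>{..<n}. \<Xi> (z i) \<omega>)"
    by (intro distr_cong_AE measurable_restrict) auto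
  then show ?thesis using law by simp
qed

lemma web_tube:
  assumes "l < t0" "t0 < r" and c: "0 < c" "a < tanh (x - c)" "tanh (x + c) < b"
    and H: "R2 \<le> t0 + H" "0 < H"
  shows "whp N (2 * H / c\<^sup>2) (\<lambda>\<omega>. \<Xi> (x, t0) \<omega> \<in> tube l r R1 R2 a b)"
proof (rule whpI)
  let ?f = "\<lambda>\<omega>. \<lambda>i\<in>{..<1::nat}. \<Xi> (x, t0) \<omega>"
  let ?\<nu> = "distr N (\<Pi>\<^sub>M i\<in>{..<1}. borel) ?f"
  have f: "?f \<in> N \<rightarrow>\<^sub>M (\<Pi>\<^sub>M i\<in>{..<1}. borel)" by (intro measurable_restrict) simp
  have law: "coalescing_BM_law 1 (\<lambda>_. (x, t0)) ?\<nu>"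
    using web_skeleton_law[of "\<lambda>_. (x, t0)" 1] by (simp add: inj_on_def)
  have "{f \<in> space (\<Pi>\<^sub>M i\<in>{..<1::nat}. borel). f 0 \<notin> tube l r R1 R2 a b} \<in> sets (\<Pi>\<^sub>M i\<in>{..<1}. borel)"
    by measurable
  then have "measure ?\<nu> {f \<in> space ?\<nu>. f 0 \<notin> tube l r R1 R2 a b} =
      measure N {\<omega> \<in> space N. \<not> \<Xi> (x, t0) \<omega> \<in> tube l r R1 R2 a b}"
    using f by (subst measure_distr) (auto simp: space_PiM intro!: arg_cong[where f = "measure N"])
  then show "measure N {\<omega> \<in> space N. \<not> \<Xi> (x, t0) \<omega> \<in> tube l r R1 R2 a b} \<le> 2 * H / c\<^sup>2"
    using coalescing_BM_law_tube[OF law refl assms(1,2) c H, of R1] by simp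
  show "{\<omega> \<in> space N. \<not> \<Xi> (x, t0) \<omega> \<in> tube l r R1 R2 a b} \<in> sets N" by measurable
qed

lemma ex_small_tube_bound:
  assumes "0 < \<gamma>" "0 < (H :: real)"
  obtains c where "0 < c" "2 * H / c\<^sup>2 \<le> \<gamma>"
proof
  show "0 < sqrt (2 * H / \<gamma>)" "2 * H / (sqrt (2 * H / \<gamma>))\<^sup>2 \<le> \<gamma>" using assms by auto
qed

text \<open>The path stays within distance \<open>c\<close> of its starting position up to time
  \<open>k\<close> except with probability of the order of \<open>1 / c\<^sup>2\<close>, and
  \<open>c\<close> is arbitrary.\<close>

lemma web_finite_vals: "AE \<omega> in N. \<forall>t. \<bar>pv (\<Xi> (x, r) \<omega>) t\<bar> < 1"
proof -
  have "AE \<omega> in N. \<forall>t\<in>{- real k..real k}. \<bar>pv (\<Xi> (x, r) \<omega>) t\<bar> < 1" for k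
  proof (rule N.AE_if_whp)
    fix \<gamma> :: real assume "0 < \<gamma>"
    obtain c where c: "0 < c" "2 * max 1 (k - r) / c\<^sup>2 \<le> \<gamma>"
      using ex_small_tube_bound[OF \<open>0 < \<gamma>\<close>, of "max 1 (k - r)"] by (auto simp: less_max_iff_disj)
    have "whp N (2 * max 1 (k - r) / c\<^sup>2) (\<lambda>\<omega>. \<Xi> (x, r) \<omega> \<in> tube (r - 1) (r + 1) (- real k) k (-1) 1)"
      using c(1) tanh_real_gt_neg1 tanh_real_lt_1 by (intro web_tube) auto
    then show "whp N \<gamma> (\<lambda>\<omega>. \<forall>t\<in>{- real k..real k}. \<bar>pv (\<Xi> (x, r) \<omega>) t\<bar> < 1)"
      by (rule whp_mono) (use c in \<open>auto simp: tube_def abs_less_iff\<close>)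
  qed
  then have "AE \<omega> in N. \<forall>k. \<forall>t\<in>{- real k..real k}. \<bar>pv (\<Xi> (x, r) \<omega>) t\<bar> < 1"
    by (simp add: AE_all_countable)
  then show ?thesis
  proof eventually_elim
    case (elim \<omega>)
    show ?case
    proof
      fix t :: real
      obtain k :: nat where "\<bar>t\<bar> \<le> k" using real_arch_simple by blast
      then have "t \<in> {- real k..real k}" by (simp add: abs_le_iff)
      then show "\<bar>pv (\<Xi> (x, r) \<omega>) t\<bar> < 1" using elim by blast
    qed
  qed
qed

text \<open>A path from \<open>\<sigma> * j\<close> with \<open>j > n + c\<close> stays beyond
  \<open>n\<close> unless it moves by more than \<open>c\<close> within time \<open>2 * n\<close>,
  which is unlikely for large \<open>c\<close>.\<close>

lemma web_barrier:
  assumes \<sigma>: "\<sigma> \<in> {1, -1 :: real}" and n: "0 < (n :: real)"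
  shows "AE \<omega> in N. \<exists>x\<in>\<rat>. \<forall>t\<in>{-n..n}. tanh n \<le> \<sigma> * pv (\<Xi> (x, - n) \<omega>) t"
proof (rule N.AE_if_whp)
  fix \<gamma> :: real assume "0 < \<gamma>"
  obtain c where c: "0 < c" "2 * (2 * n) / c\<^sup>2 \<le> \<gamma>"
    using ex_small_tube_bound[OF \<open>0 < \<gamma>\<close>, of "2 * n"] n by auto
  obtain j :: nat where j: "n + c < j" using reals_Archimedean2 by blast
  define a where "a = (if \<sigma> = 1 then tanh n else -2)"
  define b where "b = (if \<sigma> = 1 then 2 else - tanh n)"
  have "\<sigma> * j + c < - n" if "\<sigma> = -1" using that j by simp
  then have "whp N (2 * (2 * n) / c\<^sup>2) (\<lambda>\<omega>. \<Xi> (\<sigma> * j, - n) \<omega> \<in> tube (- n - 1) (- n + 1) (- n) n a b)"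
    using \<sigma> j c n tanh_real_lt_1[of "j + c"] tanh_real_gt_neg1[of "- j - c"]
    by (intro web_tube) (auto simp: a_def b_def simp flip: tanh_minus)
  then show "whp N \<gamma> (\<lambda>\<omega>. \<exists>x\<in>\<rat>. \<forall>t\<in>{-n..n}. tanh n \<le> \<sigma> * pv (\<Xi> (x, - n) \<omega>) t)"
  proof (rule whp_mono[OF _ c(2)])
    fix \<omega> assume "\<Xi> (\<sigma> * j, - n) \<omega> \<in> tube (- n - 1) (- n + 1) (- n) n a b"
    then have "\<forall>t\<in>{-n..n}. tanh n \<le> \<sigma> * pv (\<Xi> (\<sigma> * j, - n) \<omega>) t"
      using \<sigma> by (auto simp: tube_def a_def b_def less_imp_le less_minus_iff)
    moreover have "\<sigma> * j \<in> \<rat>" using \<sigma> by auto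
    ultimately show "\<exists>x\<in>\<rat>. \<forall>t\<in>{-n..n}. tanh n \<le> \<sigma> * pv (\<Xi> (x, - n) \<omega>) t" by blast
  qed
qed

lemma web_pair_law:
  assumes "z \<noteq> z'"
  shows "coalescing_BM_law 2 (\<lambda>i. if i = 0 then z else z')
    (distr N (\<Pi>\<^sub>M i\<in>{..<2}. borel) (\<lambda>\<omega>. \<lambda>i\<in>{..<2}. \<Xi> (if i = 0 then z else z') \<omega>))"
  using assms by (intro web_skeleton_law) (auto simp: inj_on_def)

lemma web_pair_measurable [measurable]:
  "(\<lambda>\<omega>. \<lambda>i\<in>{..<2::nat}. \<Xi> (if i = 0 then z else z') \<omega>) \<in> N \<rightarrow>\<^sub>M (\<Pi>\<^sub>M i\<in>{..<2}. borel)"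
  by (intro measurable_restrict) simp

lemma web_coalesce_from: "AE \<omega> in N. coalesce_from (max (snd z) (snd z')) (\<Xi> z \<omega>) (\<Xi> z' \<omega>)"
proof (cases "z = z'")
  case True
  then show ?thesis by (simp add: coalesce_from_def)
next
  case False
  from AE_distrD[OF web_pair_measurable coalescing_BM_law_coalesce_from[OF web_pair_law[OF False]]]
  show ?thesis by simp
qed

lemma web_distinct:
  assumes "0 < h" "0 < t"
  shows "h / sqrt (pi * t) * exp (- h\<^sup>2 / (4 * t)) \<le>
    measure N {\<omega> \<in> space N. pv (\<Xi> (x, r) \<omega>) (r + t) \<noteq> pv (\<Xi> (x + h, r) \<omega>) (r + t)}"
proof -
  let ?f = "\<lambda>\<omega>. \<lambda>i\<in>{..<2::nat}. \<Xi> (if i = 0 then (x, r) else (x + h, r)) \<omega>"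
  let ?\<nu> = "distr N (\<Pi>\<^sub>M i\<in>{..<2}. borel) ?f"
  have "h / sqrt (pi * t) * exp (- h\<^sup>2 / (4 * t)) \<le>
      measure ?\<nu> {f \<in> space ?\<nu>. pv (f 0) (r + t) \<noteq> pv (f 1) (r + t)}"
    using assms by (intro coalescing_BM_law_distinct[OF web_pair_law]) auto
  also have "measure ?\<nu> {f \<in> space ?\<nu>. pv (f 0) (r + t) \<noteq> pv (f 1) (r + t)} =
      measure N {\<omega> \<in> space N. pv (\<Xi> (x, r) \<omega>) (r + t) \<noteq> pv (\<Xi> (x + h, r) \<omega>) (r + t)}"
  proof (subst measure_distr)
    have "(\<lambda>f :: nat \<Rightarrow> web_path. pv (f i) (r + t)) \<in> borel_measurable (\<Pi>\<^sub>M i\<in>{..<2}. borel)" if "i < 2" for i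
      by (rule measurable_compose[OF _ measurable_pv], rule measurable_component_singleton) (use that in simp)
    from borel_measurable_neq[OF this[of 0] this[of 1]]
    show "{f \<in> space ?\<nu>. pv (f 0) (r + t) \<noteq> pv (f 1) (r + t)} \<in> sets (\<Pi>\<^sub>M i\<in>{..<2}. borel)"
      by simp
  qed (auto simp: space_PiM intro!: arg_cong[where f = "measure N"])
  finally show ?thesis .
qed

text \<open>Let \<open>Z\<close> count the positions reached from the \<open>n + 1\<close> starting
  points and \<open>E\<close> all counted points. Then \<open>Z \<le> E\<close>, and since both
  count points, they differ by at least 1 if they differ at all. So the probability of a difference
  is at most the difference of the expectations, which is small for large \<open>n\<close>.\<close>

lemma web_eta:
  assumes rQ: "r \<in> \<rat>" and \<tau>: "0 < \<tau>" and j: "j \<in> \<rat>" "0 < j"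
  shows "AE \<omega> in N. finite (eta_points r \<tau> (-j) j (W \<omega>)) \<and>
    (\<forall>y\<in>eta_points r \<tau> (-j) j (W \<omega>). \<exists>x\<in>\<rat> \<inter> {-j..j}. pv (\<Xi> (x, r) \<omega>) (r + \<tau>) = tanh y)"
proof (rule N.AE_if_whp)
  fix \<gamma> :: real assume \<gamma>: "0 < \<gamma>"
  define q where "q = 2 * j / sqrt (pi * \<tau>)"
  have "(\<lambda>n. (2 * j * (1 / real n))\<^sup>2 / (4 * \<tau>)) \<longlonglongrightarrow> (2 * j * 0)\<^sup>2 / (4 * \<tau>)"
    by (intro tendsto_intros lim_1_over_n) (use \<tau> in auto)
  then have "(\<lambda>n. q - q * exp (- ((2 * j / real n)\<^sup>2 / (4 * \<tau>)))) \<longlonglongrightarrow> q - q * exp (- 0)"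
    by (intro tendsto_intros) simp
  then have "\<forall>\<^sub>F n in sequentially. q - q * exp (- ((2 * j / real n)\<^sup>2 / (4 * \<tau>))) < \<gamma>"
    using \<gamma> by (intro order_tendstoD) auto
  then have "\<forall>\<^sub>F n in sequentially. 0 < n \<and> q - q * exp (- ((2 * j / real n)\<^sup>2 / (4 * \<tau>))) < \<gamma>"
    using eventually_gt_at_top[of 0] by eventually_elim simp
  then obtain n :: nat where n: "0 < n" "q - q * exp (- ((2 * j / real n)\<^sup>2 / (4 * \<tau>))) < \<gamma>"
    by (auto simp: eventually_sequentially)
  \<comment> \<open>As \<open>j\<close> is rational, so are all the starting points.\<close>
  define h where "h = 2 * j / n"
  have h: "0 < h" "h \<in> \<rat>" "n * h = 2 * j" using j n by (auto simp: h_def)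
  define x where "x i = - j + real i * h" for i
  have xQ: "x i \<in> \<rat>" for i using j h by (simp add: x_def)
  have x_range: "x i \<in> {-j..j}" if "i \<le> n" for i
  proof -
    have "real i * h \<le> n * h" using that h(1) by (intro mult_right_mono) auto
    then show ?thesis using h by (simp add: x_def)
  qed
  have x_Suc: "x (Suc i) = x i + h" for i by (simp add: x_def algebra_simps)
  define V where "V \<omega> i = pv (\<Xi> (x i, r) \<omega>) (r + \<tau>)" for \<omega> i
  have V [measurable]: "(\<lambda>\<omega>. V \<omega> i) \<in> borel_measurable N" for i
    unfolding V_def by (rule measurable_compose[OF \<Xi> measurable_pv])
  define E where "E \<omega> = ennreal_of_enat (eta r \<tau> (-j) j (W \<omega>))" for \<omega>
  have E [measurable]: "E \<in> borel_measurable N"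
    unfolding E_def using \<tau> by (intro measurable_compose[OF W_measurable measurable_eta]) simp
  have EE: "(\<integral>\<^sup>+\<omega>. E \<omega> \<partial>N) = ennreal (1 + q)"
  proof -
    have "(\<integral>\<^sup>+\<omega>. E \<omega> \<partial>N) = (\<integral>\<^sup>+ K. ennreal_of_enat (eta r \<tau> (-j) j K) \<partial>distr N borel W)"
      unfolding E_def using measurable_eta[OF less_imp_le[OF \<tau>], of r "-j" j]
      by (subst nn_integral_distr) simp_all
    also have "\<dots> = ennreal (1 + (j - (- j)) / sqrt (pi * \<tau>))"
      using web \<tau> j by (simp add: standard_Brownian_web_def)
    finally show ?thesis by (simp add: q_def)
  qed
  define S where "S i = {\<omega> \<in> space N. V \<omega> i \<noteq> V \<omega> (Suc i)}" for i
  have S [measurable]: "S i \<in> sets N" for i unfolding S_def by measurable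
  define Z :: "'v \<Rightarrow> ennreal" where "Z \<omega> = 1 + (\<Sum>i<n. indicator (S i) \<omega>)" for \<omega>
  have Z [measurable]: "Z \<in> borel_measurable N" unfolding Z_def by measurable
  have EZ: "ennreal (1 + q * exp (- (h\<^sup>2 / (4 * \<tau>)))) \<le> (\<integral>\<^sup>+\<omega>. Z \<omega> \<partial>N)"
  proof -
    have "h / sqrt (pi * \<tau>) * exp (- h\<^sup>2 / (4 * \<tau>)) \<le> measure N (S i)" for i
      using web_distinct[OF h(1) \<tau>, of "x i" r] by (simp add: S_def V_def x_Suc)
    then have "(\<Sum>i<n. h / sqrt (pi * \<tau>) * exp (- h\<^sup>2 / (4 * \<tau>))) \<le> (\<Sum>i<n. measure N (S i))"
      by (intro sum_mono)
    moreover have "(\<Sum>i<n. h / sqrt (pi * \<tau>) * exp (- h\<^sup>2 / (4 * \<tau>))) = q * exp (- (h\<^sup>2 / (4 * \<tau>)))"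
      unfolding q_def h(3)[symmetric] by simp
    ultimately have "1 + q * exp (- (h\<^sup>2 / (4 * \<tau>))) \<le> 1 + (\<Sum>i<n. measure N (S i))"
      by simp
    then have "ennreal (1 + q * exp (- (h\<^sup>2 / (4 * \<tau>)))) \<le> ennreal (1 + (\<Sum>i<n. measure N (S i)))"
      by (rule ennreal_leI)
    also have "\<dots> = 1 + (\<Sum>i<n. ennreal (measure N (S i)))"
      by (subst ennreal_plus) (simp_all add: sum_nonneg sum_ennreal)
    also have "\<dots> = (\<integral>\<^sup>+\<omega>. Z \<omega> \<partial>N)"
      unfolding Z_def by (simp add: nn_integral_add nn_integral_sum N.emeasure_eq_measure N.prob_space)
    finally show ?thesis .
  qed
  define B where "B = {\<omega> \<in> space N. Z \<omega> + 1 \<le> E \<omega>}"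
  have B [measurable]: "B \<in> sets N" unfolding B_def by measurable
  define T where "T \<omega> = {y. tanh y \<in> V \<omega> ` {..n}}" for \<omega>
  have "AE \<omega> in N. (\<forall>i. {p \<in> paths (W \<omega>). starts_at p (x i, r)} = {\<Xi> (x i, r) \<omega>}) \<and>
      (\<forall>i. \<forall>t. \<bar>pv (\<Xi> (x i, r) \<omega>) t\<bar> < 1) \<and>
      (\<forall>i. coalesce_from (max r r) (\<Xi> (x (Suc i), r) \<omega>) (\<Xi> (x i, r) \<omega>))"
    using \<Xi>_unique web_finite_vals web_coalesce_from[of "(x (Suc _), r)" "(x _, r)"]
    by (intro AE_conjI) (simp_all add: AE_all_countable)
  then have good: "AE \<omega> in N. \<omega> \<in> space N \<longrightarrow> T \<omega> \<subseteq> eta_points r \<tau> (-j) j (W \<omega>) \<and> finite (T \<omega>) \<and> Z \<omega> = of_nat (card (T \<omega>))"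
  proof eventually_elim
    case (elim \<omega>)
    then have \<Xi>p: "\<Xi> (x i, r) \<omega> \<in> paths (W \<omega>)" "path_start (\<Xi> (x i, r) \<omega>) = ereal r"
      "pv (\<Xi> (x i, r) \<omega>) r = tanh (x i)" for i
    proof -
      have "\<Xi> (x i, r) \<omega> \<in> {p \<in> paths (W \<omega>). starts_at p (x i, r)}" using elim by simp
      then show "\<Xi> (x i, r) \<omega> \<in> paths (W \<omega>)" "path_start (\<Xi> (x i, r) \<omega>) = ereal r"
        "pv (\<Xi> (x i, r) \<omega>) r = tanh (x i)" by (simp_all add: starts_at_iff)
    qed
    have "T \<omega> \<subseteq> eta_points r \<tau> (-j) j (W \<omega>)"
    proof
      fix y assume "y \<in> T \<omega>"
      then obtain i where i: "i \<le> n" "tanh y = V \<omega> i" by (auto simp: T_def)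
      then have "touches (\<Xi> (x i, r) \<omega>) (y, r + \<tau>)" "touches (\<Xi> (x i, r) \<omega>) (x i, r)"
        using \<Xi>p[of i] \<tau> by (auto simp: touches_iff V_def)
      then show "y \<in> eta_points r \<tau> (-j) j (W \<omega>)"
        using x_range[OF i(1)] \<Xi>p(1)[of i] unfolding eta_points_def by blast
    qed
    moreover have "tanh ` T \<omega> = V \<omega> ` {..n}"
    proof -
      have "\<exists>y. V \<omega> i = tanh y" for i using elim surj_tanh unfolding V_def by metis
      then have "V \<omega> i \<in> tanh ` T \<omega>" if "i \<le> n" for i
        using that unfolding T_def by (metis (mono_tags, lifting) atMost_iff imageI mem_Collect_eq)
      then show ?thesis by (auto simp: T_def)
    qed
    moreover have inj: "inj_on tanh (T \<omega>)" by (auto simp: inj_on_def)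
    ultimately have T: "finite (T \<omega>)" "card (T \<omega>) = card (V \<omega> ` {..n})"
      using finite_image_iff[OF inj] card_image[OF inj] by auto
    \<comment> \<open>Coalescing paths keep their order, so distinct positions can be counted
      through neighbours.\<close>
    have mono: "V \<omega> i \<le> V \<omega> (Suc i)" for i
    proof -
      have "pv (\<Xi> (x i, r) \<omega>) r \<le> pv (\<Xi> (x (Suc i), r) \<omega>) r"
        using h(1) unfolding \<Xi>p(3) by (simp add: x_Suc)
      then show ?thesis
        using coalesce_from_order[of r "\<Xi> (x (Suc i), r) \<omega>" "\<Xi> (x i, r) \<omega>" r "r + \<tau>" 1] elim \<tau>
        by (simp add: V_def)
    qed
    have "Z \<omega> = of_nat (card (T \<omega>))" if "\<omega> \<in> space N"
    proof -
      have "(\<Sum>i<n. indicator (S i) \<omega>) = (of_nat (card {i \<in> {..<n}. V \<omega> i \<noteq> V \<omega> (Suc i)}) :: ennreal)"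
        using that by (simp add: indicator_def S_def sum.If_cases Int_def)
      then show ?thesis
        unfolding T(2) card_monotone_values[of n "V \<omega>", OF mono] by (simp add: Z_def)
    qed
    then show ?case using T \<open>T \<omega> \<subseteq> _\<close> by blast
  qed
  have "(\<integral>\<^sup>+\<omega>. Z \<omega> + indicator B \<omega> \<partial>N) \<le> (\<integral>\<^sup>+\<omega>. E \<omega> \<partial>N)"
  proof (rule nn_integral_mono_AE)
    show "AE \<omega> in N. Z \<omega> + indicator B \<omega> \<le> E \<omega>"
      using good AE_space
    proof eventually_elim
      case (elim \<omega>)
      then have "enat (card (T \<omega>)) \<le> eta r \<tau> (-j) j (W \<omega>)" by (auto simp: le_eta_iff)
      then have "Z \<omega> \<le> E \<omega>" using elim by (simp add: E_def of_nat_eq_enat)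
      then show ?case by (auto simp: indicator_def B_def)
    qed
  qed
  also have "(\<integral>\<^sup>+\<omega>. Z \<omega> + indicator B \<omega> \<partial>N) = (\<integral>\<^sup>+\<omega>. Z \<omega> \<partial>N) + emeasure N B"
    by (simp add: nn_integral_add)
  \<comment> \<open>\<open>Z\<close> has expectation at least
    \<open>1 + q * exp (- (h\<^sup>2 / (4 * \<tau>)))\<close>, and \<open>E\<close> has expectation
    \<open>1 + q\<close>; what is left bounds the measure of \<open>B\<close>.\<close>
  finally have "ennreal (1 + q * exp (- (h\<^sup>2 / (4 * \<tau>)))) + emeasure N B \<le> ennreal (1 + q)"
    unfolding EE using EZ by (meson add_right_mono order_trans)
  then have "measure N B \<le> q - q * exp (- (h\<^sup>2 / (4 * \<tau>)))"
    using j \<tau> by (simp add: N.emeasure_eq_measure q_def ennreal_le_iff flip: ennreal_plus)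
  then have "measure N B \<le> \<gamma>" using n(2) by (simp add: h_def)
  then have "whp N \<gamma> (\<lambda>\<omega>. \<omega> \<notin> B)" unfolding whp_def using B by blast
  from whp_conj[OF this whp_AE[OF good]]
  have *: "whp N \<gamma> (\<lambda>\<omega>. \<omega> \<notin> B \<and> (\<omega> \<in> space N \<longrightarrow> T \<omega> \<subseteq> eta_points r \<tau> (-j) j (W \<omega>) \<and> finite (T \<omega>) \<and> Z \<omega> = of_nat (card (T \<omega>))))"
    by simp
  show "whp N \<gamma> (\<lambda>\<omega>. finite (eta_points r \<tau> (-j) j (W \<omega>)) \<and>
    (\<forall>y\<in>eta_points r \<tau> (-j) j (W \<omega>). \<exists>x\<in>\<rat> \<inter> {-j..j}. pv (\<Xi> (x, r) \<omega>) (r + \<tau>) = tanh y))"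
  proof (rule whp_mono[OF * order_refl])
    fix \<omega> assume \<omega>: "\<omega> \<in> space N" "\<omega> \<notin> B \<and> (\<omega> \<in> space N \<longrightarrow> T \<omega> \<subseteq> eta_points r \<tau> (-j) j (W \<omega>) \<and> finite (T \<omega>) \<and> Z \<omega> = of_nat (card (T \<omega>)))"
    let ?P = "eta_points r \<tau> (-j) j (W \<omega>)"
    have T: "T \<omega> \<subseteq> ?P" "finite (T \<omega>)" "Z \<omega> = of_nat (card (T \<omega>))" and "E \<omega> < Z \<omega> + 1"
      using \<omega> by (auto simp: B_def not_le)
    then have "E \<omega> < ennreal_of_enat (enat (Suc (card (T \<omega>))))" by (simp add: add.commute)
    then have lt: "eta r \<tau> (-j) j (W \<omega>) < enat (Suc (card (T \<omega>)))"
      unfolding E_def by (simp only: ennreal_of_enat_le_iff flip: not_le) simp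
    then have fin: "finite ?P" by (auto simp: eta_eq split: if_splits)
    then have "card ?P \<le> card (T \<omega>)" using lt by (simp add: eta_eq)
    then have "T \<omega> = ?P" using T fin by (intro card_seteq)
    have "\<exists>x\<in>\<rat> \<inter> {-j..j}. pv (\<Xi> (x, r) \<omega>) (r + \<tau>) = tanh y" if "y \<in> ?P" for y
    proof -
      have "y \<in> T \<omega>" using that \<open>T \<omega> = ?P\<close> by simp
      then obtain i where "i \<le> n" "tanh y = V \<omega> i" unfolding T_def by blast
      then show ?thesis using xQ x_range by (intro bexI[of _ "x i"]) (auto simp: V_def)
    qed
    then show "finite ?P \<and> (\<forall>y\<in>?P. \<exists>x\<in>\<rat> \<inter> {-j..j}. pv (\<Xi> (x, r) \<omega>) (r + \<tau>) = tanh y)"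
      using fin by blast
  qed
qed

lemma web_skeleton_dense:
  assumes D: "countable D" "closure D = UNIV"
  shows "AE \<omega> in N. (\<forall>y\<in>D. \<Xi> y \<omega> \<in> paths (W \<omega>)) \<and> (\<forall>p\<in>paths (W \<omega>). p \<in> closure ((\<lambda>y. \<Xi> y \<omega>) ` D))"
proof -
  have Q: "countable (\<rat> \<times> \<rat> :: (real \<times> real) set)" by (simp add: countable_rat)
  have Q1: "countable (\<rat> :: real set)" and Q2: "countable (\<rat> \<inter> {0<..} :: real set)"
    by (simp_all add: countable_rat)
  have Q3: "countable (\<nat> \<inter> {0<..} :: real set)" "\<And>x :: real. x \<in> \<nat> \<Longrightarrow> x \<in> \<rat>"
    using Nats_subset_Rats countable_subset[OF Nats_subset_Rats Q1] by (auto simp: countable_Int1)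
  have "AE \<omega> in N. \<forall>y\<in>D \<union> \<rat> \<times> \<rat>. {p \<in> paths (W \<omega>). starts_at p y} = {\<Xi> y \<omega>}"
    using D Q \<Xi>_unique by (intro AE_ball_countable') auto
  moreover have "AE \<omega> in N. \<forall>y\<in>\<rat> \<times> \<rat>. \<forall>t. \<bar>pv (\<Xi> y \<omega>) t\<bar> < 1"
    using Q web_finite_vals by (intro AE_ball_countable') auto
  moreover have "AE \<omega> in N. \<forall>y\<in>\<rat> \<times> \<rat>. \<forall>z\<in>\<rat> \<times> \<rat>. coalesce_from (max (snd y) (snd z)) (\<Xi> y \<omega>) (\<Xi> z \<omega>)"
    using Q web_coalesce_from by (intro AE_ball_countable') auto
  moreover have "AE \<omega> in N. \<forall>r\<in>\<rat>. \<forall>\<tau>\<in>\<rat> \<inter> {0<..}. \<forall>j\<in>\<nat> \<inter> {0<..}.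
      finite (eta_points r \<tau> (-j) j (W \<omega>)) \<and>
      (\<forall>y\<in>eta_points r \<tau> (-j) j (W \<omega>). \<exists>x\<in>\<rat> \<inter> {-j..j}. pv (\<Xi> (x, r) \<omega>) (r + \<tau>) = tanh y)"
    using Q1 Q2 Q3 by (intro AE_ball_countable' web_eta) simp_all
  moreover have "AE \<omega> in N. \<forall>\<sigma>\<in>{1, -1}. \<forall>n\<in>\<nat> \<inter> {0<..}.
      \<exists>x\<in>\<rat>. \<forall>t\<in>{-n..n}. tanh n \<le> \<sigma> * pv (\<Xi> (x, - n) \<omega>) t"
    using Q3 by (intro AE_ball_countable' web_barrier) simp_all
  ultimately show ?thesis
  proof eventually_elim
    case (elim \<omega>)
    have inD: "\<Xi> y \<omega> \<in> paths (W \<omega>)" if "y \<in> D" for y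
      using elim(1) that by blast
    have "p \<in> closure ((\<lambda>y. \<Xi> y \<omega>) ` D)" if p: "p \<in> paths (W \<omega>)" for p
    proof (rule skeleton_dense_web'[OF _ _ _ _ _ D(2) _ p, where \<xi> = "\<lambda>y. \<Xi> y \<omega>"])
      show "coalesce_from (max r r') (\<Xi> (x, r) \<omega>) (\<Xi> (x', r') \<omega>)"
        if "x \<in> \<rat>" "r \<in> \<rat>" "x' \<in> \<rat>" "r' \<in> \<rat>" for x r x' r'
        using elim(3)[rule_format, of "(x, r)" "(x', r')"] that by simp
    qed (use elim in \<open>auto\<close>)
    then show ?case using inD by blast
  qed
qed

end

section \<open>Weak convergence\<close>

text \<open>A bounded continuous \<open>g\<close> is the pointwise limit from below of its Lipschitz
  regularisations \<open>G k\<close>, the infimal convolutions with \<open>real k * dist\<close>.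
  This gives the lower bound for the limit; applied to \<open>- g\<close> it gives the upper
  one.\<close>

lemma weakly_converges_if_lipschitz:
  fixes \<mu> :: "'i \<Rightarrow> 'a::metric_space measure"
  assumes \<mu>: "\<forall>\<^sub>F i in F. prob_space (\<mu> i) \<and> sets (\<mu> i) = sets borel"
    and \<nu>: "prob_space \<nu>" "sets \<nu> = sets borel"
    and lip: "\<And>(g :: 'a \<Rightarrow> real) L B. L-lipschitz_on UNIV g \<Longrightarrow> (\<And>x. \<bar>g x\<bar> \<le> B) \<Longrightarrow>
      ((\<lambda>i. \<integral>x. g x \<partial>\<mu> i) \<longlongrightarrow> (\<integral>x. g x \<partial>\<nu>)) F"
  shows "weakly_converges \<mu> \<nu> F"
proof -
  interpret \<nu>: prob_space \<nu> by fact
  have lower: "\<forall>\<^sub>F i in F. a < (\<integral>x. g x \<partial>\<mu> i)"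
    if g: "continuous_on UNIV g" "\<And>x. \<bar>g x\<bar> \<le> B" and a: "a < (\<integral>x. g x \<partial>\<nu>)" for g :: "'a \<Rightarrow> real" and B a
  proof -
    define G where "G k x = (INF y. g y + real k * dist x y)" for k x
    have pos: "0 \<le> real k * dist x y" for k and x y :: 'a by simp
    have bdd: "bdd_below (range (\<lambda>y. g y + real k * dist x y))" for k x
    proof (rule bdd_belowI2)
      fix y show "- B \<le> g y + real k * dist x y"
        using g(2)[of y] pos[of k x y] by linarith
    qed
    have G_le: "G k x \<le> g x" for k x
      unfolding G_def by (rule cINF_lower2[OF bdd, of x]) auto
    have G_ge: "- B \<le> G k x" for k x
      unfolding G_def
    proof (rule cINF_greatest)
      fix y show "- B \<le> g y + real k * dist x y"
        using g(2)[of y] pos[of k x y] by linarith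
    qed simp
    have G_abs: "\<bar>G k x\<bar> \<le> B" for k x
      using G_le[of k x] G_ge[of k x] g(2)[of x] by (auto simp: abs_le_iff)
    have G_lip1: "G k x \<le> G k x' + real k * dist x x'" for k x x'
    proof -
      have "G k x - real k * dist x x' \<le> G k x'"
        unfolding G_def[of k x']
      proof (rule cINF_greatest)
        fix y
        have "G k x \<le> g y + real k * dist x y"
          unfolding G_def by (rule cINF_lower[OF bdd]) simp
        also have "\<dots> \<le> g y + real k * (dist x x' + dist x' y)"
          by (intro add_left_mono mult_left_mono dist_triangle) simp
        finally show "G k x - real k * dist x x' \<le> g y + real k * dist x' y"
          by (simp add: algebra_simps)
      qed simp
      then show ?thesis by simp
    qed
    have G_lip: "(real k)-lipschitz_on UNIV (G k)" for k
    proof (rule lipschitz_onI)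
      fix x y show "dist (G k x) (G k y) \<le> real k * dist x y"
        using G_lip1[of k x y] G_lip1[of k y x] by (simp add: dist_real_def abs_le_iff dist_commute)
    qed simp
    have G_cont: "continuous_on UNIV (G k)" for k
      using G_lip by (rule lipschitz_on_continuous_on)
    have G_meas: "G k \<in> borel_measurable M" and g_meas: "g \<in> borel_measurable M"
      if "sets M = sets borel" for k and M :: "'a measure"
      using borel_measurable_continuous_onI[OF G_cont, of k] borel_measurable_continuous_onI[OF g(1)]
        measurable_cong_sets[OF that refl] by blast+
    have G_lim: "(\<lambda>k. G k x) \<longlonglongrightarrow> g x" for x
    proof (rule order_tendstoI)
      fix b assume "b < g x"
      then have e: "0 < (g x - b) / 2" by simp
      obtain d where d: "0 < d" "\<And>y. dist y x < d \<Longrightarrow> dist (g y) (g x) < (g x - b) / 2"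
        using g(1)[unfolded continuous_on_iff, rule_format, OF UNIV_I e] by blast
      \<comment> \<open>For \<open>k \<ge> K\<close>, points at distance at least \<open>d\<close>
        cost more than \<open>2 * B\<close> and cannot lower the infimum below
        \<open>g x\<close>.\<close>
      obtain K :: nat where K: "2 * B / d < K" using reals_Archimedean2 by blast
      have "b < G k x" if "K \<le> k" for k
      proof -
        have "(g x + b) / 2 \<le> G k x"
          unfolding G_def
        proof (rule cINF_greatest)
          fix y
          show "(g x + b) / 2 \<le> g y + real k * dist x y"
          proof (cases "dist y x < d")
            case True
            then have "\<bar>g y - g x\<bar> < (g x - b) / 2" using d(2) by (simp only: dist_real_def)
            then have "g x - (g x - b) / 2 < g y" by linarith
            then show ?thesis using pos[of k x y] by argo
          next
            case False
            have "2 * B < real K * d" using K d(1) by (simp add: field_simps)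
            also have "\<dots> \<le> real k * dist x y"
              using False that d(1) by (intro mult_mono) (auto simp: dist_commute)
            finally show ?thesis using g(2)[of x] g(2)[of y] \<open>b < g x\<close> by argo
          qed
        qed simp
        then show ?thesis using \<open>b < g x\<close> by argo
      qed
      then show "\<forall>\<^sub>F k in sequentially. b < G k x" by (auto simp: eventually_sequentially)
    next
      fix b assume "g x < b"
      then show "\<forall>\<^sub>F k in sequentially. G k x < b" using G_le le_less_trans by (intro always_eventually) blast
    qed
    have "(\<lambda>k. \<integral>x. G k x \<partial>\<nu>) \<longlonglongrightarrow> (\<integral>x. g x \<partial>\<nu>)"
      by (rule integral_dominated_convergence[where w = "\<lambda>_. B"])
         (use G_meas g_meas \<nu> G_lim G_abs in auto)
    from order_tendstoD(1)[OF this a] obtain k where "a < (\<integral>x. G k x \<partial>\<nu>)"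
      using eventually_happens by fastforce
    from order_tendstoD(1)[OF lip[OF G_lip G_abs] this] \<mu> show ?thesis
    proof eventually_elim
      case (elim i)
      then interpret \<mu>: prob_space "\<mu> i" by simp
      have "(\<integral>x. G k x \<partial>\<mu> i) \<le> (\<integral>x. g x \<partial>\<mu> i)"
        using elim G_meas g_meas G_abs g(2) G_le
        by (intro integral_mono \<mu>.integrable_const_bound[of _ B]) auto
      then show ?case using elim by simp
    qed
  qed
  show ?thesis
    unfolding weakly_converges_def
  proof (intro allI impI, elim conjE)
    fix g :: "'a \<Rightarrow> real" assume g: "continuous_on UNIV g" "bounded (range g)"
    obtain B where B: "\<And>x. \<bar>g x\<bar> \<le> B" using g(2) by (auto simp: bounded_iff)
    show "((\<lambda>i. \<integral>x. g x \<partial>\<mu> i) \<longlongrightarrow> (\<integral>x. g x \<partial>\<nu>)) F"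
    proof (rule order_tendstoI)
      fix a assume "(\<integral>x. g x \<partial>\<nu>) < a"
      then have "\<forall>\<^sub>F i in F. - a < (\<integral>x. - g x \<partial>\<mu> i)"
        using g(1) B by (intro lower[of "\<lambda>x. - g x" B]) (auto intro: continuous_on_minus)
      then show "\<forall>\<^sub>F i in F. (\<integral>x. g x \<partial>\<mu> i) < a" by simp
    qed (rule lower[OF g(1) B])
  qed
qed

section \<open>Families consisting of finitely many paths\<close>

definition skeleton_family :: "nat \<Rightarrow> (nat \<Rightarrow> web_path) \<Rightarrow> path_family" where
  "skeleton_family m f = Abs_path_family (f ` {..<m})"

lemma paths_skeleton_family: "0 < m \<Longrightarrow> paths (skeleton_family m f) = f ` {..<m}"
  unfolding skeleton_family_def by (subst Abs_path_family_inverse) (auto simp: finite_imp_compact)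

text \<open>Moving each path by at most \<open>e / 2\<close> moves the family by at most
  \<open>e / 2\<close> in the Hausdorff metric. Hence a continuous function of families becomes a
  continuous function of finitely many paths, to which (I1) applies.\<close>

lemma continuous_on_skeleton_family:
  assumes "0 < m"
  shows "continuous_on UNIV (skeleton_family m)"
  unfolding continuous_on_def tendsto_iff
proof (intro ballI allI impI)
  fix f :: "nat \<Rightarrow> web_path" and e :: real assume e: "0 < e"
  have "\<forall>\<^sub>F f' in at f. dist (f' i) (f i) < e / 2" for i
  proof -
    have "((\<lambda>f'. f' i) \<longlongrightarrow> f i) (at f)"
      using continuous_on_coordinate[of UNIV i] unfolding continuous_on_def by blast
    then show ?thesis using e by (intro tendstoD) auto
  qed
  then have "\<forall>\<^sub>F f' in at f. \<forall>i\<in>{..<m}. dist (f' i) (f i) < e / 2"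
    by (intro eventually_ball_finite) auto
  then show "\<forall>\<^sub>F f' in at f. dist (skeleton_family m f') (skeleton_family m f) < e"
  proof eventually_elim
    case (elim f')
    have "dist (skeleton_family m f') (skeleton_family m f) \<le> e / 2"
      unfolding dist_path_family paths_skeleton_family[OF assms]
    proof (rule hausdorff_dist_leI)
      fix p assume "p \<in> f' ` {..<m}"
      then obtain i where "i < m" "p = f' i" by auto
      then show "infdist p (f ` {..<m}) \<le> e / 2"
        using elim by (intro infdist_le2[of "f i"]) (auto intro: less_imp_le)
    next
      fix p assume "p \<in> f ` {..<m}"
      then obtain i where "i < m" "p = f i" by auto
      then show "infdist p (f' ` {..<m}) \<le> e / 2"
        using elim by (intro infdist_le2[of "f' i"]) (auto simp: dist_commute intro: less_imp_le)
    qed (use assms in auto)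
    then show ?case using e by simp
  qed
qed

lemma dist_skeleton_family_le:
  assumes "0 < m" "f ` {..<m} \<subseteq> paths K" "0 \<le> e" "\<And>p. p \<in> paths K \<Longrightarrow> \<exists>i<m. dist p (f i) \<le> e"
  shows "dist (skeleton_family m f) K \<le> e"
  unfolding dist_path_family paths_skeleton_family[OF assms(1)]
proof (rule hausdorff_dist_leI)
  fix p assume "p \<in> f ` {..<m}"
  then have "p \<in> paths K" using assms(2) by blast
  then show "infdist p (paths K) \<le> e" using assms(3) by simp
next
  fix p assume "p \<in> paths K"
  then obtain i where "i < m" "dist p (f i) \<le> e" using assms(4) by blast
  then show "infdist p (f ` {..<m}) \<le> e" by (intro infdist_le2[of "f i"]) auto
qed (use assms(1) paths_nonempty in auto)

text \<open>Compactness upgrades density: finitely many of the balls around the \<open>f i\<close>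
  already cover \<open>paths K\<close>.\<close>

lemma skeleton_family_tendsto:
  assumes f: "range f \<subseteq> paths K" "paths K \<subseteq> closure (range f)"
  shows "(\<lambda>m. skeleton_family (Suc m) f) \<longlonglongrightarrow> K"
proof (rule metric_LIMSEQ_I)
  fix e :: real assume e: "0 < e"
  have "paths K \<subseteq> (\<Union>i. ball (f i) (e / 2))"
  proof
    fix p assume "p \<in> paths K"
    then obtain i where "dist (f i) p < e / 2"
      using f(2) e closure_approachable[of p "range f"] by (auto dest!: subsetD spec[of _ "e / 2"])
    then show "p \<in> (\<Union>i. ball (f i) (e / 2))" by auto
  qed
  then obtain I where I: "finite I" "paths K \<subseteq> (\<Union>i\<in>I. ball (f i) (e / 2))"
    using compactE_image[OF compact_paths, of UNIV "\<lambda>i. ball (f i) (e / 2)" K] by auto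
  obtain m0 where m0: "\<And>i. i \<in> I \<Longrightarrow> i \<le> m0" using I(1)[unfolded finite_nat_set_iff_bounded_le] by blast
  have "dist (skeleton_family (Suc m) f) K < e" if "m0 \<le> m" for m
  proof -
    have "dist (skeleton_family (Suc m) f) K \<le> e / 2"
    proof (rule dist_skeleton_family_le)
      fix p assume "p \<in> paths K"
      then obtain i where i: "i \<in> I" "dist (f i) p < e / 2" using I(2) by auto
      then show "\<exists>i<Suc m. dist p (f i) \<le> e / 2"
        using m0[OF i(1)] that by (intro exI[of _ i]) (auto simp: dist_commute)
    qed (use f e in auto)
    then show ?thesis using e by simp
  qed
  then show "\<exists>m0. \<forall>m\<ge>m0. dist (skeleton_family (Suc m) f) K < e" by blast
qed

text \<open>Continuity is a statement about the full function type, measurability one about the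
  product over \<open>{..<m}\<close>. The inclusion is measurable since the remaining coordinates
  are constantly \<open>undefined\<close>.\<close>

lemma measurable_skeleton_family:
  fixes h :: "path_family \<Rightarrow> real"
  assumes h: "continuous_on UNIV h" and m: "0 < m"
  shows "(\<lambda>f. h (skeleton_family m f)) \<in> borel_measurable (\<Pi>\<^sub>M i\<in>{..<m}. borel)"
proof -
  have "(\<lambda>f. f) \<in> (\<Pi>\<^sub>M i\<in>{..<m}. borel) \<rightarrow>\<^sub>M (borel :: (nat \<Rightarrow> web_path) measure)"
  proof (rule measurable_coordinatewise_then_product)
    fix i
    show "(\<lambda>f :: nat \<Rightarrow> web_path. f i) \<in> (\<Pi>\<^sub>M i\<in>{..<m}. borel) \<rightarrow>\<^sub>M borel"
    proof (cases "i < m")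
      case True
      then show ?thesis by (intro measurable_component_singleton) simp
    next
      case False
      then have "f i = undefined" if "f \<in> space (\<Pi>\<^sub>M i\<in>{..<m}. borel)" for f :: "nat \<Rightarrow> web_path"
        using that by (auto simp: space_PiM PiE_def extensional_def)
      then show ?thesis by (subst measurable_cong[where g = "\<lambda>_. undefined"]) auto
    qed
  qed
  moreover have "(\<lambda>f. h (skeleton_family m f)) \<in> borel_measurable borel"
    using continuous_on_compose2[OF h continuous_on_skeleton_family[OF m]]
    by (intro borel_measurable_continuous_onI) auto
  ultimately show ?thesis by (rule measurable_compose)
qed

lemma skeleton_family_restrict: "skeleton_family m (\<lambda>i\<in>{..<m}. f i) = skeleton_family m f"
  by (auto simp: skeleton_family_def intro: arg_cong[where f = Abs_path_family])

lemma integral_diff_whp: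
  fixes u v :: "'w \<Rightarrow> real"
  assumes "prob_space M" and u: "u \<in> borel_measurable M" "\<And>\<omega>. \<bar>u \<omega>\<bar> \<le> B"
    and v: "v \<in> borel_measurable M" "\<And>\<omega>. \<bar>v \<omega>\<bar> \<le> B"
    and close: "whp M \<gamma> (\<lambda>\<omega>. \<bar>u \<omega> - v \<omega>\<bar> \<le> c)" and c: "0 \<le> c"
  shows "\<bar>(\<integral>\<omega>. u \<omega> \<partial>M) - (\<integral>\<omega>. v \<omega> \<partial>M)\<bar> \<le> c + 2 * B * \<gamma>"
proof -
  interpret prob_space M by fact
  obtain A where A: "A \<in> sets M" "prob A \<le> \<gamma>" "\<And>\<omega>. \<omega> \<in> space M \<Longrightarrow> \<omega> \<notin> A \<Longrightarrow> \<bar>u \<omega> - v \<omega>\<bar> \<le> c"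
    using close unfolding whp_def by blast
  have B: "0 \<le> B" using u(2)[of undefined] by linarith
  have int: "integrable M u" "integrable M v"
    using u v by (auto intro: integrable_const_bound[of _ B])
  have "\<bar>(\<integral>\<omega>. u \<omega> \<partial>M) - (\<integral>\<omega>. v \<omega> \<partial>M)\<bar> = \<bar>\<integral>\<omega>. u \<omega> - v \<omega> \<partial>M\<bar>" using int by simp
  also have "\<dots> \<le> (\<integral>\<omega>. \<bar>u \<omega> - v \<omega>\<bar> \<partial>M)" by (rule integral_abs_bound)
  also have "\<dots> \<le> (\<integral>\<omega>. c + 2 * B * indicator A \<omega> \<partial>M)"
  proof (rule integral_mono)
    show "integrable M (\<lambda>\<omega>. \<bar>u \<omega> - v \<omega>\<bar>)" using int by (intro integrable_abs Bochner_Integration.integrable_diff)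
    show "integrable M (\<lambda>\<omega>. c + 2 * B * indicator A \<omega>)" using A(1) by (intro integrable_const_bound[of _ "c + 2 * B"]) (auto simp: indicator_def B c)
    fix \<omega> assume \<omega>: "\<omega> \<in> space M"
    show "\<bar>u \<omega> - v \<omega>\<bar> \<le> c + 2 * B * indicator A \<omega>"
    proof (cases "\<omega> \<in> A")
      case True
      then show ?thesis using u(2)[of \<omega>] v(2)[of \<omega>] c by (simp add: abs_le_iff)
    qed (use A(3) \<omega> in simp)
  qed
  also have "\<dots> = c + 2 * B * prob A"
    using A(1) by (subst Bochner_Integration.integral_add) (auto simp: prob_space emeasure_eq_measure intro!: integrable_mult_right integrable_real_indicator)
  also have "\<dots> \<le> c + 2 * B * \<gamma>" using A(2) B by (intro add_left_mono mult_left_mono) auto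
  finally show ?thesis .
qed

theorem theorem2p1:
  fixes M :: "real \<Rightarrow> 'w measure"
    and X :: "real \<Rightarrow> 'w \<Rightarrow> path_family"
    and \<mu> :: "real \<Rightarrow> path_family measure"
    and D :: "(real \<times> real) set"
    and N :: "'v measure"
    and W :: "'v \<Rightarrow> path_family"
  assumes "\<And>\<delta>. \<delta> \<in> {0<..1} \<Longrightarrow> prob_space (M \<delta>)"
    and "\<And>\<delta>. \<delta> \<in> {0<..1} \<Longrightarrow> X \<delta> \<in> M \<delta> \<rightarrow>\<^sub>M borel"
    and "\<And>\<delta>. \<delta> \<in> {0<..1} \<Longrightarrow> \<mu> \<delta> = distr (M \<delta>) borel (X \<delta>)"
    and "\<And>\<delta>. \<delta> \<in> {0<..1} \<Longrightarrow> AE \<omega> in M \<delta>. coalescing (X \<delta> \<omega>)"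
    and "countable D" and "closure D = UNIV"
    and T1: "\<And>u. 0 < u \<Longrightarrow>
      ((\<lambda>t. ennreal (t powr (-3/2)) *
            (SUP \<delta>\<in>{0<..1}. SUP x0. SUP t0. emeasure (\<mu> \<delta>) (crossing_event t u x0 t0)))
        \<longlongrightarrow> 0) (at_right 0)"
    and I1: "\<exists>\<theta> :: real \<Rightarrow> real \<times> real \<Rightarrow> 'w \<Rightarrow> web_path.
      (\<forall>\<delta>\<in>{0<..1}. \<forall>y\<in>D. \<theta> \<delta> y \<in> M \<delta> \<rightarrow>\<^sub>M borel \<and>
         (\<forall>\<omega>\<in>space (M \<delta>). \<theta> \<delta> y \<omega> \<in> paths (X \<delta> \<omega>))) \<and>
      (\<forall>m (y :: nat \<Rightarrow> real \<times> real). (\<forall>i<m. y i \<in> D) \<longrightarrow>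
         (\<exists>\<nu>. coalescing_BM_law m y \<nu> \<and>
            weakly_converges
              (\<lambda>\<delta>. distr (M \<delta>) (\<Pi>\<^sub>M i\<in>{..<m}. borel) (\<lambda>\<omega>. \<lambda>i\<in>{..<m}. \<theta> \<delta> (y i) \<omega>))
              \<nu> (at_right 0)))"
    and B1: "\<And>t0 t. 0 < t \<Longrightarrow>
      ((\<lambda>\<epsilon>. Limsup (at_right 0) (\<lambda>\<delta>. SUP a. emeasure (\<mu> \<delta>) {K. 2 \<le> eta t0 t a (a + \<epsilon>) K}))
        \<longlongrightarrow> 0) (at_right 0)"
    and B2: "\<And>t0 t. 0 < t \<Longrightarrow>
      ((\<lambda>\<epsilon>. ennreal (1 / \<epsilon>) *
            Limsup (at_right 0) (\<lambda>\<delta>. SUP a. emeasure (\<mu> \<delta>) {K. 3 \<le> eta t0 t a (a + \<epsilon>) K}))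
        \<longlongrightarrow> 0) (at_right 0)"
    and web: "standard_Brownian_web N W"
  shows "weakly_converges \<mu> (distr N borel W) (at_right 0)"
proof -
  note prob = assms(1) and X = assms(2) and \<mu> = assms(3) and coal = assms(4)
    and D = \<open>countable D\<close> \<open>closure D = UNIV\<close>
  obtain \<theta> :: "real \<Rightarrow> real \<times> real \<Rightarrow> 'w \<Rightarrow> web_path"
    where \<theta>1: "\<forall>\<delta>\<in>{0<..1}. \<forall>y\<in>D. \<theta> \<delta> y \<in> M \<delta> \<rightarrow>\<^sub>M borel \<and>
        (\<forall>\<omega>\<in>space (M \<delta>). \<theta> \<delta> y \<omega> \<in> paths (X \<delta> \<omega>))"
      and \<theta>2: "\<forall>m (y :: nat \<Rightarrow> real \<times> real). (\<forall>i<m. y i \<in> D) \<longrightarrow>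
        (\<exists>\<nu>. coalescing_BM_law m y \<nu> \<and>
          weakly_converges (\<lambda>\<delta>. distr (M \<delta>) (\<Pi>\<^sub>M i\<in>{..<m}. borel) (\<lambda>\<omega>. \<lambda>i\<in>{..<m}. \<theta> \<delta> (y i) \<omega>))
            \<nu> (at_right 0))"
    using I1 by (elim exE conjE) (rule that)
  have \<theta>: "\<theta> \<delta> y \<in> M \<delta> \<rightarrow>\<^sub>M borel"
    and \<theta>_paths: "\<omega> \<in> space (M \<delta>) \<Longrightarrow> \<theta> \<delta> y \<omega> \<in> paths (X \<delta> \<omega>)" if "\<delta> \<in> {0<..1}" "y \<in> D" for \<delta> y \<omega>
    using bspec[OF bspec[OF \<theta>1 that(1)] that(2)] by blast+
  have \<theta>_conv: "\<exists>\<nu>. coalescing_BM_law m y \<nu> \<and>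
      weakly_converges (\<lambda>\<delta>. distr (M \<delta>) (\<Pi>\<^sub>M i\<in>{..<m}. borel) (\<lambda>\<omega>. \<lambda>i\<in>{..<m}. \<theta> \<delta> (y i) \<omega>))
        \<nu> (at_right 0)" if "\<And>i. i < m \<Longrightarrow> y i \<in> D" for m and y :: "nat \<Rightarrow> real \<times> real"
    by (rule mp[OF spec[OF spec[OF \<theta>2]]]) (use that in blast)
  interpret N: prob_space N using web unfolding standard_Brownian_web_def by (elim conjE)
  have W [measurable]: "W \<in> N \<rightarrow>\<^sub>M borel" 
    using web unfolding standard_Brownian_web_def by (elim conjE)
  have "\<exists>\<xi>. \<xi> \<in> N \<rightarrow>\<^sub>M borel \<and> (AE \<omega> in N. {p \<in> paths (W \<omega>). starts_at p z} = {\<xi> \<omega>})" for z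
  proof -
    have "inj_on (\<lambda>_. z) {..<1::nat}" by (simp add: inj_on_def)
    then obtain \<xi> where "\<forall>i<1::nat. \<xi> i \<in> N \<rightarrow>\<^sub>M borel"
      "AE \<omega> in N. \<forall>i<1. {p \<in> paths (W \<omega>). starts_at p z} = {\<xi> i \<omega>}"
      using web unfolding standard_Brownian_web_def by blast
    then show ?thesis by (intro exI[of _ "\<xi> 0"]) simp
  qed
  then have "\<exists>\<Xi>. \<forall>z. \<Xi> z \<in> N \<rightarrow>\<^sub>M borel \<and> (AE \<omega> in N. {p \<in> paths (W \<omega>). starts_at p z} = {\<Xi> z \<omega>})"
    by (intro choice allI)
  then obtain \<Xi> where \<Xi>: "\<And>z. \<Xi> z \<in> N \<rightarrow>\<^sub>M borel"
      "\<And>z. AE \<omega> in N. {p \<in> paths (W \<omega>). starts_at p z} = {\<Xi> z \<omega>}"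
    by blast
  \<comment> \<open>This allows \<open>D\<close> to be enumerated without repetition, as the law of
    the web is specified for distinct points.\<close>
  have "infinite D"
  proof
    assume "finite D"
    then have "D = UNIV" using D(2) closure_closed[OF finite_imp_closed] by blast
    then have "finite (fst ` (UNIV :: (real \<times> real) set))" using \<open>finite D\<close> by blast
    then show False using infinite_UNIV_char_0[where 'a = real] by simp
  qed
  define e where "e = from_nat_into D"
  have e: "bij_betw e UNIV D" unfolding e_def by (rule bij_betw_from_nat_into[OF D(1) \<open>infinite D\<close>])
  then have eD: "e i \<in> D" and e_range: "range e = D" and e_inj: "inj_on e A" for i A
    by (auto simp: bij_betw_def inj_on_def)
  show ?thesis
  proof (rule weakly_converges_if_lipschitz)
    show "\<forall>\<^sub>F \<delta> in at_right 0. prob_space (\<mu> \<delta>) \<and> sets (\<mu> \<delta>) = sets borel"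
      using eventually_unit
    proof eventually_elim
      case (elim \<delta>)
      show ?case
        unfolding \<mu>[OF elim] using prob_space.prob_space_distr[OF prob[OF elim] X[OF elim]] by simp
    qed
    show "prob_space (distr N borel W)" using W by (rule N.prob_space_distr)
  next
    fix g :: "path_family \<Rightarrow> real" and L B
    assume lip: "L-lipschitz_on UNIV g" and B: "\<And>K. \<bar>g K\<bar> \<le> B"
    have g: "continuous_on UNIV g" using lip by (rule lipschitz_on_continuous_on)
    have g_meas [measurable]: "g \<in> borel_measurable borel" by (rule borel_measurable_continuous_onI[OF g])
    have L: "0 \<le> L" by (rule lipschitz_on_nonneg[OF lip])
    have B0: "0 \<le> B" using B[of undefined] by linarith
    \<comment> \<open>The test function evaluated at the family formed by the paths from the first
      \<open>Suc m\<close> points of \<open>D\<close>.\<close>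
    define h where "h m f = g (skeleton_family (Suc m) f)" for m f
    have h_cont: "continuous_on UNIV (h m)" for m
      unfolding h_def using continuous_on_compose2[OF g continuous_on_skeleton_family, of "Suc m"] by simp
    have h_meas: "h m \<in> borel_measurable (\<Pi>\<^sub>M i\<in>{..<Suc m}. borel)" for m
      unfolding h_def by (rule measurable_skeleton_family[OF g]) simp
    have h_restrict: "h m (\<lambda>i\<in>{..<Suc m}. f i) = h m f" for m f
      unfolding h_def skeleton_family_restrict ..
    have \<Xi>_meas: "(\<lambda>\<omega>. \<lambda>i\<in>{..<m}. \<Xi> (e i) \<omega>) \<in> N \<rightarrow>\<^sub>M (\<Pi>\<^sub>M i\<in>{..<m}. borel)" for m
      using \<Xi>(1) by (intro measurable_restrict)
    have h\<Xi>_meas: "(\<lambda>\<omega>. h m (\<lambda>i. \<Xi> (e i) \<omega>)) \<in> borel_measurable N" for m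
      using measurable_compose[OF \<Xi>_meas h_meas] by (simp add: h_restrict)
    have lim_W: "(\<lambda>m. \<integral>\<omega>. h m (\<lambda>i. \<Xi> (e i) \<omega>) \<partial>N) \<longlonglongrightarrow> (\<integral>\<omega>. g (W \<omega>) \<partial>N)"
    proof (rule integral_dominated_convergence[where w = "\<lambda>_. B"])
      show "AE \<omega> in N. (\<lambda>m. h m (\<lambda>i. \<Xi> (e i) \<omega>)) \<longlonglongrightarrow> g (W \<omega>)"
        using web_skeleton_dense[OF web \<Xi> D]
      proof eventually_elim
        case (elim \<omega>)
        have ran: "range (\<lambda>i. \<Xi> (e i) \<omega>) = (\<lambda>y. \<Xi> y \<omega>) ` D" using e_range by auto
        have "(\<lambda>m. skeleton_family (Suc m) (\<lambda>i. \<Xi> (e i) \<omega>)) \<longlonglongrightarrow> W \<omega>"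
          using elim unfolding ran[symmetric] by (intro skeleton_family_tendsto) (auto simp: eD)
        then show ?case
          unfolding h_def using continuous_on_tendsto_compose[OF g, of _ "W \<omega>"] by simp
      qed
      show "AE \<omega> in N. norm (h m (\<lambda>i. \<Xi> (e i) \<omega>)) \<le> B" for m using B by (simp add: h_def)
    qed (use h\<Xi>_meas in auto)
    \<comment> \<open>For fixed \<open>m\<close> both sides involve the same finitely many points,
      and the limit law in (I1) is that of the web by
      \<open>coalescing_BM_law_unique\<close>.\<close>
    have lim_\<theta>: "((\<lambda>\<delta>. \<integral>\<omega>. h m (\<lambda>i. \<theta> \<delta> (e i) \<omega>) \<partial>M \<delta>) \<longlongrightarrow> (\<integral>\<omega>. h m (\<lambda>i. \<Xi> (e i) \<omega>) \<partial>N)) (at_right 0)" for m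
    proof -
      obtain \<nu> where \<nu>: "coalescing_BM_law (Suc m) e \<nu>"
        and conv: "weakly_converges (\<lambda>\<delta>. distr (M \<delta>) (\<Pi>\<^sub>M i\<in>{..<Suc m}. borel) (\<lambda>\<omega>. \<lambda>i\<in>{..<Suc m}. \<theta> \<delta> (e i) \<omega>))
            \<nu> (at_right 0)"
        using \<theta>_conv[of "Suc m" e] eD by blast
      have "\<nu> = distr N (\<Pi>\<^sub>M i\<in>{..<Suc m}. borel) (\<lambda>\<omega>. \<lambda>i\<in>{..<Suc m}. \<Xi> (e i) \<omega>)"
        by (rule coalescing_BM_law_unique[OF \<nu> web_skeleton_law[OF web \<Xi> e_inj]]) simp
      then have "(\<integral>f. h m f \<partial>\<nu>) = (\<integral>\<omega>. h m (\<lambda>i. \<Xi> (e i) \<omega>) \<partial>N)"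
        using integral_distr[OF \<Xi>_meas h_meas] by (simp add: h_restrict)
      moreover have "bounded (range (h m))" using B by (auto simp: bounded_iff h_def)
      ultimately have "((\<lambda>\<delta>. \<integral>f. h m f \<partial>distr (M \<delta>) (\<Pi>\<^sub>M i\<in>{..<Suc m}. borel) (\<lambda>\<omega>. \<lambda>i\<in>{..<Suc m}. \<theta> \<delta> (e i) \<omega>))
          \<longlongrightarrow> (\<integral>\<omega>. h m (\<lambda>i. \<Xi> (e i) \<omega>) \<partial>N)) (at_right 0)"
        using conv h_cont[of m] unfolding weakly_converges_def by auto
      moreover have "\<forall>\<^sub>F \<delta> in at_right 0.
          (\<integral>f. h m f \<partial>distr (M \<delta>) (\<Pi>\<^sub>M i\<in>{..<Suc m}. borel) (\<lambda>\<omega>. \<lambda>i\<in>{..<Suc m}. \<theta> \<delta> (e i) \<omega>)) =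
          (\<integral>\<omega>. h m (\<lambda>i. \<theta> \<delta> (e i) \<omega>) \<partial>M \<delta>)"
        using eventually_unit
      proof eventually_elim
        case (elim \<delta>)
        have "(\<lambda>\<omega>. \<lambda>i\<in>{..<Suc m}. \<theta> \<delta> (e i) \<omega>) \<in> M \<delta> \<rightarrow>\<^sub>M (\<Pi>\<^sub>M i\<in>{..<Suc m}. borel)"
          using \<theta>[OF elim eD] by (intro measurable_restrict)
        from integral_distr[OF this h_meas] show ?case by (simp add: h_restrict)
      qed
      ultimately show ?thesis by (rule Lim_transform_eventually)
    qed
    show "((\<lambda>\<delta>. \<integral>K. g K \<partial>\<mu> \<delta>) \<longlongrightarrow> (\<integral>K. g K \<partial>distr N borel W)) (at_right 0)"
    proof (rule tendstoI)
      fix \<epsilon> :: real assume \<epsilon>: "0 < \<epsilon>"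
      \<comment> \<open>The second term makes the replacement of \<open>X\<close> by its skeleton
        cost at most \<open>\<epsilon> / 3\<close>: \<open>L * \<gamma>\<close> where it is close,
        \<open>2 * B * \<gamma>\<close> where it may not be. The bound \<open>1 / 2\<close> is there
        because \<open>X_skeleton\<close> asks for an error below 1.\<close>
      define \<gamma> where "\<gamma> = min (1 / 2) (\<epsilon> / (3 * (L + 2 * B + 1)))"
      have \<gamma>: "0 < \<gamma>" "\<gamma> < 1" using \<epsilon> L B0 by (auto simp: \<gamma>_def)
      have \<gamma>_le: "L * \<gamma> + 2 * B * \<gamma> \<le> \<epsilon> / 3"
      proof -
        have "(L + 2 * B) * \<gamma> \<le> (L + 2 * B + 1) * (\<epsilon> / (3 * (L + 2 * B + 1)))"
          using L B0 \<epsilon> \<gamma> by (intro mult_mono) (auto simp: \<gamma>_def)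
        also have "\<dots> = \<epsilon> / 3" using L B0 by (simp add: field_simps)
        finally show ?thesis by (simp add: algebra_simps)
      qed
      obtain F where F: "finite F" "F \<subseteq> D"
        and close: "\<forall>\<^sub>F \<delta> in at_right 0. whp (M \<delta>) \<gamma> (\<lambda>\<omega>. \<forall>p\<in>paths (X \<delta> \<omega>). \<exists>y\<in>F. dist p (\<theta> \<delta> y \<omega>) \<le> \<gamma>)"
        using X_skeleton[OF prob X \<mu> coal D(2) T1 B2 \<theta> \<theta>_paths \<theta>_conv \<gamma>] by blast
      obtain m0 where m0: "F \<subseteq> e ` {..m0}"
      proof -
        obtain I where I: "finite I" "F = e ` I"
          using finite_subset_image[OF F(1), of e UNIV] F(2) e_range by auto
        obtain m0 where "\<forall>i\<in>I. i \<le> m0" using I(1)[unfolded finite_nat_set_iff_bounded_le] by blast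
        then show thesis using that I(2) by auto
      qed
      \<comment> \<open>One \<open>m\<close> serves both sides: large enough for the web, and such
        that the first \<open>Suc m\<close> points contain \<open>F\<close>. It is fixed before
        \<delta> tends to 0.\<close>
      have "\<forall>\<^sub>F m in sequentially. dist (\<integral>\<omega>. h m (\<lambda>i. \<Xi> (e i) \<omega>) \<partial>N) (\<integral>\<omega>. g (W \<omega>) \<partial>N) < \<epsilon> / 3 \<and> m0 \<le> m"
        using \<epsilon> by (intro eventually_conj tendstoD[OF lim_W] eventually_ge_at_top) simp
      then obtain m where m: "dist (\<integral>\<omega>. h m (\<lambda>i. \<Xi> (e i) \<omega>) \<partial>N) (\<integral>\<omega>. g (W \<omega>) \<partial>N) < \<epsilon> / 3" "m0 \<le> m"
        by (auto simp: eventually_sequentially)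
      have "\<forall>\<^sub>F \<delta> in at_right 0. dist (\<integral>\<omega>. h m (\<lambda>i. \<theta> \<delta> (e i) \<omega>) \<partial>M \<delta>) (\<integral>\<omega>. h m (\<lambda>i. \<Xi> (e i) \<omega>) \<partial>N) < \<epsilon> / 3"
        using \<epsilon> by (intro tendstoD[OF lim_\<theta>]) simp
      with close eventually_unit
      show "\<forall>\<^sub>F \<delta> in at_right 0. dist (\<integral>K. g K \<partial>\<mu> \<delta>) (\<integral>K. g K \<partial>distr N borel W) < \<epsilon>"
      proof eventually_elim
        case (elim \<delta>)
        note \<delta> = elim(2)
        have "whp (M \<delta>) \<gamma> (\<lambda>\<omega>. \<bar>g (X \<delta> \<omega>) - h m (\<lambda>i. \<theta> \<delta> (e i) \<omega>)\<bar> \<le> L * \<gamma>)"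
        proof (rule whp_mono[OF elim(1) order_refl])
          fix \<omega> assume \<omega>: "\<omega> \<in> space (M \<delta>)" "\<forall>p\<in>paths (X \<delta> \<omega>). \<exists>y\<in>F. dist p (\<theta> \<delta> y \<omega>) \<le> \<gamma>"
          have "dist (skeleton_family (Suc m) (\<lambda>i. \<theta> \<delta> (e i) \<omega>)) (X \<delta> \<omega>) \<le> \<gamma>"
          proof (rule dist_skeleton_family_le)
            show "(\<lambda>i. \<theta> \<delta> (e i) \<omega>) ` {..<Suc m} \<subseteq> paths (X \<delta> \<omega>)"
              using \<theta>_paths[OF \<delta> eD \<omega>(1)] by auto
            fix p assume "p \<in> paths (X \<delta> \<omega>)"
            then obtain y where y: "y \<in> F" "dist p (\<theta> \<delta> y \<omega>) \<le> \<gamma>" using \<omega>(2) by blast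
            then obtain i where "i \<le> m0" "y = e i" using m0 by blast
            then show "\<exists>i<Suc m. dist p (\<theta> \<delta> (e i) \<omega>) \<le> \<gamma>" using y(2) m(2) by (intro exI[of _ i]) auto
          qed (use \<gamma> in auto)
          then have "L * dist (X \<delta> \<omega>) (skeleton_family (Suc m) (\<lambda>i. \<theta> \<delta> (e i) \<omega>)) \<le> L * \<gamma>"
            using L by (intro mult_left_mono) (simp_all add: dist_commute)
          then show "\<bar>g (X \<delta> \<omega>) - h m (\<lambda>i. \<theta> \<delta> (e i) \<omega>)\<bar> \<le> L * \<gamma>"
            using lipschitz_onD[OF lip UNIV_I UNIV_I] unfolding h_def dist_real_def by (meson order_trans)
        qed
        moreover have "(\<lambda>\<omega>. h m (\<lambda>i. \<theta> \<delta> (e i) \<omega>)) \<in> borel_measurable (M \<delta>)"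
        proof -
          have "(\<lambda>\<omega>. \<lambda>i\<in>{..<Suc m}. \<theta> \<delta> (e i) \<omega>) \<in> M \<delta> \<rightarrow>\<^sub>M (\<Pi>\<^sub>M i\<in>{..<Suc m}. borel)"
            using \<theta>[OF \<delta> eD] by (intro measurable_restrict)
          from measurable_compose[OF this h_meas] show ?thesis by (simp add: h_restrict)
        qed
        moreover have "0 \<le> L * \<gamma>" using L \<gamma> by simp
        ultimately have "\<bar>(\<integral>\<omega>. g (X \<delta> \<omega>) \<partial>M \<delta>) - (\<integral>\<omega>. h m (\<lambda>i. \<theta> \<delta> (e i) \<omega>) \<partial>M \<delta>)\<bar> \<le> L * \<gamma> + 2 * B * \<gamma>"
          using B measurable_compose[OF X[OF \<delta>] g_meas]
          by (intro integral_diff_whp[OF prob[OF \<delta>]]) (auto simp: h_def)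
        moreover have "(\<integral>K. g K \<partial>\<mu> \<delta>) = (\<integral>\<omega>. g (X \<delta> \<omega>) \<partial>M \<delta>)"
          unfolding \<mu>[OF \<delta>] by (rule integral_distr[OF X[OF \<delta>] g_meas])
        moreover have "(\<integral>K. g K \<partial>distr N borel W) = (\<integral>\<omega>. g (W \<omega>) \<partial>N)"
          by (rule integral_distr[OF W g_meas])
        ultimately show ?case using elim(3) m(1) \<gamma>_le unfolding dist_real_def by argo
      qed
    qed
  qed simp
qed

end
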